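(* For every $q\ge1$ and $t>0$, the sequence of measures $(\mathbb P^N_{t,q})_{N\ge q}$ on $E^q$ defined by $\mathbb P^N_{t,q}(F)=\mathbb E\bigl((\eta^N_t)^{\odot q}(F)\bigr)$, $F\in\mathcal B_b(E^q)$, is differentiable up to any order.
   Context: **Feynman-Kac model.** $E=\mathbb R^d$ (or an arbitrary metric space). $L_t$ is the time-inhomogeneous generator of an $E$-valued Markov process $(X_t)_{t\ge0}$ with continuous trajectories and initial law $\gamma_0=\eta_0$. The potential functions satisfy $0\le V_t(x)\le V_\infty$ for a constant $V_\infty>0$ (with the regularity needed for the objects below to be well defined). **Functions.** $\mathcal B_b(E^q)$ is the set of smooth bounded real functions on $E^q$; on a general metric space, "smooth" means belonging to a suitable class of regular test functions. **$N$-particle system.** At time $0$, $\xi^1_0,\dots,\xi^N_0$ are i.i.d. with law $\eta_0$. Each $\xi^i$ evolves according to $L_t$, independently of the others, and has an independent exponential clock of rate $V_\infty$. When the clock of $\xi^i$ rings, at time $\tau$, then with probability $V_\tau(\xi^i_\tau)/V_\infty$ it jumps to the position of a particle chosen uniformly among the $N$ particles (itself included), and with probability $1-V_\tau(\xi^i_\tau)/V_\infty$ it stays where it is. **Empirical U-statistics.** $\eta^N_t=\frac1N\sum_{i=1}^N\delta_{\xi^i_t}$, and for $F$ on $E^q$ and $N\ge q$, $(\eta^N_t)^{\odot q}(F)=\frac1{(N)_q}\sum_sF(\xi_t^{s(1)},\dots,\xi_t^{s(q)})$, the sum being over injective maps $s:\{1,\dots,q\}\to\{1,\dots,N\}$,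 with $(N)_q=N!/(N-q)!$. **Differentiability.** $\|L\|_{tv}=\sup\{|L(f)|:f\in\mathcal B_b(E^q),\|f\|\le1\}$. A sequence of signed measures $\Theta^N$ on $E^q$ is uniformly bounded if $\sup_N\|\Theta^N\|_{tv}<\infty$. A uniformly bounded sequence converges strongly to $\Theta$ if $\Theta^N(f)\to\Theta(f)$ for all $f\in\mathcal B_b(E^q)$. In that case the discrete derivative is $\partial\Theta^N=N[\Theta^N-\Theta]$, and $\Theta^N$ is differentiable if $\partial\Theta^N$ is uniformly bounded and converges strongly to a measure $\partial\Theta$. Iterating, $\partial^0\Theta^N=\Theta^N$, $\partial^0\Theta=\Theta$, $\partial^{r+1}\Theta^N=N[\partial^r\Theta^N-\partial^r\Theta]$, and $\partial^{r+1}\Theta$ is its strong limit. The sequence is differentiable up to any order if for every $r\ge0$ the sequence $\partial^r\Theta^N$ is uniformly bounded and converges strongly to some measure $\partial^r\Theta$. *)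

theory Defs
  imports "HOL-Probability.Probability"
begin

abbreviation half_line :: "real measure" where
  "half_line \<equiv> restrict_space borel {0..}"

definition path_space :: "(real \<Rightarrow> 'a::metric_space) measure" where
  "path_space = restrict_space (Pi\<^sub>M {0..} (\<lambda>_. borel)) {\<omega>. continuous_on {0..} \<omega>}"

definition path_history :: "real \<Rightarrow> real \<Rightarrow> (real \<Rightarrow> 'a::metric_space) set set" where
  "path_history s t = sigma_sets (space path_space)
     {{\<omega> \<in> space path_space. \<omega> r \<in> A} | r A. s \<le> r \<and> r \<le> t \<and> A \<in> sets borel}"

text \<open>
  \<open>K s x\<close> is the law of the trajectory of the process that starts from \<open>x\<close> at time \<open>s\<close>. It is a
  measure on paths over \<open>[0,\<infinity>)\<close>; only the part of a path after time \<open>s\<close> carries meaning, and the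
  part before \<open>s\<close> is left unconstrained.
  The process \<open>X\<close> with initial law \<open>\<eta>\<close> has the law \<open>\<eta> \<bind> K 0\<close>.
\<close>

locale continuous_markov_process =
  fixes K :: "real \<Rightarrow> 'a::metric_space \<Rightarrow> (real \<Rightarrow> 'a) measure"
  assumes kernel: "(\<lambda>(s, x). K s x) \<in> half_line \<Otimes>\<^sub>M borel \<rightarrow>\<^sub>M prob_algebra path_space"
    and start: "0 \<le> s \<Longrightarrow> AE \<omega> in K s x. \<omega> s = x"
    and markov: "\<lbrakk>0 \<le> s; s \<le> t; t \<le> u; B \<in> path_history s t; A \<in> sets borel\<rbrakk> \<Longrightarrow>
      measure (K s x) {\<omega> \<in> B. \<omega> u \<in> A} =
      (\<integral>\<omega>. indicator B \<omega> * measure (K t (\<omega> t)) {\<omega>' \<in> space path_space. \<omega>' u \<in> A} \<partial>K s x)"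

text \<open>
  \<open>L t f\<close> is specified only for \<open>f\<close> in a class \<open>\<D>\<close> on which the right derivative of the transition
  semigroup exists pointwise.
\<close>

definition is_generator ::
  "(real \<Rightarrow> 'a::metric_space \<Rightarrow> (real \<Rightarrow> 'a) measure) \<Rightarrow> ('a \<Rightarrow> real) set \<Rightarrow>
   (real \<Rightarrow> ('a \<Rightarrow> real) \<Rightarrow> 'a \<Rightarrow> real) \<Rightarrow> bool" where
  "is_generator K \<D> L \<longleftrightarrow> (\<forall>f\<in>\<D>. \<forall>t\<ge>0. \<forall>x.
     ((\<lambda>h. ((\<integral>\<omega>. f (\<omega> (t + h)) \<partial>K t x) - f x) / h) \<longlongrightarrow> L t f x) (at_right 0))"

locale feynman_kac_model = continuous_markov_process K
  for K :: "real \<Rightarrow> 'a::metric_space \<Rightarrow> (real \<Rightarrow> 'a) measure" +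
  fixes \<eta>0 :: "'a measure"
    and \<D> :: "('a \<Rightarrow> real) set"
    and L :: "real \<Rightarrow> ('a \<Rightarrow> real) \<Rightarrow> 'a \<Rightarrow> real"
    and V :: "real \<Rightarrow> 'a \<Rightarrow> real"
    and Vinf :: real
  assumes initial_law: "prob_space \<eta>0" "sets \<eta>0 = sets borel"
    and domain: "f \<in> \<D> \<Longrightarrow> f \<in> borel_measurable borel \<and> bounded (range f)"
    and generator: "is_generator K \<D> L"
    and V_measurable: "(\<lambda>(t, x). V t x) \<in> borel_measurable (half_line \<Otimes>\<^sub>M borel)"
    and V_bounds: "0 \<le> t \<Longrightarrow> 0 \<le> V t x \<and> V t x \<le> Vinf"
    and Vinf_pos: "0 < Vinf"

text \<open>
  The particles are \<open>0, \<dots>, N - 1\<close>. Between two successive rings of the \<open>N\<close> clocks, a state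
  consists of the trajectory that each particle is following and the next ring time of each clock.
\<close>

type_synonym 'a particle_state = "(nat \<Rightarrow> real \<Rightarrow> 'a) \<times> (nat \<Rightarrow> real)"

definition state_space :: "nat \<Rightarrow> 'a::metric_space particle_state measure" where
  "state_space N = Pi\<^sub>M {..<N} (\<lambda>_. path_space) \<Otimes>\<^sub>M Pi\<^sub>M {..<N} (\<lambda>_. half_line)"

definition exponential_law :: "real \<Rightarrow> real measure" where
  "exponential_law l = restrict_space (density lborel (exponential_density l)) {0..}"

definition initial_state_law ::
  "(real \<Rightarrow> 'a::metric_space \<Rightarrow> (real \<Rightarrow> 'a) measure) \<Rightarrow> 'a measure \<Rightarrow> real \<Rightarrow> nat \<Rightarrow>
   'a particle_state measure" where
  "initial_state_law K \<eta>0 Vinf N =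
     Pi\<^sub>M {..<N} (\<lambda>_. \<eta>0 \<bind> K 0) \<Otimes>\<^sub>M Pi\<^sub>M {..<N} (\<lambda>_. exponential_law Vinf)"

definition first_to_ring :: "nat \<Rightarrow> (nat \<Rightarrow> real) \<Rightarrow> nat" where
  "first_to_ring N c = (LEAST i. i < N \<and> (\<forall>j<N. c i \<le> c j))"

text \<open>
  What happens when the next clock rings: its particle \<open>i\<close> either starts a fresh trajectory of the
  process from the position of the selected particle \<open>j\<close>, or keeps following its own trajectory,
  and its clock is reset. Everything concerning the other particles is unchanged.
\<close>

definition ring_kernel ::
  "(real \<Rightarrow> 'a::metric_space \<Rightarrow> (real \<Rightarrow> 'a) measure) \<Rightarrow> (real \<Rightarrow> 'a \<Rightarrow> real) \<Rightarrow> real \<Rightarrow> nat \<Rightarrow>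
   'a particle_state \<Rightarrow> 'a particle_state measure" where
  "ring_kernel K V Vinf N = (\<lambda>(\<omega>, c).
     let i = first_to_ring N c; \<tau> = c i in do {
       \<sigma> \<leftarrow> exponential_law Vinf;
       jump \<leftarrow> measure_pmf (bernoulli_pmf (V \<tau> (\<omega> i \<tau>) / Vinf));
       j \<leftarrow> uniform_count_measure {..<N};
       \<omega>' \<leftarrow> (if jump then K \<tau> (\<omega> j \<tau>) else return path_space (\<omega> i));
       return (state_space N) (fun_upd \<omega> i \<omega>', fun_upd c i (\<tau> + \<sigma>))
     })"

definition markov_chain ::
  "'w measure \<Rightarrow> 's measure \<Rightarrow> 's measure \<Rightarrow> ('s \<Rightarrow> 's measure) \<Rightarrow> (nat \<Rightarrow> 'w \<Rightarrow> 's) \<Rightarrow> bool" where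
  "markov_chain M S \<mu> \<kappa> Z \<longleftrightarrow>
     prob_space M \<and> (\<forall>n. Z n \<in> M \<rightarrow>\<^sub>M S) \<and> distr M S (Z 0) = \<mu> \<and>
     (\<forall>n. \<forall>A\<in>sets (Pi\<^sub>M {..n} (\<lambda>_. S)). \<forall>B\<in>sets S.
        measure M {w \<in> space M. (\<lambda>k\<in>{..n}. Z k w) \<in> A \<and> Z (Suc n) w \<in> B} =
        (\<integral>w. indicator A (\<lambda>k\<in>{..n}. Z k w) * measure (\<kappa> (Z n w)) B \<partial>M))"

text \<open>\<open>Z n\<close> is the state of the \<open>N\<close>-particle system after \<open>n\<close> rings.\<close>

definition particle_system ::
  "(real \<Rightarrow> 'a::metric_space \<Rightarrow> (real \<Rightarrow> 'a) measure) \<Rightarrow> 'a measure \<Rightarrow> (real \<Rightarrow> 'a \<Rightarrow> real) \<Rightarrow> real \<Rightarrow>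
   nat \<Rightarrow> 'w measure \<Rightarrow> (nat \<Rightarrow> 'w \<Rightarrow> 'a particle_state) \<Rightarrow> bool" where
  "particle_system K \<eta>0 V Vinf N M Z \<longleftrightarrow>
     markov_chain M (state_space N) (initial_state_law K \<eta>0 Vinf N) (ring_kernel K V Vinf N) Z"

text \<open>
  The position \<open>\<xi>\<^sup>i\<^sub>t\<close>. The number of rings up to time \<open>t\<close> is the least \<open>n\<close> such that, after \<open>n\<close>
  rings, all clocks are due after \<open>t\<close>; it exists almost surely.
\<close>

definition particle ::
  "nat \<Rightarrow> (nat \<Rightarrow> 'w \<Rightarrow> 'a particle_state) \<Rightarrow> real \<Rightarrow> 'w \<Rightarrow> nat \<Rightarrow> 'a" where
  "particle N Z t w i =
     (let n = (LEAST n. \<forall>j<N. t < snd (Z n w) j) in fst (Z n w) i t)"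

text \<open>\<open>E\<^sup>q\<close> is rendered by extensional functions on \<open>{..<q}\<close>.\<close>

abbreviation tuple_space :: "nat \<Rightarrow> (nat \<Rightarrow> 'a::metric_space) measure" where
  "tuple_space q \<equiv> Pi\<^sub>M {..<q} (\<lambda>_. borel)"

definition u_statistic :: "nat \<Rightarrow> nat \<Rightarrow> (nat \<Rightarrow> 'a) \<Rightarrow> ((nat \<Rightarrow> 'a) \<Rightarrow> real) \<Rightarrow> real" where
  "u_statistic N q x F =
     1 / (fact N / fact (N - q)) *
     (\<Sum>s | s \<in> {..<q} \<rightarrow>\<^sub>E {..<N} \<and> inj_on s {..<q}. F (\<lambda>k\<in>{..<q}. x (s k)))"

definition mean_u_statistic ::
  "nat \<Rightarrow> 'w measure \<Rightarrow> (nat \<Rightarrow> 'w \<Rightarrow> 'a particle_state) \<Rightarrow> real \<Rightarrow> nat \<Rightarrow>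
   ((nat \<Rightarrow> 'a) \<Rightarrow> real) \<Rightarrow> real" where
  "mean_u_statistic N M Z t q F = (\<integral>w. u_statistic N q (particle N Z t w) F \<partial>M)"

definition bounded_measurable :: "'b measure \<Rightarrow> ('b \<Rightarrow> real) set" where
  "bounded_measurable S = {f \<in> borel_measurable S. bounded (f ` space S)}"

text \<open>
  Signed measures are identified with the functionals \<open>f \<mapsto> \<Theta>(f)\<close> that they induce by integration.
\<close>

definition is_signed_measure :: "'b measure \<Rightarrow> (('b \<Rightarrow> real) \<Rightarrow> real) \<Rightarrow> bool" where
  "is_signed_measure S \<Theta> \<longleftrightarrow>
     (\<exists>\<mu> \<nu>. finite_measure \<mu> \<and> finite_measure \<nu> \<and> sets \<mu> = sets S \<and> sets \<nu> = sets S \<and>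
        (\<forall>f\<in>bounded_measurable S. \<Theta> f = (\<integral>x. f x \<partial>\<mu>) - (\<integral>x. f x \<partial>\<nu>)))"

text \<open>
  In the following, \<open>\<B>\<close> is the class of test functions on \<open>space S\<close>, and the sequences are indexed
  by \<open>N \<ge> m\<close>.
\<close>

definition tv_norm :: "'b measure \<Rightarrow> ('b \<Rightarrow> real) set \<Rightarrow> (('b \<Rightarrow> real) \<Rightarrow> real) \<Rightarrow> ennreal" where
  "tv_norm S \<B> \<Theta> = (SUP f\<in>{f \<in> \<B>. \<forall>x\<in>space S. \<bar>f x\<bar> \<le> 1}. ennreal \<bar>\<Theta> f\<bar>)"

definition uniformly_bounded ::
  "'b measure \<Rightarrow> ('b \<Rightarrow> real) set \<Rightarrow> nat \<Rightarrow> (nat \<Rightarrow> ('b \<Rightarrow> real) \<Rightarrow> real) \<Rightarrow> bool" where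
  "uniformly_bounded S \<B> m \<Theta> \<longleftrightarrow> (SUP N\<in>{m..}. tv_norm S \<B> (\<Theta> N)) < \<infinity>"

definition converges_strongly ::
  "('b \<Rightarrow> real) set \<Rightarrow> (nat \<Rightarrow> ('b \<Rightarrow> real) \<Rightarrow> real) \<Rightarrow> (('b \<Rightarrow> real) \<Rightarrow> real) \<Rightarrow> bool" where
  "converges_strongly \<B> \<Theta> \<Theta>lim \<longleftrightarrow> (\<forall>f\<in>\<B>. (\<lambda>N. \<Theta> N f) \<longlonglongrightarrow> \<Theta>lim f)"

text \<open>\<open>D r\<close> plays the role of the limit \<open>\<partial>\<^sup>r\<Theta>\<close>.\<close>

primrec discrete_derivative ::
  "(nat \<Rightarrow> ('b \<Rightarrow> real) \<Rightarrow> real) \<Rightarrow> (nat \<Rightarrow> ('b \<Rightarrow> real) \<Rightarrow> real) \<Rightarrow>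
   nat \<Rightarrow> nat \<Rightarrow> ('b \<Rightarrow> real) \<Rightarrow> real" where
  "discrete_derivative \<Theta> D 0 = \<Theta>"
| "discrete_derivative \<Theta> D (Suc r) =
     (\<lambda>N f. real N * (discrete_derivative \<Theta> D r N f - D r f))"

definition differentiable_up_to_any_order ::
  "'b measure \<Rightarrow> ('b \<Rightarrow> real) set \<Rightarrow> nat \<Rightarrow> (nat \<Rightarrow> ('b \<Rightarrow> real) \<Rightarrow> real) \<Rightarrow> bool" where
  "differentiable_up_to_any_order S \<B> m \<Theta> \<longleftrightarrow>
     (\<forall>N\<ge>m. is_signed_measure S (\<Theta> N)) \<and>
     (\<exists>D. \<forall>r. is_signed_measure S (D r) \<and>
        uniformly_bounded S \<B> m (discrete_derivative \<Theta> D r) \<and>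
        converges_strongly \<B> (discrete_derivative \<Theta> D r) (D r))"

end

theory Submission
 imports Defs
begin

text \<open>
 Let \<open>\<Phi>\<^sub>q(t, F)\<close> be the mean of the U-statistic of order \<open>q\<close>. Conditioning on the last ring before \<open>t\<close> and
 resumming the rings that do not touch the sampled particles gives a closed hierarchy
 \<open>\<Phi> = g\<^sub>0 + T \<Phi> + W \<Phi> / N\<close>, where \<open>T\<close> raises the level \<open>q\<close> by one and neither \<open>g\<^sub>0\<close> nor the operators
 \<open>T\<close>, \<open>W\<close> depend on \<open>N\<close>. In the norms with weight \<open>q (q + 1) \<cdots> (q + \<kappa> - 1) exp (\<kappa> V t)\<close> the operator \<open>T\<close> is a
 contraction, its powers are summable after raising \<open>\<kappa>\<close> by two, and \<open>W\<close> raises \<open>\<kappa>\<close> by one. Hence \<open>1 - T\<close> can be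
 inverted, and iterating yields an expansion of \<open>\<Phi>\<close> in powers of \<open>1/N\<close> to every order.
\<close>

text \<open>The equation for level q involves level q + 1 with a factor that grows like q, so no
  finite Gronwall argument closes it. The remedy is the exponential damping exp(-q V t) of the q
  sampled clocks: together with growth \<kappa> V it turns the factor q into q / (q + \<kappa>), and
  the rising factorial is the weight with q (q + 1) ... (q + \<kappa>) = (q + \<kappa>) times the
  weight at q, so the bound for \<open>T\<close> is exactly 1. Since 1 does not suffice to sum
  powers of \<open>T\<close>, two more weight factors are spent. Before the resummation, N also sits
  in the damping rate N V. Only N - q of the N clocks are irrelevant for the sample, and removing
  them lowers the rate to q V. On the probabilistic side, the Markov property is given for a single
  later time and a fixed conditioning time, whereas rings happen at random times and a kept
  trajectory remembers its past. Hence the detour over laws of whole futures and over functionals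
  that cannot see the past. Positivity is tracked throughout because limits of functionals must be
  recognised as signed measures, which is done by representing two positive parts
  separately.\<close>

section \<open>Evaluation of continuous paths and products of kernels\<close>

lemma space_path_space: "space path_space = {\<omega> \<in> extensional {0..}. continuous_on {0..} \<omega>}"
 by (auto simp: path_space_def space_restrict_space space_PiM PiE_def)

lemma measurable_path_at:
 "0 <= r ==> (%\<omega>. \<omega> r) \<in> path_space \<rightarrow>\<^sub>M borel"
 unfolding path_space_def by (intro measurable_restrict_space1 measurable_component_singleton) auto

text \<open>The time is rounded down to a multiple of 1 / (n + 1). Only countably many times then
  occur, each with a measurable evaluation, and continuity of the path recovers the value at the
  true time in the limit.\<close>

lemma measurable_path_eval:
 assumes f: "f \<in> M \<rightarrow>\<^sub>M half_line" and g: "g \<in> M \<rightarrow>\<^sub>M path_space"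
 shows "(%x. g x (f x)) \<in> M \<rightarrow>\<^sub>M borel"
proof (rule borel_measurable_LIMSEQ_metric)
 have f': "f \<in> borel_measurable M"
  using f by (simp add: measurable_restrict_space2_iff)
 fix n
 show "(%x. g x (real (nat \<lfloor>f x * real (Suc n)\<rfloor>) / real (Suc n))) \<in> borel_measurable M"
 proof (rule measurable_compose_countable[where f="%k x. g x (real k / real (Suc n))"])
  show "(%x. g x (real k / real (Suc n))) \<in> borel_measurable M" for k
   by (rule measurable_compose[OF g measurable_path_at]) auto
  show "(%x. nat \<lfloor>f x * real (Suc n)\<rfloor>) \<in> M \<rightarrow>\<^sub>M count_space UNIV"
   using f' by measurable
 qed
next
 fix x assume x: "x \<in> space M"
 have fx: "0 <= f x" using measurable_space[OF f x] by (auto simp: space_restrict_space)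
 have gx: "continuous_on {0..} (g x)" using measurable_space[OF g x] by (auto simp: space_path_space)
 have "(%n. real (nat \<lfloor>f x * real (Suc n)\<rfloor>) / real (Suc n)) \<longlonglongrightarrow> f x"
 proof (rule tendsto_sandwich)
  show "\<forall>\<^sub>F n in sequentially. f x - 1 / real (Suc n) <= real (nat \<lfloor>f x * real (Suc n)\<rfloor>) / real (Suc n)"
  proof (rule always_eventually, rule allI)
   fix n
   have "f x * real (Suc n) - 1 <= of_int \<lfloor>f x * real (Suc n)\<rfloor>" by linarith
   also have "... = real (nat \<lfloor>f x * real (Suc n)\<rfloor>)" using fx by simp
   finally show "f x - 1 / real (Suc n) <= real (nat \<lfloor>f x * real (Suc n)\<rfloor>) / real (Suc n)"
    by (simp add: le_divide_eq left_diff_distrib del: of_nat_Suc)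
  qed
  show "\<forall>\<^sub>F n in sequentially. real (nat \<lfloor>f x * real (Suc n)\<rfloor>) / real (Suc n) <= f x"
  proof (rule always_eventually, rule allI)
   fix n
   have "real (nat \<lfloor>f x * real (Suc n)\<rfloor>) <= f x * real (Suc n)" using fx
    by (simp del: of_nat_Suc)
   then show "real (nat \<lfloor>f x * real (Suc n)\<rfloor>) / real (Suc n) <= f x"
    by (simp add: field_simps del: of_nat_Suc)
  qed
  have "(%n. f x - 1 / real (Suc n)) \<longlonglongrightarrow> f x - 0"
   by (intro tendsto_diff tendsto_const LIMSEQ_inverse_real_of_nat[unfolded inverse_eq_divide])
  then show "(%n. f x - 1 / real (Suc n)) \<longlonglongrightarrow> f x" by simp
 qed simp
 then show "(%n. g x (real (nat \<lfloor>f x * real (Suc n)\<rfloor>) / real (Suc n))) \<longlonglongrightarrow> g x (f x)"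
  by (rule continuous_on_tendsto_compose[OF gx]) (use fx in auto)
qed

lemma measurable_half_lineI:
 "f \<in> borel_measurable M ==> (\<And>x. x \<in> space M ==> 0 <= f x) ==> f \<in> M \<rightarrow>\<^sub>M half_line"
 by (auto simp: measurable_restrict_space2_iff)

lemma measurable_half_lineD: "f \<in> M \<rightarrow>\<^sub>M half_line ==> f \<in> borel_measurable M"
 by (simp add: measurable_restrict_space2_iff)

text \<open>Boxes generate the product and are stable under intersection, and the mass of a box is a
  finite product of measurable functions of the parameter.\<close>

lemma measurable_PiM_prob_algebra:
 assumes I: "finite I" and k: "\<And>i. i \<in> I ==> k i \<in> M \<rightarrow>\<^sub>M prob_algebra (N i)"
 shows "(%z. Pi\<^sub>M I (%i. k i z)) \<in> M \<rightarrow>\<^sub>M prob_algebra (Pi\<^sub>M I N)"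
proof (rule measurable_prob_algebra_generated[OF sets_PiM Int_stable_prod_algebra prod_algebra_sets_into_space])
 have prob: "prob_space (k i z)" and sets: "sets (k i z) = sets (N i)" if "i \<in> I" "z \<in> space M" for i z
  using measurable_space[OF k that(2)] that by (auto simp: space_prob_algebra)
 fix z assume z: "z \<in> space M"
 show "prob_space (Pi\<^sub>M I (%i. k i z))" by (intro prob_space_PiM prob z)
 show "sets (Pi\<^sub>M I (%i. k i z)) = sets (Pi\<^sub>M I N)" by (intro sets_PiM_cong sets z refl)
next
 fix X assume "X \<in> prod_algebra I N"
 then obtain A where X: "X = Pi\<^sub>E I A" and A: "\<And>i. i \<in> I ==> A i \<in> sets (N i)"
  by (auto simp: prod_algebra_eq_finite[OF I])
 have "emeasure (Pi\<^sub>M I (%i. k i z)) X = (\<Prod>i\<in>I. emeasure (k i z) (A i))" if z: "z \<in> space M" for z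
 proof -
  have prob: "prob_space (k i z)" and sets: "sets (k i z) = sets (N i)" if "i \<in> I" for i
   using measurable_space[OF k z] that by (auto simp: space_prob_algebra)
  have "emeasure (Pi\<^sub>M I (%i. k i z)) (prod_emb I (%i. k i z) I (Pi\<^sub>E I A)) = (\<Prod>i\<in>I. emeasure (k i z) (A i))"
   using I A prob sets by (intro emeasure_PiM_emb) auto
  moreover have "prod_emb I (%i. k i z) I (Pi\<^sub>E I A) = Pi\<^sub>E I A"
   by (rule prod_emb_PiE_same_index) (use sets.sets_into_space[OF A] sets_eq_imp_space_eq[OF sets] in auto)
  ultimately show ?thesis by (simp add: X)
 qed
 moreover have "(%z. \<Prod>i\<in>I. emeasure (k i z) (A i)) \<in> borel_measurable M"
  using k A
  by (intro borel_measurable_prod_ennreal measurable_compose[OF measurable_prob_algebraD[OF k]] measurable_emeasure_subprob_algebra) auto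
 ultimately show "(%z. emeasure (Pi\<^sub>M I (%i. k i z)) X) \<in> borel_measurable M"
  by (simp cong: measurable_cong)
qed

text \<open>Randomising independent coordinates independently keeps them independent. On boxes this
  is the factorisation of an integral of a product.\<close>

lemma bind_PiM:
 assumes I: "finite I" and M: "\<And>i. i \<in> I ==> prob_space (M i)"
  and k: "\<And>i. i \<in> I ==> k i \<in> M i \<rightarrow>\<^sub>M prob_algebra (N i)"
 shows "Pi\<^sub>M I (%i. M i \<bind> k i) = Pi\<^sub>M I M \<bind> (%y. Pi\<^sub>M I (%i. k i (y i)))"
proof -
 \<comment> \<open>The locale \<open>product_prob_space\<close> asks for a probability measure at
   every index, so both families are continued by a point mass off \<open>I\<close>.\<close>
 define M' where "M' = (%i. if i \<in> I then M i \<bind> k i else return (count_space UNIV) undefined)"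
 define L where "L = (%i. if i \<in> I then M i else return (count_space UNIV) undefined)"
 have bind: "prob_space (M i \<bind> k i)" "sets (M i \<bind> k i) = sets (N i)" if "i \<in> I" for i
 proof -
  have *: "M i \<in> space (prob_algebra (M i))" using M that by (simp add: space_prob_algebra)
  show "prob_space (M i \<bind> k i)" using prob_space_bind'[OF * k] that by blast
  show "sets (M i \<bind> k i) = sets (N i)" using sets_bind'[OF * k] that by blast
 qed
 have k': "(%y. Pi\<^sub>M I (%i. k i (y i))) \<in> Pi\<^sub>M I M \<rightarrow>\<^sub>M prob_algebra (Pi\<^sub>M I N)"
  by (rule measurable_PiM_prob_algebra[OF I], rule measurable_compose[OF _ k]) auto
 have L_eq: "Pi\<^sub>M I L = Pi\<^sub>M I M" by (rule PiM_cong) (auto simp: L_def)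
 interpret M': product_prob_space M' 
  by (rule product_prob_spaceI) (auto simp: M'_def bind intro!: prob_space_return)
 interpret L: product_prob_space L
  by (rule product_prob_spaceI) (auto simp: L_def M intro!: prob_space_return)
 have "Pi\<^sub>M I M \<bind> (%y. Pi\<^sub>M I (%i. k i (y i))) = Pi\<^sub>M I M'"
 proof (rule M'.PiM_eqI[OF I])
  have *: "Pi\<^sub>M I M \<in> space (prob_algebra (Pi\<^sub>M I M))" by (auto simp add: space_prob_algebra intro!: prob_space_PiM M)
  show "sets (Pi\<^sub>M I M \<bind> (%y. Pi\<^sub>M I (%i. k i (y i)))) = sets (Pi\<^sub>M I M')"
   using sets_bind'[OF * k'] by (auto simp: M'_def bind intro!: sets_PiM_cong)
  fix A assume "\<And>i. i \<in> I ==> A i \<in> sets (M' i)"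
  then have A: "A i \<in> sets (N i)" if "i \<in> I" for i using that bind by (auto simp: M'_def)
  have "emeasure (Pi\<^sub>M I M \<bind> (%y. Pi\<^sub>M I (%i. k i (y i)))) (Pi\<^sub>E I A)
    = (\<integral>\<^sup>+y. emeasure (Pi\<^sub>M I (%i. k i (y i))) (Pi\<^sub>E I A) \<partial>Pi\<^sub>M I M)"
   using I A by (intro emeasure_bind_prob_algebra[OF * k'] sets_PiM_I_finite) auto
  also have "... = (\<integral>\<^sup>+y. (\<Prod>i\<in>I. emeasure (k i (y i)) (A i)) \<partial>Pi\<^sub>M I L)"
   unfolding L_eq
  proof (rule nn_integral_cong)
   fix y assume y: "y \<in> space (Pi\<^sub>M I M)"
   have prob: "prob_space (k i (y i))" and sets: "sets (k i (y i)) = sets (N i)" if "i \<in> I" for i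
    using measurable_space[OF k, of i "y i"] that y by (auto simp: space_prob_algebra space_PiM)
   have "emeasure (Pi\<^sub>M I (%i. k i (y i))) (prod_emb I (%i. k i (y i)) I (Pi\<^sub>E I A)) = (\<Prod>i\<in>I. emeasure (k i (y i)) (A i))"
    using I A prob sets by (intro emeasure_PiM_emb) auto
   moreover have "prod_emb I (%i. k i (y i)) I (Pi\<^sub>E I A) = Pi\<^sub>E I A"
    by (rule prod_emb_PiE_same_index) (use sets.sets_into_space[OF A] sets_eq_imp_space_eq[OF sets] in auto)
   ultimately show "emeasure (Pi\<^sub>M I (%i. k i (y i))) (Pi\<^sub>E I A) = (\<Prod>i\<in>I. emeasure (k i (y i)) (A i))" by simp
  qed
  also have "... = (\<Prod>i\<in>I. \<integral>\<^sup>+y. emeasure (k i y) (A i) \<partial>L i)"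
   using I A
   by (intro L.product_nn_integral_prod)
     (auto simp: L_def intro!: measurable_compose[OF measurable_prob_algebraD[OF k]] measurable_emeasure_subprob_algebra)
  also have "... = (\<Prod>i\<in>I. emeasure (M' i) (A i))"
  proof (rule prod.cong[OF refl])
   fix i assume i: "i \<in> I"
   have *: "M i \<in> space (prob_algebra (M i))" using M i by (simp add: space_prob_algebra)
   show "(\<integral>\<^sup>+y. emeasure (k i y) (A i) \<partial>L i) = emeasure (M' i) (A i)"
    using i A by (simp add: L_def M'_def emeasure_bind_prob_algebra[OF * k])
  qed
  finally show "emeasure (Pi\<^sub>M I M \<bind> (%y. Pi\<^sub>M I (%i. k i (y i)))) (Pi\<^sub>E I A) = (\<Prod>i\<in>I. emeasure (M' i) (A i))" .
 qed
 also have "Pi\<^sub>M I M' = Pi\<^sub>M I (%i. M i \<bind> k i)" by (rule PiM_cong) (auto simp: M'_def)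
 finally show ?thesis by simp
qed

section \<open>Markov property for the law of the whole future\<close>

text \<open>Freezing a path at its value at time r before r keeps it continuous, hence inside
  \<open>path_space\<close>, while it forgets everything that happened before r. Since
  \<open>K s x\<close> does not constrain a path before s, laws with different starting times can
  only be compared through such tails.\<close>

definition path_tail :: "real => (real => 'a) => real => 'a" where
 "path_tail r \<omega> = (\<lambda>u\<in>{0..}. \<omega> (max u r))"

lemma path_tail_in_space:
 assumes "0 <= r" "\<omega> \<in> space path_space" shows "path_tail r \<omega> \<in> space path_space"
proof -
 have "continuous_on {0..} (%u. \<omega> (max u r))"
 proof (rule continuous_on_compose2[of "{0..}" \<omega>])
  show "continuous_on {0..} (%u. max u r)"
   by (rule continuous_on_max[OF continuous_on_id continuous_on_const])
 qed (use assms in \<open>auto simp: space_path_space\<close>)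
 then have "continuous_on {0..} (path_tail r \<omega>)"
  by (rule continuous_on_eq) (auto simp: path_tail_def)
 then show ?thesis by (simp add: space_path_space path_tail_def)
qed

lemma measurable_path_tail_PiM:
 "0 <= r ==> path_tail r \<in> path_space \<rightarrow>\<^sub>M Pi\<^sub>M {0..} (%_. borel)"
 unfolding path_tail_def by (intro measurable_restrict measurable_path_at) auto

lemma measurable_path_tail:
 assumes r: "0 <= r" shows "path_tail r \<in> path_space \<rightarrow>\<^sub>M path_space"
proof -
 have "path_tail r \<in> path_space \<rightarrow>\<^sub>M restrict_space (Pi\<^sub>M {0..} (%_. borel)) {\<omega>. continuous_on {0..} \<omega>}"
  using path_tail_in_space[OF r]
  by (intro measurable_restrict_space2 measurable_path_tail_PiM[OF r]) (auto simp: space_path_space Pi_iff)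
 then show ?thesis by (simp only: path_space_def[symmetric])
qed

lemma path_tail_eq: "0 <= r ==> r <= u ==> path_tail r \<omega> u = \<omega> u"
 by (simp add: path_tail_def max_def)

lemma path_history_sets: "0 <= s ==> path_history s t \<subseteq> sets path_space"
 unfolding path_history_def
proof (rule sets.sigma_sets_subset, safe)
 fix r and A :: "'a set" assume "0 <= s" "s <= r" "A \<in> sets borel"
 then show "{\<omega> \<in> space path_space. \<omega> r \<in> A} \<in> sets path_space"
  using measurable_sets[OF measurable_path_at[of r], of A] by (simp add: vimage_def Int_def conj_commute)
qed

definition cylinder :: "real set => (real => 'a::metric_space set) => (real => 'a) set" where
 "cylinder J A = {\<omega> \<in> space path_space. \<forall>u\<in>J. \<omega> u \<in> A u}"

lemma cylinder_path_history:
 assumes "finite J" "J \<subseteq> {s..t}" "\<And>u. u \<in> J ==> A u \<in> sets borel"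
 shows "cylinder J A \<in> path_history s t"
 using assms
proof (induction J rule: finite_induct)
 case empty
 show ?case by (simp add: cylinder_def path_history_def sigma_sets_top)
next
 case (insert u J)
 interpret sigma_algebra "space (path_space :: (real => 'a) measure)" "path_history s t :: (real => 'a) set set"
  unfolding path_history_def by (rule sigma_algebra_sigma_sets) auto
 have "cylinder (insert u J) A = {\<omega> \<in> space path_space. \<omega> u \<in> A u} \<inter> cylinder J A"
  by (auto simp: cylinder_def)
 moreover have "{\<omega> \<in> space path_space. \<omega> u \<in> A u} \<in> path_history s t"
  unfolding path_history_def using insert by (intro sigma_sets.Basic) auto
 ultimately show ?case using insert by auto
qed

context continuous_markov_process
begin

lemma K_in_prob_algebra: "0 <= s ==> K s x \<in> space (prob_algebra path_space)"
 using measurable_space[OF kernel, of "(s, x)"] by (simp add: space_pair_measure space_restrict_space)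

lemma K_prob: "0 <= s ==> prob_space (K s x)"
 using K_in_prob_algebra[of s x] by (simp add: space_prob_algebra)

lemma K_sets: "0 <= s ==> sets (K s x) = sets path_space"
 using K_in_prob_algebra[of s x] by (simp add: space_prob_algebra)

lemma K_space: "0 <= s ==> space (K s x) = space path_space"
 using sets_eq_imp_space_eq[OF K_sets] .

lemma measurable_K:
 assumes "f \<in> M \<rightarrow>\<^sub>M half_line" "g \<in> M \<rightarrow>\<^sub>M borel"
 shows "(%z. K (f z) (g z)) \<in> M \<rightarrow>\<^sub>M prob_algebra path_space"
 using measurable_compose[OF measurable_Pair[OF assms] kernel] by simp

lemma measurable_K_start:
 assumes "0 <= r" shows "(%\<omega>. K r (\<omega> r)) \<in> path_space \<rightarrow>\<^sub>M prob_algebra path_space"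
 using assms by (intro measurable_K measurable_path_at) (auto simp: space_restrict_space)

text \<open>The locale axiom is the case of an indicator; both sides are linear and monotone
  continuous in g, so the standard induction over measurable functions applies.\<close>

lemma markov_nn:
 assumes st: "0 <= s" "s <= t" "t <= u" and B: "B \<in> path_history s t" and g: "g \<in> borel_measurable borel"
 shows "(\<integral>\<^sup>+\<omega>. indicator B \<omega> * g (\<omega> u) \<partial>K s x) =
     (\<integral>\<^sup>+\<omega>. indicator B \<omega> * (\<integral>\<^sup>+\<omega>'. g (\<omega>' u) \<partial>K t (\<omega> t)) \<partial>K s x)"
proof -
 have t: "0 <= t" and u: "0 <= u" using st by auto
 have Ks[measurable_cong]: "sets (K s x) = sets path_space" and Kt[measurable_cong]: "\<And>y. sets (K t y) = sets path_space"
  using K_sets st t by auto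
 have B'[measurable]: "B \<in> sets path_space" using B path_history_sets[of s t] st by auto
 note [measurable] = measurable_path_at[OF u] measurable_path_at[OF t]
 have Kk: "(%\<omega>. K t (\<omega> t)) \<in> path_space \<rightarrow>\<^sub>M subprob_algebra path_space"
  by (rule measurable_prob_algebraD[OF measurable_K_start[OF t]])
 have inner: "(%\<omega>. \<integral>\<^sup>+\<omega>'. h (\<omega>' u) \<partial>K t (\<omega> t)) \<in> borel_measurable path_space"
  if [measurable]: "h \<in> borel_measurable borel" for h :: "'a => ennreal"
  by (rule nn_integral_measurable_subprob_algebra2[OF _ Kk]) measurable
 interpret Ks: prob_space "K s x" by (rule K_prob) fact
 show ?thesis using g
 proof (induction g rule: borel_measurable_induct)
  case (cong f g)
  then show ?case by simp
 next
  case (set A)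
  then have A[measurable]: "A \<in> sets borel" by simp
  have sub: "(\<integral>\<^sup>+\<omega>'. indicator A (\<omega>' u) \<partial>K t y) = ennreal (measure (K t y) {\<omega>' \<in> space path_space. \<omega>' u \<in> A})" for y
  proof -
   interpret prob_space "K t y" by (rule K_prob) fact
   have "(\<integral>\<^sup>+\<omega>'. indicator A (\<omega>' u) \<partial>K t y) = (\<integral>\<^sup>+\<omega>'. indicator {\<omega>' \<in> space path_space. \<omega>' u \<in> A} \<omega>' \<partial>K t y)"
    by (rule nn_integral_cong) (auto simp: K_space[OF t] indicator_def)
   also have "... = emeasure (K t y) {\<omega>' \<in> space path_space. \<omega>' u \<in> A}"
    by (rule nn_integral_indicator) measurable
   finally show ?thesis by (simp add: emeasure_eq_measure)
  qed
  have BA: "{\<omega> \<in> B. \<omega> u \<in> A} \<in> sets (K s x)"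
  proof -
   have "{\<omega> \<in> B. \<omega> u \<in> A} = B \<inter> {\<omega> \<in> space path_space. \<omega> u \<in> A}"
    using sets.sets_into_space[OF B'] by auto
   also have "... \<in> sets (K s x)" by measurable
   finally show ?thesis .
  qed
  have "(\<integral>\<^sup>+\<omega>. indicator B \<omega> * indicator A (\<omega> u) \<partial>K s x) = (\<integral>\<^sup>+\<omega>. indicator {\<omega> \<in> B. \<omega> u \<in> A} \<omega> \<partial>K s x)"
   by (rule nn_integral_cong) (auto simp: indicator_def)
  also have "... = emeasure (K s x) {\<omega> \<in> B. \<omega> u \<in> A}"
   using BA by simp
  also have "... = ennreal (\<integral>\<omega>. indicator B \<omega> * measure (K t (\<omega> t)) {\<omega>' \<in> space path_space. \<omega>' u \<in> A} \<partial>K s x)"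
   unfolding Ks.emeasure_eq_measure markov[OF st B A] ..
  also have "... = (\<integral>\<^sup>+\<omega>. ennreal (indicator B \<omega> * measure (K t (\<omega> t)) {\<omega>' \<in> space path_space. \<omega>' u \<in> A}) \<partial>K s x)"
  proof (rule nn_integral_eq_integral[symmetric])
   have m: "(%\<omega>. measure (K t (\<omega> t)) {\<omega>' \<in> space path_space. \<omega>' u \<in> A}) \<in> borel_measurable path_space"
    by (rule measurable_compose[OF Kk measurable_measure_subprob_algebra]) measurable
   show "integrable (K s x) (%\<omega>. indicator B \<omega> * measure (K t (\<omega> t)) {\<omega>' \<in> space path_space. \<omega>' u \<in> A})"
    using m by (intro Ks.integrable_const_bound[of _ 1])
     (auto simp: indicator_def mult_le_one prob_space.prob_le_1[OF K_prob[OF t]])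
  qed auto
  also have "... = (\<integral>\<^sup>+\<omega>. indicator B \<omega> * (\<integral>\<^sup>+\<omega>'. indicator A (\<omega>' u) \<partial>K t (\<omega> t)) \<partial>K s x)"
   unfolding sub by (intro nn_integral_cong) (auto simp: indicator_def)
  finally show ?case .
 next
  case (mult f c)
  note [measurable] = \<open>f \<in> borel_measurable borel\<close>
  have "(\<integral>\<^sup>+\<omega>. indicator B \<omega> * (c * f (\<omega> u)) \<partial>K s x) = c * (\<integral>\<^sup>+\<omega>. indicator B \<omega> * f (\<omega> u) \<partial>K s x)"
   by (subst nn_integral_cmult[symmetric]) (measurable, simp add: mult_ac)
  also have "... = (\<integral>\<^sup>+\<omega>. c * (indicator B \<omega> * (\<integral>\<^sup>+\<omega>'. f (\<omega>' u) \<partial>K t (\<omega> t))) \<partial>K s x)"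
   unfolding mult using inner[OF mult(2)] by (subst nn_integral_cmult) auto
  also have "... = (\<integral>\<^sup>+\<omega>. indicator B \<omega> * (\<integral>\<^sup>+\<omega>'. c * f (\<omega>' u) \<partial>K t (\<omega> t)) \<partial>K s x)"
   by (intro nn_integral_cong) (subst nn_integral_cmult, measurable, simp add: mult_ac)
  finally show ?case .
 next
  case (add f g)
  note [measurable] = \<open>f \<in> borel_measurable borel\<close> \<open>g \<in> borel_measurable borel\<close> inner[OF \<open>f \<in> borel_measurable borel\<close>] inner[OF \<open>g \<in> borel_measurable borel\<close>]
  show ?case
   by (simp add: distrib_left nn_integral_add add)
 next
  case (seq F)
  note [measurable] = seq(1) inner[OF seq(1)]
  have SUP1: "(SUP i. F i) (\<omega> u) = (SUP i. F i (\<omega> u))" for \<omega> by (simp add: image_image)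
  have inc: "incseq (%i \<omega>. indicator B \<omega> * F i (\<omega> u))"
   using \<open>incseq F\<close> by (auto simp: incseq_def le_fun_def intro!: mult_left_mono)
  have "(\<integral>\<^sup>+\<omega>. indicator B \<omega> * (SUP i. F i) (\<omega> u) \<partial>K s x) = (\<integral>\<^sup>+\<omega>. (SUP i. indicator B \<omega> * F i (\<omega> u)) \<partial>K s x)"
   unfolding SUP1 by (simp add: SUP_mult_left_ennreal)
  also have "... = (SUP i. \<integral>\<^sup>+\<omega>. indicator B \<omega> * F i (\<omega> u) \<partial>K s x)"
   by (rule nn_integral_monotone_convergence_SUP[OF inc]) measurable
  also have "... = (SUP i. \<integral>\<^sup>+\<omega>. indicator B \<omega> * (\<integral>\<^sup>+\<omega>'. F i (\<omega>' u) \<partial>K t (\<omega> t)) \<partial>K s x)"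
   using seq.IH by simp
  also have "... = (\<integral>\<^sup>+\<omega>. (SUP i. indicator B \<omega> * (\<integral>\<^sup>+\<omega>'. F i (\<omega>' u) \<partial>K t (\<omega> t))) \<partial>K s x)"
   using \<open>incseq F\<close>
   by (intro nn_integral_monotone_convergence_SUP[symmetric])
     (auto simp: incseq_def le_fun_def intro!: mult_left_mono nn_integral_mono)
  also have "... = (\<integral>\<^sup>+\<omega>. indicator B \<omega> * (\<integral>\<^sup>+\<omega>'. (SUP i. F i) (\<omega>' u) \<partial>K t (\<omega> t)) \<partial>K s x)"
  proof (intro nn_integral_cong)
   fix \<omega>
   have "(\<integral>\<^sup>+\<omega>'. (SUP i. F i) (\<omega>' u) \<partial>K t (\<omega> t)) = (SUP i. \<integral>\<^sup>+\<omega>'. F i (\<omega>' u) \<partial>K t (\<omega> t))"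
    using \<open>incseq F\<close> unfolding SUP1
    by (intro nn_integral_monotone_convergence_SUP) (auto simp: incseq_def le_fun_def)
   then show "(SUP i. indicator B \<omega> * (\<integral>\<^sup>+\<omega>'. F i (\<omega>' u) \<partial>K t (\<omega> t))) = indicator B \<omega> * (\<integral>\<^sup>+\<omega>'. (SUP i. F i) (\<omega>' u) \<partial>K t (\<omega> t))"
    by (simp add: SUP_mult_left_ennreal)
  qed
  finally show ?case .
 qed
qed

text \<open>Induction on the set of times, removing the largest time b. By \<open>markov_nn\<close>
  at b, the constraint at b and the value at m merge into a function of the position at b. The same
  reduction is valid from s and from r, so the identity for fewer times finishes the step; this is
  why g is generalised.\<close>

lemma cylinder_markov:
 assumes s: "0 <= s" "s <= r" and J: "finite J" and "J \<subseteq> {r..m}" "r <= m"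
  and "\<And>u. u \<in> J ==> A u \<in> sets borel" and "g \<in> borel_measurable borel"
 shows "(\<integral>\<^sup>+\<omega>. indicator (cylinder J A) \<omega> * g (\<omega> m) \<partial>K s x) =
   (\<integral>\<^sup>+\<omega>. (\<integral>\<^sup>+\<omega>'. indicator (cylinder J A) \<omega>' * g (\<omega>' m) \<partial>K r (\<omega> r)) \<partial>K s x)"
 using J assms(4-)
proof (induction J arbitrary: m g rule: finite_linorder_max_induct)
 case empty
 have "(\<integral>\<^sup>+\<omega>. indicator (space path_space) \<omega> * g (\<omega> m) \<partial>K s x) =
     (\<integral>\<^sup>+\<omega>. indicator (space path_space) \<omega> * (\<integral>\<^sup>+\<omega>'. g (\<omega>' m) \<partial>K r (\<omega> r)) \<partial>K s x)"
  using empty s by (intro markov_nn) (auto simp: path_history_def sigma_sets_top)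
 moreover have "(\<integral>\<^sup>+\<omega>'. indicator (space path_space) \<omega>' * g (\<omega>' m) \<partial>K r y) = (\<integral>\<^sup>+\<omega>'. g (\<omega>' m) \<partial>K r y)" for y
  using s by (intro nn_integral_cong) (auto simp: K_space)
 moreover have "(\<integral>\<^sup>+\<omega>. indicator (space path_space) \<omega> * h \<omega> \<partial>K s x) = (\<integral>\<^sup>+\<omega>. h \<omega> \<partial>K s x)" for h
  using s by (intro nn_integral_cong) (auto simp: K_space)
 ultimately show ?case by (simp add: cylinder_def)
next
 case (insert b J)
 have b: "r <= b" "b <= m" "0 <= b" "0 <= m" using insert s by auto
 have A: "A b \<in> sets borel" using insert by auto
 \<comment> \<open>The backward function at the largest time b: its constraint together with the
   mean of g at m as seen from b.\<close>
 define h where "h = (%y. indicator (A b) y * (\<integral>\<^sup>+\<omega>'. g (\<omega>' m) \<partial>K b y))"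
 have "(%y. K b y) \<in> borel \<rightarrow>\<^sub>M subprob_algebra path_space"
  by (intro measurable_prob_algebraD measurable_K) (use b in \<open>auto simp: space_restrict_space\<close>)
 then have "(%y. \<integral>\<^sup>+\<omega>'. g (\<omega>' m) \<partial>K b y) \<in> borel_measurable borel"
  by (rule nn_integral_measurable_subprob_algebra2[rotated])
    (use measurable_compose[OF measurable_compose[OF measurable_snd measurable_path_at[OF b(4)]] \<open>g \<in> borel_measurable borel\<close>]
     in \<open>simp add: case_prod_beta'\<close>)
 then have h: "h \<in> borel_measurable borel"
  unfolding h_def using A by measurable
 have step: "(\<integral>\<^sup>+\<omega>. indicator (cylinder (insert b J) A) \<omega> * g (\<omega> m) \<partial>K s' y) =
   (\<integral>\<^sup>+\<omega>. indicator (cylinder J A) \<omega> * h (\<omega> b) \<partial>K s' y)" if s': "0 <= s'" "s' <= r" for s' y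
 proof -
  have "(\<integral>\<^sup>+\<omega>. indicator (cylinder (insert b J) A) \<omega> * g (\<omega> m) \<partial>K s' y) =
   (\<integral>\<^sup>+\<omega>. indicator (cylinder (insert b J) A) \<omega> * (\<integral>\<^sup>+\<omega>'. g (\<omega>' m) \<partial>K b (\<omega> b)) \<partial>K s' y)"
  proof (rule markov_nn)
   show "cylinder (insert b J) A \<in> path_history s' b"
   proof (rule cylinder_path_history)
    have "r <= u" "u <= b" if "u \<in> insert b J" for u
     using that insert.hyps insert.prems(1) b by auto
    then show "insert b J \<subseteq> {s'..b}" using s' by (meson atLeastAtMost_iff order_trans subsetI)
   qed (use insert in auto)
  qed (use insert s' b in auto)
  also have "... = (\<integral>\<^sup>+\<omega>. indicator (cylinder J A) \<omega> * h (\<omega> b) \<partial>K s' y)"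
   unfolding h_def by (intro nn_integral_cong) (auto simp: cylinder_def indicator_def)
  finally show ?thesis .
 qed
 have "(\<integral>\<^sup>+\<omega>. indicator (cylinder J A) \<omega> * h (\<omega> b) \<partial>K s x) =
   (\<integral>\<^sup>+\<omega>. (\<integral>\<^sup>+\<omega>'. indicator (cylinder J A) \<omega>' * h (\<omega>' b) \<partial>K r (\<omega> r)) \<partial>K s x)"
 proof (rule insert.IH[OF _ _ _ h])
  show "J \<subseteq> {r..b}" using insert.hyps insert.prems(1) by fastforce
 qed (use insert b in auto)
 then show ?case using s step[of s] step[of r] by simp
qed

text \<open>Restarting at time r does not change the law of what follows. Finite-dimensional
  distributions determine a law on the product space, and for those the claim is
  \<open>cylinder_markov\<close>.\<close>

lemma path_tail_markov:
 assumes s: "0 <= s" "s <= r"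
 shows "distr (K s x) path_space (path_tail r) = distr (K s x \<bind> (%\<omega>. K r (\<omega> r))) path_space (path_tail r)"
proof -
 have r: "0 <= r" using s by simp
 let ?PM = "Pi\<^sub>M {0..} (%_. borel) :: (real => 'a) measure"
 let ?B = "K s x \<bind> (%\<omega>. K r (\<omega> r))"
 have Kk: "(%\<omega>. K r (\<omega> r)) \<in> K s x \<rightarrow>\<^sub>M prob_algebra path_space"
  using measurable_K_start[OF r] measurable_cong_sets[OF K_sets[OF s(1)] refl] by blast
 have KK: "K s x \<in> space (prob_algebra (K s x))" using K_prob[OF s(1)] by (simp add: space_prob_algebra)
 have sB: "sets ?B = sets path_space" by (rule sets_bind'[OF KK Kk])
 have pB: "prob_space ?B" by (rule prob_space_bind'[OF KK Kk])
 have mt: "path_tail r \<in> K s x \<rightarrow>\<^sub>M ?PM" "path_tail r \<in> ?B \<rightarrow>\<^sub>M ?PM"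
  using measurable_path_tail_PiM[OF r] measurable_cong_sets[OF K_sets[OF s(1)] refl] measurable_cong_sets[OF sB refl] by blast+
 have mt': "path_tail r \<in> K s x \<rightarrow>\<^sub>M path_space" "path_tail r \<in> ?B \<rightarrow>\<^sub>M path_space"
  using measurable_path_tail[OF r] measurable_cong_sets[OF K_sets[OF s(1)] refl] measurable_cong_sets[OF sB refl] by blast+
 have eq: "distr (K s x) ?PM (path_tail r) = distr ?B ?PM (path_tail r)"
 proof (rule measure_eqI_PiM_infinite)
  show "finite_measure (distr (K s x) ?PM (path_tail r))"
   by (intro prob_space.finite_measure prob_space.prob_space_distr K_prob s mt)
  fix J :: "real set" and A :: "real => 'a set"
  assume J: "finite J" "J \<subseteq> {0..}" and A: "\<And>i. i \<in> J ==> A i \<in> sets borel"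
  let ?X = "prod_emb {0..} (%_. borel) J (Pi\<^sub>E J A)"
  have X: "?X \<in> sets ?PM" using J A by (intro sets_PiM_I) auto
  \<comment> \<open>A tail is read at time max u r, so all constraints at times before r move to r.
    Several sets may be imposed there, hence the intersections in \<open>A'\<close>.\<close>
  define J' where "J' = (%u. max u r) ` J"
  define A' where "A' = (%v. \<Inter>u\<in>{u\<in>J. max u r = v}. A u)"
  define m where "m = Max (insert r J')"
  have A': "A' v \<in> sets borel" if "v \<in> J'" for v
   unfolding A'_def using that J A by (intro sets.finite_INT) (auto simp: J'_def)
  have fJ': "finite J'" using J(1) by (simp add: J'_def)
  have J': "finite J'" "J' \<subseteq> {r..m}" "r <= m"
   using fJ' Max_ge[of "insert r J'"] by (auto simp: m_def) (auto simp: J'_def)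
  have vim: "path_tail r -` ?X \<inter> space path_space = cylinder J' A'"
  proof (rule set_eqI)
   fix \<omega> :: "real => 'a"
   have "path_tail r \<omega> \<in> ?X \<longleftrightarrow> (\<forall>u\<in>J. path_tail r \<omega> u \<in> A u)"
    by (auto simp: prod_emb_def path_tail_def PiE_iff)
   also have "... \<longleftrightarrow> (\<forall>u\<in>J. \<omega> (max u r) \<in> A u)"
    using J(2) by (intro ball_cong refl) (auto simp: path_tail_def subset_eq)
   also have "... \<longleftrightarrow> (\<forall>v\<in>J'. \<omega> v \<in> A' v)"
    by (auto simp: J'_def A'_def)
   finally show "\<omega> \<in> path_tail r -` ?X \<inter> space path_space \<longleftrightarrow> \<omega> \<in> cylinder J' A'"
    by (auto simp: cylinder_def)
  qed
  have cyl: "cylinder J' A' \<in> sets path_space"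
   using cylinder_path_history[OF J'(1,2) A'] path_history_sets[of r m] r by auto
  have "emeasure (distr (K s x) ?PM (path_tail r)) ?X = emeasure (K s x) (cylinder J' A')"
   using emeasure_distr[OF mt(1) X] s by (simp add: vim K_space)
  also have "... = (\<integral>\<^sup>+\<omega>. indicator (cylinder J' A') \<omega> * 1 \<partial>K s x)"
   using cyl s by (simp add: K_sets)
  also have "... = (\<integral>\<^sup>+\<omega>. (\<integral>\<^sup>+\<omega>'. indicator (cylinder J' A') \<omega>' * 1 \<partial>K r (\<omega> r)) \<partial>K s x)"
   by (rule cylinder_markov[OF s J' A']) auto
  also have "... = (\<integral>\<^sup>+\<omega>. emeasure (K r (\<omega> r)) (cylinder J' A') \<partial>K s x)"
   using cyl r by (simp add: K_sets)
  also have "... = emeasure ?B (cylinder J' A')"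
   by (rule emeasure_bind_prob_algebra[OF KK Kk cyl, symmetric])
  also have "... = emeasure (distr ?B ?PM (path_tail r)) ?X"
   using emeasure_distr[OF mt(2) X] sets_eq_imp_space_eq[OF sB] by (simp add: vim)
  finally show "emeasure (distr (K s x) ?PM (path_tail r)) ?X = emeasure (distr ?B ?PM (path_tail r)) ?X" .
 qed auto
 show ?thesis
 proof (rule measure_eqI)
  fix X assume "X \<in> sets (distr (K s x) path_space (path_tail r))"
  then have X: "X \<in> sets path_space" by simp
  \<comment> \<open>Measurable sets of continuous paths are traces of sets of the full product.
    Tails of paths in \<open>path_space\<close> are continuous, so trace and full set have the same
    preimage.\<close>
  then obtain Y where Y: "Y \<in> sets ?PM" and XY: "X = Y \<inter> {\<omega>. continuous_on {0..} \<omega>}"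
   unfolding path_space_def by (auto simp: sets_restrict_space)
  have vim: "path_tail r -` X \<inter> space path_space = path_tail r -` Y \<inter> space path_space"
   using path_tail_in_space[OF r] by (auto simp: XY space_path_space)
  show "emeasure (distr (K s x) path_space (path_tail r)) X = emeasure (distr ?B path_space (path_tail r)) X"
   using emeasure_distr[OF mt'(1) X] emeasure_distr[OF mt'(2) X] emeasure_distr[OF mt(1) Y] emeasure_distr[OF mt(2) Y] eq
   by (simp add: K_space[OF s(1)] sets_eq_imp_space_eq[OF sB] vim)
 qed simp
qed

section \<open>Independent trajectories\<close>

definition path_law :: "nat => real => (nat => 'a) => (nat => real => 'a) measure" where
 "path_law N s x = Pi\<^sub>M {..<N} (%i. K s (x i))"

end

abbreviation multipath :: "nat => (nat => real => 'a::metric_space) measure" where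
 "multipath N \<equiv> Pi\<^sub>M {..<N} (%_. path_space)"

definition positions :: "nat => real => (nat => real => 'a) => nat => 'a" where
 "positions N r \<omega> = (\<lambda>i\<in>{..<N}. \<omega> i r)"

lemma measurable_positions:
 assumes "f \<in> M \<rightarrow>\<^sub>M half_line" "g \<in> M \<rightarrow>\<^sub>M multipath N"
 shows "(%z. positions N (f z) (g z)) \<in> M \<rightarrow>\<^sub>M tuple_space N"
 unfolding positions_def
 by (intro measurable_restrict measurable_path_eval assms measurable_compose[OF assms(2)] measurable_component_singleton) auto

context continuous_markov_process
begin

lemma measurable_path_law:
 assumes "f \<in> M \<rightarrow>\<^sub>M half_line" "g \<in> M \<rightarrow>\<^sub>M tuple_space N"
 shows "(%z. path_law N (f z) (g z)) \<in> M \<rightarrow>\<^sub>M prob_algebra (multipath N)"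
 unfolding path_law_def
 by (intro measurable_PiM_prob_algebra measurable_K assms measurable_compose[OF assms(2)] measurable_component_singleton) auto

lemma path_law_prob: "0 <= s ==> prob_space (path_law N s x)"
 unfolding path_law_def by (intro prob_space_PiM K_prob)

lemma path_law_sets: "0 <= s ==> sets (path_law N s x) = sets (multipath N)"
 unfolding path_law_def by (intro sets_PiM_cong K_sets) auto

lemma path_law_space: "0 <= s ==> space (path_law N s x) = space (multipath N)"
 by (rule sets_eq_imp_space_eq[OF path_law_sets])

text \<open>A functional of the future does not change when every path is replaced by its tail. The
  tails have the same law with and without a restart at r, coordinate by coordinate, and
  \<open>bind_PiM\<close> assembles the restarted coordinates into a mixture of product
  laws.\<close>

lemma path_law_markov:
 assumes s: "0 <= s" "s <= r" and f: "f \<in> borel_measurable (multipath N)"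
  and dep: "\<And>\<omega> \<omega>'. \<lbrakk>\<omega> \<in> space (multipath N); \<omega>' \<in> space (multipath N);
   \<And>i u. i < N ==> r <= u ==> \<omega> i u = \<omega>' i u\<rbrakk> \<Longrightarrow> f \<omega> = f \<omega>'"
 shows "(\<integral>\<^sup>+\<omega>. f \<omega> \<partial>path_law N s x) = (\<integral>\<^sup>+\<omega>. (\<integral>\<^sup>+\<omega>'. f \<omega>' \<partial>path_law N r (positions N r \<omega>)) \<partial>path_law N s x)"
proof -
 have r: "0 <= r" using s by simp
 define B where "B = (%i. K s (x i) \<bind> (%\<omega>. K r (\<omega> r)))"
 have Kk: "(%\<omega>. K r (\<omega> r)) \<in> K s y \<rightarrow>\<^sub>M prob_algebra path_space" for y
  using measurable_K_start[OF r] measurable_cong_sets[OF K_sets[OF s(1)] refl] by blast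
 have KK: "K s y \<in> space (prob_algebra (K s y))" for y using K_prob[OF s(1)] by (simp add: space_prob_algebra)
 have sB: "sets (B i) = sets path_space" for i unfolding B_def by (rule sets_bind'[OF KK Kk])
 have pB: "prob_space (B i)" for i unfolding B_def by (rule prob_space_bind'[OF KK Kk])
 have tail: "(\<integral>\<^sup>+\<omega>. f \<omega> \<partial>Pi\<^sub>M {..<N} M) = (\<integral>\<^sup>+\<omega>. f \<omega> \<partial>Pi\<^sub>M {..<N} (%i. distr (M i) path_space (path_tail r)))"
  if M: "\<And>i. i \<in> {..<N} ==> prob_space (M i)" "\<And>i. i \<in> {..<N} ==> sets (M i) = sets path_space" for M
 proof -
  have sM: "sets (Pi\<^sub>M {..<N} M) = sets (multipath N)" using M by (intro sets_PiM_cong) auto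
  have mt: "path_tail r \<in> M i \<rightarrow>\<^sub>M path_space" if "i \<in> {..<N}" for i
   using measurable_path_tail[OF r] measurable_cong_sets[OF M(2)[OF that] refl] by blast
  have mt2: "path_tail r \<in> M i \<rightarrow>\<^sub>M M i" if "i \<in> {..<N}" for i
   using measurable_path_tail[OF r] measurable_cong_sets[OF M(2)[OF that] M(2)[OF that]] by blast
  have mc: "compose {..<N} (path_tail r) \<in> Pi\<^sub>M {..<N} M \<rightarrow>\<^sub>M multipath N"
   unfolding compose_def
   by (intro measurable_restrict) (rule measurable_compose[OF measurable_component_singleton], auto intro: mt)
  have "(\<integral>\<^sup>+\<omega>. f \<omega> \<partial>Pi\<^sub>M {..<N} M) = (\<integral>\<^sup>+\<omega>. f (compose {..<N} (path_tail r) \<omega>) \<partial>Pi\<^sub>M {..<N} M)"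
  proof (rule nn_integral_cong)
   fix \<omega> assume \<omega>: "\<omega> \<in> space (Pi\<^sub>M {..<N} M)"
   show "f \<omega> = f (compose {..<N} (path_tail r) \<omega>)"
    using \<omega> sets_eq_imp_space_eq[OF sM] measurable_space[OF mc \<omega>] r
    by (intro dep) (auto simp: compose_def path_tail_eq)
  qed
  also have "... = (\<integral>\<^sup>+\<omega>. f \<omega> \<partial>distr (Pi\<^sub>M {..<N} M) (multipath N) (compose {..<N} (path_tail r)))"
   by (rule nn_integral_distr[OF mc, symmetric]) (simp add: f)
  also have "distr (Pi\<^sub>M {..<N} M) (multipath N) (compose {..<N} (path_tail r))
    = distr (Pi\<^sub>M {..<N} M) (Pi\<^sub>M {..<N} M) (compose {..<N} (path_tail r))"
   by (rule distr_cong) (simp_all add: sM)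
  also have "... = Pi\<^sub>M {..<N} (%i. distr (M i) (M i) (path_tail r))"
   by (rule distr_PiM_finite_prob_space') (use M mt2 in auto)
  also have "... = Pi\<^sub>M {..<N} (%i. distr (M i) path_space (path_tail r))"
   by (intro PiM_cong refl distr_cong M)
  finally show ?thesis .
 qed
 have "(\<integral>\<^sup>+\<omega>. f \<omega> \<partial>path_law N s x) = (\<integral>\<^sup>+\<omega>. f \<omega> \<partial>Pi\<^sub>M {..<N} (%i. distr (K s (x i)) path_space (path_tail r)))"
  unfolding path_law_def by (rule tail) (use s in \<open>auto simp: K_prob K_sets\<close>)
 also have "... = (\<integral>\<^sup>+\<omega>. f \<omega> \<partial>Pi\<^sub>M {..<N} (%i. distr (B i) path_space (path_tail r)))"
  unfolding B_def path_tail_markov[OF s] ..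
 also have "... = (\<integral>\<^sup>+\<omega>. f \<omega> \<partial>Pi\<^sub>M {..<N} B)"
  by (rule tail[symmetric]) (auto simp: sB pB)
 also have "Pi\<^sub>M {..<N} B = path_law N s x \<bind> (%\<omega>. Pi\<^sub>M {..<N} (%i. K r (\<omega> i r)))"
  unfolding B_def path_law_def
  by (rule bind_PiM[where N="%_. path_space"]) (use s Kk in \<open>auto simp: K_prob\<close>)
 also have "(%\<omega>. Pi\<^sub>M {..<N} (%i. K r (\<omega> i r))) = (%\<omega>. path_law N r (positions N r \<omega>))"
  unfolding path_law_def positions_def by (intro ext PiM_cong) auto
 also have "(\<integral>\<^sup>+\<omega>. f \<omega> \<partial>(path_law N s x \<bind> (%\<omega>. path_law N r (positions N r \<omega>)))) =
   (\<integral>\<^sup>+\<omega>. (\<integral>\<^sup>+\<omega>'. f \<omega>' \<partial>path_law N r (positions N r \<omega>)) \<partial>path_law N s x)"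
 proof (rule nn_integral_bind[OF f])
  have "(%\<omega>. path_law N r (positions N r \<omega>)) \<in> multipath N \<rightarrow>\<^sub>M subprob_algebra (multipath N)"
   by (intro measurable_prob_algebraD measurable_path_law measurable_positions) (use r in \<open>auto simp: space_restrict_space\<close>)
  then show "(%\<omega>. path_law N r (positions N r \<omega>)) \<in> path_law N s x \<rightarrow>\<^sub>M subprob_algebra (multipath N)"
   using measurable_cong_sets[OF path_law_sets[OF s(1)] refl] by blast
 qed
 finally show ?thesis .
qed

lemma path_law_start:
 assumes "0 <= s" shows "AE \<omega> in path_law N s x. \<forall>i<N. \<omega> i s = x i"
proof -
 have "AE \<omega> in path_law N s x. \<omega> i s = x i" if "i \<in> {..<N}" for i
  unfolding path_law_def using assms that start[OF assms, of "x i"]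
  by (intro AE_PiM_component K_prob) auto
 then have "AE \<omega> in path_law N s x. \<forall>i\<in>{..<N}. \<omega> i s = x i"
  by (subst AE_finite_all) auto
 then show ?thesis by (simp add: Ball_def)
qed

end

section \<open>Exponential clocks and the first ring\<close>

text \<open>The law of s plus an exponential time of rate l: the next ring of a clock that is known
  to have been silent up to s.\<close>

definition clock_law :: "real => real => real measure" where
 "clock_law l s = restrict_space (density lborel (%c. ennreal (if s <= c then l * exp (- l * (c - s)) else 0))) {0..}"

lemma sets_clock_law[simp, measurable_cong]: "sets (clock_law l s) = sets half_line"
 by (simp add: clock_law_def sets_restrict_space)

lemma space_clock_law[simp]: "space (clock_law l s) = {0..}"
 by (simp add: clock_law_def space_restrict_space)

lemma measurable_clock_law[simp]: "measurable (clock_law l s) M = measurable half_line M"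
 by (rule measurable_cong_sets) auto

lemma measurable_clock_law_pair: "measurable (M \<Otimes>\<^sub>M clock_law l s) L = measurable (M \<Otimes>\<^sub>M half_line) L"
 by (intro measurable_cong_sets sets_pair_measure_cong) auto

lemma half_line_ident: "(%x. x) \<in> borel_measurable half_line"
 by (rule measurable_restrict_space1) simp

lemma exponential_law_eq_clock_law: "exponential_law l = clock_law l 0"
 unfolding exponential_law_def clock_law_def exponential_density_def
 by (intro arg_cong[where f="%M. restrict_space M {0..}"] density_cong) (auto simp: not_less mult_ac)

lemma nn_integral_clock_law:
 assumes s: "0 <= s" and h: "h \<in> borel_measurable half_line"
 shows "(\<integral>\<^sup>+c. h c \<partial>clock_law l s) = (\<integral>\<^sup>+c. indicator {s..} c * (ennreal (l * exp (- l * (c - s))) * h c) \<partial>lborel)"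
proof -
 have h': "(%c. h c * indicator {0..} c) \<in> borel_measurable borel"
  using h by (subst (asm) borel_measurable_restrict_space_iff_ennreal) auto
 have "(\<integral>\<^sup>+c. h c \<partial>clock_law l s) = (\<integral>\<^sup>+c. h c * indicator {0..} c \<partial>density lborel (%c. ennreal (if s <= c then l * exp (- l * (c - s)) else 0)))"
  unfolding clock_law_def by (rule nn_integral_restrict_space) simp
 also have "... = (\<integral>\<^sup>+c. ennreal (if s <= c then l * exp (- l * (c - s)) else 0) * (h c * indicator {0..} c) \<partial>lborel)"
  using h' by (intro nn_integral_density) auto
 also have "... = (\<integral>\<^sup>+c. indicator {s..} c * (ennreal (l * exp (- l * (c - s))) * h c) \<partial>lborel)"
  using s by (intro nn_integral_cong) (auto simp: indicator_def)
 finally show ?thesis .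
qed

lemma nn_integral_clock_law_shift:
 assumes s: "0 <= s" and h: "h \<in> borel_measurable half_line"
 shows "(\<integral>\<^sup>+c. h (s + c) \<partial>clock_law l 0) = (\<integral>\<^sup>+c. h c \<partial>clock_law l s)"
proof -
 have h': "(%c. h c * indicator {0..} c) \<in> borel_measurable borel"
  using h by (subst (asm) borel_measurable_restrict_space_iff_ennreal) auto
 have m: "(%c. indicator {s..} c * (ennreal (l * exp (- l * (c - s))) * (h c * indicator {0..} c))) \<in> borel_measurable borel"
  using h' by measurable
 have "(%c. s + c) \<in> half_line \<rightarrow>\<^sub>M half_line"
  using s by (intro measurable_restrict_space3) (auto intro: borel_measurable_add)
 then have "(\<integral>\<^sup>+c. h (s + c) \<partial>clock_law l 0) = (\<integral>\<^sup>+c. indicator {0..} c * (ennreal (l * exp (- l * (c - 0))) * h (s + c)) \<partial>lborel)"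
  by (intro nn_integral_clock_law measurable_compose[OF _ h]) auto
 also have "... = (\<integral>\<^sup>+c. indicator {s..} (s + 1 * c) * (ennreal (l * exp (- l * (s + 1 * c - s))) * (h (s + 1 * c) * indicator {0..} (s + 1 * c))) \<partial>lborel)"
  using s by (intro nn_integral_cong) (auto simp: indicator_def)
 also have "... = (\<integral>\<^sup>+c. indicator {s..} c * (ennreal (l * exp (- l * (c - s))) * (h c * indicator {0..} c)) \<partial>lborel)"
  using nn_integral_real_affine[of "%c. indicator {s..} c * (ennreal (l * exp (- l * (c - s))) * (h c * indicator {0..} c))" 1 s] m
  by simp
 also have "... = (\<integral>\<^sup>+c. h c \<partial>clock_law l s)"
  unfolding nn_integral_clock_law[OF s h] using s by (intro nn_integral_cong) (auto simp: indicator_def)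
 finally show ?thesis .
qed

lemma prob_space_clock_law:
 assumes l: "0 < l" and s: "0 <= s" shows "prob_space (clock_law l s)"
proof
 have "emeasure (clock_law l s) (space (clock_law l s)) = (\<integral>\<^sup>+c. 1 \<partial>clock_law l s)" by simp
 also have "... = (\<integral>\<^sup>+c. 1 \<partial>clock_law l 0)"
  by (rule nn_integral_clock_law_shift[OF s, symmetric]) simp
 also have "... = (\<integral>\<^sup>+c. ennreal (exponential_density l c) \<partial>lborel)"
  by (subst nn_integral_clock_law) (auto intro!: nn_integral_cong simp: exponential_density_def indicator_def mult_ac)
 also have "... = emeasure (density lborel (exponential_density l)) (space (density lborel (exponential_density l)))"
  by (subst emeasure_density) auto
 also have "... = 1" using prob_space.emeasure_space_1[OF prob_space_exponential_density[OF l]] .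
 finally show "emeasure (clock_law l s) (space (clock_law l s)) = 1" .
qed

text \<open>Memorylessness: silence until r has probability exp(-l (r - s)), and on that event the
  clock behaves as if it had been started at r.\<close>

lemma nn_integral_clock_law_ge:
 assumes l: "0 < l" and s: "0 <= s" "s <= r" and h: "h \<in> borel_measurable half_line"
 shows "(\<integral>\<^sup>+c. indicator {r..} c * h c \<partial>clock_law l s) = ennreal (exp (- l * (r - s))) * (\<integral>\<^sup>+c. h c \<partial>clock_law l r)"
proof -
 have r: "0 <= r" using s by simp
 have m: "(%c. indicator {r..} c * (ennreal (l * exp (- l * (c - r))) * h c)) \<in> borel_measurable lborel"
 proof -
  have "(%c. h c * indicator {0..} c) \<in> borel_measurable borel"
   using h by (subst (asm) borel_measurable_restrict_space_iff_ennreal) auto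
  then have "(%c. indicator {r..} c * (ennreal (l * exp (- l * (c - r))) * (h c * indicator {0..} c))) \<in> borel_measurable lborel"
   by measurable
  also have "(%c. indicator {r..} c * (ennreal (l * exp (- l * (c - r))) * (h c * indicator {0..} c))) = (%c. indicator {r..} c * (ennreal (l * exp (- l * (c - r))) * h c))"
   using r by (auto simp: fun_eq_iff indicator_def)
  finally show ?thesis .
 qed
 have ind: "indicator {r..} \<in> borel_measurable half_line"
  by (rule measurable_restrict_space1) simp
 have "(\<integral>\<^sup>+c. indicator {r..} c * h c \<partial>clock_law l s) = (\<integral>\<^sup>+c. indicator {s..} c * (ennreal (l * exp (- l * (c - s))) * (indicator {r..} c * h c)) \<partial>lborel)"
  using ind h by (intro nn_integral_clock_law s borel_measurable_times_ennreal)
 also have "... = (\<integral>\<^sup>+c. ennreal (exp (- l * (r - s))) * (indicator {r..} c * (ennreal (l * exp (- l * (c - r))) * h c)) \<partial>lborel)"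
 proof (intro nn_integral_cong)
  fix c
  have "exp (- (l * (c - s))) = exp (- (l * (r - s))) * exp (- (l * (c - r)))"
   by (simp add: exp_add[symmetric] algebra_simps)
  then have "ennreal (l * exp (- l * (c - s))) = ennreal (exp (- l * (r - s))) * ennreal (l * exp (- l * (c - r)))"
   using l by (simp add: ennreal_mult[symmetric] mult_ac)
  then show "indicator {s..} c * (ennreal (l * exp (- l * (c - s))) * (indicator {r..} c * h c)) =
    ennreal (exp (- l * (r - s))) * (indicator {r..} c * (ennreal (l * exp (- l * (c - r))) * h c))"
   using s by (auto simp: indicator_def mult_ac)
 qed
 also have "... = ennreal (exp (- l * (r - s))) * (\<integral>\<^sup>+c. h c \<partial>clock_law l r)"
  using m by (subst nn_integral_cmult) (auto simp: nn_integral_clock_law[OF r h])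
 finally show ?thesis .
qed

text \<open>Memorylessness for several independent clocks at once; splitting off one clock at a time
  multiplies the survival probabilities, which puts the number of clocks into the exponent.\<close>

lemma nn_integral_clocks_ge:
 assumes l: "0 < l" and s: "0 <= s" "s <= r" and I: "finite I"
  and f: "f \<in> borel_measurable (Pi\<^sub>M I (%_. half_line))"
 shows "(\<integral>\<^sup>+c. (\<Prod>i\<in>I. indicator {r..} (c i)) * f c \<partial>Pi\<^sub>M I (%_. clock_law l s)) =
   ennreal (exp (- real (card I) * l * (r - s))) * (\<integral>\<^sup>+c. f c \<partial>Pi\<^sub>M I (%_. clock_law l r))"
 using I f
proof (induction I arbitrary: f rule: finite_induct)
 case empty
 then show ?case by (simp add: PiM_empty)
next
 case (insert i I)
 have r: "0 <= r" using s by simp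
 interpret S: product_prob_space "%_. clock_law l s" by (rule product_prob_spaceI) (rule prob_space_clock_law[OF l s(1)])
 interpret R: product_prob_space "%_. clock_law l r" by (rule product_prob_spaceI) (rule prob_space_clock_law[OF l r])
 have cs[measurable_cong]: "sets (Pi\<^sub>M J (%_. clock_law l a)) = sets (Pi\<^sub>M J (%_. half_line))" for a J
  by (intro sets_PiM_cong) auto
 note fm[measurable] = insert.prems
 have ind[measurable]: "indicator {r..} \<in> borel_measurable half_line"
  by (rule measurable_restrict_space1) simp
 have F: "(%c. (\<Prod>j\<in>insert i I. indicator {r..} (c j)) * f c) \<in> borel_measurable (Pi\<^sub>M (insert i I) (%_. clock_law l s))"
  using insert(1) by (intro borel_measurable_times_ennreal borel_measurable_prod_ennreal) measurable
 have upd: "(%(x, y). x(i := y)) \<in> Pi\<^sub>M I (%_. half_line) \<Otimes>\<^sub>M half_line \<rightarrow>\<^sub>M Pi\<^sub>M (insert i I) (%_. half_line)"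
  by (rule measurable_add_dim)
 have fupd: "(%(x, y). f (x(i := y))) \<in> borel_measurable (Pi\<^sub>M I (%_. half_line) \<Otimes>\<^sub>M half_line)"
  using measurable_compose[OF upd fm] by (simp add: case_prod_beta')
 have fy: "(%y. f (x(i := y))) \<in> borel_measurable half_line" if "x \<in> space (Pi\<^sub>M I (%_. half_line))" for x
  using measurable_compose[OF measurable_Pair1'[OF that] fupd] by simp
 interpret rr: prob_space "clock_law l r" by (rule prob_space_clock_law[OF l r])
 have fx: "(%x. \<integral>\<^sup>+y. f (x(i := y)) \<partial>clock_law l r) \<in> borel_measurable (Pi\<^sub>M I (%_. half_line))"
  using fupd by measurable
 have "(\<integral>\<^sup>+c. (\<Prod>j\<in>insert i I. indicator {r..} (c j)) * f c \<partial>Pi\<^sub>M (insert i I) (%_. clock_law l s)) =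
  (\<integral>\<^sup>+x. (\<integral>\<^sup>+y. (\<Prod>j\<in>insert i I. indicator {r..} ((x(i := y)) j)) * f (x(i := y)) \<partial>clock_law l s) \<partial>Pi\<^sub>M I (%_. clock_law l s))"
  by (rule S.product_nn_integral_insert[OF insert(1,2) F])
 also have "... = (\<integral>\<^sup>+x. (\<Prod>j\<in>I. indicator {r..} (x j)) * (ennreal (exp (- l * (r - s))) * (\<integral>\<^sup>+y. f (x(i := y)) \<partial>clock_law l r)) \<partial>Pi\<^sub>M I (%_. clock_law l s))"
 proof (rule nn_integral_cong)
  fix x assume x: "x \<in> space (Pi\<^sub>M I (%_. clock_law l s))"
  then have x: "x \<in> space (Pi\<^sub>M I (%_. half_line))" using sets_eq_imp_space_eq[OF cs] by blast
  have "(\<integral>\<^sup>+y. (\<Prod>j\<in>insert i I. indicator {r..} ((x(i := y)) j)) * f (x(i := y)) \<partial>clock_law l s) =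
    (\<integral>\<^sup>+y. (\<Prod>j\<in>I. indicator {r..} (x j)) * (indicator {r..} y * f (x(i := y))) \<partial>clock_law l s)"
  proof (rule nn_integral_cong)
   fix y
   have "(\<Prod>j\<in>I. indicator {r..} ((x(i := y)) j)) = (\<Prod>j\<in>I. indicator {r..} (x j) :: ennreal)"
    using insert(2) by (intro prod.cong) auto
   then show "(\<Prod>j\<in>insert i I. indicator {r..} ((x(i := y)) j)) * f (x(i := y)) = (\<Prod>j\<in>I. indicator {r..} (x j)) * (indicator {r..} y * f (x(i := y)))"
    using insert(1,2) by (simp add: mult_ac)
  qed
  also have "... = (\<Prod>j\<in>I. indicator {r..} (x j)) * (\<integral>\<^sup>+y. indicator {r..} y * f (x(i := y)) \<partial>clock_law l s)"
   using ind fy[OF x] by (intro nn_integral_cmult borel_measurable_times_ennreal) simp_all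
  also have "... = (\<Prod>j\<in>I. indicator {r..} (x j)) * (ennreal (exp (- l * (r - s))) * (\<integral>\<^sup>+y. f (x(i := y)) \<partial>clock_law l r))"
   by (subst nn_integral_clock_law_ge[OF l s fy[OF x]]) simp
  finally show "(\<integral>\<^sup>+y. (\<Prod>j\<in>insert i I. indicator {r..} ((x(i := y)) j)) * f (x(i := y)) \<partial>clock_law l s) =
   (\<Prod>j\<in>I. indicator {r..} (x j)) * (ennreal (exp (- l * (r - s))) * (\<integral>\<^sup>+y. f (x(i := y)) \<partial>clock_law l r))" .
 qed
 also have "... = ennreal (exp (- real (card I) * l * (r - s))) * (\<integral>\<^sup>+x. ennreal (exp (- l * (r - s))) * (\<integral>\<^sup>+y. f (x(i := y)) \<partial>clock_law l r) \<partial>Pi\<^sub>M I (%_. clock_law l r))"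
  using fx by (intro insert.IH) measurable
 also have "... = ennreal (exp (- real (card I) * l * (r - s))) * ennreal (exp (- l * (r - s))) * (\<integral>\<^sup>+x. (\<integral>\<^sup>+y. f (x(i := y)) \<partial>clock_law l r) \<partial>Pi\<^sub>M I (%_. clock_law l r))"
  using fx by (subst nn_integral_cmult) (auto simp: mult_ac)
 also have "ennreal (exp (- real (card I) * l * (r - s))) * ennreal (exp (- l * (r - s))) = ennreal (exp (- real (card (insert i I)) * l * (r - s)))"
  using insert(1,2) by (simp add: ennreal_mult[symmetric] exp_add[symmetric] algebra_simps)
 also have "(\<integral>\<^sup>+x. (\<integral>\<^sup>+y. f (x(i := y)) \<partial>clock_law l r) \<partial>Pi\<^sub>M I (%_. clock_law l r)) = (\<integral>\<^sup>+c. f c \<partial>Pi\<^sub>M (insert i I) (%_. clock_law l r))"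
  by (rule R.product_nn_integral_insert[OF insert(1,2), symmetric]) measurable
 finally show ?case .
qed

lemma AE_clock_law_neq: "0 <= s ==> AE c in clock_law l s. c \<noteq> r"
proof -
 assume s: "0 <= s"
 have [measurable]: "indicator {r} \<in> borel_measurable half_line"
  by (rule measurable_restrict_space1) simp
 have "(\<integral>\<^sup>+c. indicator {r} c \<partial>clock_law l s) = (\<integral>\<^sup>+c. indicator {s..} c * (ennreal (l * exp (- l * (c - s))) * indicator {r} c) \<partial>lborel)"
  using s by (rule nn_integral_clock_law) measurable
 also have "... = (\<integral>\<^sup>+(c::real). 0 \<partial>lborel)"
 proof (rule nn_integral_cong_AE)
  show "AE c in lborel. indicator {s..} c * (ennreal (l * exp (- l * (c - s))) * indicator {r} c) = 0"
   using AE_lborel_singleton[of r] by eventually_elim (auto simp: indicator_def)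
 qed
 finally have "(\<integral>\<^sup>+c. indicator {r} c \<partial>clock_law l s) = 0" by simp
 then have "AE c in clock_law l s. indicator {r} c = (0::ennreal)"
  by (subst (asm) nn_integral_0_iff_AE) auto
 then show ?thesis by (rule AE_mp) (auto simp: indicator_def)
qed

lemma first_to_ring_props:
 assumes N: "1 <= N"
 shows "first_to_ring N c < N" "\<And>j. j < N ==> c (first_to_ring N c) <= c j"
proof -
 have "finite (c ` {..<N})" "c ` {..<N} \<noteq> {}" using N by (auto simp: lessThan_empty_iff)
 then obtain i where "i < N" "c i = Min (c ` {..<N})"
  by (metis (mono_tags, lifting) Min_in image_iff lessThan_iff)
 then have "i < N \<and> (\<forall>j<N. c i <= c j)" by simp
 then have "first_to_ring N c < N \<and> (\<forall>j<N. c (first_to_ring N c) <= c j)"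
  unfolding first_to_ring_def by (rule LeastI)
 then show "first_to_ring N c < N" "\<And>j. j < N ==> c (first_to_ring N c) <= c j" by auto
qed

lemma first_to_ring_strict:
 assumes "i < N" "\<And>j. j < N ==> j \<noteq> i ==> c i < c j"
 shows "first_to_ring N c = i"
 unfolding first_to_ring_def
proof (rule Least_equality)
 show "i < N \<and> (\<forall>j<N. c i <= c j)" using assms by (metis less_eq_real_def)
 fix k assume k: "k < N \<and> (\<forall>j<N. c k <= c j)"
 then have "c k <= c i" using assms by auto
 then have "k = i" using k assms(2)[of k] by force
 then show "i <= k" by simp
qed

lemma measurable_first_to_ring[measurable]:
 "first_to_ring N \<in> Pi\<^sub>M {..<N} (%_. half_line) \<rightarrow>\<^sub>M count_space UNIV"
proof -
 have c: "(%c. c i) \<in> borel_measurable (Pi\<^sub>M {..<N} (%_. half_line))" if "i < N" for i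
  by (rule measurable_compose[OF measurable_component_singleton[of i] measurable_restrict_space1[OF measurable_ident_sets[OF refl]]]) (use that in auto)
 have "(%c. i < N \<and> (\<forall>j<N. c i <= c j)) \<in> Pi\<^sub>M {..<N} (%_. half_line) \<rightarrow>\<^sub>M count_space UNIV" for i
 proof (cases "i < N")
  case True
  have "(%c. \<forall>j\<in>{..<N}. c i <= c j) \<in> Pi\<^sub>M {..<N} (%_. half_line) \<rightarrow>\<^sub>M count_space UNIV"
   using True c by (intro pred_intros_finite borel_measurable_le[unfolded pred_def[symmetric]]) (auto simp: pred_def intro!: borel_measurable_le)
  also have "(%c. \<forall>j\<in>{..<N}. c i <= c j) = (%c :: nat => real. i < N \<and> (\<forall>j<N. c i <= c j))"
   using True by (intro ext) auto
  finally show ?thesis .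
 qed simp
 then show ?thesis unfolding first_to_ring_def[abs_def] by measurable
qed

lemma measurable_clock_law_kernel:
 assumes l: "0 < l" shows "clock_law l \<in> half_line \<rightarrow>\<^sub>M prob_algebra half_line"
proof (rule measurable_prob_algebraI)
 show prob: "prob_space (clock_law l s)" if "s \<in> space half_line" for s
  using that l by (intro prob_space_clock_law) (auto simp: space_restrict_space)
 show "clock_law l \<in> half_line \<rightarrow>\<^sub>M subprob_algebra half_line"
 proof (rule measurable_subprob_algebra)
  show "subprob_space (clock_law l s)" if "s \<in> space half_line" for s
   by (intro prob_space_imp_subprob_space prob that)
  fix A assume A[measurable]: "A \<in> sets half_line"
  interpret Z: prob_space "clock_law l 0" by (rule prob_space_clock_law[OF l]) simp
  have plus: "(%z. fst z + snd z) \<in> half_line \<Otimes>\<^sub>M half_line \<rightarrow>\<^sub>M half_line"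
   using measurable_compose[OF measurable_fst half_line_ident] measurable_compose[OF measurable_snd half_line_ident]
   by (intro measurable_half_lineI) (auto simp: space_pair_measure space_restrict_space intro!: borel_measurable_add)
  have "(%s. \<integral>\<^sup>+c. indicator A (s + c) \<partial>clock_law l 0) \<in> borel_measurable half_line"
  proof (rule Z.borel_measurable_nn_integral)
   show "(%(s, c). indicator A (s + c)) \<in> borel_measurable (half_line \<Otimes>\<^sub>M clock_law l 0)"
    using measurable_compose[OF plus borel_measurable_indicator[OF A]]
    by (simp add: case_prod_beta' measurable_clock_law_pair)
  qed
  moreover have "(\<integral>\<^sup>+c. indicator A (s + c) \<partial>clock_law l 0) = emeasure (clock_law l s) A" if "s \<in> space half_line" for s
  proof -
   have "(\<integral>\<^sup>+c. indicator A (s + c) \<partial>clock_law l 0) = (\<integral>\<^sup>+c. indicator A c \<partial>clock_law l s)"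
    using that by (intro nn_integral_clock_law_shift) (auto simp: space_restrict_space)
   then show ?thesis by simp
  qed
  ultimately show "(%s. emeasure (clock_law l s) A) \<in> borel_measurable half_line"
   by (rule iffD1[OF measurable_cong, rotated])
 qed simp
qed

definition clocks_law :: "real => nat => real => (nat => real) measure" where
 "clocks_law l N s = Pi\<^sub>M {..<N} (%_. clock_law l s)"

lemma measurable_clocks_law:
 assumes "0 < l" shows "clocks_law l N \<in> half_line \<rightarrow>\<^sub>M prob_algebra (Pi\<^sub>M {..<N} (%_. half_line))"
 unfolding clocks_law_def by (intro measurable_PiM_prob_algebra measurable_clock_law_kernel assms) simp

lemma borel_measurable_half_line_indicator:
 fixes F :: "real => ennreal"
 assumes F: "F \<in> borel_measurable half_line" and s: "A \<in> sets borel" "A \<subseteq> {0..}"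
 shows "(%r. indicator A r * F r) \<in> borel_measurable borel"
proof -
 have "(%r. F r * indicator {0..} r) \<in> borel_measurable borel"
  using F by (subst (asm) borel_measurable_restrict_space_iff_ennreal) auto
 then have "(%r. indicator A r * (F r * indicator {0..} r)) \<in> borel_measurable borel"
  using s(1) by measurable
 also have "(%r. indicator A r * (F r * indicator {0..} r)) = (%r. indicator A r * F r)"
  using s(2) by (auto simp: fun_eq_iff indicator_def)
 finally show ?thesis .
qed

lemma half_line_fun_upd:
 assumes "i \<in> I" "f \<in> M \<rightarrow>\<^sub>M Pi\<^sub>M I N" "g \<in> M \<rightarrow>\<^sub>M N i"
 shows "(%z. (f z)(i := g z)) \<in> M \<rightarrow>\<^sub>M Pi\<^sub>M I N"
 using measurable_compose[OF measurable_Pair[OF assms(2,3)] measurable_add_dim[of i I N]] assms(1)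
 by (simp add: insert_absorb)

text \<open>Decompose by the index i and the time r of the first ring. Clock i has density l exp(-l
  (r - s)) at r. The other N - 1 clocks must be silent until r, which costs exp(-(N - 1) l (r - s))
  and leaves them fresh at r; the reset makes clock i fresh as well. So after the ring all N clocks
  are independent and started at r, whichever of them rang.\<close>

lemma nn_integral_first_ring:
 fixes \<Psi> :: "nat => real => (nat => real) => ennreal"
 assumes l: "0 < l" and N: "1 <= N" and s: "0 <= s"
  and \<Psi>: "\<And>i. i < N ==> (%(r, c). \<Psi> i r c) \<in> borel_measurable (half_line \<Otimes>\<^sub>M Pi\<^sub>M {..<N} (%_. half_line))"
 shows "(\<integral>\<^sup>+c. indicator {..t} (c (first_to_ring N c)) *
    (\<integral>\<^sup>+\<sigma>. \<Psi> (first_to_ring N c) (c (first_to_ring N c)) (c(first_to_ring N c := c (first_to_ring N c) + \<sigma>)) \<partial>clock_law l 0)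
    \<partial>Pi\<^sub>M {..<N} (%_. clock_law l s)) =
   (\<integral>\<^sup>+r. indicator {s..t} r * (\<Sum>i<N. ennreal (l * exp (- real N * l * (r - s))) * (\<integral>\<^sup>+c. \<Psi> i r c \<partial>Pi\<^sub>M {..<N} (%_. clock_law l r))) \<partial>lborel)"
proof -
 interpret S: product_prob_space "%_::nat. clock_law l s" by (rule product_prob_spaceI) (rule prob_space_clock_law[OF l s(1)])
 interpret Z: prob_space "clock_law l 0" by (rule prob_space_clock_law[OF l]) simp
 have cs[measurable_cong]: "sets (Pi\<^sub>M J (%_. clock_law l a)) = sets (Pi\<^sub>M J (%_. half_line))" for a and J :: "nat set"
  by (intro sets_PiM_cong) auto
 let ?C = "Pi\<^sub>M {..<N} (%_. half_line) :: (nat => real) measure"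
 have ind: "indicator {..t} \<in> borel_measurable half_line"
  by (rule measurable_restrict_space1) simp
 define f where "f = (%i c. indicator {..t} (c i) * (\<integral>\<^sup>+\<sigma>. \<Psi> i (c i) (c(i := c i + \<sigma>)) \<partial>clock_law l 0))"
 have plus: "(%z. g z + h z) \<in> M \<rightarrow>\<^sub>M half_line" if "g \<in> M \<rightarrow>\<^sub>M half_line" "h \<in> M \<rightarrow>\<^sub>M half_line" for M and g h :: "'z => real"
  using that by (auto simp: measurable_restrict_space2_iff Pi_iff)
 have fm: "f i \<in> borel_measurable ?C" if i: "i < N" for i
 proof -
  have ci: "(%c. c i) \<in> ?C \<rightarrow>\<^sub>M half_line" using i by (intro measurable_component_singleton) simp
  have "(%(c, \<sigma>). \<Psi> i (c i) (c(i := c i + \<sigma>))) \<in> borel_measurable (?C \<Otimes>\<^sub>M clock_law l 0)"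
  proof -
   have *: "(%z. fst z i) \<in> ?C \<Otimes>\<^sub>M half_line \<rightarrow>\<^sub>M half_line" by (rule measurable_compose[OF measurable_fst ci])
   have "(%z. (fst z i, (fst z)(i := fst z i + snd z))) \<in> ?C \<Otimes>\<^sub>M half_line \<rightarrow>\<^sub>M half_line \<Otimes>\<^sub>M ?C"
    using i by (intro measurable_Pair half_line_fun_upd plus * measurable_fst measurable_snd) auto
   from measurable_compose[OF this \<Psi>[OF i]] show ?thesis
    by (simp add: case_prod_beta' measurable_clock_law_pair)
  qed
  then have "(%c. \<integral>\<^sup>+\<sigma>. \<Psi> i (c i) (c(i := c i + \<sigma>)) \<partial>clock_law l 0) \<in> borel_measurable ?C"
   by (rule Z.borel_measurable_nn_integral)
  then show ?thesis unfolding f_def by (intro borel_measurable_times_ennreal measurable_compose[OF ci ind])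
 qed
 have first[measurable]: "Measurable.pred ?C (%c. first_to_ring N c = i)" for i by measurable
 have fm': "(%c. indicator {c. first_to_ring N c = i} c * f i c) \<in> borel_measurable ?C" if "i < N" for i
  using fm[OF that] by (intro borel_measurable_times_ennreal borel_measurable_indicator') measurable
 have one: "(\<integral>\<^sup>+c. indicator {c. first_to_ring N c = i} c * f i c \<partial>Pi\<^sub>M {..<N} (%_. clock_law l s)) =
   (\<integral>\<^sup>+r. indicator {s..t} r * (ennreal (l * exp (- real N * l * (r - s))) * (\<integral>\<^sup>+c. \<Psi> i r c \<partial>Pi\<^sub>M {..<N} (%_. clock_law l r))) \<partial>lborel)"
  if i: "i < N" for i
 proof -
  define I where "I = {..<N} - {i}"
  have I: "finite I" "i \<notin> I" "insert i I = {..<N}" "card I = N - 1" using i by (auto simp: I_def)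
  define h where "h = (%y. \<integral>\<^sup>+x. indicator {c. first_to_ring N c = i} (x(i := y)) * f i (x(i := y)) \<partial>Pi\<^sub>M I (%_. clock_law l s))"
  interpret SI: prob_space "Pi\<^sub>M I (%_. clock_law l s)" by (intro prob_space_PiM prob_space_clock_law l s)
  have hm: "h \<in> borel_measurable half_line"
   unfolding h_def
  proof (rule SI.borel_measurable_nn_integral)
   have "(%z. (snd z)(i := fst z)) \<in> half_line \<Otimes>\<^sub>M Pi\<^sub>M I (%_. half_line) \<rightarrow>\<^sub>M Pi\<^sub>M (insert i I) (%_. half_line)"
    using measurable_compose[OF measurable_pair_swap' measurable_add_dim[of i I "%_. half_line"]] by (simp add: case_prod_beta')
   from measurable_compose[OF this[unfolded I] fm'[OF i]]
   show "(%(y, x). indicator {c. first_to_ring N c = i} (x(i := y)) * f i (x(i := y))) \<in> borel_measurable (half_line \<Otimes>\<^sub>M Pi\<^sub>M I (%_. clock_law l s))"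
    by (simp add: case_prod_beta' measurable_cong_sets[OF sets_pair_measure_cong[OF refl cs] refl])
  qed
  have "(\<integral>\<^sup>+c. indicator {c. first_to_ring N c = i} c * f i c \<partial>Pi\<^sub>M {..<N} (%_. clock_law l s)) = (\<integral>\<^sup>+y. h y \<partial>clock_law l s)"
   unfolding h_def I(3)[symmetric]
   by (rule S.product_nn_integral_insert_rev[OF I(1,2)]) (use fm'[OF i] in \<open>simp add: I(3) measurable_cong_sets[OF cs refl]\<close>)
  also have "... = (\<integral>\<^sup>+y. indicator {s..} y * (ennreal (l * exp (- l * (y - s))) * h y) \<partial>lborel)"
   by (rule nn_integral_clock_law[OF s hm])
  also have "... = (\<integral>\<^sup>+r. indicator {s..t} r * (ennreal (l * exp (- real N * l * (r - s))) * (\<integral>\<^sup>+c. \<Psi> i r c \<partial>Pi\<^sub>M {..<N} (%_. clock_law l r))) \<partial>lborel)"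
  proof (rule nn_integral_cong)
   fix y
   show "indicator {s..} y * (ennreal (l * exp (- l * (y - s))) * h y) =
     indicator {s..t} y * (ennreal (l * exp (- real N * l * (y - s))) * (\<integral>\<^sup>+c. \<Psi> i y c \<partial>Pi\<^sub>M {..<N} (%_. clock_law l y)))"
   proof (cases "s <= y")
    case True
    then have y: "0 <= y" using s by simp
    interpret Y: product_prob_space "%_::nat. clock_law l y" by (rule product_prob_spaceI) (rule prob_space_clock_law[OF l y])
    have \<Psi>y: "\<Psi> i y \<in> borel_measurable ?C"
     using measurable_compose[OF measurable_Pair1'[of y half_line ?C] \<Psi>[OF i]] y by (simp add: space_restrict_space)
    define g where "g = (%x. \<integral>\<^sup>+c'. \<Psi> i y (x(i := c')) \<partial>clock_law l y)"
    have gm: "g \<in> borel_measurable (Pi\<^sub>M I (%_. half_line))"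
     unfolding g_def
    proof (rule sigma_finite_measure.borel_measurable_nn_integral[OF prob_space_imp_sigma_finite[OF prob_space_clock_law[OF l y]]])
     have "(%(x, c'). x(i := c')) \<in> Pi\<^sub>M I (%_. half_line) \<Otimes>\<^sub>M half_line \<rightarrow>\<^sub>M ?C"
      using measurable_add_dim[of i I "%_. half_line"] by (simp only: I(3))
     from measurable_compose[OF this \<Psi>y]
     show "(%(x, c'). \<Psi> i y (x(i := c'))) \<in> borel_measurable (Pi\<^sub>M I (%_. half_line) \<Otimes>\<^sub>M clock_law l y)"
      by (simp only: case_prod_beta' measurable_clock_law_pair)
    qed
    \<comment> \<open>\<open>first_to_ring\<close> breaks ties in favour of the smaller index, so
      silence of the other clocks up to y characterises the first ring only outside the null set of
      ties.\<close>
    have neq: "AE x in Pi\<^sub>M I (%_. clock_law l s). \<forall>j\<in>I. x j \<noteq> y"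
     using I(1) s by (intro AE_finite_allI AE_PiM_component prob_space_clock_law[OF l s] AE_clock_law_neq)
    have "h y = (\<integral>\<^sup>+x. (\<Prod>j\<in>I. indicator {y..} (x j)) * (indicator {..t} y * g x) \<partial>Pi\<^sub>M I (%_. clock_law l s))"
     unfolding h_def
    proof (rule nn_integral_cong_AE)
     show "AE x in Pi\<^sub>M I (%_. clock_law l s). indicator {c. first_to_ring N c = i} (x(i := y)) * f i (x(i := y)) =
       (\<Prod>j\<in>I. indicator {y..} (x j)) * (indicator {..t} y * g x)"
      using neq AE_space
     proof eventually_elim
      case (elim x)
      have x: "x \<in> space (Pi\<^sub>M I (%_. half_line))" using elim(2) sets_eq_imp_space_eq[OF cs] by blast
      have fy: "f i (x(i := y)) = indicator {..t} y * g x"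
      proof -
       have "(%c'. \<Psi> i y (x(i := c'))) \<in> borel_measurable half_line"
        using measurable_compose[OF measurable_compose[OF measurable_Pair1'[OF x] measurable_add_dim[of i I "%_. half_line", unfolded I]] \<Psi>y]
        by simp
       from nn_integral_clock_law_shift[OF y this, of l] show ?thesis
        by (simp add: f_def g_def)
      qed
      have "first_to_ring N (x(i := y)) = i \<longleftrightarrow> (\<forall>j\<in>I. y <= x j)"
      proof
       assume "first_to_ring N (x(i := y)) = i"
       then show "\<forall>j\<in>I. y <= x j" using first_to_ring_props(2)[OF N, of _ "x(i := y)"] I
        by (metis DiffE I_def fun_upd_other fun_upd_same insertI1 lessThan_iff)
      next
       assume a: "\<forall>j\<in>I. y <= x j"
       show "first_to_ring N (x(i := y)) = i"
        using a elim i by (intro first_to_ring_strict) (auto simp: I_def less_le)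
      qed
      then have "indicator {c. first_to_ring N c = i} (x(i := y)) = (\<Prod>j\<in>I. indicator {y..} (x j) :: ennreal)"
       using I(1) by (cases "\<forall>j\<in>I. y <= x j") (auto simp: indicator_def intro!: prod.neutral prod_zero[symmetric])
      then show ?case using fy by simp
     qed
    qed
    also have "... = ennreal (exp (- real (card I) * l * (y - s))) * (\<integral>\<^sup>+x. indicator {..t} y * g x \<partial>Pi\<^sub>M I (%_. clock_law l y))"
     using gm by (intro nn_integral_clocks_ge l s True I) auto
    also have "(\<integral>\<^sup>+x. indicator {..t} y * g x \<partial>Pi\<^sub>M I (%_. clock_law l y)) = indicator {..t} y * (\<integral>\<^sup>+x. g x \<partial>Pi\<^sub>M I (%_. clock_law l y))"
     using gm by (intro nn_integral_cmult) (simp add: measurable_cong_sets[OF cs refl])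
    also have "(\<integral>\<^sup>+x. g x \<partial>Pi\<^sub>M I (%_. clock_law l y)) = (\<integral>\<^sup>+c. \<Psi> i y c \<partial>Pi\<^sub>M {..<N} (%_. clock_law l y))"
     unfolding g_def I(3)[symmetric]
     by (rule Y.product_nn_integral_insert[OF I(1,2), symmetric]) (use \<Psi>y in \<open>simp add: I(3) measurable_cong_sets[OF cs refl]\<close>)
    finally have hy: "h y = ennreal (exp (- real (card I) * l * (y - s))) * (indicator {..t} y * (\<integral>\<^sup>+c. \<Psi> i y c \<partial>Pi\<^sub>M {..<N} (%_. clock_law l y)))" .
    have "l * exp (- l * (y - s)) * exp (- real (card I) * l * (y - s)) = l * exp (- real N * l * (y - s))"
     using N by (simp add: I(4) exp_add[symmetric] of_nat_diff algebra_simps)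
    then have "ennreal (l * exp (- l * (y - s))) * ennreal (exp (- real (card I) * l * (y - s))) = ennreal (l * exp (- real N * l * (y - s)))"
     using l by (simp add: ennreal_mult[symmetric])
    then show ?thesis unfolding hy using True
     by (auto simp: indicator_def mult.assoc[symmetric])
   qed simp
  qed
  finally show ?thesis .
 qed
 have "(\<integral>\<^sup>+c. f (first_to_ring N c) c \<partial>Pi\<^sub>M {..<N} (%_. clock_law l s)) =
   (\<integral>\<^sup>+c. (\<Sum>i<N. indicator {c. first_to_ring N c = i} c * f i c) \<partial>Pi\<^sub>M {..<N} (%_. clock_law l s))"
 proof (rule nn_integral_cong)
  fix c
  have "(\<Sum>i<N. indicator {c. first_to_ring N c = i} c * f i c) = (\<Sum>i<N. if i = first_to_ring N c then f i c else 0)"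
   by (intro sum.cong) (auto simp: indicator_def)
  then show "f (first_to_ring N c) c = (\<Sum>i<N. indicator {c. first_to_ring N c = i} c * f i c)"
   using first_to_ring_props(1)[OF N, of c] by simp
 qed
 also have "... = (\<Sum>i<N. \<integral>\<^sup>+c. indicator {c. first_to_ring N c = i} c * f i c \<partial>Pi\<^sub>M {..<N} (%_. clock_law l s))"
  using fm' by (intro nn_integral_sum) (simp add: measurable_cong_sets[OF cs refl])
 also have "... = (\<Sum>i<N. \<integral>\<^sup>+r. indicator {s..t} r * (ennreal (l * exp (- real N * l * (r - s))) * (\<integral>\<^sup>+c. \<Psi> i r c \<partial>Pi\<^sub>M {..<N} (%_. clock_law l r))) \<partial>lborel)"
  using one by (intro sum.cong) auto
 also have "... = (\<integral>\<^sup>+r. (\<Sum>i<N. indicator {s..t} r * (ennreal (l * exp (- real N * l * (r - s))) * (\<integral>\<^sup>+c. \<Psi> i r c \<partial>Pi\<^sub>M {..<N} (%_. clock_law l r)))) \<partial>lborel)"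
 proof (rule nn_integral_sum[symmetric])
  fix i assume "i \<in> {..<N}"
  then have "(%r. \<integral>\<^sup>+c. \<Psi> i r c \<partial>clocks_law l N r) \<in> borel_measurable half_line"
   by (intro nn_integral_measurable_subprob_algebra2[OF \<Psi> measurable_prob_algebraD[OF measurable_clocks_law[OF l]]]) simp
  moreover have "(%r. ennreal (l * exp (- real N * l * (r - s)))) \<in> borel_measurable half_line"
   by (rule measurable_restrict_space1) simp
  ultimately have "(%r. ennreal (l * exp (- real N * l * (r - s))) * (\<integral>\<^sup>+c. \<Psi> i r c \<partial>clocks_law l N r)) \<in> borel_measurable half_line"
   by (intro borel_measurable_times_ennreal)
  then have "(%r. indicator {s..t} r * (ennreal (l * exp (- real N * l * (r - s))) * (\<integral>\<^sup>+c. \<Psi> i r c \<partial>clocks_law l N r))) \<in> borel_measurable borel"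
   by (rule borel_measurable_half_line_indicator) (use s in auto)
  then show "(%r. indicator {s..t} r * (ennreal (l * exp (- real N * l * (r - s))) * (\<integral>\<^sup>+c. \<Psi> i r c \<partial>Pi\<^sub>M {..<N} (%_. clock_law l r)))) \<in> borel_measurable lborel"
   by (simp only: clocks_law_def measurable_cong_sets[OF sets_lborel refl])
 qed
 finally show ?thesis unfolding f_def by (simp add: sum_distrib_left)
qed

section \<open>The ring kernel as an integral operator\<close>

abbreviation clocks :: "nat => (nat => real) measure" where
 "clocks N \<equiv> Pi\<^sub>M {..<N} (%_. half_line)"

lemma measurable_half_line_add:
 assumes "g \<in> M \<rightarrow>\<^sub>M half_line" "h \<in> M \<rightarrow>\<^sub>M half_line"
 shows "(%z. g z + h z) \<in> M \<rightarrow>\<^sub>M half_line"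
 using assms by (auto simp: measurable_restrict_space2_iff Pi_iff)

lemma measurable_component:
 assumes "i < N" "f \<in> M \<rightarrow>\<^sub>M Pi\<^sub>M {..<N} L" shows "(%z. f z i) \<in> M \<rightarrow>\<^sub>M L i"
 using measurable_compose[OF assms(2) measurable_component_singleton[of i]] assms(1) by simp

lemma clocks_comp_nonneg: "c \<in> space (clocks N) ==> i < N ==> 0 <= c i"
 by (auto simp: space_PiM space_restrict_space PiE_iff)

context feynman_kac_model
begin

definition accept :: "real => 'a => ennreal" where "accept r y = ennreal (V r y / Vinf)"
definition reject :: "real => 'a => ennreal" where "reject r y = ennreal (1 - V r y / Vinf)"

lemma accept_add_reject: "0 <= r ==> accept r y + reject r y = 1"
 using V_bounds[of r y] Vinf_pos by (simp add: accept_def reject_def ennreal_plus[symmetric] del: ennreal_plus)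

lemma measurable_V:
 assumes "f \<in> M \<rightarrow>\<^sub>M half_line" "g \<in> M \<rightarrow>\<^sub>M borel" shows "(%z. V (f z) (g z)) \<in> borel_measurable M"
 using measurable_compose[OF measurable_Pair[OF assms] V_measurable] by simp

lemma measurable_accept_reject:
 assumes "f \<in> M \<rightarrow>\<^sub>M half_line" "g \<in> M \<rightarrow>\<^sub>M borel"
 shows "(%z. accept (f z) (g z)) \<in> borel_measurable M" "(%z. reject (f z) (g z)) \<in> borel_measurable M"
 unfolding accept_def reject_def using measurable_V[OF assms] by measurable

text \<open>The mean of f over the random marks of a ring: selected particle, decision, and fresh
  trajectory. The new ring time is not averaged here; c stands for the clocks after the
  reset.\<close>

definition kick ::
 "nat => ('a particle_state => ennreal) => nat => real => (nat => real => 'a) => (nat => real) => ennreal" where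
 "kick N f i \<tau> \<omega> c = (\<Sum>j<N. ennreal (1 / real N) *
   (accept \<tau> (\<omega> i \<tau>) * (\<integral>\<^sup>+\<omega>'. f (fun_upd \<omega> i \<omega>', c) \<partial>K \<tau> (\<omega> j \<tau>)) + reject \<tau> (\<omega> i \<tau>) * f (\<omega>, c)))"

lemma measurable_kick:
 assumes f: "f \<in> borel_measurable (state_space N)" and i: "i < N"
  and a: "a \<in> M \<rightarrow>\<^sub>M half_line" and b: "b \<in> M \<rightarrow>\<^sub>M multipath N" and d: "d \<in> M \<rightarrow>\<^sub>M clocks N"
 shows "(%z. kick N f i (a z) (b z) (d z)) \<in> borel_measurable M"
proof -
 have f': "f \<in> borel_measurable (multipath N \<Otimes>\<^sub>M clocks N)" using f by (simp add: state_space_def)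
 have ev: "(%z. b z j (a z)) \<in> M \<rightarrow>\<^sub>M borel" if "j < N" for j
  by (rule measurable_path_eval[OF a measurable_component[OF that b]])
 have "(%z. \<integral>\<^sup>+\<omega>'. f ((b z)(i := \<omega>'), d z) \<partial>K (a z) (b z j (a z))) \<in> borel_measurable M" if j: "j < N" for j
 proof (rule nn_integral_measurable_subprob_algebra2[where N=path_space])
  show "(%z. K (a z) (b z j (a z))) \<in> M \<rightarrow>\<^sub>M subprob_algebra path_space"
   by (intro measurable_prob_algebraD measurable_K a ev j)
  have "(%z. ((b (fst z))(i := snd z), d (fst z))) \<in> M \<Otimes>\<^sub>M path_space \<rightarrow>\<^sub>M multipath N \<Otimes>\<^sub>M clocks N"
   using i by (intro measurable_Pair half_line_fun_upd measurable_compose[OF measurable_fst b] measurable_compose[OF measurable_fst d] measurable_snd) auto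
  from measurable_compose[OF this f']
  show "(%(z, \<omega>'). f ((b z)(i := \<omega>'), d z)) \<in> borel_measurable (M \<Otimes>\<^sub>M path_space)"
   by (simp only: case_prod_beta')
 qed
 moreover have "(%z. f (b z, d z)) \<in> borel_measurable M"
  by (rule measurable_compose[OF measurable_Pair[OF b d] f'])
 ultimately show ?thesis
  unfolding kick_def using i
  by (intro borel_measurable_sum borel_measurable_times_ennreal borel_measurable_add measurable_accept_reject ev a borel_measurable_const) auto
qed

lemma nn_integral_uniform_index:
 assumes "1 <= N"
 shows "(\<integral>\<^sup>+j. g j \<partial>uniform_count_measure {..<N}) = (\<Sum>j<N. ennreal (1 / real N) * g j)"
 unfolding uniform_count_measure_def by (subst nn_integral_point_measure_finite) auto

context
 fixes N :: nat and \<omega> :: "nat => real => 'a" and c :: "nat => real"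
 assumes N: "1 <= N" and \<omega>: "\<omega> \<in> space (multipath N)" and c: "c \<in> space (clocks N)"
begin

private abbreviation (input) "S \<equiv> state_space N :: 'a particle_state measure"
private abbreviation (input) "i \<equiv> first_to_ring N c"

private lemma i: "i < N" using first_to_ring_props(1)[OF N] .
private lemma \<tau>: "0 <= c i" using clocks_comp_nonneg[OF c i] .

private lemma upd:
 "(%z. return S (fun_upd \<omega> i (snd z), c(i := c i + fst z))) \<in> half_line \<Otimes>\<^sub>M path_space \<rightarrow>\<^sub>M subprob_algebra S"
proof (rule measurable_compose[OF _ return_measurable])
 have "(%z. c i + fst z) \<in> half_line \<Otimes>\<^sub>M path_space \<rightarrow>\<^sub>M half_line"
  using \<tau> by (intro measurable_half_line_add measurable_fst measurable_const) (auto simp: space_restrict_space)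
 then show "(%z. (fun_upd \<omega> i (snd z), c(i := c i + fst z))) \<in> half_line \<Otimes>\<^sub>M path_space \<rightarrow>\<^sub>M S"
  unfolding state_space_def using i \<omega> c
  by (intro measurable_Pair half_line_fun_upd measurable_const measurable_snd) auto
qed

text \<open>\<open>B4\<close>, \<open>B3\<close> and \<open>B2\<close> name the nested continuations
  of the do block of \<open>ring_kernel\<close> from the inside out, so that measurability and
  integration rules can be applied to one bind at a time.\<close>

private definition "B4 \<sigma> jump j =
 (if jump then K (c i) (\<omega> j (c i)) else return path_space (\<omega> i)) \<bind>
   (%\<omega>'. return S (fun_upd \<omega> i \<omega>', c(i := c i + \<sigma>)))"

private lemma first_in: "(if jump then K (c i) (\<omega> j (c i)) else return path_space (\<omega> i)) \<in> space (subprob_algebra path_space)"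
proof -
 have "\<omega> i \<in> space path_space" using \<omega> i by (auto simp: space_PiM PiE_iff)
 then show ?thesis using K_prob[OF \<tau>] K_sets[OF \<tau>]
  by (auto simp: space_subprob_algebra intro: subprob_space_return prob_space_imp_subprob_space)
qed

private lemma B4_meas: "(%\<sigma>. B4 \<sigma> jump j) \<in> half_line \<rightarrow>\<^sub>M subprob_algebra S"
 unfolding B4_def
 by (rule measurable_bind[OF measurable_const[OF first_in]]) (use upd in \<open>simp add: case_prod_beta'\<close>)

private lemma B4_int:
 assumes f: "f \<in> borel_measurable S" and \<sigma>: "0 <= \<sigma>"
 shows "(\<integral>\<^sup>+z. f z \<partial>B4 \<sigma> jump j) =
  (if jump then (\<integral>\<^sup>+\<omega>'. f (fun_upd \<omega> i \<omega>', c(i := c i + \<sigma>)) \<partial>K (c i) (\<omega> j (c i))) else f (\<omega>, c(i := c i + \<sigma>)))"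
proof -
 let ?F = "if jump then K (c i) (\<omega> j (c i)) else return path_space (\<omega> i)"
 have sF: "sets ?F = sets path_space" using K_sets[OF \<tau>] by simp
 have upd': "(%\<omega>'. (fun_upd \<omega> i \<omega>', c(i := c i + \<sigma>))) \<in> path_space \<rightarrow>\<^sub>M S"
  unfolding state_space_def using i \<omega> c \<tau> \<sigma>
  by (intro measurable_Pair half_line_fun_upd measurable_const measurable_ident_sets refl) (auto simp: space_restrict_space)
 have "(\<integral>\<^sup>+z. f z \<partial>B4 \<sigma> jump j) = (\<integral>\<^sup>+\<omega>'. \<integral>\<^sup>+z. f z \<partial>return S (fun_upd \<omega> i \<omega>', c(i := c i + \<sigma>)) \<partial>?F)"
  unfolding B4_def
 proof (rule nn_integral_bind[OF f])
  show "(%\<omega>'. return S (fun_upd \<omega> i \<omega>', c(i := c i + \<sigma>))) \<in> ?F \<rightarrow>\<^sub>M subprob_algebra S"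
   unfolding measurable_cong_sets[OF sF refl] by (rule measurable_compose[OF upd' return_measurable])
 qed
 also have "... = (\<integral>\<^sup>+\<omega>'. f (fun_upd \<omega> i \<omega>', c(i := c i + \<sigma>)) \<partial>?F)"
  using measurable_space[OF upd'] sets_eq_imp_space_eq[OF sF] by (intro nn_integral_cong nn_integral_return f) auto
 also have "... = (if jump then (\<integral>\<^sup>+\<omega>'. f (fun_upd \<omega> i \<omega>', c(i := c i + \<sigma>)) \<partial>K (c i) (\<omega> j (c i))) else f (\<omega>, c(i := c i + \<sigma>)))"
 proof -
  have "\<omega> i \<in> space path_space" using \<omega> i by (auto simp: space_PiM PiE_iff)
  then show ?thesis using nn_integral_return[OF _ measurable_compose[OF upd' f], of "\<omega> i"] by simp
 qed
 finally show ?thesis .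
qed

private definition "B3 \<sigma> jump = uniform_count_measure {..<N} \<bind> B4 \<sigma> jump"
private definition "B2 \<sigma> = measure_pmf (bernoulli_pmf (V (c i) (\<omega> i (c i)) / Vinf)) \<bind> B3 \<sigma>"

private lemma ring_kernel_eq: "ring_kernel K V Vinf N (\<omega>, c) = clock_law Vinf 0 \<bind> B2"
 by (simp add: ring_kernel_def Let_def B2_def[abs_def] B3_def[abs_def] B4_def[abs_def] exponential_law_eq_clock_law)

private lemma ucm: "uniform_count_measure {..<N} \<in> space (subprob_algebra (count_space {..<N}))"
 using N by (auto simp: lessThan_empty_iff space_subprob_algebra sets_uniform_count_measure_count_space intro!: prob_space_imp_subprob_space prob_space_uniform_count_measure)

private lemma B4_meas2: "(%z. B4 (fst z) jump (snd z)) \<in> half_line \<Otimes>\<^sub>M count_space {..<N} \<rightarrow>\<^sub>M subprob_algebra S"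
 by (rule measurable_compose_countable'[OF measurable_compose[OF measurable_fst B4_meas] measurable_snd]) auto

private lemma B3_meas: "(%\<sigma>. B3 \<sigma> jump) \<in> half_line \<rightarrow>\<^sub>M subprob_algebra S"
 unfolding B3_def
 by (rule measurable_bind[OF measurable_const[OF ucm]]) (use B4_meas2[of jump] in \<open>simp add: case_prod_beta'\<close>)

private lemma bern: "measure_pmf p \<in> space (subprob_algebra (count_space UNIV))"
 by (simp add: space_subprob_algebra prob_space_imp_subprob_space measure_pmf.prob_space_axioms)

private lemma B3_meas2: "(%z. B3 (fst z) (snd z)) \<in> half_line \<Otimes>\<^sub>M count_space UNIV \<rightarrow>\<^sub>M subprob_algebra S"
 by (rule measurable_compose_countable'[OF measurable_compose[OF measurable_fst B3_meas] measurable_snd]) auto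

private lemma B2_meas: "B2 \<in> half_line \<rightarrow>\<^sub>M subprob_algebra S"
 unfolding B2_def[abs_def]
 by (rule measurable_bind[OF measurable_const[OF bern]]) (use B3_meas2 in \<open>simp add: case_prod_beta'\<close>)

lemma nn_integral_ring_kernel:
 assumes f: "f \<in> borel_measurable (state_space N)"
 shows "(\<integral>\<^sup>+z. f z \<partial>ring_kernel K V Vinf N (\<omega>, c)) =
  (\<integral>\<^sup>+\<sigma>. kick N f (first_to_ring N c) (c (first_to_ring N c)) \<omega> (c(first_to_ring N c := c (first_to_ring N c) + \<sigma>)) \<partial>clock_law Vinf 0)"
proof -
 have "(\<integral>\<^sup>+z. f z \<partial>ring_kernel K V Vinf N (\<omega>, c)) = (\<integral>\<^sup>+\<sigma>. \<integral>\<^sup>+z. f z \<partial>B2 \<sigma> \<partial>clock_law Vinf 0)"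
  unfolding ring_kernel_eq by (rule nn_integral_bind[OF f]) (simp add: B2_meas)
 also have "... = (\<integral>\<^sup>+\<sigma>. kick N f i (c i) \<omega> (c(i := c i + \<sigma>)) \<partial>clock_law Vinf 0)"
 proof (rule nn_integral_cong)
  fix \<sigma> assume "\<sigma> \<in> space (clock_law Vinf 0)"
  then have \<sigma>: "0 <= \<sigma>" by simp
  have sp: "B4 \<sigma> jump j \<in> space (subprob_algebra S)" for jump j
   using measurable_space[OF B4_meas, of \<sigma>] \<sigma> by (simp add: space_restrict_space)
  have sp3: "B3 \<sigma> jump \<in> space (subprob_algebra S)" for jump
   using measurable_space[OF B3_meas, of \<sigma>] \<sigma> by (simp add: space_restrict_space)
  let ?v = "V (c i) (\<omega> i (c i)) / Vinf"
  have v: "0 <= ?v" "?v <= 1" using V_bounds[OF \<tau>] Vinf_pos by auto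
  have B3: "(\<integral>\<^sup>+z. f z \<partial>B3 \<sigma> jump) = (\<Sum>j<N. ennreal (1 / real N) *
   (if jump then (\<integral>\<^sup>+\<omega>'. f (fun_upd \<omega> i \<omega>', c(i := c i + \<sigma>)) \<partial>K (c i) (\<omega> j (c i))) else f (\<omega>, c(i := c i + \<sigma>))))" for jump
  proof -
   have "(\<integral>\<^sup>+z. f z \<partial>B3 \<sigma> jump) = (\<integral>\<^sup>+j. \<integral>\<^sup>+z. f z \<partial>B4 \<sigma> jump j \<partial>uniform_count_measure {..<N})"
    unfolding B3_def by (rule nn_integral_bind[OF f]) (use sp in \<open>simp add: uniform_count_measure_def\<close>)
   then show ?thesis by (simp add: nn_integral_uniform_index[OF N] B4_int[OF f \<sigma>])
  qed
  have "(\<integral>\<^sup>+z. f z \<partial>B2 \<sigma>) = (\<integral>\<^sup>+jump. \<integral>\<^sup>+z. f z \<partial>B3 \<sigma> jump \<partial>measure_pmf (bernoulli_pmf ?v))"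
   unfolding B2_def by (rule nn_integral_bind[OF f]) (use sp3 in simp)
  also have "... = (\<integral>\<^sup>+z. f z \<partial>B3 \<sigma> True) * ennreal ?v + (\<integral>\<^sup>+z. f z \<partial>B3 \<sigma> False) * ennreal (1 - ?v)"
   using v by (subst nn_integral_bernoulli_pmf) auto
  also have "... = kick N f i (c i) \<omega> (c(i := c i + \<sigma>))"
   unfolding B3 kick_def accept_def reject_def
   by (simp only: sum_distrib_right sum.distrib[symmetric] if_True if_False)
     (intro sum.cong refl, simp add: distrib_left mult_ac)
  finally show "(\<integral>\<^sup>+z. f z \<partial>B2 \<sigma>) = kick N f i (c i) \<omega> (c(i := c i + \<sigma>))" .
 qed
 finally show ?thesis .
qed

lemma sets_ring_kernel: "sets (ring_kernel K V Vinf N (\<omega>, c)) = sets (state_space N)"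
 unfolding ring_kernel_eq
 using measurable_space[OF B2_meas] by (intro sets_bind) (auto simp: space_subprob_algebra space_restrict_space)

end

lemma kick_one:
 assumes "1 <= N" "0 <= \<tau>" shows "kick N (%_. 1) i \<tau> \<omega> c = 1"
 using assms prob_space.emeasure_space_1[OF K_prob[of \<tau>]]
 by (simp add: kick_def accept_add_reject) (simp add: ennreal_of_nat_eq_real_of_nat ennreal_mult[symmetric])

lemma space_state_space: "space (state_space N) = space (multipath N) \<times> space (clocks N)"
 by (simp add: state_space_def space_pair_measure)

lemma prob_space_ring_kernel:
 assumes "1 <= N" "z \<in> space (state_space N)"
 shows "prob_space (ring_kernel K V Vinf N z)"
proof
 obtain \<omega> c where z: "z = (\<omega>, c)" "\<omega> \<in> space (multipath N)" "c \<in> space (clocks N)"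
  using assms(2) by (auto simp: space_state_space)
 have "emeasure (ring_kernel K V Vinf N z) (space (ring_kernel K V Vinf N z)) = (\<integral>\<^sup>+z'. 1 \<partial>ring_kernel K V Vinf N z)" by simp
 also have "... = 1"
  unfolding z(1) using clocks_comp_nonneg[OF z(3) first_to_ring_props(1)[OF assms(1)]]
   prob_space.emeasure_space_1[OF prob_space_clock_law[OF Vinf_pos]]
  by (subst nn_integral_ring_kernel[OF assms(1) z(2,3)]) (simp_all add: kick_one[OF assms(1)])
 finally show "emeasure (ring_kernel K V Vinf N z) (space (ring_kernel K V Vinf N z)) = 1" .
qed

lemma measurable_ring_kernel_integral:
 assumes N: "1 <= N" and f: "f \<in> borel_measurable (state_space N)"
 shows "(%z. \<integral>\<^sup>+z'. f z' \<partial>ring_kernel K V Vinf N z) \<in> borel_measurable (state_space N)"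
proof -
 let ?S = "multipath N \<Otimes>\<^sub>M clocks N :: 'a particle_state measure"
 let ?F = "%i z. \<integral>\<^sup>+\<sigma>. kick N f i (snd z i) (fst z) ((snd z)(i := snd z i + \<sigma>)) \<partial>clock_law Vinf 0"
 interpret Z: prob_space "clock_law Vinf 0" by (rule prob_space_clock_law[OF Vinf_pos]) simp
 have "(%z. ?F (first_to_ring N (snd z)) z) \<in> borel_measurable ?S"
 \<comment> \<open>The index of the ringing particle depends on the state but takes finitely many
   values, so it may be frozen for the measurability argument.\<close>
 proof (rule measurable_compose_countable'[where I="{..<N}"])
  fix i assume "i \<in> {..<N}"
  then have i: "i < N" by simp
  have ci: "(%z. snd (fst z) i) \<in> ?S \<Otimes>\<^sub>M half_line \<rightarrow>\<^sub>M half_line"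
   by (rule measurable_component[OF i measurable_compose[OF measurable_fst measurable_snd]])
  have "(%z. kick N f i (snd (fst z) i) (fst (fst z)) ((snd (fst z))(i := snd (fst z) i + snd z))) \<in> borel_measurable (?S \<Otimes>\<^sub>M half_line)"
   using i by (intro measurable_kick[OF f i] ci half_line_fun_upd measurable_half_line_add
      measurable_compose[OF measurable_fst measurable_snd] measurable_compose[OF measurable_fst measurable_fst] measurable_snd) auto
  then show "?F i \<in> borel_measurable ?S"
   by (intro Z.borel_measurable_nn_integral) (simp only: case_prod_beta' measurable_clock_law_pair)
 next
  have "(%z. first_to_ring N (snd z)) \<in> ?S \<rightarrow>\<^sub>M count_space UNIV"
   by (rule measurable_compose[OF measurable_snd measurable_first_to_ring])
  then show "(%z. first_to_ring N (snd z)) \<in> ?S \<rightarrow>\<^sub>M count_space {..<N}"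
   using first_to_ring_props(1)[OF N] by (auto simp: measurable_count_space_eq2_countable)
 qed simp
 then have "(%z. ?F (first_to_ring N (snd z)) z) \<in> borel_measurable (state_space N)" by (simp only: state_space_def)
 then show ?thesis
 proof (rule iffD1[OF measurable_cong, rotated])
  fix z :: "'a particle_state" assume "z \<in> space (state_space N)"
  then obtain \<omega> c where "z = (\<omega>, c)" "\<omega> \<in> space (multipath N)" "c \<in> space (clocks N)"
   by (auto simp: space_state_space)
  then show "?F (first_to_ring N (snd z)) z = (\<integral>\<^sup>+z'. f z' \<partial>ring_kernel K V Vinf N z)"
   by (simp add: nn_integral_ring_kernel[OF N _ _ f])
 qed
qed

lemma measurable_ring_kernel:
 assumes N: "1 <= N"
 shows "ring_kernel K V Vinf N \<in> state_space N \<rightarrow>\<^sub>M prob_algebra (state_space N)"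
proof (rule measurable_prob_algebraI)
 show "ring_kernel K V Vinf N \<in> state_space N \<rightarrow>\<^sub>M subprob_algebra (state_space N)"
 proof (rule measurable_subprob_algebra)
  fix z :: "'a particle_state" assume z: "z \<in> space (state_space N)"
  show "subprob_space (ring_kernel K V Vinf N z)"
   by (intro prob_space_imp_subprob_space prob_space_ring_kernel N z)
  show "sets (ring_kernel K V Vinf N z) = sets (state_space N)"
   using z sets_ring_kernel[OF N] by (cases z) (simp add: space_state_space)
 next
  fix A :: "'a particle_state set" assume A: "A \<in> sets (state_space N)"
  have "(%z. \<integral>\<^sup>+z'. indicator A z' \<partial>ring_kernel K V Vinf N z) \<in> borel_measurable (state_space N)"
   using A by (intro measurable_ring_kernel_integral N) simp
  then show "(%z. emeasure (ring_kernel K V Vinf N z) A) \<in> borel_measurable (state_space N)"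
  proof (rule iffD1[OF measurable_cong, rotated])
   fix z :: "'a particle_state" assume "z \<in> space (state_space N)"
   then have "sets (ring_kernel K V Vinf N z) = sets (state_space N)"
    using sets_ring_kernel[OF N] by (cases z) (simp add: space_state_space)
   then show "(\<integral>\<^sup>+z'. indicator A z' \<partial>ring_kernel K V Vinf N z) = emeasure (ring_kernel K V Vinf N z) A"
    using A by simp
  qed
 qed
qed (rule prob_space_ring_kernel[OF N])

end

section \<open>One ring, started from a regenerated state\<close>

text \<open>A particle that rejects its jump keeps a trajectory with a past, while a restarted
  trajectory from the same position has none. Functionals of this kind cannot tell the two apart as
  long as all pending rings lie after s. This is the hypothesis under which the Markov property can
  be used at a ring time.\<close>

definition future_dep :: "nat => real => ('a::metric_space particle_state => ennreal) => bool" where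
 "future_dep N t f \<longleftrightarrow> (\<forall>\<omega> \<omega>' c s. \<omega> \<in> space (multipath N) \<longrightarrow> \<omega>' \<in> space (multipath N) \<longrightarrow>
   c \<in> space (clocks N) \<longrightarrow> 0 <= s \<longrightarrow> s <= t \<longrightarrow> (\<forall>j<N. s <= c j) \<longrightarrow>
   (\<forall>i<N. \<forall>u\<ge>s. \<omega> i u = \<omega>' i u) \<longrightarrow> f (\<omega>, c) = f (\<omega>', c))"

text \<open>The chain has not yet reached time t: at least one more ring must be processed before
  the state describes the system at t.\<close>

definition alive :: "nat => real => 'a particle_state => bool" where
 "alive N t z \<longleftrightarrow> (\<exists>j<N. snd z j <= t)"

lemma alive_iff: "1 <= N ==> alive N t (\<omega>, c) \<longleftrightarrow> c (first_to_ring N c) <= t"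
 using first_to_ring_props[where N=N and c=c] by (auto simp: alive_def intro: order_trans)

lemma measurable_clock_component:
 "i < N ==> f \<in> M \<rightarrow>\<^sub>M clocks N ==> (%z. f z i) \<in> borel_measurable M"
 by (rule measurable_half_lineD, rule measurable_component[where L="%_. half_line"])

lemma measurable_alive:
 assumes "f \<in> borel_measurable M" "g \<in> M \<rightarrow>\<^sub>M state_space N"
 shows "Measurable.pred M (%z. alive N (f z) (g z))"
proof -
 have g: "(%z. snd (g z)) \<in> M \<rightarrow>\<^sub>M clocks N"
  using measurable_compose[OF assms(2)[unfolded state_space_def] measurable_snd] .
 have "Measurable.pred M (%z. \<exists>j\<in>{..<N}. snd (g z) j <= f z)"
  using measurable_clock_component[OF _ g] assms(1)
  by (intro pred_intros_finite) (auto simp: pred_def intro!: borel_measurable_le)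
 also have "(%z. \<exists>j\<in>{..<N}. snd (g z) j <= f z) = (%z. alive N (f z) (g z))"
  by (auto simp: alive_def fun_eq_iff)
 finally show ?thesis .
qed

lemma measurable_alive_indicator:
 assumes "f \<in> borel_measurable M" "g \<in> M \<rightarrow>\<^sub>M state_space N"
 shows "(%z. indicator {z. alive N (f z) (g z)} z :: ennreal) \<in> borel_measurable M"
 using measurable_alive[OF assms] by (intro borel_measurable_indicator') (simp add: pred_def)

context feynman_kac_model
begin

text \<open>The regenerated state: at time s the configuration is x, all trajectories start afresh
  from there, and all clocks are fresh and independent of them.\<close>

definition start_law :: "nat => real => (nat => 'a) => 'a particle_state measure" where
 "start_law N s x = path_law N s x \<Otimes>\<^sub>M clocks_law Vinf N s"

definition transition :: "nat => real => real => ((nat => 'a) => ennreal) => (nat => 'a) => ennreal" where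
 "transition N s t G x = (\<integral>\<^sup>+\<omega>. G (positions N t \<omega>) \<partial>path_law N s x)"

text \<open>What remains of \<open>kick\<close> on the level of configurations: the mean effect of a
  ring of particle i at time r.\<close>

definition jump_mean :: "nat => nat => real => ((nat => 'a) => ennreal) => (nat => 'a) => ennreal" where
 "jump_mean N i r h y = (\<Sum>j<N. ennreal (1 / real N) * (accept r (y i) * h (y(i := y j)) + reject r (y i) * h y))"

lemma clocks_law_sets: "sets (clocks_law l N s) = sets (clocks N)"
 unfolding clocks_law_def by (intro sets_PiM_cong) auto

lemma clocks_law_space: "space (clocks_law l N s) = space (clocks N)"
 by (rule sets_eq_imp_space_eq[OF clocks_law_sets])

lemma clocks_law_prob: "0 <= s ==> prob_space (clocks_law Vinf N s)"
 unfolding clocks_law_def by (intro prob_space_PiM prob_space_clock_law Vinf_pos)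

lemma start_law_sets: "0 <= s ==> sets (start_law N s x) = sets (state_space N)"
 unfolding start_law_def state_space_def by (intro sets_pair_measure_cong path_law_sets clocks_law_sets)

lemma pair_sigma_finite_start: "0 <= s ==> 0 <= r ==> pair_sigma_finite (path_law N s x) (clocks_law Vinf N r)"
 unfolding pair_sigma_finite_def by (intro conjI prob_space_imp_sigma_finite path_law_prob clocks_law_prob)

lemma nn_integral_start_law:
 assumes s: "0 <= s" and f: "f \<in> borel_measurable (state_space N)"
 shows "(\<integral>\<^sup>+z. f z \<partial>start_law N s x) = (\<integral>\<^sup>+c. \<integral>\<^sup>+\<omega>. f (\<omega>, c) \<partial>path_law N s x \<partial>clocks_law Vinf N s)"
proof -
 interpret pair_sigma_finite "path_law N s x" "clocks_law Vinf N s" using pair_sigma_finite_start[OF s s] .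
 have "f \<in> borel_measurable (path_law N s x \<Otimes>\<^sub>M clocks_law Vinf N s)"
  using f start_law_sets[OF s, of N x] unfolding start_law_def by (simp cong: measurable_cong_sets)
 then show ?thesis unfolding start_law_def by (rule nn_integral_snd[symmetric])
qed

lemma Fubini_paths_clocks:
 assumes "0 <= s" "0 <= r" and f: "(%(\<omega>, c). f \<omega> c) \<in> borel_measurable (multipath N \<Otimes>\<^sub>M clocks N)"
 shows "(\<integral>\<^sup>+c. \<integral>\<^sup>+\<omega>. f \<omega> c \<partial>path_law N s x \<partial>clocks_law Vinf N r) = (\<integral>\<^sup>+\<omega>. \<integral>\<^sup>+c. f \<omega> c \<partial>clocks_law Vinf N r \<partial>path_law N s x)"
proof -
 interpret pair_sigma_finite "path_law N s x" "clocks_law Vinf N r" using pair_sigma_finite_start assms by auto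
 have "sets (path_law N s x \<Otimes>\<^sub>M clocks_law Vinf N r) = sets (multipath N \<Otimes>\<^sub>M clocks N)"
  using assms by (intro sets_pair_measure_cong path_law_sets clocks_law_sets)
 then show ?thesis using f by (intro Fubini') (simp cong: measurable_cong_sets)
qed

lemma measurable_path_law_integral:
 assumes "(%z. g (fst z) (snd z)) \<in> borel_measurable (M \<Otimes>\<^sub>M multipath N)" "a \<in> M \<rightarrow>\<^sub>M half_line" "b \<in> M \<rightarrow>\<^sub>M tuple_space N"
 shows "(%z. \<integral>\<^sup>+\<omega>. g z \<omega> \<partial>path_law N (a z) (b z)) \<in> borel_measurable M"
 using assms
 by (intro nn_integral_measurable_subprob_algebra2[where N="multipath N"] measurable_prob_algebraD measurable_path_law) (simp_all add: case_prod_beta')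

lemma measurable_clocks_law_integral:
 assumes "(%z. g (fst z) (snd z)) \<in> borel_measurable (M \<Otimes>\<^sub>M clocks N)" "a \<in> M \<rightarrow>\<^sub>M half_line"
 shows "(%z. \<integral>\<^sup>+c. g z c \<partial>clocks_law Vinf N (a z)) \<in> borel_measurable M"
 using assms
 by (intro nn_integral_measurable_subprob_algebra2[where N="clocks N"] measurable_prob_algebraD measurable_compose[OF _ measurable_clocks_law[OF Vinf_pos]])
   (simp_all add: case_prod_beta')

lemma measurable_start_law_integral:
 assumes f: "f \<in> borel_measurable (state_space N)" and a: "a \<in> M \<rightarrow>\<^sub>M half_line" and b: "b \<in> M \<rightarrow>\<^sub>M tuple_space N"
 shows "(%z. \<integral>\<^sup>+z'. f z' \<partial>start_law N (a z) (b z)) \<in> borel_measurable M"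
proof -
 have "(%z. \<integral>\<^sup>+c. \<integral>\<^sup>+\<omega>. f (\<omega>, c) \<partial>path_law N (a z) (b z) \<partial>clocks_law Vinf N (a z)) \<in> borel_measurable M"
 proof (rule measurable_clocks_law_integral[OF _ a], rule measurable_path_law_integral)
  show "(%z. f (snd z, snd (fst z))) \<in> borel_measurable ((M \<Otimes>\<^sub>M clocks N) \<Otimes>\<^sub>M multipath N)"
   by (rule measurable_compose[OF measurable_Pair[OF measurable_snd measurable_compose[OF measurable_fst measurable_snd]] f[unfolded state_space_def]])
 qed (rule measurable_compose[OF measurable_fst a] measurable_compose[OF measurable_fst b])+
 then show ?thesis
 proof (rule iffD1[OF measurable_cong, rotated])
  fix z assume "z \<in> space M"
  then have "0 <= a z" using measurable_space[OF a] by (auto simp: space_restrict_space)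
  then show "(\<integral>\<^sup>+c. \<integral>\<^sup>+\<omega>. f (\<omega>, c) \<partial>path_law N (a z) (b z) \<partial>clocks_law Vinf N (a z)) = (\<integral>\<^sup>+z'. f z' \<partial>start_law N (a z) (b z))"
   by (simp add: nn_integral_start_law f)
 qed
qed

lemma measurable_jump_mean:
 assumes h: "(%z. h (fst z) (snd z)) \<in> borel_measurable (M \<Otimes>\<^sub>M tuple_space N)" and i: "i < N"
  and a: "a \<in> M \<rightarrow>\<^sub>M half_line" and b: "b \<in> M \<rightarrow>\<^sub>M tuple_space N"
 shows "(%z. jump_mean N i (a z) (h z) (b z)) \<in> borel_measurable M"
proof -
 have comp: "(%z. h z (g z)) \<in> borel_measurable M" if "g \<in> M \<rightarrow>\<^sub>M tuple_space N" for g
  using measurable_compose[OF measurable_Pair[OF measurable_ident_sets[OF refl] that] h] by simp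
 have bj: "(%z. b z j) \<in> borel_measurable M" if "j < N" for j by (rule measurable_component[OF that b])
 have "(%z. h z ((b z)(i := b z j))) \<in> borel_measurable M" if "j < N" for j
  using i that by (intro comp half_line_fun_upd b bj) auto
 moreover have "(%z. h z (b z)) \<in> borel_measurable M" by (rule comp[OF b])
 ultimately show ?thesis
  unfolding jump_mean_def using i
  by (intro borel_measurable_sum borel_measurable_times_ennreal borel_measurable_add measurable_accept_reject bj a borel_measurable_const) auto
qed

lemma measurable_transition:
 assumes G: "(%z. G (fst z) (snd z)) \<in> borel_measurable (M \<Otimes>\<^sub>M tuple_space N)"
  and a: "a \<in> M \<rightarrow>\<^sub>M half_line" and d: "d \<in> M \<rightarrow>\<^sub>M half_line" and b: "b \<in> M \<rightarrow>\<^sub>M tuple_space N"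
 shows "(%z. transition N (a z) (d z) (G z) (b z)) \<in> borel_measurable M"
 unfolding transition_def
proof (rule measurable_path_law_integral[OF _ a b])
 have "(%z. (fst z, positions N (d (fst z)) (snd z))) \<in> M \<Otimes>\<^sub>M multipath N \<rightarrow>\<^sub>M M \<Otimes>\<^sub>M tuple_space N"
  by (intro measurable_Pair measurable_fst measurable_positions measurable_compose[OF measurable_fst d] measurable_snd)
 from measurable_compose[OF this G] show "(%z. G (fst z) (positions N (d (fst z)) (snd z))) \<in> borel_measurable (M \<Otimes>\<^sub>M multipath N)" by simp
qed

text \<open>Overwriting coordinate i makes the average over its old trajectory an average of a
  constant, and independence lets the new trajectory take its place in the product.\<close>

lemma nn_integral_path_law_update:
 assumes r: "0 <= r" and i: "i < N" and g: "g \<in> borel_measurable (multipath N)"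
 shows "(\<integral>\<^sup>+\<omega>. \<integral>\<^sup>+\<omega>'. g (fun_upd \<omega> i \<omega>') \<partial>K r a \<partial>path_law N r y) = (\<integral>\<^sup>+\<omega>. g \<omega> \<partial>path_law N r (y(i := a)))"
proof -
 define I where "I = {..<N} - {i}"
 have I: "finite I" "i \<notin> I" "insert i I = {..<N}" using i by (auto simp: I_def)
 interpret Y: product_prob_space "%j. K r (y j)" by (rule product_prob_spaceI) (rule K_prob[OF r])
 interpret A: product_prob_space "%j. K r ((y(i := a)) j)" by (rule product_prob_spaceI) (rule K_prob[OF r])
 have sets: "sets (Pi\<^sub>M {..<N} (%j. K r (x j))) = sets (multipath N)" for x
  by (intro sets_PiM_cong K_sets r refl)
 have eqI: "Pi\<^sub>M I (%j. K r (y j)) = Pi\<^sub>M I (%j. K r ((y(i := a)) j))"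
  by (rule PiM_cong) (use I in auto)
 have m: "(%\<omega>. \<integral>\<^sup>+\<omega>'. g (fun_upd \<omega> i \<omega>') \<partial>K r a) \<in> borel_measurable (multipath N)"
 proof (rule nn_integral_measurable_subprob_algebra2[where N=path_space])
  have "(%z. fun_upd (fst z) i (snd z)) \<in> multipath N \<Otimes>\<^sub>M path_space \<rightarrow>\<^sub>M multipath N"
   using i by (intro half_line_fun_upd measurable_fst measurable_snd) auto
  from measurable_compose[OF this g]
  show "(%(\<omega>, \<omega>'). g (fun_upd \<omega> i \<omega>')) \<in> borel_measurable (multipath N \<Otimes>\<^sub>M path_space)" by (simp only: case_prod_beta')
  show "(%\<omega>. K r a) \<in> multipath N \<rightarrow>\<^sub>M subprob_algebra path_space"
   by (rule measurable_const) (use K_prob[OF r] K_sets[OF r] in \<open>auto simp: space_subprob_algebra prob_space_imp_subprob_space\<close>)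
 qed
 have "(\<integral>\<^sup>+\<omega>. \<integral>\<^sup>+\<omega>'. g (fun_upd \<omega> i \<omega>') \<partial>K r a \<partial>path_law N r y) =
   (\<integral>\<^sup>+x. \<integral>\<^sup>+w. \<integral>\<^sup>+\<omega>'. g (fun_upd (x(i := w)) i \<omega>') \<partial>K r a \<partial>K r (y i) \<partial>Pi\<^sub>M I (%j. K r (y j)))"
  unfolding path_law_def I(3)[symmetric]
  by (rule Y.product_nn_integral_insert[OF I(1,2)]) (use m in \<open>simp only: I(3) measurable_cong_sets[OF sets refl]\<close>)
 also have "... = (\<integral>\<^sup>+x. \<integral>\<^sup>+\<omega>'. g (fun_upd x i \<omega>') \<partial>K r a \<partial>Pi\<^sub>M I (%j. K r (y j)))"
  using prob_space.emeasure_space_1[OF K_prob[OF r]] by (intro nn_integral_cong) simp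
 also have "... = (\<integral>\<^sup>+x. \<integral>\<^sup>+\<omega>'. g (fun_upd x i \<omega>') \<partial>K r ((y(i := a)) i) \<partial>Pi\<^sub>M I (%j. K r ((y(i := a)) j)))"
  unfolding eqI by simp
 also have "... = (\<integral>\<^sup>+\<omega>. g \<omega> \<partial>path_law N r (y(i := a)))"
  unfolding path_law_def I(3)[symmetric]
  by (rule A.product_nn_integral_insert[OF I(1,2), symmetric]) (use g in \<open>simp only: I(3) measurable_cong_sets[OF sets refl]\<close>)
 finally show ?thesis .
qed

text \<open>Trajectories started at r sit in y at time r almost surely, so the acceptance
  probability and the starting point of the new trajectory are deterministic and
  \<open>nn_integral_path_law_update\<close> applies to each target j.\<close>

lemma nn_integral_kick:
 assumes r: "0 <= r" and i: "i < N" and f: "f \<in> borel_measurable (state_space N)" and c: "c \<in> space (clocks N)"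
 shows "(\<integral>\<^sup>+\<omega>. kick N f i r \<omega> c \<partial>path_law N r y) = jump_mean N i r (%y. \<integral>\<^sup>+\<omega>. f (\<omega>, c) \<partial>path_law N r y) y"
proof -
 have fc: "(%\<omega>. f (\<omega>, c)) \<in> borel_measurable (multipath N)"
  using measurable_compose[OF measurable_Pair[OF measurable_ident_sets[OF refl] measurable_const[OF c]] f[unfolded state_space_def]] by simp
 have fcu: "(%\<omega>. \<integral>\<^sup>+\<omega>'. f (fun_upd \<omega> i \<omega>', c) \<partial>K r a) \<in> borel_measurable (multipath N)" for a
 proof (rule nn_integral_measurable_subprob_algebra2[where N=path_space])
  have "(%z. fun_upd (fst z) i (snd z)) \<in> multipath N \<Otimes>\<^sub>M path_space \<rightarrow>\<^sub>M multipath N"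
   using i by (intro half_line_fun_upd measurable_fst measurable_snd) auto
  from measurable_compose[OF this fc]
  show "(%(\<omega>, \<omega>'). f (fun_upd \<omega> i \<omega>', c)) \<in> borel_measurable (multipath N \<Otimes>\<^sub>M path_space)" by (simp only: case_prod_beta')
  show "(%\<omega>. K r a) \<in> multipath N \<rightarrow>\<^sub>M subprob_algebra path_space"
   by (rule measurable_const) (use K_prob[OF r] K_sets[OF r] in \<open>auto simp: space_subprob_algebra prob_space_imp_subprob_space\<close>)
 qed
 note pm = measurable_cong_sets[OF path_law_sets[OF r] refl]
 have "(\<integral>\<^sup>+\<omega>. kick N f i r \<omega> c \<partial>path_law N r y) =
   (\<integral>\<^sup>+\<omega>. (\<Sum>j<N. ennreal (1 / real N) * (accept r (y i) * (\<integral>\<^sup>+\<omega>'. f (fun_upd \<omega> i \<omega>', c) \<partial>K r (y j)) + reject r (y i) * f (\<omega>, c))) \<partial>path_law N r y)"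
 proof (rule nn_integral_cong_AE)
  show "AE \<omega> in path_law N r y. kick N f i r \<omega> c = (\<Sum>j<N. ennreal (1 / real N) * (accept r (y i) * (\<integral>\<^sup>+\<omega>'. f (fun_upd \<omega> i \<omega>', c) \<partial>K r (y j)) + reject r (y i) * f (\<omega>, c)))"
   using path_law_start[OF r, of N y]
  proof eventually_elim
   case (elim \<omega>)
   then show ?case unfolding kick_def using i by (intro sum.cong refl) simp
  qed
 qed
 also have "... = (\<Sum>j<N. \<integral>\<^sup>+\<omega>. ennreal (1 / real N) * (accept r (y i) * (\<integral>\<^sup>+\<omega>'. f (fun_upd \<omega> i \<omega>', c) \<partial>K r (y j)) + reject r (y i) * f (\<omega>, c)) \<partial>path_law N r y)"
  by (rule nn_integral_sum) (use fc fcu in \<open>simp only: pm, intro borel_measurable_times_ennreal borel_measurable_add borel_measurable_const\<close>)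
 also have "... = jump_mean N i r (%y. \<integral>\<^sup>+\<omega>. f (\<omega>, c) \<partial>path_law N r y) y"
  unfolding jump_mean_def
 proof (rule sum.cong[OF refl])
  fix j
  have "(\<integral>\<^sup>+\<omega>. ennreal (1 / real N) * (accept r (y i) * (\<integral>\<^sup>+\<omega>'. f (fun_upd \<omega> i \<omega>', c) \<partial>K r (y j)) + reject r (y i) * f (\<omega>, c)) \<partial>path_law N r y)
   = ennreal (1 / real N) * (accept r (y i) * (\<integral>\<^sup>+\<omega>. \<integral>\<^sup>+\<omega>'. f (fun_upd \<omega> i \<omega>', c) \<partial>K r (y j) \<partial>path_law N r y) + reject r (y i) * (\<integral>\<^sup>+\<omega>. f (\<omega>, c) \<partial>path_law N r y))"
  proof -
   have 1: "(%\<omega>. \<integral>\<^sup>+\<omega>'. f (fun_upd \<omega> i \<omega>', c) \<partial>K r (y j)) \<in> borel_measurable (path_law N r y)"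
    "(%\<omega>. f (\<omega>, c)) \<in> borel_measurable (path_law N r y)"
    using fc fcu by (simp_all only: pm)
   show ?thesis using 1
    by (subst nn_integral_cmult, measurable, subst nn_integral_add, measurable, simp add: nn_integral_cmult)
  qed
  also have "(\<integral>\<^sup>+\<omega>. \<integral>\<^sup>+\<omega>'. f (fun_upd \<omega> i \<omega>', c) \<partial>K r (y j) \<partial>path_law N r y) = (\<integral>\<^sup>+\<omega>. f (\<omega>, c) \<partial>path_law N r (y(i := y j)))"
   by (rule nn_integral_path_law_update[OF r i fc])
  finally show "(\<integral>\<^sup>+\<omega>. ennreal (1 / real N) * (accept r (y i) * (\<integral>\<^sup>+\<omega>'. f (fun_upd \<omega> i \<omega>', c) \<partial>K r (y j)) + reject r (y i) * f (\<omega>, c)) \<partial>path_law N r y)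
    = ennreal (1 / real N) * (accept r (y i) * (\<integral>\<^sup>+\<omega>. f (\<omega>, c) \<partial>path_law N r (y(i := y j))) + reject r (y i) * (\<integral>\<^sup>+\<omega>. f (\<omega>, c) \<partial>path_law N r y))" .
 qed
 finally show ?thesis .
qed

lemma nn_integral_jump_mean:
 assumes h: "\<And>y. y \<in> space (tuple_space N) ==> (%c. h c y) \<in> borel_measurable M"
  and y: "y \<in> space (tuple_space N)" and i: "i < N"
 shows "(\<integral>\<^sup>+c. jump_mean N i r (h c) y \<partial>M) = jump_mean N i r (%y. \<integral>\<^sup>+c. h c y \<partial>M) y"
proof -
 have yj: "y(i := y j) \<in> space (tuple_space N)" if "j < N" for j
  using y i that by (auto simp: space_PiM PiE_iff extensional_def)
 note [measurable] = h[OF y] h[OF yj]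
 have "(\<integral>\<^sup>+c. jump_mean N i r (h c) y \<partial>M) = (\<Sum>j<N. \<integral>\<^sup>+c. ennreal (1 / real N) * (accept r (y i) * h c (y(i := y j)) + reject r (y i) * h c y) \<partial>M)"
  unfolding jump_mean_def by (rule nn_integral_sum) simp
 also have "... = jump_mean N i r (%y. \<integral>\<^sup>+c. h c y \<partial>M) y"
  unfolding jump_mean_def
  by (intro sum.cong refl) (subst nn_integral_cmult, simp, subst nn_integral_add, simp, simp, simp add: nn_integral_cmult)
 finally show ?thesis .
qed

lemma AE_clocks_law_ge:
 assumes r: "0 <= r" shows "AE c in clocks_law Vinf N r. \<forall>j<N. r <= c j"
proof -
 have 1: "AE c in clock_law Vinf r. r <= c"
 proof -
  have m: "indicator {..<r} \<in> borel_measurable half_line" by (rule measurable_restrict_space1) simp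
  have "(\<integral>\<^sup>+c. indicator {..<r} c \<partial>clock_law Vinf r) = (\<integral>\<^sup>+c. indicator {r..} c * (ennreal (Vinf * exp (- Vinf * (c - r))) * indicator {..<r} c) \<partial>lborel)"
   by (rule nn_integral_clock_law[OF r m])
  also have "... = (\<integral>\<^sup>+(c::real). 0 \<partial>lborel)" by (rule nn_integral_cong) (auto simp: indicator_def)
  finally have "(\<integral>\<^sup>+c. indicator {..<r} c \<partial>clock_law Vinf r) = 0" by simp
  then have "AE c in clock_law Vinf r. indicator {..<r} c = (0::ennreal)"
   using m by (subst (asm) nn_integral_0_iff_AE) auto
  then show ?thesis by eventually_elim (auto simp: indicator_def split: if_splits)
 qed
 have "AE c in clocks_law Vinf N r. r <= c j" if "j \<in> {..<N}" for j
  unfolding clocks_law_def using that 1 by (intro AE_PiM_component prob_space_clock_law Vinf_pos r)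
 then have "AE c in clocks_law Vinf N r. \<forall>j\<in>{..<N}. r <= c j" by (subst AE_finite_all) auto
 then show ?thesis by eventually_elim auto
qed

end

context feynman_kac_model
begin

lemma state_section_measurable:
 assumes f: "f \<in> borel_measurable (state_space N)" and c: "c \<in> space (clocks N)"
 shows "(%\<omega>. f (\<omega>, c)) \<in> borel_measurable (multipath N)"
 using measurable_compose[OF measurable_Pair[OF measurable_ident_sets[OF refl] measurable_const[OF c]] f[unfolded state_space_def]] by simp

lemma future_depD:
 assumes "future_dep N t f" "\<omega> \<in> space (multipath N)" "\<omega>' \<in> space (multipath N)" "c \<in> space (clocks N)"
  "0 <= s" "s <= t" "\<And>j. j < N ==> s <= c j" "\<And>i u. i < N ==> s <= u ==> \<omega> i u = \<omega>' i u"
 shows "f (\<omega>, c) = f (\<omega>', c)"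
 using assms unfolding future_dep_def by blast

lemma fun_upd_multipath:
 "\<omega> \<in> space (multipath N) ==> i < N ==> \<omega>' \<in> space path_space ==> fun_upd \<omega> i \<omega>' \<in> space (multipath N)"
 by (auto simp: space_PiM PiE_iff extensional_def)

lemma kick_cong:
 assumes f: "future_dep N t f" and \<omega>: "\<omega> \<in> space (multipath N)" "\<omega>' \<in> space (multipath N)" and c: "c \<in> space (clocks N)"
  and s: "0 <= s" "s <= t" "\<And>j. j < N ==> s <= c j" and \<tau>: "s <= \<tau>" and i: "i < N"
  and eq: "\<And>i u. i < N ==> s <= u ==> \<omega> i u = \<omega>' i u"
 shows "kick N f i \<tau> \<omega> c = kick N f i \<tau> \<omega>' c"
proof -
 have 1: "f (\<omega>, c) = f (\<omega>', c)" by (rule future_depD[OF f \<omega> c s eq])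
 have 2: "(\<integral>\<^sup>+w. f (fun_upd \<omega> i w, c) \<partial>K \<tau> a) = (\<integral>\<^sup>+w. f (fun_upd \<omega>' i w, c) \<partial>K \<tau> a)" for a
 proof (rule nn_integral_cong)
  fix w assume "w \<in> space (K \<tau> a)"
  then have w: "w \<in> space path_space" using K_space[of \<tau> a] s \<tau> by simp
  show "f (fun_upd \<omega> i w, c) = f (fun_upd \<omega>' i w, c)"
   using eq by (intro future_depD[OF f fun_upd_multipath[OF \<omega>(1) i w] fun_upd_multipath[OF \<omega>(2) i w] c s]) auto
 qed
 show ?thesis unfolding kick_def using 1 2 eq[OF _ \<tau>] i by (intro sum.cong refl) simp
qed

text \<open>A ring reads the trajectories only at its own time, which is not before s, and only
  postpones a clock. Hence blindness for the past is inherited backwards along the chain.\<close>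

lemma future_dep_ring:
 assumes N: "1 <= N" and f: "f \<in> borel_measurable (state_space N)" "future_dep N t f"
 shows "future_dep N t (%z. indicator {z. alive N t z} z * (\<integral>\<^sup>+z'. f z' \<partial>ring_kernel K V Vinf N z))"
 unfolding future_dep_def
proof (intro allI impI)
 fix \<omega> \<omega>' :: "nat => real => 'a" and c s
 assume \<omega>: "\<omega> \<in> space (multipath N)" "\<omega>' \<in> space (multipath N)" and c: "c \<in> space (clocks N)"
  and s: "0 <= s" "s <= t" "\<forall>j<N. s <= c j" and eq: "\<forall>i<N. \<forall>u\<ge>s. \<omega> i u = \<omega>' i u"
 let ?i = "first_to_ring N c"
 have i: "?i < N" using first_to_ring_props(1)[OF N] .
 have "(\<integral>\<^sup>+\<sigma>. kick N f ?i (c ?i) \<omega> (c(?i := c ?i + \<sigma>)) \<partial>clock_law Vinf 0) = (\<integral>\<^sup>+\<sigma>. kick N f ?i (c ?i) \<omega>' (c(?i := c ?i + \<sigma>)) \<partial>clock_law Vinf 0)"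
 proof (rule nn_integral_cong)
  fix \<sigma> assume "\<sigma> \<in> space (clock_law Vinf 0)"
  then have \<sigma>: "0 <= \<sigma>" by simp
  have c': "c(?i := c ?i + \<sigma>) \<in> space (clocks N)"
   using c i \<sigma> by (auto simp: space_PiM PiE_iff extensional_def space_restrict_space)
  have ge: "s <= (c(?i := c ?i + \<sigma>)) j" if "j < N" for j using s(3) that \<sigma> i by (auto intro: add_increasing2)
  show "kick N f ?i (c ?i) \<omega> (c(?i := c ?i + \<sigma>)) = kick N f ?i (c ?i) \<omega>' (c(?i := c ?i + \<sigma>))"
   using eq s(3) i by (intro kick_cong[OF f(2) \<omega> c' s(1,2) ge _ i]) auto
 qed
 then show "indicator {z. alive N t z} (\<omega>, c) * (\<integral>\<^sup>+z'. f z' \<partial>ring_kernel K V Vinf N (\<omega>, c)) =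
  indicator {z. alive N t z} (\<omega>', c) * (\<integral>\<^sup>+z'. f z' \<partial>ring_kernel K V Vinf N (\<omega>', c))"
  by (simp add: nn_integral_ring_kernel[OF N \<omega>(1) c f(1)] nn_integral_ring_kernel[OF N \<omega>(2) c f(1)] alive_def indicator_def)
qed

lemma measurable_state_ident: "(%z. z) \<in> state_space N \<rightarrow>\<^sub>M state_space N"
 by (rule measurable_ident_sets[OF refl])

lemma measurable_alive_ring:
 assumes N: "1 <= N" and f: "f \<in> borel_measurable (state_space N)"
 shows "(%z. indicator {z. alive N t z} z * (\<integral>\<^sup>+z'. f z' \<partial>ring_kernel K V Vinf N z)) \<in> borel_measurable (state_space N)"
 by (intro borel_measurable_times_ennreal measurable_alive_indicator borel_measurable_const measurable_state_ident measurable_ring_kernel_integral N f)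

text \<open>Trajectories and clocks are independent under \<open>start_law\<close>, so Fubini lets
  the clocks decide first and \<open>nn_integral_first_ring\<close> produces the density of the ring
  time r and fresh clocks. The kicked functional sees only the future of r, so the Markov property
  restarts all trajectories at r, and the ring turns into \<open>jump_mean\<close>. The outcome is
  again an average over start laws, now at time r.\<close>

lemma one_step:
 assumes N: "1 <= N" and s: "0 <= s" and f: "f \<in> borel_measurable (state_space N)" "future_dep N t f"
 shows "(\<integral>\<^sup>+z. indicator {z. alive N t z} z * (\<integral>\<^sup>+z'. f z' \<partial>ring_kernel K V Vinf N z) \<partial>start_law N s x) =
  (\<integral>\<^sup>+r. indicator {s..t} r * (\<Sum>i<N. ennreal (Vinf * exp (- real N * Vinf * (r - s))) *
    transition N s r (jump_mean N i r (%y. \<integral>\<^sup>+z. f z \<partial>start_law N r y)) x) \<partial>lborel)"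
proof -
 \<comment> \<open>The average over trajectories from s with ring time and reset clocks as free
   parameters; the clocks are inserted afterwards.\<close>
 define \<Psi> where "\<Psi> = (%i r c. \<integral>\<^sup>+\<omega>. kick N f i r \<omega> c \<partial>path_law N s x)"
 interpret P: prob_space "path_law N s x" by (rule path_law_prob[OF s])
 note pm = measurable_cong_sets[OF sets_pair_measure_cong[OF refl path_law_sets[OF s]] refl]
 have \<Psi>m: "(%(r, c). \<Psi> i r c) \<in> borel_measurable (half_line \<Otimes>\<^sub>M clocks N)" if i: "i < N" for i
 proof -
  have "(%z. kick N f i (fst (fst z)) (snd z) (snd (fst z))) \<in> borel_measurable ((half_line \<Otimes>\<^sub>M clocks N) \<Otimes>\<^sub>M multipath N)"
   by (rule measurable_kick[OF f(1) i measurable_compose[OF measurable_fst measurable_fst] measurable_snd measurable_compose[OF measurable_fst measurable_snd]])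
  then have "(%z. \<integral>\<^sup>+\<omega>. kick N f i (fst z) \<omega> (snd z) \<partial>path_law N s x) \<in> borel_measurable (half_line \<Otimes>\<^sub>M clocks N)"
   by (intro P.borel_measurable_nn_integral) (simp only: case_prod_beta' pm)
  then show ?thesis by (simp only: \<Psi>_def case_prod_beta')
 qed
 have "(\<integral>\<^sup>+z. indicator {z. alive N t z} z * (\<integral>\<^sup>+z'. f z' \<partial>ring_kernel K V Vinf N z) \<partial>start_law N s x) =
  (\<integral>\<^sup>+c. \<integral>\<^sup>+\<omega>. indicator {z. alive N t z} (\<omega>, c) * (\<integral>\<^sup>+z'. f z' \<partial>ring_kernel K V Vinf N (\<omega>, c)) \<partial>path_law N s x \<partial>clocks_law Vinf N s)"
  by (rule nn_integral_start_law[OF s measurable_alive_ring[OF N f(1)]])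
 also have "... = (\<integral>\<^sup>+c. indicator {..t} (c (first_to_ring N c)) *
    (\<integral>\<^sup>+\<sigma>. \<Psi> (first_to_ring N c) (c (first_to_ring N c)) (c(first_to_ring N c := c (first_to_ring N c) + \<sigma>)) \<partial>clock_law Vinf 0)
    \<partial>Pi\<^sub>M {..<N} (%_. clock_law Vinf s))"
  unfolding clocks_law_def[symmetric]
 proof (rule nn_integral_cong)
  fix c assume "c \<in> space (clocks_law Vinf N s)"
  then have c: "c \<in> space (clocks N)" by (simp add: clocks_law_space)
  let ?i = "first_to_ring N c"
  have i: "?i < N" using first_to_ring_props(1)[OF N] .
  have \<tau>: "0 <= c ?i" by (rule clocks_comp_nonneg[OF c i])
  interpret PC: pair_sigma_finite "path_law N s x" "clock_law Vinf 0"
   unfolding pair_sigma_finite_def by (intro conjI prob_space_imp_sigma_finite path_law_prob s prob_space_clock_law Vinf_pos) simp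
  have km: "(%z. kick N f ?i (c ?i) (fst z) (c(?i := c ?i + snd z))) \<in> borel_measurable (multipath N \<Otimes>\<^sub>M half_line)"
  proof (rule measurable_kick[OF f(1) i _ measurable_fst])
   show "(%z. c ?i) \<in> multipath N \<Otimes>\<^sub>M half_line \<rightarrow>\<^sub>M half_line" using \<tau> by (intro measurable_const) (simp add: space_restrict_space)
   then show "(%z. c(?i := c ?i + snd z)) \<in> multipath N \<Otimes>\<^sub>M half_line \<rightarrow>\<^sub>M clocks N"
    using i c \<tau> by (intro half_line_fun_upd measurable_const measurable_half_line_add measurable_snd) (auto simp: space_restrict_space)
  qed
  have sp: "sets (path_law N s x \<Otimes>\<^sub>M clock_law Vinf 0) = sets (multipath N \<Otimes>\<^sub>M half_line)"
   by (intro sets_pair_measure_cong path_law_sets s sets_clock_law)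
  have "(\<integral>\<^sup>+\<omega>. indicator {z. alive N t z} (\<omega>, c) * (\<integral>\<^sup>+z'. f z' \<partial>ring_kernel K V Vinf N (\<omega>, c)) \<partial>path_law N s x) =
   (\<integral>\<^sup>+\<omega>. indicator {..t} (c ?i) * (\<integral>\<^sup>+\<sigma>. kick N f ?i (c ?i) \<omega> (c(?i := c ?i + \<sigma>)) \<partial>clock_law Vinf 0) \<partial>path_law N s x)"
   using path_law_space[OF s]
   by (intro nn_integral_cong) (simp add: nn_integral_ring_kernel[OF N _ c f(1)] indicator_def alive_iff[OF N])
  also have "... = indicator {..t} (c ?i) * (\<integral>\<^sup>+\<omega>. (\<integral>\<^sup>+\<sigma>. kick N f ?i (c ?i) \<omega> (c(?i := c ?i + \<sigma>)) \<partial>clock_law Vinf 0) \<partial>path_law N s x)"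
   by (rule nn_integral_cmult, rule PC.M2.borel_measurable_nn_integral)
     (use km in \<open>simp only: case_prod_beta' measurable_cong_sets[OF sp refl]\<close>)
  also have "(\<integral>\<^sup>+\<omega>. (\<integral>\<^sup>+\<sigma>. kick N f ?i (c ?i) \<omega> (c(?i := c ?i + \<sigma>)) \<partial>clock_law Vinf 0) \<partial>path_law N s x) =
    (\<integral>\<^sup>+\<sigma>. \<integral>\<^sup>+\<omega>. kick N f ?i (c ?i) \<omega> (c(?i := c ?i + \<sigma>)) \<partial>path_law N s x \<partial>clock_law Vinf 0)"
   by (rule PC.Fubini'[symmetric]) (use km in \<open>simp only: case_prod_beta' measurable_cong_sets[OF sp refl]\<close>)
  finally show "(\<integral>\<^sup>+\<omega>. indicator {z. alive N t z} (\<omega>, c) * (\<integral>\<^sup>+z'. f z' \<partial>ring_kernel K V Vinf N (\<omega>, c)) \<partial>path_law N s x) =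
   indicator {..t} (c ?i) * (\<integral>\<^sup>+\<sigma>. \<Psi> ?i (c ?i) (c(?i := c ?i + \<sigma>)) \<partial>clock_law Vinf 0)"
   by (simp only: \<Psi>_def)
 qed
 also have "... = (\<integral>\<^sup>+r. indicator {s..t} r * (\<Sum>i<N. ennreal (Vinf * exp (- real N * Vinf * (r - s))) * (\<integral>\<^sup>+c. \<Psi> i r c \<partial>Pi\<^sub>M {..<N} (%_. clock_law Vinf r))) \<partial>lborel)"
  by (rule nn_integral_first_ring[OF Vinf_pos N s \<Psi>m])
 also have "... = (\<integral>\<^sup>+r. indicator {s..t} r * (\<Sum>i<N. ennreal (Vinf * exp (- real N * Vinf * (r - s))) *
    transition N s r (jump_mean N i r (%y. \<integral>\<^sup>+z. f z \<partial>start_law N r y)) x) \<partial>lborel)"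
 proof (rule nn_integral_cong)
  fix r
  show "indicator {s..t} r * (\<Sum>i<N. ennreal (Vinf * exp (- real N * Vinf * (r - s))) * (\<integral>\<^sup>+c. \<Psi> i r c \<partial>Pi\<^sub>M {..<N} (%_. clock_law Vinf r))) =
   indicator {s..t} r * (\<Sum>i<N. ennreal (Vinf * exp (- real N * Vinf * (r - s))) * transition N s r (jump_mean N i r (%y. \<integral>\<^sup>+z. f z \<partial>start_law N r y)) x)"
  proof (cases "r \<in> {s..t}")
   case True
   then have r: "s <= r" "r <= t" "0 <= r" using s by auto
   have "(\<integral>\<^sup>+c. \<Psi> i r c \<partial>clocks_law Vinf N r) = transition N s r (jump_mean N i r (%y. \<integral>\<^sup>+z. f z \<partial>start_law N r y)) x" if i: "i < N" for i
   proof -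
    define h where "h = (%c y. \<integral>\<^sup>+\<omega>. f (\<omega>, c) \<partial>path_law N r y)"
    have hm: "(%z. h (fst z) (snd z)) \<in> borel_measurable (clocks N \<Otimes>\<^sub>M tuple_space N)"
     unfolding h_def
    proof (rule measurable_path_law_integral)
     show "(%z. f (snd z, fst (fst z))) \<in> borel_measurable ((clocks N \<Otimes>\<^sub>M tuple_space N) \<Otimes>\<^sub>M multipath N)"
      by (rule measurable_compose[OF measurable_Pair[OF measurable_snd measurable_compose[OF measurable_fst measurable_fst]] f(1)[unfolded state_space_def]])
    qed (use r in \<open>auto simp: space_restrict_space\<close>)
    have r': "(%z. r) \<in> M \<rightarrow>\<^sub>M half_line" for M :: "'q measure" using r by (intro measurable_const) (simp add: space_restrict_space)
    have "(\<integral>\<^sup>+c. \<Psi> i r c \<partial>clocks_law Vinf N r) = (\<integral>\<^sup>+c. \<integral>\<^sup>+\<omega>. jump_mean N i r (h c) (positions N r \<omega>) \<partial>path_law N s x \<partial>clocks_law Vinf N r)"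
    \<comment> \<open>\<open>future_dep\<close> speaks only of clocks due at or after r; fresh
      clocks satisfy this almost surely.\<close>
    proof (rule nn_integral_cong_AE)
     show "AE c in clocks_law Vinf N r. \<Psi> i r c = (\<integral>\<^sup>+\<omega>. jump_mean N i r (h c) (positions N r \<omega>) \<partial>path_law N s x)"
      using AE_clocks_law_ge[OF r(3)] AE_space
     proof eventually_elim
      case (elim c)
      then have c: "c \<in> space (clocks N)" by (simp add: clocks_law_space)
      have "\<Psi> i r c = (\<integral>\<^sup>+\<omega>. \<integral>\<^sup>+\<omega>'. kick N f i r \<omega>' c \<partial>path_law N r (positions N r \<omega>) \<partial>path_law N s x)"
       unfolding \<Psi>_def
      proof (rule path_law_markov[OF s r(1)])
       show "(%\<omega>. kick N f i r \<omega> c) \<in> borel_measurable (multipath N)"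
        by (rule measurable_kick[OF f(1) i r' measurable_ident_sets[OF refl] measurable_const[OF c]])
       show "kick N f i r \<omega> c = kick N f i r \<omega>' c"
        if "\<omega> \<in> space (multipath N)" "\<omega>' \<in> space (multipath N)" "\<And>i u. i < N ==> r <= u ==> \<omega> i u = \<omega>' i u" for \<omega> \<omega>'
        using that elim(1) by (intro kick_cong[OF f(2) that(1,2) c r(3,2) _ order_refl i]) auto
      qed
      also have "... = (\<integral>\<^sup>+\<omega>. jump_mean N i r (h c) (positions N r \<omega>) \<partial>path_law N s x)"
       unfolding h_def by (intro nn_integral_cong nn_integral_kick r i f c)
      finally show ?case .
     qed
    qed
    also have "... = (\<integral>\<^sup>+\<omega>. \<integral>\<^sup>+c. jump_mean N i r (h c) (positions N r \<omega>) \<partial>clocks_law Vinf N r \<partial>path_law N s x)"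
    proof (rule Fubini_paths_clocks[OF s r(3)])
     have "(%z. h (snd (fst z)) (snd z)) \<in> borel_measurable ((multipath N \<Otimes>\<^sub>M clocks N) \<Otimes>\<^sub>M tuple_space N)"
      using measurable_compose[OF measurable_Pair[OF measurable_compose[OF measurable_fst measurable_snd] measurable_snd] hm] by simp
     from measurable_jump_mean[OF this i r' measurable_positions[OF r' measurable_fst]]
     show "(%(\<omega>, c). jump_mean N i r (h c) (positions N r \<omega>)) \<in> borel_measurable (multipath N \<Otimes>\<^sub>M clocks N)"
      by (simp only: case_prod_beta')
    qed
    also have "... = (\<integral>\<^sup>+\<omega>. jump_mean N i r (%y. \<integral>\<^sup>+c. h c y \<partial>clocks_law Vinf N r) (positions N r \<omega>) \<partial>path_law N s x)"
    proof (intro nn_integral_cong nn_integral_jump_mean i)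
     fix \<omega> show "positions N r \<omega> \<in> space (tuple_space N)" by (auto simp: positions_def space_PiM)
     fix y :: "nat => 'a" assume y: "y \<in> space (tuple_space N)"
     show "(%c. h c y) \<in> borel_measurable (clocks_law Vinf N r)"
      using measurable_compose[OF measurable_Pair[OF measurable_ident_sets[OF refl] measurable_const[OF y]] hm]
      by (simp add: measurable_cong_sets[OF clocks_law_sets refl])
    qed
    also have "... = transition N s r (jump_mean N i r (%y. \<integral>\<^sup>+z. f z \<partial>start_law N r y)) x"
     unfolding transition_def h_def nn_integral_start_law[OF r(3) f(1)] ..
    finally show ?thesis .
   qed
   then show ?thesis by (simp add: clocks_law_def)
  qed simp
 qed
 finally show ?thesis .
qed

text \<open>The trajectories stored in a state are those followed at time t as soon as no clock is
  due by t; together with the event that all earlier states are still alive this singles out the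
  state that \<open>particle\<close> reads.\<close>

definition final_value :: "nat => real => ((nat => 'a) => ennreal) => 'a particle_state => ennreal" where
 "final_value N t G z = indicator {z. \<not> alive N t z} z * G (positions N t (fst z))"

lemma measurable_final_value:
 assumes G: "(%z. G (fst z) (snd z)) \<in> borel_measurable (M \<Otimes>\<^sub>M tuple_space N)"
  and a: "a \<in> M \<rightarrow>\<^sub>M half_line" and b: "b \<in> M \<rightarrow>\<^sub>M state_space N"
 shows "(%z. final_value N (a z) (G z) (b z)) \<in> borel_measurable M"
 unfolding final_value_def
proof (rule borel_measurable_times_ennreal)
 have "(%z. 1 - indicator {z. alive N (a z) (b z)} z :: ennreal) \<in> borel_measurable M"
  by (intro borel_measurable_minus_ennreal borel_measurable_const measurable_alive_indicator measurable_half_lineD a b) 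
 also have "(%z. 1 - indicator {z. alive N (a z) (b z)} z :: ennreal) = (%z. indicator {y. \<not> alive N (a z) y} (b z))"
  by (auto simp: indicator_def)
 finally show "(%z. indicator {y. \<not> alive N (a z) y} (b z) :: ennreal) \<in> borel_measurable M" .
 have "(%z. fst (b z)) \<in> M \<rightarrow>\<^sub>M multipath N"
  by (rule measurable_compose[OF b[unfolded state_space_def] measurable_fst])
 then have "(%z. (z, positions N (a z) (fst (b z)))) \<in> M \<rightarrow>\<^sub>M M \<Otimes>\<^sub>M tuple_space N"
  by (intro measurable_Pair measurable_ident_sets[OF refl] measurable_positions a)
 from measurable_compose[OF this G]
 show "(%z. G z (positions N (a z) (fst (b z)))) \<in> borel_measurable M" by simp
qed

lemma future_dep_final_value: "future_dep N t (final_value N t G)"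
 unfolding future_dep_def final_value_def alive_def positions_def
 by (intro allI impI arg_cong2[where f="(*)"] arg_cong[where f=G]) (auto simp: indicator_def)

text \<open>The exponential is the probability that N fresh clocks stay silent from s to t,
  independently of the trajectories. Silence here means rings strictly after t, whereas
  \<open>nn_integral_clocks_ge\<close> allows t itself; the difference is a null set.\<close>

lemma nn_integral_final_value:
 assumes N: "1 <= N" and s: "0 <= s" "s <= t" and G: "G \<in> borel_measurable (tuple_space N)"
 shows "(\<integral>\<^sup>+z. final_value N t G z \<partial>start_law N s x) = ennreal (exp (- real N * Vinf * (t - s))) * transition N s t G x"
proof -
 have t: "0 <= t" using s by simp
 have t': "(%z. t) \<in> M \<rightarrow>\<^sub>M half_line" for M :: "'q measure" using t by (intro measurable_const) (simp add: space_restrict_space)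
 have m: "final_value N t G \<in> borel_measurable (state_space N)"
  using measurable_final_value[OF measurable_compose[OF measurable_snd G] t' measurable_state_ident] by simp
 have "(\<integral>\<^sup>+z. final_value N t G z \<partial>start_law N s x) = (\<integral>\<^sup>+c. \<integral>\<^sup>+\<omega>. final_value N t G (\<omega>, c) \<partial>path_law N s x \<partial>clocks_law Vinf N s)"
  by (rule nn_integral_start_law[OF s(1) m])
 also have "... = (\<integral>\<^sup>+c. (\<Prod>j<N. indicator {t..} (c j)) * transition N s t G x \<partial>clocks_law Vinf N s)"
 proof (rule nn_integral_cong_AE)
  have "AE c in clocks_law Vinf N s. c j \<noteq> t" if "j \<in> {..<N}" for j
   unfolding clocks_law_def using that by (intro AE_PiM_component prob_space_clock_law Vinf_pos s AE_clock_law_neq)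
  then have "AE c in clocks_law Vinf N s. \<forall>j\<in>{..<N}. c j \<noteq> t" by (subst AE_finite_all) auto
  then show "AE c in clocks_law Vinf N s. (\<integral>\<^sup>+\<omega>. final_value N t G (\<omega>, c) \<partial>path_law N s x) = (\<Prod>j<N. indicator {t..} (c j)) * transition N s t G x"
  proof eventually_elim
   case (elim c)
   have ind: "indicator {z. \<not> alive N t z} (\<omega>, c) = (\<Prod>j<N. indicator {t..} (c j) :: ennreal)" for \<omega> :: "nat => real => 'a"
   proof (cases "alive N t (\<omega>, c)")
    case True
    then obtain j where "j < N" "c j <= t" by (auto simp: alive_def)
    then have "(\<Prod>j<N. indicator {t..} (c j) :: ennreal) = 0" using elim by (intro prod_zero) (force simp: indicator_def)+
    then show ?thesis using True by simp
   next
    case False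
    then have "\<And>j. j < N ==> t <= c j" by (force simp: alive_def)
    then have "(\<Prod>j<N. indicator {t..} (c j) :: ennreal) = 1" by (intro prod.neutral) auto
    then show ?thesis using False by simp
   qed
   have "(\<integral>\<^sup>+\<omega>. final_value N t G (\<omega>, c) \<partial>path_law N s x) = (\<integral>\<^sup>+\<omega>. (\<Prod>j<N. indicator {t..} (c j)) * G (positions N t \<omega>) \<partial>path_law N s x)"
    unfolding final_value_def ind by simp
   also have "... = (\<Prod>j<N. indicator {t..} (c j)) * transition N s t G x"
    unfolding transition_def
    using measurable_compose[OF measurable_positions[OF t' measurable_ident_sets[OF refl]] G]
    by (intro nn_integral_cmult) (simp only: measurable_cong_sets[OF path_law_sets[OF s(1)] refl])
   finally show ?case .
  qed
 qed
 also have "... = ennreal (exp (- real N * Vinf * (t - s))) * transition N s t G x"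
  unfolding clocks_law_def
  using nn_integral_clocks_ge[OF Vinf_pos s, of "{..<N}" "%_. transition N s t G x"]
   prob_space.emeasure_space_1[OF clocks_law_prob[OF t, of N]] by (simp add: clocks_law_def)
 finally show ?thesis .
qed

end

section \<open>Regeneration at the ring times of the chain\<close>

text \<open>Weighting M with the indicator of the past turns the defining identity of the chain into
  an equality of two measures on S; equal measures integrate every nonnegative f alike.\<close>

lemma markov_chain_step:
 assumes mc: "markov_chain M S \<mu> \<kappa> Z" and \<kappa>: "\<kappa> \<in> S \<rightarrow>\<^sub>M prob_algebra S"
  and A: "A \<in> sets (Pi\<^sub>M {..n} (%_. S))" and f: "f \<in> borel_measurable S"
 shows "(\<integral>\<^sup>+w. indicator A (\<lambda>k\<in>{..n}. Z k w) * f (Z (Suc n) w) \<partial>M) =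
  (\<integral>\<^sup>+w. indicator A (\<lambda>k\<in>{..n}. Z k w) * (\<integral>\<^sup>+z. f z \<partial>\<kappa> (Z n w)) \<partial>M)"
proof -
 interpret prob_space M using mc by (simp add: markov_chain_def)
 have Z: "Z k \<in> M \<rightarrow>\<^sub>M S" for k using mc by (simp add: markov_chain_def)
 let ?h = "%w. \<lambda>k\<in>{..n}. Z k w"
 have h: "?h \<in> M \<rightarrow>\<^sub>M Pi\<^sub>M {..n} (%_. S)" by (intro measurable_restrict Z)
 let ?I = "%w. indicator A (?h w) :: ennreal"
 have I: "?I \<in> borel_measurable M" by (rule measurable_compose[OF h borel_measurable_indicator[OF A]])
 have I': "(%w. indicator A (?h w) :: real) \<in> borel_measurable M" by (rule measurable_compose[OF h borel_measurable_indicator[OF A]])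
 let ?D = "density M ?I"
 have \<kappa>Z: "(%w. \<kappa> (Z n w)) \<in> M \<rightarrow>\<^sub>M subprob_algebra S"
  by (rule measurable_compose[OF Z measurable_prob_algebraD[OF \<kappa>]])
 have \<kappa>sp: "prob_space (\<kappa> (Z n w))" "sets (\<kappa> (Z n w)) = sets S" if "w \<in> space M" for w
  using measurable_space[OF \<kappa> measurable_space[OF Z that]] by (auto simp: space_prob_algebra)
 have ne: "space M \<noteq> {}" by (rule not_empty)
 have "distr ?D S (Z (Suc n)) = ?D \<bind> (%w. \<kappa> (Z n w))"
 proof (rule measure_eqI)
  show "sets (distr ?D S (Z (Suc n))) = sets (?D \<bind> (%w. \<kappa> (Z n w)))"
   using \<kappa>sp(2) ne by (subst sets_bind[of _ _ S]) auto
  fix B assume "B \<in> sets (distr ?D S (Z (Suc n)))"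
  then have B: "B \<in> sets S" by simp
  have ZB: "(%w. indicator B (Z (Suc n) w) :: ennreal) \<in> borel_measurable M"
   by (rule measurable_compose[OF Z borel_measurable_indicator[OF B]])
  have ev: "{w \<in> space M. ?h w \<in> A \<and> Z (Suc n) w \<in> B} \<in> sets M"
  proof -
   have "{w \<in> space M. ?h w \<in> A \<and> Z (Suc n) w \<in> B} = (?h -` A \<inter> space M) \<inter> (Z (Suc n) -` B \<inter> space M)" by auto
   then show ?thesis using measurable_sets[OF h A] measurable_sets[OF Z B] by simp
  qed
  have "emeasure (distr ?D S (Z (Suc n))) B = (\<integral>\<^sup>+z. indicator B z \<partial>distr ?D S (Z (Suc n)))" using B by simp
  also have "... = (\<integral>\<^sup>+w. indicator B (Z (Suc n) w) \<partial>?D)"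
   by (rule nn_integral_distr) (use Z B in auto)
  also have "... = (\<integral>\<^sup>+w. ?I w * indicator B (Z (Suc n) w) \<partial>M)"
   by (rule nn_integral_density[OF I ZB])
  also have "... = (\<integral>\<^sup>+w. indicator {w \<in> space M. ?h w \<in> A \<and> Z (Suc n) w \<in> B} w \<partial>M)"
   by (rule nn_integral_cong) (auto simp: indicator_def)
  also have "... = ennreal (measure M {w \<in> space M. ?h w \<in> A \<and> Z (Suc n) w \<in> B})"
   using ev by (simp add: emeasure_eq_measure)
  also have "... = ennreal (\<integral>w. indicator A (?h w) * measure (\<kappa> (Z n w)) B \<partial>M)"
   using mc A B by (simp add: markov_chain_def)
  also have "... = (\<integral>\<^sup>+w. ennreal (indicator A (?h w) * measure (\<kappa> (Z n w)) B) \<partial>M)"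
  proof (rule nn_integral_eq_integral[symmetric])
   have "(%w. measure (\<kappa> (Z n w)) B) \<in> borel_measurable M"
    by (rule measurable_compose[OF \<kappa>Z measurable_measure_subprob_algebra[OF B]])
   then show "integrable M (%w. indicator A (?h w) * measure (\<kappa> (Z n w)) B)"
    using I' by (intro integrable_const_bound[of _ 1] AE_I2 borel_measurable_times)
     (auto simp: indicator_def prob_space.prob_le_1[OF \<kappa>sp(1)])
  qed (simp add: indicator_def)
  also have "... = (\<integral>\<^sup>+w. ?I w * emeasure (\<kappa> (Z n w)) B \<partial>M)"
  proof (rule nn_integral_cong)
   fix w assume "w \<in> space M"
   interpret k: prob_space "\<kappa> (Z n w)" by (rule \<kappa>sp) fact
   show "ennreal (indicator A (?h w) * measure (\<kappa> (Z n w)) B) = ?I w * emeasure (\<kappa> (Z n w)) B"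
    by (simp add: k.emeasure_eq_measure indicator_def)
  qed
  also have "... = (\<integral>\<^sup>+w. emeasure (\<kappa> (Z n w)) B \<partial>?D)"
   using I measurable_compose[OF \<kappa>Z measurable_emeasure_subprob_algebra[OF B]] by (simp add: nn_integral_density)
  also have "... = emeasure (?D \<bind> (%w. \<kappa> (Z n w))) B"
   by (rule emeasure_bind[symmetric]) (use ne \<kappa>Z B in auto)
  finally show "emeasure (distr ?D S (Z (Suc n))) B = emeasure (?D \<bind> (%w. \<kappa> (Z n w))) B" .
 qed
 then have "(\<integral>\<^sup>+z. f z \<partial>distr ?D S (Z (Suc n))) = (\<integral>\<^sup>+z. f z \<partial>(?D \<bind> (%w. \<kappa> (Z n w))))" by simp
 moreover have "(\<integral>\<^sup>+z. f z \<partial>distr ?D S (Z (Suc n))) = (\<integral>\<^sup>+w. ?I w * f (Z (Suc n) w) \<partial>M)"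
  using f Z I measurable_compose[OF Z f] by (simp add: nn_integral_distr nn_integral_density)
 moreover have "(\<integral>\<^sup>+z. f z \<partial>(?D \<bind> (%w. \<kappa> (Z n w)))) = (\<integral>\<^sup>+w. ?I w * (\<integral>\<^sup>+z. f z \<partial>\<kappa> (Z n w)) \<partial>M)"
  using I measurable_compose[OF \<kappa>Z nn_integral_measurable_subprob_algebra[OF f]] \<kappa>Z
  by (subst nn_integral_bind[OF f]) (simp_all add: nn_integral_density)
 ultimately show ?thesis by simp
qed

locale particle_model = feynman_kac_model K \<eta>0 \<D> L V Vinf
 for K :: "real => 'a::metric_space => (real => 'a) measure" and \<eta>0 \<D> L V Vinf +
 fixes N :: nat and M :: "'w measure" and Z :: "nat => 'w => 'a particle_state"
 assumes N: "1 <= N" and ps: "particle_system K \<eta>0 V Vinf N M Z"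
begin

sublocale MP: prob_space M
 using ps by (simp add: particle_system_def markov_chain_def)

lemma Z_measurable: "Z k \<in> M \<rightarrow>\<^sub>M state_space N"
 using ps by (simp add: particle_system_def markov_chain_def)

lemma Z_initial: "distr M (state_space N) (Z 0) = initial_state_law K \<eta>0 Vinf N"
 using ps by (simp add: particle_system_def markov_chain_def)

text \<open>The mean of f after n rings, restricted to the event that all these n rings happen by
  time t.\<close>

definition stage :: "nat => real => ('a particle_state => ennreal) => ennreal" where
 "stage n t f = (\<integral>\<^sup>+w. indicator {w. \<forall>k<n. alive N t (Z k w)} w * f (Z n w) \<partial>M)"

lemma stage_Suc:
 assumes f: "f \<in> borel_measurable (state_space N)"
 shows "stage (Suc n) t f = stage n t (%z. indicator {z. alive N t z} z * (\<integral>\<^sup>+z'. f z' \<partial>ring_kernel K V Vinf N z))"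
proof -
 let ?S = "state_space N :: 'a particle_state measure"
 define A where "A = {h \<in> space (Pi\<^sub>M {..n} (%_. ?S)). \<forall>k\<in>{..n}. alive N t (h k)}"
 have A: "A \<in> sets (Pi\<^sub>M {..n} (%_. ?S))"
 proof -
  have "Measurable.pred (Pi\<^sub>M {..n} (%_. ?S)) (%h. \<forall>k\<in>{..n}. alive N t (h k))"
   by (intro pred_intros_finite measurable_alive borel_measurable_const measurable_component_singleton) auto
  then show ?thesis by (simp add: A_def pred_def)
 qed
 have h: "(\<lambda>k\<in>{..n}. Z k w) \<in> A \<longleftrightarrow> (\<forall>k<Suc n. alive N t (Z k w))" if "w \<in> space M" for w
  using measurable_space[OF Z_measurable that] by (auto simp: A_def space_PiM less_Suc_eq_le)
 have "stage (Suc n) t f = (\<integral>\<^sup>+w. indicator A (\<lambda>k\<in>{..n}. Z k w) * f (Z (Suc n) w) \<partial>M)"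
  unfolding stage_def using h by (intro nn_integral_cong) (simp add: indicator_def)
 also have "... = (\<integral>\<^sup>+w. indicator A (\<lambda>k\<in>{..n}. Z k w) * (\<integral>\<^sup>+z. f z \<partial>ring_kernel K V Vinf N (Z n w)) \<partial>M)"
  by (rule markov_chain_step[OF ps[unfolded particle_system_def] measurable_ring_kernel[OF N] A f])
 also have "... = stage n t (%z. indicator {z. alive N t z} z * (\<integral>\<^sup>+z'. f z' \<partial>ring_kernel K V Vinf N z))"
  unfolding stage_def using h by (intro nn_integral_cong) (auto simp: indicator_def less_Suc_eq)
 finally show ?thesis .
qed

abbreviation "\<eta>N \<equiv> Pi\<^sub>M {..<N} (%_. \<eta>0)"

lemma \<eta>N_prob: "prob_space \<eta>N" by (intro prob_space_PiM initial_law)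
lemma \<eta>N_sets: "sets \<eta>N = sets (tuple_space N)" by (intro sets_PiM_cong initial_law) auto

lemma initial_path_law: "Pi\<^sub>M {..<N} (%_. \<eta>0 \<bind> K 0) = \<eta>N \<bind> path_law N 0"
proof -
 have "K 0 \<in> \<eta>0 \<rightarrow>\<^sub>M prob_algebra path_space"
  using measurable_K[of "%_. 0" borel "%x. x"] measurable_cong_sets[OF initial_law(2) refl]
  by (auto simp: space_restrict_space)
 then have "Pi\<^sub>M {..<N} (%_. \<eta>0 \<bind> K 0) = \<eta>N \<bind> (%y. Pi\<^sub>M {..<N} (%i. K 0 (y i)))"
  by (intro bind_PiM[where N="%_. path_space"] initial_law) auto
 then show ?thesis by (simp only: path_law_def[abs_def])
qed

text \<open>The initial state is a mixture of start laws at time 0 over i.i.d. positions, by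
  \<open>bind_PiM\<close> for the trajectories and Fubini for the clocks.\<close>

lemma stage_0:
 assumes f: "f \<in> borel_measurable (state_space N)"
 shows "stage 0 t f = (\<integral>\<^sup>+x. \<integral>\<^sup>+z. f z \<partial>start_law N 0 x \<partial>\<eta>N)"
proof -
 let ?P = "Pi\<^sub>M {..<N} (%_. \<eta>0 \<bind> K 0)"
 have pk: "path_law N 0 \<in> tuple_space N \<rightarrow>\<^sub>M subprob_algebra (multipath N)"
  using measurable_path_law[of "%_. 0" "tuple_space N" "%x. x" N]
  by (intro measurable_prob_algebraD) (auto simp: space_restrict_space)
 have pk': "path_law N 0 \<in> \<eta>N \<rightarrow>\<^sub>M subprob_algebra (multipath N)"
  using pk by (simp only: measurable_cong_sets[OF \<eta>N_sets refl])
 have c: "Pi\<^sub>M {..<N} (%_. exponential_law Vinf) = clocks_law Vinf N 0"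
  by (simp add: clocks_law_def exponential_law_eq_clock_law)
 have Psets: "sets ?P = sets (multipath N)" and Pp: "prob_space ?P"
 proof -
  have KK: "\<eta>N \<in> space (prob_algebra \<eta>N)" using \<eta>N_prob by (simp add: space_prob_algebra)
  have "path_law N 0 \<in> \<eta>N \<rightarrow>\<^sub>M prob_algebra (multipath N)"
   using measurable_path_law[of "%_. 0" "tuple_space N" "%x. x" N]
   by (simp add: measurable_cong_sets[OF \<eta>N_sets refl] space_restrict_space)
  from sets_bind'[OF KK this] prob_space_bind'[OF KK this] show "sets ?P = sets (multipath N)" "prob_space ?P"
   by (simp_all add: initial_path_law)
 qed
 interpret PC: pair_sigma_finite ?P "clocks_law Vinf N 0"
  unfolding pair_sigma_finite_def by (intro conjI prob_space_imp_sigma_finite Pp clocks_law_prob) simp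
 interpret EC: pair_sigma_finite \<eta>N "clocks_law Vinf N 0"
  unfolding pair_sigma_finite_def by (intro conjI prob_space_imp_sigma_finite \<eta>N_prob clocks_law_prob) simp
 have sP: "sets (?P \<Otimes>\<^sub>M clocks_law Vinf N 0) = sets (state_space N)"
  unfolding state_space_def by (intro sets_pair_measure_cong Psets clocks_law_sets)
 have sE: "sets (\<eta>N \<Otimes>\<^sub>M clocks_law Vinf N 0) = sets (tuple_space N \<Otimes>\<^sub>M clocks N)"
  by (intro sets_pair_measure_cong \<eta>N_sets clocks_law_sets)
 have z0: "(%_. 0) \<in> Y \<rightarrow>\<^sub>M half_line" for Y :: "'q measure" by (intro measurable_const) (simp add: space_restrict_space)
 have "stage 0 t f = (\<integral>\<^sup>+w. f (Z 0 w) \<partial>M)" by (simp add: stage_def)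
 also have "... = (\<integral>\<^sup>+z. f z \<partial>distr M (state_space N) (Z 0))"
  using Z_measurable f by (simp add: nn_integral_distr)
 also have "... = (\<integral>\<^sup>+z. f z \<partial>(?P \<Otimes>\<^sub>M clocks_law Vinf N 0))"
  unfolding Z_initial initial_state_law_def c ..
 also have "... = (\<integral>\<^sup>+c. \<integral>\<^sup>+\<omega>. f (\<omega>, c) \<partial>?P \<partial>clocks_law Vinf N 0)"
  by (rule PC.nn_integral_snd[symmetric]) (use f in \<open>simp only: measurable_cong_sets[OF sP refl]\<close>)
 also have "... = (\<integral>\<^sup>+c. \<integral>\<^sup>+x. \<integral>\<^sup>+\<omega>. f (\<omega>, c) \<partial>path_law N 0 x \<partial>\<eta>N \<partial>clocks_law Vinf N 0)"
  unfolding initial_path_law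
  by (intro nn_integral_cong nn_integral_bind[OF _ pk'] state_section_measurable f) (simp add: clocks_law_space)
 also have "... = (\<integral>\<^sup>+x. \<integral>\<^sup>+c. \<integral>\<^sup>+\<omega>. f (\<omega>, c) \<partial>path_law N 0 x \<partial>clocks_law Vinf N 0 \<partial>\<eta>N)"
 proof (rule EC.Fubini')
  have "(%z. f (snd z, snd (fst z))) \<in> borel_measurable ((tuple_space N \<Otimes>\<^sub>M clocks N) \<Otimes>\<^sub>M multipath N)"
   by (rule measurable_compose[OF measurable_Pair[OF measurable_snd measurable_compose[OF measurable_fst measurable_snd]] f[unfolded state_space_def]])
  from measurable_path_law_integral[OF this z0 measurable_fst]
  show "(%(x, c). \<integral>\<^sup>+\<omega>. f (\<omega>, c) \<partial>path_law N 0 x) \<in> borel_measurable (\<eta>N \<Otimes>\<^sub>M clocks_law Vinf N 0)"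
   by (simp only: case_prod_beta' measurable_cong_sets[OF sE refl])
 qed
 also have "... = (\<integral>\<^sup>+x. \<integral>\<^sup>+z. f z \<partial>start_law N 0 x \<partial>\<eta>N)"
  by (simp add: nn_integral_start_law[OF order_refl f])
 finally show ?thesis .
qed

text \<open>\<rho> is the joint law of the time of the n-th ring and of the configuration right
  after it, on the event that this ring comes by T. For functionals that see only the future, the
  state after n rings is then a mixture of regenerated states. The horizon T is present because the
  measure for the next ring is built on Lebesgue measure over a bounded interval.\<close>

definition regen :: "real => nat => (real \<times> (nat => 'a)) measure => bool" where
 "regen T n \<rho> \<longleftrightarrow> finite_measure \<rho> \<and> sets \<rho> = sets (half_line \<Otimes>\<^sub>M tuple_space N) \<and>
   (\<forall>t f. 0 <= t \<longrightarrow> t <= T \<longrightarrow> f \<in> borel_measurable (state_space N) \<longrightarrow> future_dep N t f \<longrightarrow>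
    stage n t f = (\<integral>\<^sup>+p. indicator {..t} (fst p) * (\<integral>\<^sup>+z. f z \<partial>start_law N (fst p) (snd p)) \<partial>\<rho>))"

lemma measurable_final_value_const:
 assumes G: "G \<in> borel_measurable (tuple_space N)" and t: "0 <= t"
 shows "final_value N t G \<in> borel_measurable (state_space N)"
proof -
 have t': "(%z. t) \<in> Y \<rightarrow>\<^sub>M half_line" for Y :: "'q measure" using t by (intro measurable_const) (simp add: space_restrict_space)
 show ?thesis using measurable_final_value[OF measurable_compose[OF measurable_snd G] t' measurable_state_ident] by simp
qed

text \<open>\<open>one_step\<close> conditions on the first ring at r after a regeneration at s and
  produces the factor exp(-N V (r - s)). The same factor is the probability in
  \<open>nn_integral_final_value\<close> that nothing rings between s and r. Integrating over \<rho>
  therefore collects everything before r into \<open>stage n r\<close> of a final value: the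
  condition has moved to the last ring before t, with exactly n rings before it.\<close>

lemma regen_stage:
 assumes \<rho>: "regen T n \<rho>" and t: "0 <= t" "t <= T" and f: "f \<in> borel_measurable (state_space N)" "future_dep N t f"
 shows "stage (Suc n) t f = (\<integral>\<^sup>+r. indicator {0..t} r * (\<Sum>i<N. ennreal Vinf *
   stage n r (final_value N r (jump_mean N i r (%y. \<integral>\<^sup>+z. f z \<partial>start_law N r y)))) \<partial>lborel)"
proof -
 interpret \<rho>: finite_measure \<rho> using \<rho> by (simp add: regen_def)
 have \<rho>s: "sets \<rho> = sets (half_line \<Otimes>\<^sub>M tuple_space N)" using \<rho> by (simp add: regen_def)
 have \<rho>sp: "space \<rho> = {0..} \<times> space (tuple_space N)"
  using sets_eq_imp_space_eq[OF \<rho>s] by (simp add: space_pair_measure space_restrict_space)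
 have \<rho>I: "stage n t f = (\<integral>\<^sup>+p. indicator {..t} (fst p) * (\<integral>\<^sup>+z. f z \<partial>start_law N (fst p) (snd p)) \<partial>\<rho>)"
  if "0 <= t" "t <= T" "f \<in> borel_measurable (state_space N)" "future_dep N t f" for t f
  using \<rho> that unfolding regen_def by blast
 interpret RL: pair_sigma_finite \<rho> "lborel :: real measure"
  unfolding pair_sigma_finite_def by (intro conjI \<rho>.sigma_finite_measure sigma_finite_lborel)
 define J where "J = (%i r. jump_mean N i r (%y. \<integral>\<^sup>+z. f z \<partial>start_law N r y))"
 have Jm: "(%z. J i (a z) (b z)) \<in> borel_measurable Y" if "a \<in> Y \<rightarrow>\<^sub>M half_line" "b \<in> Y \<rightarrow>\<^sub>M tuple_space N" "i < N"
  for i and Y :: "'q measure" and a b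
  unfolding J_def using that
  by (intro measurable_jump_mean measurable_start_law_integral f measurable_compose[OF measurable_fst] measurable_snd) auto
 define g where "g = (%p r. \<Sum>i<N. ennreal (Vinf * exp (- real N * Vinf * (r - fst p))) * transition N (fst p) r (J i r) (snd p))"
 have gm: "(%z. indicator {fst (fst z)..t} (snd z) * g (fst z) (snd z)) \<in> borel_measurable (\<rho> \<Otimes>\<^sub>M lborel)"
 proof -
  let ?Y = "(half_line \<Otimes>\<^sub>M tuple_space N) \<Otimes>\<^sub>M (borel :: real measure)"
  have a: "(%z. fst (fst z)) \<in> ?Y \<rightarrow>\<^sub>M half_line" by (rule measurable_compose[OF measurable_fst measurable_fst])
  have a': "(%z. fst (fst z)) \<in> borel_measurable ?Y" by (rule measurable_half_lineD[OF a])
  \<comment> \<open>Ring times are integrated over the whole line but the kernels are measurable on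
    the half line only; clipping at 0 changes nothing where the indicator is nonzero.\<close>
  have d: "(%z. max 0 (snd z)) \<in> ?Y \<rightarrow>\<^sub>M half_line"
   by (intro measurable_half_lineI borel_measurable_max measurable_snd borel_measurable_const) auto
  have b: "(%z. snd (fst z)) \<in> ?Y \<rightarrow>\<^sub>M tuple_space N" by (rule measurable_compose[OF measurable_fst measurable_snd])
  have tr: "(%z. transition N (fst (fst z)) (max 0 (snd z)) (J i (max 0 (snd z))) (snd (fst z))) \<in> borel_measurable ?Y" if "i < N" for i
   by (rule measurable_transition[OF _ a d b])
     (rule Jm[OF measurable_compose[OF measurable_fst d] measurable_snd that])
  have ex: "(%z. ennreal (Vinf * exp (- real N * Vinf * (snd z - fst (fst z))))) \<in> borel_measurable ?Y"
   using a' by measurable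
  have ind: "(%z. indicator {fst (fst z)..t} (snd z) :: ennreal) \<in> borel_measurable ?Y"
  proof (rule borel_measurable_indicator')
   have "{z \<in> space ?Y. snd z \<in> {fst (fst z)..t}} = {z \<in> space ?Y. fst (fst z) <= snd z} \<inter> {z \<in> space ?Y. snd z <= t}" by auto
   also have "... \<in> sets ?Y"
    by (intro sets.Int borel_measurable_le a' measurable_snd borel_measurable_const)
   finally show "{z \<in> space ?Y. snd z \<in> {fst (fst z)..t}} \<in> sets ?Y" .
  qed
  have "(%z. indicator {fst (fst z)..t} (snd z) * (\<Sum>i<N. ennreal (Vinf * exp (- real N * Vinf * (snd z - fst (fst z)))) *
    transition N (fst (fst z)) (max 0 (snd z)) (J i (max 0 (snd z))) (snd (fst z)))) \<in> borel_measurable ?Y"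
   using tr by (intro borel_measurable_times_ennreal ind borel_measurable_sum ex) auto
  then have "(%z. indicator {fst (fst z)..t} (snd z) * g (fst z) (snd z)) \<in> borel_measurable ?Y"
   by (rule iffD1[OF measurable_cong, rotated])
     (auto simp: g_def indicator_def max_def space_pair_measure space_restrict_space)
  then show ?thesis
   by (simp only: measurable_cong_sets[OF sets_pair_measure_cong[OF \<rho>s sets_lborel] refl])
 qed
 have "stage (Suc n) t f = stage n t (%z. indicator {z. alive N t z} z * (\<integral>\<^sup>+z'. f z' \<partial>ring_kernel K V Vinf N z))"
  by (rule stage_Suc[OF f(1)])
 also have "... = (\<integral>\<^sup>+p. indicator {..t} (fst p) *
   (\<integral>\<^sup>+z. indicator {z. alive N t z} z * (\<integral>\<^sup>+z'. f z' \<partial>ring_kernel K V Vinf N z) \<partial>start_law N (fst p) (snd p)) \<partial>\<rho>)"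
  by (rule \<rho>I[OF t measurable_alive_ring[OF N f(1)] future_dep_ring[OF N f]])
 also have "... = (\<integral>\<^sup>+p. \<integral>\<^sup>+r. indicator {fst p..t} r * g p r \<partial>lborel \<partial>\<rho>)"
 proof (rule nn_integral_cong)
  fix p assume "p \<in> space \<rho>"
  then have p: "0 <= fst p" by (auto simp: \<rho>sp)
  have os: "(\<integral>\<^sup>+z. indicator {z. alive N t z} z * (\<integral>\<^sup>+z'. f z' \<partial>ring_kernel K V Vinf N z) \<partial>start_law N (fst p) (snd p)) =
   (\<integral>\<^sup>+r. indicator {fst p..t} r * g p r \<partial>lborel)"
   unfolding one_step[OF N p f] g_def J_def ..
  show "indicator {..t} (fst p) * (\<integral>\<^sup>+z. indicator {z. alive N t z} z * (\<integral>\<^sup>+z'. f z' \<partial>ring_kernel K V Vinf N z) \<partial>start_law N (fst p) (snd p)) =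
   (\<integral>\<^sup>+r. indicator {fst p..t} r * g p r \<partial>lborel)"
   unfolding os by (cases "fst p <= t") simp_all
 qed
 also have "... = (\<integral>\<^sup>+r. \<integral>\<^sup>+p. indicator {fst p..t} r * g p r \<partial>\<rho> \<partial>lborel)"
  by (rule RL.Fubini'[symmetric]) (use gm in \<open>simp only: case_prod_beta'\<close>)
 also have "... = (\<integral>\<^sup>+r. indicator {0..t} r * (\<Sum>i<N. ennreal Vinf * stage n r (final_value N r (J i r))) \<partial>lborel)"
 proof (rule nn_integral_cong)
  fix r
  show "(\<integral>\<^sup>+p. indicator {fst p..t} r * g p r \<partial>\<rho>) = indicator {0..t} r * (\<Sum>i<N. ennreal Vinf * stage n r (final_value N r (J i r)))"
  proof (cases "r \<in> {0..t}")
   case False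
   then have "(\<integral>\<^sup>+p. indicator {fst p..t} r * g p r \<partial>\<rho>) = (\<integral>\<^sup>+p. 0 \<partial>\<rho>)"
    by (intro nn_integral_cong) (auto simp: \<rho>sp indicator_def)
   then show ?thesis using False by simp
  next
   case True
   then have r: "0 <= r" "r <= t" "r <= T" using t by auto
   have r': "(%z. r) \<in> Y \<rightarrow>\<^sub>M half_line" for Y :: "'q measure" using r by (intro measurable_const) (simp add: space_restrict_space)
   have Jr: "J i r \<in> borel_measurable (tuple_space N)" if "i < N" for i
    by (rule Jm[OF r' measurable_ident_sets[OF refl] that])
   have st: "stage n r (final_value N r (J i r)) = (\<integral>\<^sup>+p. indicator {..r} (fst p) * (ennreal (exp (- real N * Vinf * (r - fst p))) * transition N (fst p) r (J i r) (snd p)) \<partial>\<rho>)"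
    if i: "i < N" for i
   proof -
    have "stage n r (final_value N r (J i r)) = (\<integral>\<^sup>+p. indicator {..r} (fst p) * (\<integral>\<^sup>+z. final_value N r (J i r) z \<partial>start_law N (fst p) (snd p)) \<partial>\<rho>)"
     by (rule \<rho>I[OF r(1,3) measurable_final_value_const[OF Jr[OF i] r(1)] future_dep_final_value])
    also have "... = (\<integral>\<^sup>+p. indicator {..r} (fst p) * (ennreal (exp (- real N * Vinf * (r - fst p))) * transition N (fst p) r (J i r) (snd p)) \<partial>\<rho>)"
    proof (rule nn_integral_cong)
     fix p assume "p \<in> space \<rho>"
     then have p: "0 <= fst p" by (auto simp: \<rho>sp)
     show "indicator {..r} (fst p) * (\<integral>\<^sup>+z. final_value N r (J i r) z \<partial>start_law N (fst p) (snd p)) =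
      indicator {..r} (fst p) * (ennreal (exp (- real N * Vinf * (r - fst p))) * transition N (fst p) r (J i r) (snd p))"
      by (cases "fst p <= r") (simp_all add: nn_integral_final_value[OF N p _ Jr[OF i]])
    qed
    finally show ?thesis .
   qed
   have mm: "(%p. indicator {..r} (fst p) * (ennreal (exp (- real N * Vinf * (r - fst p))) * transition N (fst p) r (J i r) (snd p))) \<in> borel_measurable \<rho>"
    if i: "i < N" for i
   proof -
    let ?Y = "half_line \<Otimes>\<^sub>M (tuple_space N :: (nat => 'a) measure)"
    have a': "fst \<in> borel_measurable ?Y" by (rule measurable_half_lineD[OF measurable_fst])
    have ind: "(%p. indicator {..r} (fst p) :: ennreal) \<in> borel_measurable ?Y"
     by (rule measurable_compose[OF a', of "indicator {..r}"]) simp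
    have ex: "(%p. ennreal (exp (- real N * Vinf * (r - fst p)))) \<in> borel_measurable ?Y"
     by (rule measurable_compose[OF a', of "%u. ennreal (exp (- real N * Vinf * (r - u)))"]) measurable
    have "(%p. indicator {..r} (fst p) * (ennreal (exp (- real N * Vinf * (r - fst p))) * transition N (fst p) r (J i r) (snd p))) \<in> borel_measurable ?Y"
     by (intro borel_measurable_times_ennreal ind ex measurable_transition[OF _ measurable_fst r' measurable_snd] measurable_compose[OF measurable_snd Jr[OF i]])
    then show ?thesis by (simp only: measurable_cong_sets[OF \<rho>s refl])
   qed
   have "(\<integral>\<^sup>+p. indicator {fst p..t} r * g p r \<partial>\<rho>) = (\<integral>\<^sup>+p. (\<Sum>i<N. ennreal Vinf * (indicator {..r} (fst p) * (ennreal (exp (- real N * Vinf * (r - fst p))) * transition N (fst p) r (J i r) (snd p)))) \<partial>\<rho>)"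
   proof (rule nn_integral_cong)
    fix p :: "real \<times> (nat => 'a)"
    have "ennreal (Vinf * exp (- real N * Vinf * (r - fst p))) = ennreal Vinf * ennreal (exp (- real N * Vinf * (r - fst p)))"
     using Vinf_pos by (simp add: ennreal_mult)
    then show "indicator {fst p..t} r * g p r = (\<Sum>i<N. ennreal Vinf * (indicator {..r} (fst p) * (ennreal (exp (- real N * Vinf * (r - fst p))) * transition N (fst p) r (J i r) (snd p))))"
     using r by (cases "fst p <= r") (simp_all add: g_def mult.assoc)
   qed
   also have "... = (\<Sum>i<N. ennreal Vinf * stage n r (final_value N r (J i r)))"
    using mm by (subst nn_integral_sum) (auto simp: nn_integral_cmult st intro!: sum.cong)
   finally show ?thesis using True by simp
  qed
 qed
 finally show ?thesis unfolding J_def .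
qed

end

context particle_model
begin

text \<open>Without a ring the regeneration time is 0 and the configuration is the initial
  one.\<close>

lemma regen_0: "\<exists>\<rho>. regen T 0 \<rho>"
proof -
 let ?Y = "half_line \<Otimes>\<^sub>M (tuple_space N :: (nat => 'a) measure)"
 let ?\<rho> = "distr \<eta>N ?Y (%x. (0, x))"
 have m: "(%x. (0, x)) \<in> \<eta>N \<rightarrow>\<^sub>M ?Y"
  unfolding measurable_cong_sets[OF \<eta>N_sets refl]
  by (intro measurable_Pair measurable_const measurable_ident_sets[OF refl]) (simp add: space_restrict_space)
 have "stage 0 t f = (\<integral>\<^sup>+p. indicator {..t} (fst p) * (\<integral>\<^sup>+z. f z \<partial>start_law N (fst p) (snd p)) \<partial>?\<rho>)"
  if t: "0 <= t" and f: "f \<in> borel_measurable (state_space N)" for t f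
 proof -
  have a': "fst \<in> borel_measurable ?Y" by (rule measurable_half_lineD[OF measurable_fst])
  have ind: "(%p. indicator {..t} (fst p) :: ennreal) \<in> borel_measurable ?Y"
   by (rule measurable_compose[OF a', of "indicator {..t}"]) simp
  have "(%p. indicator {..t} (fst p) * (\<integral>\<^sup>+z. f z \<partial>start_law N (fst p) (snd p))) \<in> borel_measurable ?Y"
   by (intro borel_measurable_times_ennreal ind measurable_start_law_integral f measurable_fst measurable_snd)
  then have "(\<integral>\<^sup>+p. indicator {..t} (fst p) * (\<integral>\<^sup>+z. f z \<partial>start_law N (fst p) (snd p)) \<partial>?\<rho>)
    = (\<integral>\<^sup>+x. indicator {..t} (fst (0, x)) * (\<integral>\<^sup>+z. f z \<partial>start_law N (fst (0, x)) (snd (0, x))) \<partial>\<eta>N)"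
   by (subst nn_integral_distr[OF m]) simp_all
  then show ?thesis using t by (simp add: stage_0[OF f])
 qed
 then have "regen T 0 ?\<rho>"
  unfolding regen_def using prob_space.finite_measure[OF prob_space.prob_space_distr[OF \<eta>N_prob m]] by auto
 then show ?thesis by blast
qed

lemma measurable_stage_indicator:
 assumes a: "a \<in> borel_measurable Y" and b: "b \<in> Y \<rightarrow>\<^sub>M M"
 shows "(%z. indicator {w. \<forall>k<n. alive N (a z) (Z k w)} (b z) :: ennreal) \<in> borel_measurable Y"
proof (rule borel_measurable_indicator')
 have "Measurable.pred Y (%z. \<forall>k\<in>{..<n}. alive N (a z) (Z k (b z)))"
  by (intro pred_intros_finite measurable_alive a measurable_compose[OF b Z_measurable]) auto
 also have "(%z. \<forall>k\<in>{..<n}. alive N (a z) (Z k (b z))) = (%z. b z \<in> {w. \<forall>k<n. alive N (a z) (Z k w)})"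
  by (intro ext) auto
 finally show "{z \<in> space Y. b z \<in> {w. \<forall>k<n. alive N (a z) (Z k w)}} \<in> sets Y"
  by (simp only: pred_def)
qed

lemma measurable_stage:
 assumes G: "(%z. G (fst z) (snd z)) \<in> borel_measurable (Y \<Otimes>\<^sub>M tuple_space N)" and a: "a \<in> Y \<rightarrow>\<^sub>M half_line"
 shows "(%z. stage n (a z) (final_value N (a z) (G z))) \<in> borel_measurable Y"
 unfolding stage_def
proof (rule MP.borel_measurable_nn_integral)
 have G': "(%z. G (fst (fst z)) (snd z)) \<in> borel_measurable ((Y \<Otimes>\<^sub>M M) \<Otimes>\<^sub>M tuple_space N)"
  using measurable_compose[OF measurable_Pair[OF measurable_compose[OF measurable_fst measurable_fst] measurable_snd] G] by simp
 have a2: "(%z. a (fst z)) \<in> Y \<Otimes>\<^sub>M M \<rightarrow>\<^sub>M half_line" by (rule measurable_compose[OF measurable_fst a])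
 have "(%z. indicator {w. \<forall>k<n. alive N (a (fst z)) (Z k w)} (snd z) * final_value N (a (fst z)) (G (fst z)) (Z n (snd z))) \<in> borel_measurable (Y \<Otimes>\<^sub>M M)"
  by (intro borel_measurable_times_ennreal measurable_stage_indicator[OF measurable_half_lineD[OF a2] measurable_snd]
    measurable_final_value[OF G' a2 measurable_compose[OF measurable_snd Z_measurable]])
 then show "(%(x, y). indicator {w. \<forall>k<n. alive N (a x) (Z k w)} y * final_value N (a x) (G x) (Z n y)) \<in> borel_measurable (Y \<Otimes>\<^sub>M M)"
  by (simp only: case_prod_beta')
qed

lemma stage_final_measurable:
 assumes G: "G \<in> borel_measurable (tuple_space N)" and r: "0 <= r"
 shows "(%w. indicator {w. \<forall>k<n. alive N r (Z k w)} w * final_value N r G (Z n w)) \<in> borel_measurable M"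
 by (intro borel_measurable_times_ennreal measurable_compose[OF Z_measurable measurable_final_value_const[OF G r]]
   measurable_stage_indicator borel_measurable_const measurable_ident_sets[OF refl])

text \<open>The next measure is explicit. \<open>P\<close> carries a candidate ring time r, the
  chain, and the marks of a ring: ringing particle, target, decision. \<open>A\<close> is the event
  of exactly n rings by r, \<open>W\<close> the density of a further ring at r with the given marks,
  and \<open>U\<close> returns r with the configuration after the jump. Integrating out the marks
  reproduces \<open>jump_mean\<close>, so that \<open>regen_stage\<close> is the required identity;
  finiteness follows from W being at most V / N on a finite measure space.\<close>

lemma regen_Suc:
 assumes "regen T n \<rho>" and T: "0 <= T" shows "\<exists>\<rho>'. regen T (Suc n) \<rho>'"
proof -
 let ?Y = "half_line \<Otimes>\<^sub>M (tuple_space N :: (nat => 'a) measure)"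
 define Q where "Q = {..<N} \<times> {..<N} \<times> (UNIV :: bool set)"
 have Qf: "finite Q" by (simp add: Q_def)
 define R where "R = restrict_space lborel {0..T}"
 define P where "P = R \<Otimes>\<^sub>M (M \<Otimes>\<^sub>M count_space Q)"
 define X where "X = (%r w. positions N r (fst (Z n w)))"
 define A where "A = (%r w. indicator {w. \<forall>k<n. alive N r (Z k w)} w * indicator {z. \<not> alive N r z} (Z n w) :: ennreal)"
 define W where "W = (%p :: real \<times> 'w \<times> nat \<times> nat \<times> bool. ennreal (Vinf / real N) * A (fst p) (fst (snd p)) *
   (if snd (snd (snd (snd p))) then accept (fst p) (X (fst p) (fst (snd p)) (fst (snd (snd p))))
   else reject (fst p) (X (fst p) (fst (snd p)) (fst (snd (snd p))))))"
 define U where "U = (%p :: real \<times> 'w \<times> nat \<times> nat \<times> bool. (fst p, if snd (snd (snd (snd p))) then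
   (X (fst p) (fst (snd p)))(fst (snd (snd p)) := X (fst p) (fst (snd p)) (fst (snd (snd (snd p))))) else X (fst p) (fst (snd p))))"
 have R_id: "(%r. r) \<in> R \<rightarrow>\<^sub>M half_line"
  unfolding R_def by (intro measurable_half_lineI measurable_restrict_space1) (auto simp: space_restrict_space)
 have a: "fst \<in> P \<rightarrow>\<^sub>M half_line" unfolding P_def by (rule measurable_compose[OF measurable_fst R_id])
 have b: "(%p. fst (snd p)) \<in> P \<rightarrow>\<^sub>M M" unfolding P_def by (rule measurable_compose[OF measurable_snd measurable_fst])
 have q: "(%p. snd (snd p)) \<in> P \<rightarrow>\<^sub>M count_space Q" unfolding P_def by (rule measurable_compose[OF measurable_snd measurable_snd])
 have Xm: "(%p. X (fst p) (fst (snd p))) \<in> P \<rightarrow>\<^sub>M tuple_space N"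
  unfolding X_def
  by (rule measurable_positions[OF a measurable_compose[OF measurable_compose[OF b Z_measurable, unfolded state_space_def] measurable_fst]])
 have Xim: "(%p. X (fst p) (fst (snd p)) i) \<in> P \<rightarrow>\<^sub>M borel" if "i < N" for i
  by (rule measurable_component[OF that Xm])
 have Am: "(%p. A (fst p) (fst (snd p))) \<in> borel_measurable P"
 proof -
  have "(%p. final_value N (fst p) (%_. 1) (Z n (fst (snd p)))) \<in> borel_measurable P"
   by (rule measurable_final_value[OF _ a measurable_compose[OF b Z_measurable]]) simp
  then show ?thesis unfolding A_def
   by (intro borel_measurable_times_ennreal measurable_stage_indicator[OF measurable_half_lineD[OF a] b]) (simp add: final_value_def)
 qed
 have Wm: "W \<in> borel_measurable P"
  unfolding W_def
 proof (rule measurable_compose_countable'[OF _ q, where f="%q p. ennreal (Vinf / real N) * A (fst p) (fst (snd p)) *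
   (if snd (snd q) then accept (fst p) (X (fst p) (fst (snd p)) (fst q)) else reject (fst p) (X (fst p) (fst (snd p)) (fst q)))"])
  fix q assume "q \<in> Q"
  then have "fst q < N" by (auto simp: Q_def)
  then show "(%p. ennreal (Vinf / real N) * A (fst p) (fst (snd p)) *
    (if snd (snd q) then accept (fst p) (X (fst p) (fst (snd p)) (fst q)) else reject (fst p) (X (fst p) (fst (snd p)) (fst q)))) \<in> borel_measurable P"
   using measurable_accept_reject[OF a Xim] Am by (cases "snd (snd q)") (auto intro!: borel_measurable_times_ennreal)
 qed (use Qf in \<open>auto intro: countable_finite\<close>)
 have Um: "U \<in> P \<rightarrow>\<^sub>M ?Y"
  unfolding U_def
 proof (rule measurable_compose_countable'[OF _ q, where f="%q p. (fst p, if snd (snd q) then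
   (X (fst p) (fst (snd p)))(fst q := X (fst p) (fst (snd p)) (fst (snd q))) else X (fst p) (fst (snd p)))"])
  fix q assume "q \<in> Q"
  then have "fst q < N" "fst (snd q) < N" by (auto simp: Q_def)
  then show "(%p. (fst p, if snd (snd q) then
   (X (fst p) (fst (snd p)))(fst q := X (fst p) (fst (snd p)) (fst (snd q))) else X (fst p) (fst (snd p)))) \<in> P \<rightarrow>\<^sub>M ?Y"
   using Xm Xim a by (cases "snd (snd q)") (auto intro!: measurable_Pair half_line_fun_upd)
 qed (use Qf in \<open>auto intro: countable_finite\<close>)
 have finR: "finite_measure R"
  by (intro finite_measureI) (simp add: R_def emeasure_restrict_space space_restrict_space T)
 interpret CQ: finite_measure "count_space Q" using Qf by (rule finite_measure_count_space)
 interpret MQ: sigma_finite_measure "M \<Otimes>\<^sub>M count_space Q"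
  by (intro sigma_finite_pair_measure MP.sigma_finite_measure CQ.sigma_finite_measure)
 define \<rho>' where "\<rho>' = distr (density P W) ?Y U"
 have int: "(\<integral>\<^sup>+p. h p \<partial>\<rho>') = (\<integral>\<^sup>+r. (\<Sum>i<N. ennreal Vinf * stage n r (final_value N r (jump_mean N i r (%y. h (r, y))))) * indicator {0..T} r \<partial>lborel)"
  if h: "h \<in> borel_measurable ?Y" for h
 proof -
  have hU: "(%p. h (U p)) \<in> borel_measurable P" by (rule measurable_compose[OF Um h])
  have WhU: "(%p. W p * h (U p)) \<in> borel_measurable P" by (intro borel_measurable_times_ennreal Wm hU)
  have "(\<integral>\<^sup>+p. h p \<partial>\<rho>') = (\<integral>\<^sup>+p. h (U p) \<partial>density P W)"
   unfolding \<rho>'_def by (rule nn_integral_distr) (use Um h in simp_all)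
  also have "... = (\<integral>\<^sup>+p. W p * h (U p) \<partial>P)" by (rule nn_integral_density[OF Wm hU])
  also have "... = (\<integral>\<^sup>+r. \<integral>\<^sup>+v. W (r, v) * h (U (r, v)) \<partial>(M \<Otimes>\<^sub>M count_space Q) \<partial>R)"
   using WhU unfolding P_def by (rule MQ.nn_integral_fst[symmetric])
  also have "... = (\<integral>\<^sup>+r. (\<Sum>i<N. ennreal Vinf * stage n r (final_value N r (jump_mean N i r (%y. h (r, y))))) \<partial>R)"
  proof (rule nn_integral_cong)
   fix r assume r: "r \<in> space R"
   then have r0: "0 <= r" by (simp add: R_def space_restrict_space)
   have hr: "(%y. h (r, y)) \<in> borel_measurable (tuple_space N)"
    using measurable_compose[OF measurable_Pair1' h, of r] r0 by (simp add: space_restrict_space)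
   have r': "(%z. r) \<in> Y \<rightarrow>\<^sub>M half_line" for Y :: "'q measure" using r0 by (intro measurable_const) (simp add: space_restrict_space)
   have Jm: "jump_mean N i r (%y. h (r, y)) \<in> borel_measurable (tuple_space N)" if "i < N" for i
    using measurable_jump_mean[OF measurable_compose[OF measurable_snd hr] that r' measurable_ident_sets[OF refl]] by simp
   have "(\<integral>\<^sup>+v. W (r, v) * h (U (r, v)) \<partial>(M \<Otimes>\<^sub>M count_space Q)) = (\<integral>\<^sup>+w. \<integral>\<^sup>+q. W (r, (w, q)) * h (U (r, (w, q))) \<partial>count_space Q \<partial>M)"
   proof (rule CQ.nn_integral_fst[symmetric])
    show "(%v. W (r, v) * h (U (r, v))) \<in> borel_measurable (M \<Otimes>\<^sub>M count_space Q)"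
     using measurable_compose[OF measurable_Pair1' WhU[unfolded P_def], OF r] by simp
   qed
   also have "... = (\<integral>\<^sup>+w. (\<Sum>i<N. ennreal Vinf * (indicator {w. \<forall>k<n. alive N r (Z k w)} w * final_value N r (jump_mean N i r (%y. h (r, y))) (Z n w))) \<partial>M)"
   proof (rule nn_integral_cong)
    fix w
    have c: "ennreal (Vinf / real N) = ennreal Vinf * ennreal (1 / real N)"
     using Vinf_pos by (simp add: ennreal_mult[symmetric])
    have "(\<integral>\<^sup>+q. W (r, (w, q)) * h (U (r, (w, q))) \<partial>count_space Q) = (\<Sum>q\<in>Q. W (r, (w, q)) * h (U (r, (w, q))))"
     using Qf by (rule nn_integral_count_space_finite)
    also have "... = (\<Sum>i<N. \<Sum>j<N. \<Sum>bb\<in>UNIV. W (r, (w, (i, j, bb))) * h (U (r, (w, (i, j, bb)))))"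
     unfolding Q_def by (simp add: sum.cartesian_product')
    also have "... = (\<Sum>i<N. \<Sum>j<N. ennreal Vinf * ennreal (1 / real N) * A r w * (accept r (X r w i) * h (r, (X r w)(i := X r w j)) + reject r (X r w i) * h (r, X r w)))"
     by (intro sum.cong refl) (simp add: W_def U_def UNIV_bool c distrib_left mult_ac add_ac)
    also have "... = (\<Sum>i<N. ennreal Vinf * (A r w * jump_mean N i r (%y. h (r, y)) (X r w)))"
     unfolding jump_mean_def sum_distrib_left by (intro sum.cong refl) (simp add: mult_ac)
    also have "... = (\<Sum>i<N. ennreal Vinf * (indicator {w. \<forall>k<n. alive N r (Z k w)} w * final_value N r (jump_mean N i r (%y. h (r, y))) (Z n w)))"
     by (simp add: A_def X_def final_value_def mult.assoc)
    finally show "(\<integral>\<^sup>+q. W (r, (w, q)) * h (U (r, (w, q))) \<partial>count_space Q) =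
      (\<Sum>i<N. ennreal Vinf * (indicator {w. \<forall>k<n. alive N r (Z k w)} w * final_value N r (jump_mean N i r (%y. h (r, y))) (Z n w)))" .
   qed
   also have "... = (\<Sum>i<N. \<integral>\<^sup>+w. ennreal Vinf * (indicator {w. \<forall>k<n. alive N r (Z k w)} w * final_value N r (jump_mean N i r (%y. h (r, y))) (Z n w)) \<partial>M)"
    by (rule nn_integral_sum, rule borel_measurable_times_ennreal[OF borel_measurable_const stage_final_measurable[OF Jm r0]]) simp
   also have "... = (\<Sum>i<N. ennreal Vinf * stage n r (final_value N r (jump_mean N i r (%y. h (r, y)))))"
    unfolding stage_def by (rule sum.cong[OF refl], rule nn_integral_cmult, rule stage_final_measurable[OF Jm r0]) simp
   finally show "(\<integral>\<^sup>+v. W (r, v) * h (U (r, v)) \<partial>(M \<Otimes>\<^sub>M count_space Q)) =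
    (\<Sum>i<N. ennreal Vinf * stage n r (final_value N r (jump_mean N i r (%y. h (r, y)))))" .
  qed
  also have "... = (\<integral>\<^sup>+r. (\<Sum>i<N. ennreal Vinf * stage n r (final_value N r (jump_mean N i r (%y. h (r, y))))) * indicator {0..T} r \<partial>lborel)"
   unfolding R_def by (rule nn_integral_restrict_space) simp
  finally show ?thesis .
 qed
 have "finite_measure \<rho>'"
 proof (rule finite_measureI)
  have "emeasure \<rho>' (space \<rho>') = (\<integral>\<^sup>+p. 1 \<partial>\<rho>')" by simp
  also have "... = (\<integral>\<^sup>+p. 1 \<partial>density P W)"
   unfolding \<rho>'_def by (rule nn_integral_distr) (use Um in simp_all)
  also have "... = (\<integral>\<^sup>+p. W p * 1 \<partial>P)" by (rule nn_integral_density[OF Wm]) simp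
  also have "... = (\<integral>\<^sup>+p. W p \<partial>P)" by simp
  also have "... <= (\<integral>\<^sup>+p. ennreal (Vinf / real N) \<partial>P)"
  proof (rule nn_integral_mono)
   fix p assume "p \<in> space P"
   then have p: "0 <= fst p" using measurable_space[OF a] by (auto simp: space_restrict_space)
   have 1: "accept (fst p) y <= 1" "reject (fst p) y <= 1" for y
    using accept_add_reject[OF p, of y] by (metis le_add1 le_iff_add, metis le_iff_add add.commute)
   have 2: "A r w <= 1" for r w by (auto simp: A_def indicator_def)
   have "A (fst p) (fst (snd p)) * (if snd (snd (snd (snd p))) then accept (fst p) (X (fst p) (fst (snd p)) (fst (snd (snd p))))
     else reject (fst p) (X (fst p) (fst (snd p)) (fst (snd (snd p))))) <= 1 * 1"
    by (intro mult_mono 2) (use 1 in auto)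
   then show "W p <= ennreal (Vinf / real N)"
    unfolding W_def mult.assoc by (metis (no_types, lifting) mult.right_neutral mult_left_mono zero_le)
  qed
  also have "... = ennreal (Vinf / real N) * emeasure P (space P)" by simp
  also have "... < \<infinity>"
  proof -
   have "finite_measure P" unfolding P_def
    by (intro finite_measure_pair_measure finR MP.finite_measure_axioms CQ.finite_measure_axioms)
   then have "emeasure P (space P) < \<infinity>" using finite_measure.emeasure_finite by (metis infinity_ennreal_def top.not_eq_extremum)
   then show ?thesis by (simp add: ennreal_mult_less_top)
  qed
  finally show "emeasure \<rho>' (space \<rho>') \<noteq> \<infinity>" by simp
 qed
 moreover have "stage (Suc n) t f = (\<integral>\<^sup>+p. indicator {..t} (fst p) * (\<integral>\<^sup>+z. f z \<partial>start_law N (fst p) (snd p)) \<partial>\<rho>')"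
  if t: "0 <= t" "t <= T" and f: "f \<in> borel_measurable (state_space N)" "future_dep N t f" for t f
 proof -
  have a': "fst \<in> borel_measurable ?Y" by (rule measurable_half_lineD[OF measurable_fst])
  have ind: "(%p. indicator {..t} (fst p) :: ennreal) \<in> borel_measurable ?Y"
   by (rule measurable_compose[OF a', of "indicator {..t}"]) simp
  have m: "(%p. indicator {..t} (fst p) * (\<integral>\<^sup>+z. f z \<partial>start_law N (fst p) (snd p))) \<in> borel_measurable ?Y"
   by (intro borel_measurable_times_ennreal ind measurable_start_law_integral f measurable_fst measurable_snd)
  show ?thesis
   unfolding int[OF m] regen_stage[OF assms(1) t f]
  proof (rule nn_integral_cong)
   fix r
   \<comment> \<open>One side cuts the ring time at t, the other at T. For r between t and T the
     indicator inside \<open>jump_mean\<close> makes the second integrand vanish.\<close>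
   consider "r \<in> {0..t}" | "r \<notin> {0..T}" | "t < r" by fastforce
   then show "indicator {0..t} r * (\<Sum>i<N. ennreal Vinf * stage n r (final_value N r (jump_mean N i r (%y. \<integral>\<^sup>+z. f z \<partial>start_law N r y)))) =
    (\<Sum>i<N. ennreal Vinf * stage n r (final_value N r (jump_mean N i r (%y. indicator {..t} (fst (r, y)) * (\<integral>\<^sup>+z. f z \<partial>start_law N (fst (r, y)) (snd (r, y))))))) * indicator {0..T} r"
   proof cases
    case 3
    have "jump_mean N i r (%y. 0) = (%_. 0)" for i by (simp add: jump_mean_def fun_eq_iff)
    then show ?thesis using 3 by (simp add: final_value_def stage_def)
   qed (use t in auto)
  qed
 qed
 ultimately have "regen T (Suc n) \<rho>'" unfolding regen_def by (auto simp: \<rho>'_def)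
 then show ?thesis by blast
qed

lemma regen_exists: "0 <= T ==> \<exists>\<rho>. regen T n \<rho>"
 by (induction n) (use regen_0 regen_Suc in blast)+

end

section \<open>Number of rings and the integral equation for the configuration\<close>

lemma measurable_half_line_const: "0 <= r ==> (%z. r) \<in> Y \<rightarrow>\<^sub>M half_line"
 by (intro measurable_const) (simp add: space_restrict_space)

context feynman_kac_model
begin

lemma measurable_transition_const:
 assumes "G \<in> borel_measurable (tuple_space N)" "0 <= r" "0 <= t"
 shows "transition N r t G \<in> borel_measurable (tuple_space N)"
 using measurable_transition[OF measurable_compose[OF measurable_snd assms(1)] measurable_half_line_const[OF assms(2)]
  measurable_half_line_const[OF assms(3)] measurable_ident_sets[OF refl]] by simp

lemma measurable_jump_mean_const:
 assumes "h \<in> borel_measurable (tuple_space N)" "0 <= r" "i < N"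
 shows "jump_mean N i r h \<in> borel_measurable (tuple_space N)"
 using measurable_jump_mean[OF measurable_compose[OF measurable_snd assms(1)] assms(3) measurable_half_line_const[OF assms(2)]
   measurable_ident_sets[OF refl]] by simp

lemma jump_mean_cmult: "jump_mean N i r (%y. c * h y) = (%y. c * jump_mean N i r h y)"
 by (auto simp: fun_eq_iff jump_mean_def sum_distrib_left distrib_left mult_ac intro!: sum.cong)

lemma jump_mean_const: "1 <= N ==> 0 <= r ==> jump_mean N i r (%_. c) = (%_. c)"
proof
 fix y assume N: "1 <= N" and r: "0 <= r"
 have "jump_mean N i r (%_. c) y = (\<Sum>j<N. ennreal (1 / real N) * c)"
  unfolding jump_mean_def by (simp add: distrib_right[symmetric] accept_add_reject[OF r])
 also have "... = ennreal (real N * (1 / real N)) * c"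
  by (simp only: sum_constant card_lessThan ennreal_of_nat_eq_real_of_nat mult.assoc[symmetric] ennreal_mult[symmetric] of_nat_0_le_iff)
   (simp add: ennreal_mult[symmetric])
 finally show "jump_mean N i r (%_. c) y = c" using N by simp
qed

lemma transition_const: "0 <= r ==> transition N r t (%_. c) = (%_. c)"
 using prob_space.emeasure_space_1[OF path_law_prob] by (simp add: transition_def fun_eq_iff)

end

context particle_model
begin

lemma stage_cmult:
 assumes G: "G \<in> borel_measurable (tuple_space N)" and r: "0 <= r"
 shows "stage n r (final_value N r (%y. c * G y)) = c * stage n r (final_value N r G)"
proof -
 have "stage n r (final_value N r (%y. c * G y)) = (\<integral>\<^sup>+w. c * (indicator {w. \<forall>k<n. alive N r (Z k w)} w * final_value N r G (Z n w)) \<partial>M)"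
  unfolding stage_def final_value_def by (simp add: mult_ac)
 also have "... = c * stage n r (final_value N r G)"
  unfolding stage_def by (rule nn_integral_cmult[OF stage_final_measurable[OF G r]])
 finally show ?thesis .
qed

lemma stage_final_0:
 assumes G: "G \<in> borel_measurable (tuple_space N)" and t: "0 <= t"
 shows "stage 0 t (final_value N t G) = ennreal (exp (- real N * Vinf * t)) * (\<integral>\<^sup>+x. transition N 0 t G x \<partial>\<eta>N)"
proof -
 have "stage 0 t (final_value N t G) = (\<integral>\<^sup>+x. \<integral>\<^sup>+z. final_value N t G z \<partial>start_law N 0 x \<partial>\<eta>N)"
  by (rule stage_0[OF measurable_final_value_const[OF G t]])
 also have "... = (\<integral>\<^sup>+x. ennreal (exp (- real N * Vinf * t)) * transition N 0 t G x \<partial>\<eta>N)"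
  by (simp add: nn_integral_final_value[OF N order_refl t G])
 also have "... = ennreal (exp (- real N * Vinf * t)) * (\<integral>\<^sup>+x. transition N 0 t G x \<partial>\<eta>N)"
  using measurable_transition_const[OF G order_refl t]
  by (intro nn_integral_cmult) (simp only: measurable_cong_sets[OF \<eta>N_sets refl])
 finally show ?thesis .
qed

text \<open>After the last ring at r all clocks must stay silent until t, which has probability
  exp(-N V (t - r)), and the trajectories run freely, which is
  \<open>transition N r t\<close>.\<close>

lemma stage_final_Suc:
 assumes G: "G \<in> borel_measurable (tuple_space N)" and t: "0 <= t"
 shows "stage (Suc n) t (final_value N t G) = (\<integral>\<^sup>+r. indicator {0..t} r * (\<Sum>i<N. ennreal (Vinf * exp (- real N * Vinf * (t - r))) *
   stage n r (final_value N r (jump_mean N i r (transition N r t G)))) \<partial>lborel)"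
proof -
 obtain \<rho> where \<rho>: "regen t n \<rho>" using regen_exists[OF t] by blast
 show ?thesis
  unfolding regen_stage[OF \<rho> t order_refl measurable_final_value_const[OF G t] future_dep_final_value]
 proof (rule nn_integral_cong)
  fix r
  show "indicator {0..t} r * (\<Sum>i<N. ennreal Vinf * stage n r (final_value N r (jump_mean N i r (%y. \<integral>\<^sup>+z. final_value N t G z \<partial>start_law N r y)))) =
   indicator {0..t} r * (\<Sum>i<N. ennreal (Vinf * exp (- real N * Vinf * (t - r))) * stage n r (final_value N r (jump_mean N i r (transition N r t G))))"
  proof (cases "r \<in> {0..t}")
   case True
   then have r: "0 <= r" "r <= t" by auto
   have "ennreal Vinf * stage n r (final_value N r (jump_mean N i r (%y. \<integral>\<^sup>+z. final_value N t G z \<partial>start_law N r y))) =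
    ennreal (Vinf * exp (- real N * Vinf * (t - r))) * stage n r (final_value N r (jump_mean N i r (transition N r t G)))" if i: "i < N" for i
   proof -
    have eq: "(%y. \<integral>\<^sup>+z. final_value N t G z \<partial>start_law N r y) = (%y. ennreal (exp (- real N * Vinf * (t - r))) * transition N r t G y)"
     by (simp add: nn_integral_final_value[OF N r G])
    show ?thesis
     unfolding eq jump_mean_cmult stage_cmult[OF measurable_jump_mean_const[OF measurable_transition_const[OF G r(1) t] r(1) i] r(1)]
     using Vinf_pos by (simp add: ennreal_mult mult.assoc)
   qed
   then show ?thesis by (auto intro!: sum.cong)
  qed simp
 qed
qed

text \<open>For the constant function the positions drop out, and the recursion over the last ring
  integrates to the Poisson weights of mean N V t. This identifies the law of the number of rings by
  time t and serves to exclude explosion.\<close>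

lemma stage_poisson:
 "0 <= t ==> stage n t (final_value N t (%_. 1)) = ennreal (exp (- real N * Vinf * t) * ((real N * Vinf * t) ^ n / fact n))"
proof (induction n arbitrary: t)
 case 0
 then show ?case
  using prob_space.emeasure_space_1[OF \<eta>N_prob]
  by (subst stage_final_0) (simp_all add: transition_const)
next
 case (Suc n)
 let ?l = "real N * Vinf"
 have l: "0 < ?l" using N Vinf_pos by simp
 define f where "f = (%r. exp (- ?l * t) * (?l * (?l * r) ^ n / fact n))"
 have "stage (Suc n) t (final_value N t (%_. 1)) = (\<integral>\<^sup>+r. ennreal (f r) * indicator {0..t} r \<partial>lborel)"
  unfolding stage_final_Suc[OF borel_measurable_const Suc.prems]
 proof (rule nn_integral_cong)
  fix r
  show "indicator {0..t} r * (\<Sum>i<N. ennreal (Vinf * exp (- real N * Vinf * (t - r))) * stage n r (final_value N r (jump_mean N i r (transition N r t (%_. 1))))) =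
   ennreal (f r) * indicator {0..t} r"
  proof (cases "r \<in> {0..t}")
   case True
   then have r: "0 <= r" by simp
   have "(\<Sum>i<N. ennreal (Vinf * exp (- ?l * (t - r))) * stage n r (final_value N r (jump_mean N i r (transition N r t (%_. 1))))) =
    (\<Sum>i<N. ennreal (Vinf * exp (- ?l * (t - r))) * ennreal (exp (- ?l * r) * ((?l * r) ^ n / fact n)))"
    by (simp only: transition_const[OF r] jump_mean_const[OF N r] Suc.IH[OF r] mult_minus_left)
   also have "... = (\<Sum>i<N. ennreal (Vinf * exp (- ?l * (t - r)) * (exp (- ?l * r) * ((?l * r) ^ n / fact n))))"
    using Vinf_pos r by (intro sum.cong refl ennreal_mult[symmetric]) auto
   also have "... = ennreal (\<Sum>i<N. Vinf * exp (- ?l * (t - r)) * (exp (- ?l * r) * ((?l * r) ^ n / fact n)))"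
    using Vinf_pos r by (intro sum_ennreal) auto
   also have "(\<Sum>i<N. Vinf * exp (- ?l * (t - r)) * (exp (- ?l * r) * ((?l * r) ^ n / fact n))) = f r"
   proof -
    have "exp (- ?l * (t - r)) * exp (- ?l * r) = exp (- ?l * t)" by (simp add: exp_add[symmetric] algebra_simps)
    then have eq: "Vinf * exp (- ?l * (t - r)) * (exp (- ?l * r) * ((?l * r) ^ n / fact n)) = Vinf * (exp (- ?l * t) * ((?l * r) ^ n / fact n))"
     by (simp add: mult.assoc[symmetric])
    have alg: "real N * (Vinf * (e * (x / F))) = e * (?l * x / F)" for e x F :: real by simp
    show ?thesis unfolding f_def by (simp only: eq sum_constant card_lessThan alg)
   qed
   finally show ?thesis using True by simp
  qed simp
 qed
 also have "... = ennreal (exp (- ?l * t) * ((?l * t) ^ Suc n / fact (Suc n)) - exp (- ?l * t) * ((?l * 0) ^ Suc n / fact (Suc n)))"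
 proof (rule nn_integral_FTC_Icc[where F="%r. exp (- ?l * t) * ((?l * r) ^ Suc n / fact (Suc n))"])
  show "f \<in> borel_measurable borel" unfolding f_def by measurable
  fix r assume "r \<in> {0..t}"
  then show "0 <= f r" unfolding f_def using l by simp
  have "((%r. (?l * r) ^ Suc n) has_real_derivative (real (Suc n) * (?l * r) ^ n * ?l)) (at r)"
  proof -
   have "((%r. ?l * r) has_real_derivative ?l) (at r)" by (auto intro!: derivative_eq_intros)
   from DERIV_power[OF this, of "Suc n"] show ?thesis by (simp add: mult_ac del: of_nat_Suc power_Suc)
  qed
  then have "((%r. exp (- ?l * t) * ((?l * r) ^ Suc n / fact (Suc n))) has_real_derivative (exp (- ?l * t) * ((real (Suc n) * (?l * r) ^ n * ?l) / fact (Suc n)))) (at r)"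
   by (intro DERIV_cmult DERIV_cdivide)
  moreover have "exp (- ?l * t) * ((real (Suc n) * (?l * r) ^ n * ?l) / fact (Suc n)) = f r"
   unfolding f_def by (simp add: field_simps del: of_nat_Suc)
  ultimately show "((%r. exp (- ?l * t) * ((?l * r) ^ Suc n / fact (Suc n))) has_real_derivative f r) (at r)" by simp
 qed (rule Suc.prems)
 finally show ?case by simp
qed

definition conf :: "real => 'w => nat => 'a" where
 "conf t w = (\<lambda>i\<in>{..<N}. particle N Z t w i)"

lemma not_alive_iff: "\<not> alive N t z \<longleftrightarrow> (\<forall>j<N. t < snd z j)"
 by (auto simp: alive_def not_le)

lemma conf_eq: "conf t w = positions N t (fst (Z (LEAST n. \<not> alive N t (Z n w)) w))"
 by (simp add: conf_def particle_def not_alive_iff positions_def Let_def)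

lemma measurable_conf:
 assumes a: "a \<in> Y \<rightarrow>\<^sub>M half_line" and b: "b \<in> Y \<rightarrow>\<^sub>M M"
 shows "(%z. conf (a z) (b z)) \<in> Y \<rightarrow>\<^sub>M tuple_space N"
 unfolding conf_eq
proof (rule measurable_compose_countable[where f="%n z. positions N (a z) (fst (Z n (b z)))"])
 show "(%z. positions N (a z) (fst (Z n (b z)))) \<in> Y \<rightarrow>\<^sub>M tuple_space N" for n
  by (rule measurable_positions[OF a measurable_compose[OF measurable_compose[OF b Z_measurable, unfolded state_space_def] measurable_fst]])
 have "Measurable.pred Y (%z. \<not> alive N (a z) (Z n (b z)))" for n
  using measurable_alive[OF measurable_half_lineD[OF a] measurable_compose[OF b Z_measurable]] by measurable
 then show "(%z. LEAST n. \<not> alive N (a z) (Z n (b z))) \<in> Y \<rightarrow>\<^sub>M count_space UNIV"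
  by measurable
qed

text \<open>Exactly one term survives, namely the one whose index is the number of rings by time t;
  this is the \<open>LEAST\<close> in the definition of \<open>particle\<close>.\<close>

lemma sum_stages:
 assumes t: "0 <= t" and w: "\<exists>n. \<not> alive N t (Z n w)"
 shows "(\<Sum>n. indicator {w. \<forall>k<n. alive N t (Z k w)} w * final_value N t G (Z n w)) = G (conf t w)"
proof -
 define m where "m = (LEAST n. \<not> alive N t (Z n w))"
 have m: "\<not> alive N t (Z m w)" unfolding m_def using w by (rule LeastI_ex)
 have lt: "alive N t (Z k w)" if "k < m" for k using not_less_Least[OF that[unfolded m_def]] by simp
 have "(\<Sum>n. indicator {w. \<forall>k<n. alive N t (Z k w)} w * final_value N t G (Z n w)) =
  (\<Sum>n\<in>{m}. indicator {w. \<forall>k<n. alive N t (Z k w)} w * final_value N t G (Z n w))"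
 proof (rule suminf_finite)
  fix n assume "n \<notin> {m}"
  then consider "n < m" | "m < n" by (metis insertI1 linorder_neqE_nat)
  then show "indicator {w. \<forall>k<n. alive N t (Z k w)} w * final_value N t G (Z n w) = 0"
  proof cases
   case 1
   then have "alive N t (Z n w)" by (rule lt)
   then show ?thesis by (simp add: final_value_def)
  next
   case 2
   then have "w \<notin> {w. \<forall>k<n. alive N t (Z k w)}" using m by blast
   then show ?thesis by simp
  qed
 qed simp
 also have "... = indicator {w. \<forall>k<m. alive N t (Z k w)} w * final_value N t G (Z m w)"
  by (simp only: sum.insert finite.emptyI empty_iff not_False_eq_True sum.empty add_0_right)
 also have "indicator {w. \<forall>k<m. alive N t (Z k w)} w = (1::ennreal)" using lt by (intro indicator_simps(1)) blast
 also have "1 * final_value N t G (Z m w) = G (conf t w)" using m unfolding final_value_def conf_eq m_def[symmetric] by simp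
 finally show ?thesis .
qed

text \<open>The Poisson weights sum to 1, so the events of exactly n rings by t exhaust the
  probability space up to a null set.\<close>

lemma AE_finite_rings:
 assumes t: "0 <= t" shows "AE w in M. \<exists>n. \<not> alive N t (Z n w)"
proof -
 let ?l = "real N * Vinf"
 let ?g = "%n w. indicator {w. \<forall>k<n. alive N t (Z k w)} w * final_value N t (%_. 1) (Z n w)"
 have gm: "?g n \<in> borel_measurable M" for n by (rule stage_final_measurable[OF borel_measurable_const t])
 have "(\<integral>\<^sup>+w. (\<Sum>n. ?g n w) \<partial>M) = (\<Sum>n. \<integral>\<^sup>+w. ?g n w \<partial>M)"
  by (rule nn_integral_suminf[OF gm])
 also have "... = (\<Sum>n. ennreal (exp (- ?l * t) * ((?l * t) ^ n / fact n)))"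
  using stage_poisson[OF t] by (simp add: stage_def)
 also have "... = ennreal (exp (- ?l * t) * exp (?l * t))"
 proof (rule suminf_ennreal_eq)
  show "0 <= exp (- ?l * t) * ((?l * t) ^ n / fact n)" for n using t Vinf_pos by simp
  show "(%n. exp (- ?l * t) * ((?l * t) ^ n / fact n)) sums (exp (- ?l * t) * exp (?l * t))"
   using exp_converges[of "?l * t"] by (intro sums_mult) (simp add: divide_inverse mult.commute)
 qed
 also have "... = 1" by (simp add: exp_minus[symmetric] exp_add[symmetric])
 finally have one: "(\<integral>\<^sup>+w. (\<Sum>n. ?g n w) \<partial>M) = 1" .
 have "Measurable.pred M (%w. \<not> alive N t (Z n w))" for n
  using measurable_alive[OF borel_measurable_const[of t] Z_measurable] by measurable
 then have pr: "Measurable.pred M (%w. \<exists>n. \<not> alive N t (Z n w))" by measurable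
 then have ae: "{w \<in> space M. \<exists>n. \<not> alive N t (Z n w)} \<in> sets M" by (simp add: pred_def)
 have "(\<integral>\<^sup>+w. (\<Sum>n. ?g n w) \<partial>M) = (\<integral>\<^sup>+w. indicator {w \<in> space M. \<exists>n. \<not> alive N t (Z n w)} w \<partial>M)"
 proof (rule nn_integral_cong)
  fix w assume w: "w \<in> space M"
  show "(\<Sum>n. ?g n w) = indicator {w \<in> space M. \<exists>n. \<not> alive N t (Z n w)} w"
  proof (cases "\<exists>n. \<not> alive N t (Z n w)")
   case True
   then show ?thesis using sum_stages[OF t True, of "%_. 1"] w by simp
  next
   case False
   then show ?thesis by (simp add: final_value_def)
  qed
 qed
 then have "emeasure M {w \<in> space M. \<exists>n. \<not> alive N t (Z n w)} = 1" using one ae by simp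
 then show ?thesis using MP.AE_iff_emeasure_eq_1[OF pr] by blast
qed

lemma conf_nn_integral:
 assumes t: "0 <= t" and G: "G \<in> borel_measurable (tuple_space N)"
 shows "(\<integral>\<^sup>+w. G (conf t w) \<partial>M) = (\<Sum>n. stage n t (final_value N t G))"
proof -
 have "(\<integral>\<^sup>+w. G (conf t w) \<partial>M) = (\<integral>\<^sup>+w. (\<Sum>n. indicator {w. \<forall>k<n. alive N t (Z k w)} w * final_value N t G (Z n w)) \<partial>M)"
  by (rule nn_integral_cong_AE) (use AE_finite_rings[OF t] in eventually_elim, simp add: sum_stages[OF t])
 also have "... = (\<Sum>n. stage n t (final_value N t G))"
  unfolding stage_def by (rule nn_integral_suminf[OF stage_final_measurable[OF G t]])
 finally show ?thesis .
qed

text \<open>Sum \<open>stage_final_Suc\<close> over the number of rings and add the case without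
  rings. All terms are nonnegative, so sums and integrals may be exchanged freely.\<close>

theorem conf_integral_equation:
 assumes t: "0 <= t" and G: "G \<in> borel_measurable (tuple_space N)"
 shows "(\<integral>\<^sup>+w. G (conf t w) \<partial>M) = ennreal (exp (- real N * Vinf * t)) * (\<integral>\<^sup>+x. transition N 0 t G x \<partial>\<eta>N) +
  (\<integral>\<^sup>+r. indicator {0..t} r * (\<Sum>i<N. ennreal (Vinf * exp (- real N * Vinf * (t - r))) *
   (\<integral>\<^sup>+w. jump_mean N i r (transition N r t G) (conf r w) \<partial>M)) \<partial>lborel)"
proof -
 define J where "J = (%i r. jump_mean N i r (transition N r t G))"
 have J': "J i r = jump_mean N i r (transition N r t G)" for i r by (simp add: J_def)
 have Jm: "(%z. J i (a z) (b z)) \<in> borel_measurable Y" if a: "a \<in> Y \<rightarrow>\<^sub>M half_line" and b: "b \<in> Y \<rightarrow>\<^sub>M tuple_space N" and i: "i < N"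
  for i and Y :: "'q measure" and a b
  unfolding J_def
 proof (rule measurable_jump_mean[OF _ i a b], rule measurable_transition)
  show "(%z. G (snd z)) \<in> borel_measurable ((Y \<Otimes>\<^sub>M tuple_space N) \<Otimes>\<^sub>M tuple_space N)" by (rule measurable_compose[OF measurable_snd G])
  show "(%z. a (fst z)) \<in> Y \<Otimes>\<^sub>M tuple_space N \<rightarrow>\<^sub>M half_line" by (rule measurable_compose[OF measurable_fst a])
  show "(%z. t) \<in> Y \<Otimes>\<^sub>M tuple_space N \<rightarrow>\<^sub>M half_line" by (rule measurable_half_line_const[OF t])
  show "snd \<in> Y \<Otimes>\<^sub>M tuple_space N \<rightarrow>\<^sub>M tuple_space N" by (rule measurable_snd)
 qed
 have Jr: "J i r \<in> borel_measurable (tuple_space N)" if "i < N" "0 <= r" for i r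
  by (rule Jm[OF measurable_half_line_const[OF that(2)] measurable_ident_sets[OF refl] that(1)])
 have sm: "(%r. indicator {0..t} r * (\<Sum>i<N. ennreal (Vinf * exp (- real N * Vinf * (t - r))) * stage n r (final_value N r (J i r)))) \<in> borel_measurable borel" for n
 proof (rule borel_measurable_half_line_indicator)
  have id: "(%r. r) \<in> half_line \<rightarrow>\<^sub>M half_line" by (rule measurable_ident_sets[OF refl])
  have "(%r. stage n r (final_value N r (J i r))) \<in> borel_measurable half_line" if "i < N" for i
   by (rule measurable_stage[OF Jm[OF measurable_fst measurable_snd that] id])
  moreover have "(%r. ennreal (Vinf * exp (- real N * Vinf * (t - r)))) \<in> borel_measurable half_line"
   by (rule measurable_restrict_space1) simp
  ultimately show "(%r. \<Sum>i<N. ennreal (Vinf * exp (- real N * Vinf * (t - r))) * stage n r (final_value N r (J i r))) \<in> borel_measurable half_line"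
   by (intro borel_measurable_sum borel_measurable_times_ennreal) auto
 qed (use t in auto)
 have "(\<integral>\<^sup>+w. G (conf t w) \<partial>M) = (\<Sum>n. stage n t (final_value N t G))" by (rule conf_nn_integral[OF t G])
 also have "... = stage 0 t (final_value N t G) + (\<Sum>n. stage (Suc n) t (final_value N t G))"
  by (subst suminf_offset[where i=1]) auto
 also have "(\<Sum>n. stage (Suc n) t (final_value N t G)) = (\<integral>\<^sup>+r. (\<Sum>n. indicator {0..t} r * (\<Sum>i<N. ennreal (Vinf * exp (- real N * Vinf * (t - r))) * stage n r (final_value N r (J i r)))) \<partial>lborel)"
  unfolding stage_final_Suc[OF G t] J'[symmetric] by (rule nn_integral_suminf[symmetric]) (use sm in simp)
 also have "... = (\<integral>\<^sup>+r. indicator {0..t} r * (\<Sum>i<N. ennreal (Vinf * exp (- real N * Vinf * (t - r))) * (\<integral>\<^sup>+w. J i r (conf r w) \<partial>M)) \<partial>lborel)"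
 proof (rule nn_integral_cong)
  fix r
  show "(\<Sum>n. indicator {0..t} r * (\<Sum>i<N. ennreal (Vinf * exp (- real N * Vinf * (t - r))) * stage n r (final_value N r (J i r)))) =
   indicator {0..t} r * (\<Sum>i<N. ennreal (Vinf * exp (- real N * Vinf * (t - r))) * (\<integral>\<^sup>+w. J i r (conf r w) \<partial>M))"
  proof (cases "r \<in> {0..t}")
   case True
   then have r: "0 <= r" by simp
   have "(\<Sum>n. (\<Sum>i<N. ennreal (Vinf * exp (- real N * Vinf * (t - r))) * stage n r (final_value N r (J i r)))) =
    (\<Sum>i<N. ennreal (Vinf * exp (- real N * Vinf * (t - r))) * (\<integral>\<^sup>+w. J i r (conf r w) \<partial>M))"
    by (subst suminf_sum) (auto simp: conf_nn_integral[OF r Jr[OF _ r]] intro!: sum.cong)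
   then show ?thesis using True by simp
  qed simp
 qed
 finally show ?thesis unfolding stage_final_0[OF G t] J_def .
qed

end

section \<open>The integral equation for bounded real functions\<close>

text \<open>Pushing the kernel forward along y |-> (x, y) lets it carry the parameter, so that the
  integrand no longer depends on x.\<close>

lemma integral_measurable_subprob_algebra2:
 fixes f :: "'a => 'b => real"
 assumes f: "(%z. f (fst z) (snd z)) \<in> borel_measurable (M \<Otimes>\<^sub>M N)" and L: "L \<in> M \<rightarrow>\<^sub>M subprob_algebra N"
 shows "(%x. integral\<^sup>L (L x) (f x)) \<in> borel_measurable M"
proof -
 have "(%x. distr (L x) (M \<Otimes>\<^sub>M N) (%y. (x, y))) \<in> M \<rightarrow>\<^sub>M subprob_algebra (M \<Otimes>\<^sub>M N)"
  by (rule measurable_distr2[OF _ L]) (simp add: measurable_ident_sets case_prod_beta')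
 from measurable_compose[OF this integral_measurable_subprob_algebra[OF f]]
 have "(%x. integral\<^sup>L (distr (L x) (M \<Otimes>\<^sub>M N) (%y. (x, y))) (%z. f (fst z) (snd z))) \<in> borel_measurable M" .
 then show ?thesis
 proof (rule measurable_cong[THEN iffD1, rotated])
  fix x assume x: "x \<in> space M"
  have LN: "sets (L x) = sets N" using measurable_space[OF L x] by (simp add: space_subprob_algebra)
  have "(%y. (x, y)) \<in> L x \<rightarrow>\<^sub>M M \<Otimes>\<^sub>M N"
   unfolding measurable_cong_sets[OF LN refl] by (rule measurable_Pair1'[OF x])
  from integral_distr[OF this f]
  show "integral\<^sup>L (distr (L x) (M \<Otimes>\<^sub>M N) (%y. (x, y))) (%z. f (fst z) (snd z)) = integral\<^sup>L (L x) (f x)" by simp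
 qed
qed

abbreviation bm :: "nat => ((nat => 'a::metric_space) => real) set" where
 "bm q \<equiv> bounded_measurable (tuple_space q)"

lemma bounded_measurableI:
 assumes "F \<in> borel_measurable S" "\<And>x. x \<in> space S ==> \<bar>F x\<bar> <= B"
 shows "F \<in> bounded_measurable S"
 using assms by (auto simp: bounded_measurable_def bounded_iff)

lemma bounded_measurableD:
 assumes "F \<in> bounded_measurable S"
 shows "F \<in> borel_measurable S" "\<exists>B\<ge>0. \<forall>x\<in>space S. \<bar>F x\<bar> <= B"
proof -
 show "F \<in> borel_measurable S" using assms by (simp add: bounded_measurable_def)
 obtain B where "\<forall>x\<in>space S. \<bar>F x\<bar> <= B" using assms by (auto simp: bounded_measurable_def bounded_iff)
 then show "\<exists>B\<ge>0. \<forall>x\<in>space S. \<bar>F x\<bar> <= B" by (intro exI[of _ "max 0 B"]) (auto simp: le_max_iff_disj)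
qed

lemma borel_measurable_half_line_indicator_real:
 fixes F :: "real => real"
 assumes F: "F \<in> borel_measurable half_line" and s: "A \<in> sets borel" "A \<subseteq> {0..}"
 shows "(%r. indicator A r * F r) \<in> borel_measurable borel"
proof -
 have "(%r. indicator {0..} r * F r) \<in> borel_measurable borel"
  using F by (subst (asm) borel_measurable_restrict_space_iff) auto
 then have "(%r. indicator A r * (indicator {0..} r * F r)) \<in> borel_measurable borel"
  using s(1) by measurable
 also have "(%r. indicator A r * (indicator {0..} r * F r)) = (%r. indicator A r * F r)"
  using s(2) by (auto simp: fun_eq_iff indicator_def)
 finally show ?thesis .
qed

lemma integrable_half_line_Icc:
 fixes F :: "real => real"
 assumes F: "F \<in> borel_measurable half_line" and B: "\<And>r. 0 <= r ==> r <= t ==> \<bar>F r\<bar> <= B"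
 shows "integrable lborel (%r. indicator {0..t} r * F r)"
proof -
 have m: "(%r. indicator {0..t} r * F r) \<in> borel_measurable lborel"
  using borel_measurable_half_line_indicator_real[OF F, of "{0..t}"] by simp
 have "integrable lborel (%r. indicator {0..t} r *\<^sub>R (indicator {0..t} r * F r))"
  by (rule integrableI_bounded_set_indicator[OF _ m, of _ B]) (use B in \<open>auto simp: indicator_def emeasure_lborel_Icc_eq\<close>)
 also have "(%r. indicator {0..t} r *\<^sub>R (indicator {0..t} r * F r)) = (%r. indicator {0..t} r * F r)"
  by (auto simp: fun_eq_iff indicator_def)
 finally show ?thesis .
qed

lemma (in prob_space) integrable_bounded:
 fixes f :: "'a => real"
 assumes "f \<in> borel_measurable M" "\<And>x. x \<in> space M ==> \<bar>f x\<bar> <= B"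
 shows "integrable M f"
 using assms by (intro integrable_const_bound[of _ B] AE_I2) auto

lemma (in prob_space) integral_abs_le:
 fixes f :: "'a => real"
 assumes "f \<in> borel_measurable M" "\<And>x. x \<in> space M ==> \<bar>f x\<bar> <= B"
 shows "\<bar>integral\<^sup>L M f\<bar> <= B"
proof -
 have "\<bar>integral\<^sup>L M f\<bar> <= (\<integral>x. \<bar>f x\<bar> \<partial>M)" by (rule integral_abs_bound)
 also have "... <= (\<integral>x. B \<partial>M)"
  using assms by (intro integral_mono integrable_abs integrable_bounded[of f B]) auto
 finally show ?thesis by (simp add: prob_space)
qed

lemma positions_in_space: "positions N r \<omega> \<in> space (tuple_space N)"
 by (auto simp: positions_def space_PiM)

context feynman_kac_model
begin

definition vel :: "real => 'a => real" where "vel r y = V r y / Vinf"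

lemma vel_bounds: "0 <= r ==> 0 <= vel r y" "0 <= r ==> vel r y <= 1"
 using V_bounds[of r y] Vinf_pos by (auto simp: vel_def)

lemma measurable_vel:
 assumes "f \<in> M \<rightarrow>\<^sub>M half_line" "g \<in> M \<rightarrow>\<^sub>M borel" shows "(%z. vel (f z) (g z)) \<in> borel_measurable M"
 unfolding vel_def by (intro borel_measurable_divide measurable_V assms borel_measurable_const)

text \<open>Real-valued twins of \<open>transition\<close> and \<open>jump_mean\<close>. The
  nonnegative versions served the limit exchanges; from here on signed test functions and linearity
  are needed.\<close>

definition rtrans :: "nat => real => real => ((nat => 'a) => real) => (nat => 'a) => real" where
 "rtrans q r t F x = (\<integral>\<omega>. F (positions q t \<omega>) \<partial>path_law q r x)"

definition rjump :: "nat => nat => real => ((nat => 'a) => real) => (nat => 'a) => real" where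
 "rjump N i r h y = (\<Sum>j<N. 1 / real N * (vel r (y i) * h (y(i := y j)) + (1 - vel r (y i)) * h y))"

lemma measurable_rtrans:
 assumes G: "(%z. G (fst z) (snd z)) \<in> borel_measurable (M \<Otimes>\<^sub>M tuple_space N)"
  and a: "a \<in> M \<rightarrow>\<^sub>M half_line" and d: "d \<in> M \<rightarrow>\<^sub>M half_line" and b: "b \<in> M \<rightarrow>\<^sub>M tuple_space N"
 shows "(%z. rtrans N (a z) (d z) (G z) (b z)) \<in> borel_measurable M"
 unfolding rtrans_def
proof (rule integral_measurable_subprob_algebra2[where N="multipath N"])
 have "(%z. (fst z, positions N (d (fst z)) (snd z))) \<in> M \<Otimes>\<^sub>M multipath N \<rightarrow>\<^sub>M M \<Otimes>\<^sub>M tuple_space N"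
  by (intro measurable_Pair measurable_fst measurable_positions measurable_compose[OF measurable_fst d] measurable_snd)
 from measurable_compose[OF this G] show "(%z. G (fst z) (positions N (d (fst z)) (snd z))) \<in> borel_measurable (M \<Otimes>\<^sub>M multipath N)" by simp
 show "(%z. path_law N (a z) (b z)) \<in> M \<rightarrow>\<^sub>M subprob_algebra (multipath N)"
  by (intro measurable_prob_algebraD measurable_path_law a b)
qed

lemma rtrans_integrand:
 assumes F: "F \<in> borel_measurable (tuple_space q)" and r: "0 <= r" "0 <= t"
 shows "(%\<omega>. F (positions q t \<omega>)) \<in> borel_measurable (path_law q r x)"
 using measurable_compose[OF measurable_positions[OF measurable_half_line_const[OF r(2)] measurable_ident_sets[OF refl]] F]
 by (simp only: measurable_cong_sets[OF path_law_sets[OF r(1)] refl])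

lemma rtrans_bound:
 assumes F: "F \<in> borel_measurable (tuple_space q)" and B: "\<And>x. x \<in> space (tuple_space q) ==> \<bar>F x\<bar> <= B" and r: "0 <= r" "0 <= t"
 shows "\<bar>rtrans q r t F x\<bar> <= B"
 unfolding rtrans_def
 by (rule prob_space.integral_abs_le[OF path_law_prob[OF r(1)] rtrans_integrand[OF F r]]) (rule B[OF positions_in_space])

lemma rtrans_integrable:
 assumes F: "F \<in> bm q" and r: "0 <= r" "0 <= t"
 shows "integrable (path_law q r x) (%\<omega>. F (positions q t \<omega>))"
proof -
 obtain B where "\<forall>x\<in>space (tuple_space q). \<bar>F x\<bar> <= B" using bounded_measurableD(2)[OF F] by blast
 then show ?thesis
  by (intro prob_space.integrable_bounded[OF path_law_prob[OF r(1)] rtrans_integrand[OF bounded_measurableD(1)[OF F] r], where B=B])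
    (auto simp: positions_in_space)
qed

lemma rtrans_bm:
 assumes F: "F \<in> bm q" and r: "0 <= r" "0 <= t"
 shows "rtrans q r t F \<in> bm q"
proof -
 obtain B where B: "\<And>x. x \<in> space (tuple_space q) ==> \<bar>F x\<bar> <= B" using bounded_measurableD(2)[OF F] by blast
 note Fm = bounded_measurableD(1)[OF F]
 have "rtrans q r t F \<in> borel_measurable (tuple_space q)"
  using measurable_rtrans[OF measurable_compose[OF measurable_snd Fm] measurable_half_line_const[OF r(1)] measurable_half_line_const[OF r(2)] measurable_ident_sets[OF refl]]
  by simp
 then show ?thesis by (rule bounded_measurableI) (rule rtrans_bound[OF Fm B r])
qed

lemma ennreal_rtrans:
 assumes F: "F \<in> bm q" and F0: "\<And>x. x \<in> space (tuple_space q) ==> 0 <= F x" and r: "0 <= r" "0 <= t"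
 shows "transition q r t (%x. ennreal (F x)) x = ennreal (rtrans q r t F x)"
 unfolding transition_def rtrans_def
 by (rule nn_integral_eq_integral[OF rtrans_integrable[OF F r]]) (intro AE_I2 F0 positions_in_space)

lemma rtrans_nonneg:
 assumes "\<And>x. x \<in> space (tuple_space q) ==> 0 <= F x" shows "0 <= rtrans q r t F x"
 unfolding rtrans_def by (intro integral_nonneg_AE AE_I2 assms positions_in_space)

lemma tuple_upd: "y \<in> space (tuple_space N) ==> i < N ==> y(i := a) \<in> space (tuple_space N)"
 by (auto simp: space_PiM PiE_iff extensional_def)

lemma ennreal_rjump:
 assumes h: "\<And>y. y \<in> space (tuple_space N) ==> 0 <= h y" and y: "y \<in> space (tuple_space N)" and i: "i < N" and r: "0 <= r"
 shows "jump_mean N i r (%y. ennreal (h y)) y = ennreal (rjump N i r h y)"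
proof -
 have "jump_mean N i r (%y. ennreal (h y)) y = (\<Sum>j<N. ennreal (1 / real N * (vel r (y i) * h (y(i := y j)) + (1 - vel r (y i)) * h y)))"
  unfolding jump_mean_def accept_def reject_def vel_def[symmetric]
  using vel_bounds[OF r, of "y i"] h[OF y] h[OF tuple_upd[OF y i]]
  by (intro sum.cong refl) (simp add: ennreal_mult[symmetric] ennreal_plus[symmetric] del: ennreal_plus)
 also have "... = ennreal (rjump N i r h y)"
  unfolding rjump_def using vel_bounds[OF r, of "y i"] h[OF y] h[OF tuple_upd[OF y i]] by (intro sum_ennreal) auto
 finally show ?thesis .
qed

lemma measurable_rjump:
 assumes h: "(%z. h (fst z) (snd z)) \<in> borel_measurable (M \<Otimes>\<^sub>M tuple_space N)" and i: "i < N"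
  and a: "a \<in> M \<rightarrow>\<^sub>M half_line" and b: "b \<in> M \<rightarrow>\<^sub>M tuple_space N"
 shows "(%z. rjump N i (a z) (h z) (b z)) \<in> borel_measurable M"
proof -
 have comp: "(%z. h z (g z)) \<in> borel_measurable M" if "g \<in> M \<rightarrow>\<^sub>M tuple_space N" for g
  using measurable_compose[OF measurable_Pair[OF measurable_ident_sets[OF refl] that] h] by simp
 have bj: "(%z. b z j) \<in> borel_measurable M" if "j < N" for j by (rule measurable_component[OF that b])
 have "(%z. h z ((b z)(i := b z j))) \<in> borel_measurable M" if "j < N" for j
  using i that by (intro comp half_line_fun_upd b bj) auto
 moreover have "(%z. h z (b z)) \<in> borel_measurable M" by (rule comp[OF b])
 ultimately show ?thesis
  unfolding rjump_def using i
  by (intro borel_measurable_sum borel_measurable_times borel_measurable_add borel_measurable_diff measurable_vel bj a borel_measurable_const) auto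
qed

lemma rjump_bound:
 assumes h: "\<And>y. y \<in> space (tuple_space N) ==> \<bar>h y\<bar> <= B" and y: "y \<in> space (tuple_space N)" and i: "i < N" and r: "0 <= r"
 shows "\<bar>rjump N i r h y\<bar> <= B"
proof -
 have "\<bar>vel r (y i) * h (y(i := y j)) + (1 - vel r (y i)) * h y\<bar> <= vel r (y i) * B + (1 - vel r (y i)) * B" for j
 proof -
  have "\<bar>vel r (y i) * h (y(i := y j)) + (1 - vel r (y i)) * h y\<bar> <= vel r (y i) * \<bar>h (y(i := y j))\<bar> + (1 - vel r (y i)) * \<bar>h y\<bar>"
   using vel_bounds[OF r, of "y i"] by (intro order_trans[OF abs_triangle_ineq]) (simp add: abs_mult)
  also have "... <= vel r (y i) * B + (1 - vel r (y i)) * B"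
   using vel_bounds[OF r, of "y i"] h[OF y] h[OF tuple_upd[OF y i]] by (intro add_mono mult_left_mono) auto
  finally show ?thesis .
 qed
 then have *: "\<bar>vel r (y i) * h (y(i := y j)) + (1 - vel r (y i)) * h y\<bar> <= B" for j by (simp add: algebra_simps)
 have "\<bar>rjump N i r h y\<bar> <= (\<Sum>j<N. \<bar>1 / real N * (vel r (y i) * h (y(i := y j)) + (1 - vel r (y i)) * h y)\<bar>)"
  unfolding rjump_def by (rule sum_abs)
 also have "... <= (\<Sum>j<N. 1 / real N * B)"
  unfolding abs_mult using * by (intro sum_mono mult_mono) auto
 also have "... = B" using i by simp
 finally show ?thesis .
qed

lemma rjump_nonneg:
 assumes h: "\<And>y. y \<in> space (tuple_space N) ==> 0 <= h y" and y: "y \<in> space (tuple_space N)" and i: "i < N" and r: "0 <= r"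
 shows "0 <= rjump N i r h y"
 unfolding rjump_def using vel_bounds[OF r, of "y i"] h[OF y] h[OF tuple_upd[OF y i]]
 by (intro sum_nonneg mult_nonneg_nonneg add_nonneg_nonneg) auto

end

context particle_model
begin

definition mean_conf :: "real => ((nat => 'a) => real) => real" where
 "mean_conf t G = (\<integral>w. G (conf t w) \<partial>M)"

lemma conf_in_space: "conf t w \<in> space (tuple_space N)"
 by (auto simp: conf_def space_PiM)

lemma measurable_conf_const: "0 <= t ==> conf t \<in> M \<rightarrow>\<^sub>M tuple_space N"
 using measurable_conf[OF measurable_half_line_const measurable_ident_sets[OF refl]] by simp

lemma mean_conf_integrable:
 assumes G: "G \<in> bm N" and t: "0 <= t" shows "integrable M (%w. G (conf t w))"
proof -
 obtain B where "\<forall>x\<in>space (tuple_space N). \<bar>G x\<bar> <= B" using bounded_measurableD(2)[OF G] by blast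
 then show ?thesis
  using measurable_compose[OF measurable_conf_const[OF t] bounded_measurableD(1)[OF G]]
  by (intro MP.integrable_bounded[of _ B]) (auto simp: conf_in_space)
qed

lemma mean_conf_bound:
 assumes G: "G \<in> borel_measurable (tuple_space N)" and B: "\<And>x. x \<in> space (tuple_space N) ==> \<bar>G x\<bar> <= B" and t: "0 <= t"
 shows "\<bar>mean_conf t G\<bar> <= B"
 unfolding mean_conf_def
 by (rule MP.integral_abs_le[OF measurable_compose[OF measurable_conf_const[OF t] G] B[OF conf_in_space]])

lemma measurable_mean_conf:
 assumes G: "(%z. G (fst z) (snd z)) \<in> borel_measurable (Y \<Otimes>\<^sub>M tuple_space N)" and a: "a \<in> Y \<rightarrow>\<^sub>M half_line"
 shows "(%z. mean_conf (a z) (G z)) \<in> borel_measurable Y"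
 unfolding mean_conf_def
proof (rule MP.borel_measurable_lebesgue_integral)
 have "(%z. (fst z, conf (a (fst z)) (snd z))) \<in> Y \<Otimes>\<^sub>M M \<rightarrow>\<^sub>M Y \<Otimes>\<^sub>M tuple_space N"
  by (intro measurable_Pair measurable_fst measurable_conf measurable_compose[OF measurable_fst a] measurable_snd)
 from measurable_compose[OF this G]
 show "(%(x, y). G x (conf (a x) y)) \<in> borel_measurable (Y \<Otimes>\<^sub>M M)" by (simp add: case_prod_beta')
qed

lemma rjump_rtrans_bm:
 assumes G: "G \<in> bm N" and r: "0 <= r" "0 <= t" and i: "i < N"
 shows "rjump N i r (rtrans N r t G) \<in> bm N"
proof -
 note T = rtrans_bm[OF G r]
 obtain B where B: "\<And>x. x \<in> space (tuple_space N) ==> \<bar>rtrans N r t G x\<bar> <= B" using bounded_measurableD(2)[OF T] by blast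
 have "rjump N i r (rtrans N r t G) \<in> borel_measurable (tuple_space N)"
  using measurable_rjump[OF measurable_compose[OF measurable_snd bounded_measurableD(1)[OF T]] i measurable_half_line_const[OF r(1)] measurable_ident_sets[OF refl]]
  by simp
 then show ?thesis by (rule bounded_measurableI) (rule rjump_bound[OF B _ i r(1)])
qed

lemma measurable_mean_rjump:
 assumes G: "G \<in> bm N" and t: "0 <= t" and i: "i < N"
 shows "(%r. mean_conf r (rjump N i r (rtrans N r t G))) \<in> borel_measurable half_line"
proof -
 have "(%z. rtrans N (fst (fst z)) t G (snd z)) \<in> borel_measurable ((half_line \<Otimes>\<^sub>M tuple_space N) \<Otimes>\<^sub>M tuple_space N)"
  by (rule measurable_rtrans[OF measurable_compose[OF measurable_snd bounded_measurableD(1)[OF G]]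
    measurable_compose[OF measurable_fst measurable_fst] measurable_half_line_const[OF t] measurable_snd])
 from measurable_mean_conf[OF measurable_rjump[OF this i measurable_fst measurable_snd] measurable_ident_sets[OF refl]]
 show ?thesis .
qed

lemma ring_integrand_integrable:
 assumes G: "G \<in> bm N" and t: "0 <= t"
 shows "integrable lborel (%r. indicator {0..t} r * (\<Sum>i<N. Vinf * exp (- real N * Vinf * (t - r)) * mean_conf r (rjump N i r (rtrans N r t G))))"
proof -
 obtain B where B: "0 <= B" "\<And>x. x \<in> space (tuple_space N) ==> \<bar>G x\<bar> <= B" using bounded_measurableD(2)[OF G] by blast
 show ?thesis
 proof (rule integrable_half_line_Icc[where B="real N * (Vinf * B)"])
  show "(%r. \<Sum>i<N. Vinf * exp (- real N * Vinf * (t - r)) * mean_conf r (rjump N i r (rtrans N r t G))) \<in> borel_measurable half_line"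
  proof (intro borel_measurable_sum borel_measurable_times borel_measurable_const)
   show "(%r. exp (- real N * Vinf * (t - r))) \<in> borel_measurable half_line" by (rule measurable_restrict_space1) simp
  qed (use measurable_mean_rjump[OF G t] in auto)
  fix r assume r: "0 <= r" "r <= t"
  have "\<bar>Vinf * exp (- real N * Vinf * (t - r)) * mean_conf r (rjump N i r (rtrans N r t G))\<bar> <= Vinf * B" if i: "i < N" for i
  proof -
   have "\<bar>mean_conf r (rjump N i r (rtrans N r t G))\<bar> <= B"
    by (rule mean_conf_bound[OF bounded_measurableD(1)[OF rjump_rtrans_bm[OF G r(1) t i]] _ r(1)])
      (rule rjump_bound[OF rtrans_bound[OF bounded_measurableD(1)[OF G] B(2) r(1) t] _ i r(1)])
   moreover have "exp (- real N * Vinf * (t - r)) <= 1" using r Vinf_pos by simp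
   ultimately have "exp (- real N * Vinf * (t - r)) * \<bar>mean_conf r (rjump N i r (rtrans N r t G))\<bar> <= 1 * B"
    by (intro mult_mono) auto
   then show ?thesis using Vinf_pos by (simp add: abs_mult)
  qed
  then have "(\<Sum>i<N. \<bar>Vinf * exp (- real N * Vinf * (t - r)) * mean_conf r (rjump N i r (rtrans N r t G))\<bar>) <= (\<Sum>i<N. Vinf * B)"
   by (intro sum_mono) simp
  also have "... = real N * (Vinf * B)" by simp
  finally show "\<bar>\<Sum>i<N. Vinf * exp (- real N * Vinf * (t - r)) * mean_conf r (rjump N i r (rtrans N r t G))\<bar> <= real N * (Vinf * B)"
   by (rule order_trans[OF sum_abs])
 qed
qed

lemma rtrans_initial_integrable:
 assumes G: "G \<in> bm N" and t: "0 <= t" shows "integrable \<eta>N (rtrans N 0 t G)"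
proof -
 obtain B where B: "0 <= B" "\<And>x. x \<in> space (tuple_space N) ==> \<bar>G x\<bar> <= B" using bounded_measurableD(2)[OF G] by blast
 show ?thesis
  using bounded_measurableD(1)[OF rtrans_bm[OF G order_refl t]]
  by (intro prob_space.integrable_bounded[OF \<eta>N_prob, of _ B] rtrans_bound[OF bounded_measurableD(1)[OF G] B(2) order_refl t])
    (simp_all only: measurable_cong_sets[OF \<eta>N_sets refl])
qed

lemma mean_conf_equation_nonneg:
 assumes t: "0 <= t" and G: "G \<in> bm N" and G0: "\<And>x. x \<in> space (tuple_space N) ==> 0 <= G x"
 shows "mean_conf t G = exp (- real N * Vinf * t) * (\<integral>x. rtrans N 0 t G x \<partial>\<eta>N) +
  (\<integral>r. indicator {0..t} r * (\<Sum>i<N. Vinf * exp (- real N * Vinf * (t - r)) * mean_conf r (rjump N i r (rtrans N r t G))) \<partial>lborel)"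
proof -
 let ?I = "%r. indicator {0..t} r * (\<Sum>i<N. Vinf * exp (- real N * Vinf * (t - r)) * mean_conf r (rjump N i r (rtrans N r t G)))"
 have jn: "0 <= mean_conf r (rjump N i r (rtrans N r t G))" if "i < N" "0 <= r" for i r
  unfolding mean_conf_def using that by (intro integral_nonneg_AE AE_I2 rjump_nonneg[OF rtrans_nonneg[OF G0] conf_in_space]) auto
 have I0: "0 <= ?I r" for r
  using jn Vinf_pos by (cases "r \<in> {0..t}") (auto intro!: sum_nonneg mult_nonneg_nonneg)
 have In: "0 <= (\<integral>r. ?I r \<partial>lborel)" by (intro integral_nonneg_AE AE_I2 I0)
 have tr: "transition N r t (%x. ennreal (G x)) = (%y. ennreal (rtrans N r t G y))" if "0 <= r" for r
  using ennreal_rtrans[OF G G0 that t] by auto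
 have P0: "0 <= (\<integral>x. rtrans N 0 t G x \<partial>\<eta>N)" by (intro integral_nonneg_AE AE_I2 rtrans_nonneg[OF G0])
 have "ennreal (mean_conf t G) = (\<integral>\<^sup>+w. ennreal (G (conf t w)) \<partial>M)"
  unfolding mean_conf_def by (rule nn_integral_eq_integral[symmetric, OF mean_conf_integrable[OF G t]]) (intro AE_I2 G0 conf_in_space)
 also have "... = ennreal (exp (- real N * Vinf * t)) * (\<integral>\<^sup>+x. transition N 0 t (%x. ennreal (G x)) x \<partial>\<eta>N) +
  (\<integral>\<^sup>+r. indicator {0..t} r * (\<Sum>i<N. ennreal (Vinf * exp (- real N * Vinf * (t - r))) *
   (\<integral>\<^sup>+w. jump_mean N i r (transition N r t (%x. ennreal (G x))) (conf r w) \<partial>M)) \<partial>lborel)"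
  by (rule conf_integral_equation[OF t]) (use bounded_measurableD(1)[OF G] in measurable)
 also have "(\<integral>\<^sup>+x. transition N 0 t (%x. ennreal (G x)) x \<partial>\<eta>N) = ennreal (\<integral>x. rtrans N 0 t G x \<partial>\<eta>N)"
  unfolding tr[OF order_refl]
  by (rule nn_integral_eq_integral[OF rtrans_initial_integrable[OF G t]]) (intro AE_I2 rtrans_nonneg[OF G0])
 also have "(\<integral>\<^sup>+r. indicator {0..t} r * (\<Sum>i<N. ennreal (Vinf * exp (- real N * Vinf * (t - r))) *
   (\<integral>\<^sup>+w. jump_mean N i r (transition N r t (%x. ennreal (G x))) (conf r w) \<partial>M)) \<partial>lborel) = (\<integral>\<^sup>+r. ennreal (?I r) \<partial>lborel)"
 proof (rule nn_integral_cong)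
  fix r
  show "indicator {0..t} r * (\<Sum>i<N. ennreal (Vinf * exp (- real N * Vinf * (t - r))) *
   (\<integral>\<^sup>+w. jump_mean N i r (transition N r t (%x. ennreal (G x))) (conf r w) \<partial>M)) = ennreal (?I r)"
  proof (cases "r \<in> {0..t}")
   case True
   then have r: "0 <= r" by simp
   have "(\<integral>\<^sup>+w. jump_mean N i r (transition N r t (%x. ennreal (G x))) (conf r w) \<partial>M) = ennreal (mean_conf r (rjump N i r (rtrans N r t G)))" if i: "i < N" for i
   proof -
    have "(\<integral>\<^sup>+w. jump_mean N i r (transition N r t (%x. ennreal (G x))) (conf r w) \<partial>M) = (\<integral>\<^sup>+w. ennreal (rjump N i r (rtrans N r t G) (conf r w)) \<partial>M)"
     by (simp add: tr[OF r] ennreal_rjump[OF rtrans_nonneg[OF G0] conf_in_space i r])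
    also have "... = ennreal (mean_conf r (rjump N i r (rtrans N r t G)))"
     unfolding mean_conf_def
     by (rule nn_integral_eq_integral[OF mean_conf_integrable[OF rjump_rtrans_bm[OF G r t i] r]])
       (intro AE_I2 rjump_nonneg[OF rtrans_nonneg[OF G0] conf_in_space i r])
    finally show ?thesis .
   qed
   then have "(\<Sum>i<N. ennreal (Vinf * exp (- real N * Vinf * (t - r))) * (\<integral>\<^sup>+w. jump_mean N i r (transition N r t (%x. ennreal (G x))) (conf r w) \<partial>M)) =
    (\<Sum>i<N. ennreal (Vinf * exp (- real N * Vinf * (t - r)) * mean_conf r (rjump N i r (rtrans N r t G))))"
    using jn[OF _ r] Vinf_pos by (intro sum.cong refl) (simp add: ennreal_mult)
   also have "... = ennreal (\<Sum>i<N. Vinf * exp (- real N * Vinf * (t - r)) * mean_conf r (rjump N i r (rtrans N r t G)))"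
    using jn[OF _ r] Vinf_pos by (intro sum_ennreal mult_nonneg_nonneg) auto
   finally show ?thesis using True by simp
  qed simp
 qed
 also have "... = ennreal (\<integral>r. ?I r \<partial>lborel)"
  by (rule nn_integral_eq_integral[OF ring_integrand_integrable[OF G t]]) (intro AE_I2 I0)
 also have "ennreal (exp (- real N * Vinf * t)) * ennreal (\<integral>x. rtrans N 0 t G x \<partial>\<eta>N) + ennreal (\<integral>r. ?I r \<partial>lborel) =
  ennreal (exp (- real N * Vinf * t) * (\<integral>x. rtrans N 0 t G x \<partial>\<eta>N) + (\<integral>r. ?I r \<partial>lborel))"
  by (simp only: ennreal_mult[OF exp_ge_zero P0] ennreal_plus[OF mult_nonneg_nonneg[OF exp_ge_zero P0] In])
 finally have "ennreal (mean_conf t G) = ennreal (exp (- real N * Vinf * t) * (\<integral>x. rtrans N 0 t G x \<partial>\<eta>N) + (\<integral>r. ?I r \<partial>lborel))" .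
 moreover have "0 <= mean_conf t G" unfolding mean_conf_def by (intro integral_nonneg_AE AE_I2 G0 conf_in_space)
 moreover have "0 <= exp (- real N * Vinf * t) * (\<integral>x. rtrans N 0 t G x \<partial>\<eta>N) + (\<integral>r. ?I r \<partial>lborel)"
  by (rule add_nonneg_nonneg[OF mult_nonneg_nonneg[OF exp_ge_zero P0] In])
 ultimately show ?thesis by (rule ennreal_inj[THEN iffD1, rotated 2])
qed

text \<open>Both G + B and the constant B are nonnegative when B bounds G. Every operation in the
  equation is additive, so the two instances of \<open>mean_conf_equation_nonneg\<close> may be
  subtracted.\<close>

lemma mean_conf_equation:
 assumes t: "0 <= t" and G: "G \<in> bm N"
 shows "mean_conf t G = exp (- real N * Vinf * t) * (\<integral>x. rtrans N 0 t G x \<partial>\<eta>N) +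
  (\<integral>r. indicator {0..t} r * (\<Sum>i<N. Vinf * exp (- real N * Vinf * (t - r)) * mean_conf r (rjump N i r (rtrans N r t G))) \<partial>lborel)"
proof -
 obtain B where B: "0 <= B" "\<And>x. x \<in> space (tuple_space N) ==> \<bar>G x\<bar> <= B" using bounded_measurableD(2)[OF G] by blast
 define e where "e = exp (- real N * Vinf * t)"
 define c where "c = (%r. Vinf * exp (- real N * Vinf * (t - r)))"
 have Gm: "G \<in> borel_measurable (tuple_space N)" by (rule bounded_measurableD(1)[OF G])
 have G': "(%x. G x + B) \<in> bm N"
 proof (rule bounded_measurableI[of _ _ "B + B"])
  show "\<bar>G x + B\<bar> <= B + B" if "x \<in> space (tuple_space N)" for x using B(1) B(2)[OF that] by linarith
 qed (use Gm in simp)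
 have cB: "(%_. B) \<in> bm N" by (rule bounded_measurableI[of _ _ "B"]) (use B in auto)
 interpret E: prob_space \<eta>N by (rule \<eta>N_prob)
 have mc: "mean_conf r (%x. F x + B) = mean_conf r F + B" if "F \<in> bm N" "0 <= r" for F r
  unfolding mean_conf_def using mean_conf_integrable[OF that] by (simp add: MP.prob_space)
 have mcB: "mean_conf r (%_. B) = B" for r unfolding mean_conf_def by (simp add: MP.prob_space)
 have rj: "rjump N i r (%y. h y + B) = (%y. rjump N i r h y + B)" for i r h
 proof
  fix y
  have "rjump N i r (%y. h y + B) y = (\<Sum>j<N. 1 / real N * (vel r (y i) * h (y(i := y j)) + (1 - vel r (y i)) * h y) + 1 / real N * B)"
   unfolding rjump_def by (intro sum.cong refl) (simp add: algebra_simps)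
  then show "rjump N i r (%y. h y + B) y = rjump N i r h y + B" using N by (simp add: sum.distrib rjump_def)
 qed
 have rjB: "rjump N i r (%y. B) = (%y. B)" for i r
  using N by (simp add: rjump_def fun_eq_iff algebra_simps)
 have tr: "rtrans N r t (%x. G x + B) = (%x. rtrans N r t G x + B)" "rtrans N r t (%_. B) = (%_. B)" if "0 <= r" for r
  using rtrans_integrable[OF G that t] prob_space.prob_space[OF path_law_prob[OF that]]
   prob_space.finite_measure[OF path_law_prob[OF that]]
  by (auto simp: rtrans_def fun_eq_iff finite_measure.integrable_const)
 note int1 = ring_integrand_integrable[OF G t] and int2 = ring_integrand_integrable[OF cB t]
 have eq1: "mean_conf t (%x. G x + B) = e * (\<integral>x. rtrans N 0 t (%x. G x + B) x \<partial>\<eta>N) +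
   (\<integral>r. indicator {0..t} r * (\<Sum>i<N. c r * mean_conf r (rjump N i r (rtrans N r t (%x. G x + B)))) \<partial>lborel)"
  unfolding e_def c_def by (rule mean_conf_equation_nonneg[OF t G']) (use B(2) in force)
 have eq2: "mean_conf t (%x. B) = e * (\<integral>x. rtrans N 0 t (%x. B) x \<partial>\<eta>N) +
   (\<integral>r. indicator {0..t} r * (\<Sum>i<N. c r * mean_conf r (rjump N i r (rtrans N r t (%x. B)))) \<partial>lborel)"
  unfolding e_def c_def by (rule mean_conf_equation_nonneg[OF t cB]) (rule B(1))
 have "(\<integral>r. indicator {0..t} r * (\<Sum>i<N. c r * mean_conf r (rjump N i r (rtrans N r t (%x. G x + B)))) \<partial>lborel) =
  (\<integral>r. indicator {0..t} r * (\<Sum>i<N. c r * mean_conf r (rjump N i r (rtrans N r t G))) +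
    indicator {0..t} r * (\<Sum>i<N. c r * mean_conf r (rjump N i r (rtrans N r t (%x. B)))) \<partial>lborel)"
 proof (rule Bochner_Integration.integral_cong[OF refl])
  fix r
  show "indicator {0..t} r * (\<Sum>i<N. c r * mean_conf r (rjump N i r (rtrans N r t (%x. G x + B)))) =
   indicator {0..t} r * (\<Sum>i<N. c r * mean_conf r (rjump N i r (rtrans N r t G))) +
    indicator {0..t} r * (\<Sum>i<N. c r * mean_conf r (rjump N i r (rtrans N r t (%x. B))))"
  proof (cases "r \<in> {0..t}")
   case True
   then have r: "0 <= r" by simp
   have "c r * mean_conf r (rjump N i r (rtrans N r t (%x. G x + B))) =
    c r * mean_conf r (rjump N i r (rtrans N r t G)) + c r * mean_conf r (rjump N i r (rtrans N r t (%x. B)))" if "i < N" for i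
    unfolding tr[OF r] rj rjB mcB mc[OF rjump_rtrans_bm[OF G r t that] r] by (simp add: distrib_left)
   then show ?thesis using True by (simp add: sum.distrib[symmetric])
  qed simp
 qed
 also have "... = (\<integral>r. indicator {0..t} r * (\<Sum>i<N. c r * mean_conf r (rjump N i r (rtrans N r t G))) \<partial>lborel) +
    (\<integral>r. indicator {0..t} r * (\<Sum>i<N. c r * mean_conf r (rjump N i r (rtrans N r t (%x. B)))) \<partial>lborel)"
  using int1 int2 unfolding c_def by (rule Bochner_Integration.integral_add)
 finally have I: "(\<integral>r. indicator {0..t} r * (\<Sum>i<N. c r * mean_conf r (rjump N i r (rtrans N r t (%x. G x + B)))) \<partial>lborel) = ..." .
 have "(\<integral>x. rtrans N 0 t (%x. G x + B) x \<partial>\<eta>N) = (\<integral>x. rtrans N 0 t G x \<partial>\<eta>N) + (\<integral>x. rtrans N 0 t (%x. B) x \<partial>\<eta>N)"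
  unfolding tr[OF order_refl] using rtrans_initial_integrable[OF G t] by (simp add: E.prob_space)
 then show ?thesis
  using eq1 eq2 unfolding I mc[OF G t] mcB c_def[symmetric] e_def[symmetric] by (simp add: distrib_left c_def)
qed

end

section \<open>Resummation of a linear Volterra equation\<close>

lemma integral_exp_Icc:
 fixes k :: real assumes k: "k \<noteq> 0" and ab: "a <= b"
 shows "(\<integral>r. indicator {a..b} r * exp (k * r) \<partial>lborel) = (exp (k * b) - exp (k * a)) / k"
proof -
 have "(\<integral>r. exp (k * r) * indicator {a..b} r \<partial>lborel) = exp (k * b) / k - exp (k * a) / k"
 proof (rule integral_FTC_Icc_nonneg[where F="%r. exp (k * r) / k"])
  fix r show "((%r. exp (k * r) / k) has_real_derivative exp (k * r)) (at r)"
   using k by (auto intro!: derivative_eq_intros)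
 qed (use ab in auto)
 then show ?thesis by (simp add: mult.commute diff_divide_distrib)
qed

lemma integrable_Icc_bounded:
 fixes F :: "real => real"
 assumes F: "(%r. indicator {a..b} r * F r) \<in> borel_measurable borel" and B: "\<And>r. a <= r ==> r <= b ==> \<bar>F r\<bar> <= B"
 shows "integrable lborel (%r. indicator {a..b} r * F r)"
proof -
 have "integrable lborel (%r. indicator {a..b} r *\<^sub>R (indicator {a..b} r * F r))"
  by (rule integrableI_bounded_set_indicator[where B=B]) (use B F in \<open>auto simp: indicator_def emeasure_lborel_Icc_eq\<close>)
 also have "(%r. indicator {a..b} r *\<^sub>R (indicator {a..b} r * F r)) = (%r. indicator {a..b} r * F r)"
  by (auto simp: fun_eq_iff indicator_def)
 finally show ?thesis .
qed

lemma integral_Icc_exp_bound: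
 fixes F :: "real => real"
 assumes F: "(%r. indicator {0..u} r * F r) \<in> borel_measurable borel" and u: "0 <= u" and k: "0 < k"
  and B: "\<And>r. 0 <= r ==> r <= u ==> \<bar>F r\<bar> <= B * exp (k * r)"
 shows "\<bar>\<integral>r. indicator {0..u} r * F r \<partial>lborel\<bar> <= B * ((exp (k * u) - 1) / k)"
proof -
 have B0: "0 <= B" using B[of 0] u by simp
 have int: "integrable lborel (%r. indicator {0..u} r * F r)"
 proof (rule integrable_Icc_bounded[OF F, of "B * exp (k * u)"])
  fix r assume r: "0 <= r" "r <= u"
  have "B * exp (k * r) <= B * exp (k * u)" using r k B0 by (intro mult_left_mono) auto
  then show "\<bar>F r\<bar> <= B * exp (k * u)" using B[OF r] by simp
 qed
 have int2: "integrable lborel (%r. indicator {0..u} r * exp (k * r))"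
 proof (rule integrable_Icc_bounded)
  show "\<bar>exp (k * r)\<bar> <= exp (k * u)" if "0 <= r" "r <= u" for r using that k by simp
 qed measurable
 have "\<bar>\<integral>r. indicator {0..u} r * F r \<partial>lborel\<bar> <= (\<integral>r. \<bar>indicator {0..u} r * F r\<bar> \<partial>lborel)" by (rule integral_abs_bound)
 also have "... <= (\<integral>r. B * (indicator {0..u} r * exp (k * r)) \<partial>lborel)"
  using int int2 B by (intro integral_mono integrable_abs integrable_mult_right) (auto simp: indicator_def)
 also have "... = B * ((exp (k * u) - exp (k * 0)) / k)"
  using k u integral_exp_Icc[of k 0 u] by simp
 finally show ?thesis by simp
qed

text \<open>Of the rings at total rate lam, those at rate lam - \<mu> merely reproduce g. Summing
  over any number of such idle rings leaves the equation with rate \<mu> and the genuine source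
  \<beta>. The proof verifies that the right-hand side solves the same equation and that bounded
  solutions are unique.\<close>

lemma volterra_resummation:
 fixes g \<beta> :: "real => real"
 assumes mu: "0 < \<mu>" "\<mu> < lam" and t: "0 <= t"
  and gm: "(%r. indicator {0..t} r * g r) \<in> borel_measurable borel" and gB: "\<And>r. 0 <= r ==> r <= t ==> \<bar>g r\<bar> <= Bg"
  and bm: "(%r. indicator {0..t} r * \<beta> r) \<in> borel_measurable borel" and bB: "\<And>r. 0 <= r ==> r <= t ==> \<bar>\<beta> r\<bar> <= Bb"
  and eq: "\<And>u. 0 <= u ==> u <= t ==> g u = exp (- lam * u) * g0 +
    (\<integral>r. indicator {0..u} r * (exp (- lam * (u - r)) * ((lam - \<mu>) * g r + \<beta> r)) \<partial>lborel)"
 shows "g t = exp (- \<mu> * t) * g0 + (\<integral>r. indicator {0..t} r * (exp (- \<mu> * (t - r)) * \<beta> r) \<partial>lborel)"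
proof -
 have um: "(%r. indicator {0..u} r * (f r * k r)) \<in> borel_measurable borel"
  if "u <= t" "(%r. indicator {0..t} r * k r) \<in> borel_measurable borel" "f \<in> borel_measurable borel" for u and f k :: "real => real"
 proof -
  have "(%r. indicator {0..u} r * (f r * (indicator {0..t} r * k r))) \<in> borel_measurable borel" using that(2,3) by measurable
  also have "(%r. indicator {0..u} r * (f r * (indicator {0..t} r * k r))) = (%r. indicator {0..u} r * (f r * k r))"
   using that(1) by (auto simp: fun_eq_iff indicator_def)
  finally show ?thesis .
 qed
 \<comment> \<open>Cutting \<beta> off outside {0..t} makes it measurable and bounded on the whole
   line.\<close>
 define b where "b = (%r. indicator {0..t} r * \<beta> r)"
 have b_m[measurable]: "b \<in> borel_measurable borel" using bm by (simp add: b_def)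
 have Bb0: "0 <= Bb" using bB[of 0] t by simp
 have b_B: "\<bar>b r\<bar> <= Bb" for r using bB[of r] Bb0 by (auto simp: b_def indicator_def)
 \<comment> \<open>The candidate solution, with the claimed formula at every time u.\<close>
 define h where "h = (%u. exp (- \<mu> * u) * g0 + (\<integral>s. indicator {0..u} s * (exp (- \<mu> * (u - s)) * b s) \<partial>lborel))"
 have hm[measurable]: "h \<in> borel_measurable borel"
 proof -
  have "(%z. indicator {z. 0 <= snd z \<and> snd z <= fst z} z * (exp (- \<mu> * (fst z - snd z)) * b (snd z))) \<in> borel_measurable (borel \<Otimes>\<^sub>M borel)"
   by measurable
  then have "(%(u, s). indicator {0..u} s * (exp (- \<mu> * (u - s)) * b s)) \<in> borel_measurable (borel \<Otimes>\<^sub>M lborel)"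
   by (simp add: case_prod_beta' indicator_def measurable_cong_sets[OF sets_pair_measure_cong[OF refl sets_lborel] refl] conj_commute)
  then have "(%u. \<integral>s. indicator {0..u} s * (exp (- \<mu> * (u - s)) * b s) \<partial>lborel) \<in> borel_measurable borel"
   by (rule lborel.borel_measurable_lebesgue_integral)
  then show ?thesis unfolding h_def by measurable
 qed
 have hint: "integrable lborel (%s. indicator {0..u} s * (exp (- k * (u - s)) * b s))" if "0 < k" for u k
 proof (rule integrable_Icc_bounded[of _ _ _ Bb])
  fix s assume "0 <= s" "s <= u"
  then have "exp (- k * (u - s)) <= 1" using that by simp
  then have "exp (- k * (u - s)) * \<bar>b s\<bar> <= 1 * Bb" using b_B[of s] by (intro mult_mono) auto
  then show "\<bar>exp (- k * (u - s)) * b s\<bar> <= Bb" by (simp add: abs_mult)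
 qed measurable
 have hB: "\<bar>h u\<bar> <= \<bar>g0\<bar> + Bb * t" if u: "0 <= u" "u <= t" for u
 proof -
  have "\<bar>\<integral>s. indicator {0..u} s * (exp (- \<mu> * (u - s)) * b s) \<partial>lborel\<bar> <= (\<integral>s. \<bar>indicator {0..u} s * (exp (- \<mu> * (u - s)) * b s)\<bar> \<partial>lborel)"
   by (rule integral_abs_bound)
  also have "... <= (\<integral>s. Bb * indicator {0..u} s \<partial>lborel)"
  proof (rule integral_mono)
   show "integrable lborel (%s. Bb * indicator {0..u} s)" by (simp add: emeasure_lborel_Icc_eq)
   fix s
   have "exp (- \<mu> * (u - s)) * \<bar>b s\<bar> <= 1 * Bb" if "s <= u" using that b_B[of s] mu by (intro mult_mono) auto
   then show "\<bar>indicator {0..u} s * (exp (- \<mu> * (u - s)) * b s)\<bar> <= Bb * indicator {0..u} s" by (auto simp: abs_mult indicator_def)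
  qed (intro integrable_abs hint mu)
  also have "... = Bb * u" using u by simp
  also have "... <= Bb * t" using u Bb0 by (intro mult_left_mono)
  finally have 1: "\<bar>\<integral>s. indicator {0..u} s * (exp (- \<mu> * (u - s)) * b s) \<partial>lborel\<bar> <= Bb * t" .
  have "\<bar>exp (- \<mu> * u) * g0\<bar> <= 1 * \<bar>g0\<bar>" unfolding abs_mult using u mu by (intro mult_right_mono) auto
  then show ?thesis unfolding h_def using 1 by (intro order_trans[OF abs_triangle_ineq]) auto
 qed
 have heq: "h u = exp (- lam * u) * g0 + (\<integral>r. indicator {0..u} r * (exp (- lam * (u - r)) * ((lam - \<mu>) * h r + b r)) \<partial>lborel)"
  if u: "0 <= u" "u <= t" for u
 proof -
  define c where "c = exp (- lam * u) * (lam - \<mu>)"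
  have 1: "(\<integral>r. indicator {0..u} r * (exp (- lam * (u - r)) * ((lam - \<mu>) * (exp (- \<mu> * r) * g0))) \<partial>lborel) = g0 * (exp (- \<mu> * u) - exp (- lam * u))"
  proof -
   have "(\<integral>r. indicator {0..u} r * (exp (- lam * (u - r)) * ((lam - \<mu>) * (exp (- \<mu> * r) * g0))) \<partial>lborel) =
    (\<integral>r. (c * g0) * (indicator {0..u} r * exp ((lam - \<mu>) * r)) \<partial>lborel)"
    by (rule Bochner_Integration.integral_cong) (simp_all add: c_def exp_diff exp_minus exp_add algebra_simps divide_inverse)
   also have "... = (c * g0) * ((exp ((lam - \<mu>) * u) - exp ((lam - \<mu>) * 0)) / (lam - \<mu>))"
    using integral_exp_Icc[of "lam - \<mu>" 0 u] u mu by simp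
   also have "... = g0 * (exp (- lam * u) * exp ((lam - \<mu>) * u) - exp (- lam * u))"
    using mu by (simp add: c_def field_simps)
   also have "exp (- lam * u) * exp ((lam - \<mu>) * u) = exp (- \<mu> * u)"
    by (simp add: exp_add[symmetric] algebra_simps)
   finally show ?thesis .
  qed
  \<comment> \<open>The double integrand on the triangle 0 <= s <= r <= u. Multiplying out the
    exponentials separates r from s, so after Fubini the r-integral is explicit and equals
    exp(-\<mu> (u - s)) - exp(-lam (u - s)).\<close>
  define f where "f = (%r s. indicator {0..u} r * (indicator {0..r} s * (c * exp ((lam - \<mu>) * r) * (exp (\<mu> * s) * b s))))"
  have fm: "(%z. f (fst z) (snd z)) \<in> borel_measurable (lborel \<Otimes>\<^sub>M lborel)"
  proof -
   have "(%z. indicator {z. 0 <= fst z \<and> fst z <= u} z * (indicator {z. 0 <= snd z \<and> snd z <= fst z} z * (c * exp ((lam - \<mu>) * fst z) * (exp (\<mu> * snd z) * b (snd z))))) \<in> borel_measurable (borel \<Otimes>\<^sub>M borel)"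
    by measurable
   then show ?thesis unfolding f_def
    by (simp add: indicator_def measurable_cong_sets[OF sets_pair_measure_cong[OF sets_lborel sets_lborel] refl])
  qed
  define C where "C = \<bar>c\<bar> * exp ((lam - \<mu>) * u) * (exp (\<mu> * u) * Bb)"
  have fB: "\<bar>f r s\<bar> <= C * (indicator {0..u} r * indicator {0..u} s)" for r s
  proof (cases "0 <= r \<and> r <= u \<and> 0 <= s \<and> s <= r")
   case True
   then have "exp ((lam - \<mu>) * r) <= exp ((lam - \<mu>) * u)" "exp (\<mu> * s) <= exp (\<mu> * u)" using mu by auto
   then have "\<bar>c\<bar> * exp ((lam - \<mu>) * r) * (exp (\<mu> * s) * \<bar>b s\<bar>) <= C"
    unfolding C_def using b_B[of s] by (intro mult_mono) auto
   then show ?thesis using True by (simp add: f_def abs_mult)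
  next
   case False
   then have "f r s = 0" by (auto simp: f_def indicator_def)
   moreover have "0 <= C" using Bb0 by (simp add: C_def)
   ultimately show ?thesis by (simp add: indicator_def)
  qed
  have fint: "integrable (lborel \<Otimes>\<^sub>M lborel) (%(r, s). f r s)"
  proof (rule Bochner_Integration.integrable_bound[where f="%z. C * indicator ({0..u} \<times> {0..u}) z"])
   have "emeasure (lborel \<Otimes>\<^sub>M lborel) ({0..u} \<times> {0..u}) = emeasure lborel {0..u} * emeasure lborel {0..u}"
    by (rule lborel.emeasure_pair_measure_Times) auto
   then have "emeasure (lborel \<Otimes>\<^sub>M lborel) ({0..u} \<times> {0..u}) < \<infinity>" using u by (simp add: ennreal_mult_less_top)
   then show "integrable (lborel \<Otimes>\<^sub>M lborel) (%z. C * indicator ({0..u} \<times> {0..u}) z)"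
    by (intro integrable_mult_right integrable_real_indicator) auto
   show "(%(r, s). f r s) \<in> borel_measurable (lborel \<Otimes>\<^sub>M lborel)" using fm by (simp add: case_prod_beta')
   show "AE z in lborel \<Otimes>\<^sub>M lborel. norm (case z of (r, s) => f r s) <= norm (C * indicator ({0..u} \<times> {0..u}) z)"
    using fB Bb0 by (intro AE_I2) (auto simp: indicator_times C_def abs_mult split: prod.split)
  qed
  have 2: "(\<integral>r. indicator {0..u} r * (exp (- lam * (u - r)) * ((lam - \<mu>) * (\<integral>s. indicator {0..r} s * (exp (- \<mu> * (r - s)) * b s) \<partial>lborel))) \<partial>lborel)
   = (\<integral>s. indicator {0..u} s * (exp (- \<mu> * (u - s)) * b s) - indicator {0..u} s * (exp (- lam * (u - s)) * b s) \<partial>lborel)"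
  proof -
   have "(\<integral>r. indicator {0..u} r * (exp (- lam * (u - r)) * ((lam - \<mu>) * (\<integral>s. indicator {0..r} s * (exp (- \<mu> * (r - s)) * b s) \<partial>lborel))) \<partial>lborel)
    = (\<integral>r. (\<integral>s. f r s \<partial>lborel) \<partial>lborel)"
   proof (rule Bochner_Integration.integral_cong[OF refl])
    fix r
    have "(\<integral>s. f r s \<partial>lborel) = (\<integral>s. (indicator {0..u} r * (exp (- lam * (u - r)) * (lam - \<mu>))) * (indicator {0..r} s * (exp (- \<mu> * (r - s)) * b s)) \<partial>lborel)"
     by (rule Bochner_Integration.integral_cong) (simp_all add: f_def c_def exp_diff exp_minus exp_add algebra_simps divide_inverse)
    also have "... = (indicator {0..u} r * (exp (- lam * (u - r)) * (lam - \<mu>))) * (\<integral>s. indicator {0..r} s * (exp (- \<mu> * (r - s)) * b s) \<partial>lborel)"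
     by (rule integral_mult_right_zero)
    finally show "indicator {0..u} r * (exp (- lam * (u - r)) * ((lam - \<mu>) * (\<integral>s. indicator {0..r} s * (exp (- \<mu> * (r - s)) * b s) \<partial>lborel))) = (\<integral>s. f r s \<partial>lborel)"
     by (simp only: mult.assoc)
   qed
   also have "... = (\<integral>s. (\<integral>r. f r s \<partial>lborel) \<partial>lborel)"
    by (rule lborel_pair.Fubini_integral[symmetric]) (use fint in simp)
   also have "... = (\<integral>s. indicator {0..u} s * (exp (- \<mu> * (u - s)) * b s) - indicator {0..u} s * (exp (- lam * (u - s)) * b s) \<partial>lborel)"
   proof (rule Bochner_Integration.integral_cong[OF refl])
    fix s
    show "(\<integral>r. f r s \<partial>lborel) = indicator {0..u} s * (exp (- \<mu> * (u - s)) * b s) - indicator {0..u} s * (exp (- lam * (u - s)) * b s)"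
    proof (cases "0 <= s \<and> s <= u")
     case True
     have "(\<integral>r. f r s \<partial>lborel) = (\<integral>r. (c * (exp (\<mu> * s) * b s)) * (indicator {s..u} r * exp ((lam - \<mu>) * r)) \<partial>lborel)"
      using True by (intro Bochner_Integration.integral_cong) (auto simp: f_def indicator_def)
     also have "... = (c * (exp (\<mu> * s) * b s)) * ((exp ((lam - \<mu>) * u) - exp ((lam - \<mu>) * s)) / (lam - \<mu>))"
      using integral_exp_Icc[of "lam - \<mu>" s u] True mu by simp
     also have "... = exp (- lam * u) * exp (\<mu> * s) * exp ((lam - \<mu>) * u) * b s - exp (- lam * u) * exp (\<mu> * s) * exp ((lam - \<mu>) * s) * b s"
      using mu by (simp add: c_def field_simps)
     also have "exp (- lam * u) * exp (\<mu> * s) * exp ((lam - \<mu>) * u) = exp (- \<mu> * (u - s))"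
      by (simp add: exp_add[symmetric] algebra_simps)
     also have "exp (- lam * u) * exp (\<mu> * s) * exp ((lam - \<mu>) * s) = exp (- lam * (u - s))"
      by (simp add: exp_add[symmetric] algebra_simps)
     finally show ?thesis using True by simp
    next
     case False
     then have "f r s = 0" for r by (auto simp: f_def indicator_def)
     then show ?thesis using False by simp
    qed
   qed
   finally show ?thesis .
  qed
  define X1 where "X1 = (%r. indicator {0..u} r * (exp (- lam * (u - r)) * ((lam - \<mu>) * (exp (- \<mu> * r) * g0))))"
  define X2 where "X2 = (%r. indicator {0..u} r * (exp (- lam * (u - r)) * ((lam - \<mu>) * (\<integral>s. indicator {0..r} s * (exp (- \<mu> * (r - s)) * b s) \<partial>lborel))))"
  define X3 where "X3 = (%r. indicator {0..u} r * (exp (- lam * (u - r)) * b r))"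
  have i3: "integrable lborel X3" unfolding X3_def using hint[of lam] mu by simp
  have ih: "integrable lborel (%r. indicator {0..u} r * (exp (- lam * (u - r)) * ((lam - \<mu>) * h r)))"
  proof (rule integrable_Icc_bounded[of _ _ _ "(lam - \<mu>) * (\<bar>g0\<bar> + Bb * t)"])
   fix r assume r: "0 <= r" "r <= u"
   then have e: "exp (- lam * (u - r)) <= 1" using mu by simp
   have "exp (- lam * (u - r)) * ((lam - \<mu>) * \<bar>h r\<bar>) <= 1 * ((lam - \<mu>) * (\<bar>g0\<bar> + Bb * t))"
    using e hB[of r] r u mu by (intro mult_mono) auto
   then show "\<bar>exp (- lam * (u - r)) * ((lam - \<mu>) * h r)\<bar> <= (lam - \<mu>) * (\<bar>g0\<bar> + Bb * t)" using mu by (simp add: abs_mult)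
  qed measurable
  have i1: "integrable lborel X1" unfolding X1_def
  proof (rule integrable_Icc_bounded[of _ _ _ "(lam - \<mu>) * \<bar>g0\<bar>"])
   fix r assume r: "0 <= r" "r <= u"
   have "exp (- lam * (u - r)) * ((lam - \<mu>) * (exp (- \<mu> * r) * \<bar>g0\<bar>)) <= 1 * ((lam - \<mu>) * (1 * \<bar>g0\<bar>))"
    using r mu by (intro mult_mono) auto
   then show "\<bar>exp (- lam * (u - r)) * ((lam - \<mu>) * (exp (- \<mu> * r) * g0))\<bar> <= (lam - \<mu>) * \<bar>g0\<bar>" using mu by (simp add: abs_mult)
  qed measurable
  have h12: "indicator {0..u} r * (exp (- lam * (u - r)) * ((lam - \<mu>) * h r)) = X1 r + X2 r" for r
   by (simp add: X1_def X2_def h_def algebra_simps)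
  have i2: "integrable lborel X2"
  proof -
   have "integrable lborel (%r. (X1 r + X2 r) - X1 r)" using ih i1 unfolding h12 by (rule Bochner_Integration.integrable_diff)
   then show ?thesis by simp
  qed
  have "(\<integral>r. indicator {0..u} r * (exp (- lam * (u - r)) * ((lam - \<mu>) * h r + b r)) \<partial>lborel) = (\<integral>r. (X1 r + X2 r) + X3 r \<partial>lborel)"
   unfolding h12[symmetric] X3_def by (intro Bochner_Integration.integral_cong) (simp_all add: algebra_simps)
  also have "... = (\<integral>r. X1 r \<partial>lborel) + (\<integral>r. X2 r \<partial>lborel) + (\<integral>r. X3 r \<partial>lborel)"
   using i1 i2 i3 by simp
  also have "(\<integral>r. X2 r \<partial>lborel) = (\<integral>s. indicator {0..u} s * (exp (- \<mu> * (u - s)) * b s) \<partial>lborel) - (\<integral>r. X3 r \<partial>lborel)"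
   unfolding X2_def 2 X3_def using hint[of \<mu> u] hint[of lam u] mu by (intro Bochner_Integration.integral_diff) auto
  finally show ?thesis unfolding X1_def 1 by (simp add: h_def algebra_simps)
 qed
 define d where "d = (%u. g u - h u)"
 define D where "D = (SUP u\<in>{0..t}. \<bar>d u\<bar>)"
 have dB: "\<bar>d u\<bar> <= Bg + (\<bar>g0\<bar> + Bb * t)" if "0 <= u" "u <= t" for u
  unfolding d_def using gB[OF that] hB[OF that] by linarith
 have bdd: "bdd_above ((%u. \<bar>d u\<bar>) ` {0..t})" using dB by (intro bdd_aboveI2) auto
 have dD: "\<bar>d u\<bar> <= D" if "0 <= u" "u <= t" for u unfolding D_def using that by (intro cSUP_upper bdd) auto
 have D0: "0 <= D" using dD[of 0] t by linarith
 have dm: "(%r. indicator {0..t} r * d r) \<in> borel_measurable borel"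
 proof -
  have "(%r. indicator {0..t} r * g r - indicator {0..t} r * h r) \<in> borel_measurable borel" using gm by measurable
  then show ?thesis by (simp add: d_def right_diff_distrib)
 qed
 \<comment> \<open>The difference of the two solutions satisfies the homogeneous equation, whose
   kernel has total mass below (lam - \<mu>) / lam < 1. Hence its supremum D satisfies D <= D (1 -
   \<mu> / lam) and must vanish.\<close>
 have contr: "\<bar>d u\<bar> <= D * (1 - \<mu> / lam)" if u: "0 <= u" "u <= t" for u
 proof -
  have ig: "integrable lborel (%r. indicator {0..u} r * (exp (- lam * (u - r)) * ((lam - \<mu>) * k r + b r)))"
   if km: "(%r. indicator {0..t} r * k r) \<in> borel_measurable borel" and kB: "\<And>r. 0 <= r ==> r <= t ==> \<bar>k r\<bar> <= Bk" for k Bk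
  proof (rule integrable_Icc_bounded[of _ _ _ "(lam - \<mu>) * Bk + Bb"])
   have "(%r. indicator {0..t} r * ((lam - \<mu>) * k r + b r)) \<in> borel_measurable borel"
   proof -
    have "(%r. (lam - \<mu>) * (indicator {0..t} r * k r) + indicator {0..t} r * b r) \<in> borel_measurable borel" using km by measurable
    then show ?thesis by (simp add: distrib_left mult_ac)
   qed
   then show "(%r. indicator {0..u} r * (exp (- lam * (u - r)) * ((lam - \<mu>) * k r + b r))) \<in> borel_measurable borel"
    by (rule um[OF u(2)]) simp
   fix r assume r: "0 <= r" "r <= u"
   have "\<bar>(lam - \<mu>) * k r + b r\<bar> <= (lam - \<mu>) * Bk + Bb"
    using kB[of r] b_B[of r] r u mu by (intro order_trans[OF abs_triangle_ineq] add_mono) (auto simp: abs_mult)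
   then have "exp (- lam * (u - r)) * \<bar>(lam - \<mu>) * k r + b r\<bar> <= 1 * ((lam - \<mu>) * Bk + Bb)"
    using r mu by (intro mult_mono) auto
   then show "\<bar>exp (- lam * (u - r)) * ((lam - \<mu>) * k r + b r)\<bar> <= (lam - \<mu>) * Bk + Bb" by (simp add: abs_mult)
  qed
  have hm': "(%r. indicator {0..t} r * h r) \<in> borel_measurable borel" by measurable
  have "g u = exp (- lam * u) * g0 + (\<integral>r. indicator {0..u} r * (exp (- lam * (u - r)) * ((lam - \<mu>) * g r + b r)) \<partial>lborel)"
   unfolding eq[OF u] using u by (intro arg_cong2[where f="(+)"] refl Bochner_Integration.integral_cong) (auto simp: b_def indicator_def)
  then have "d u = (\<integral>r. indicator {0..u} r * (exp (- lam * (u - r)) * ((lam - \<mu>) * g r + b r)) - indicator {0..u} r * (exp (- lam * (u - r)) * ((lam - \<mu>) * h r + b r)) \<partial>lborel)"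
   unfolding d_def heq[OF u] by (subst Bochner_Integration.integral_diff[OF ig[OF gm gB] ig[OF hm' hB]]) auto
  also have "... = (\<integral>r. indicator {0..u} r * (exp (- lam * (u - r)) * (lam - \<mu>) * d r) \<partial>lborel)"
   by (intro Bochner_Integration.integral_cong) (auto simp: d_def algebra_simps)
  finally have du: "d u = ..." .
  have "\<bar>d u\<bar> <= (exp (- lam * u) * (lam - \<mu>) * D) * ((exp (lam * u) - 1) / lam)"
   unfolding du
  proof (rule integral_Icc_exp_bound)
   show "(%r. indicator {0..u} r * (exp (- lam * (u - r)) * (lam - \<mu>) * d r)) \<in> borel_measurable borel"
    using um[OF u(2) dm, of "%r. exp (- lam * (u - r)) * (lam - \<mu>)"] by simp
   fix r assume r: "0 <= r" "r <= u"
   have "exp (- lam * (u - r)) = exp (- lam * u) * exp (lam * r)" by (simp add: exp_add[symmetric] algebra_simps)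
   then have "\<bar>exp (- lam * (u - r)) * (lam - \<mu>) * d r\<bar> = exp (- lam * u) * (lam - \<mu>) * exp (lam * r) * \<bar>d r\<bar>" using mu by (simp add: abs_mult)
   also have "... <= exp (- lam * u) * (lam - \<mu>) * exp (lam * r) * D" using dD[of r] r u mu by (intro mult_left_mono) auto
   finally show "\<bar>exp (- lam * (u - r)) * (lam - \<mu>) * d r\<bar> <= exp (- lam * u) * (lam - \<mu>) * D * exp (lam * r)" by (simp add: mult_ac)
  qed (use u mu in auto)
  also have "... = D * (1 - \<mu> / lam) * (1 - exp (- lam * u))"
  proof -
   have "exp (- lam * u) * (exp (lam * u) - 1) = 1 - exp (- lam * u)" by (simp add: right_diff_distrib exp_add[symmetric])
   then have "(lam - \<mu>) * D / lam * (exp (- lam * u) * (exp (lam * u) - 1)) = (lam - \<mu>) * D / lam * (1 - exp (- lam * u))" by simp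
   then show ?thesis using mu by (simp add: field_simps)
  qed
  also have "... <= D * (1 - \<mu> / lam) * 1" using D0 mu by (intro mult_left_mono) auto
  finally show ?thesis by simp
 qed
 have "D <= D * (1 - \<mu> / lam)" unfolding D_def[of] 
  by (rule cSUP_least) (use t contr D_def in auto)
 then have "D * (\<mu> / lam) <= 0" by (simp add: algebra_simps)
 moreover have "0 < D * (\<mu> / lam)" if "\<not> D <= 0" using that mu by simp
 ultimately have "D <= 0" by linarith
 then have "d t = 0" using dD[of t] t by simp
 then show ?thesis unfolding d_def h_def b_def
  by (auto intro!: Bochner_Integration.integral_cong simp: indicator_def)
qed

section \<open>U-statistics under free motion and under a ring\<close>

definition inj_tuples :: "nat => nat => (nat => nat) set" where
 "inj_tuples q N = {s. s \<in> {..<q} \<rightarrow>\<^sub>E {..<N} \<and> inj_on s {..<q}}"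

definition pick :: "nat => (nat => nat) => (nat => 'b) => nat => 'b" where
 "pick q s x = (\<lambda>k\<in>{..<q}. x (s k))"

lemma u_statistic_eq: "u_statistic N q x F = 1 / (fact N / fact (N - q)) * (\<Sum>s\<in>inj_tuples q N. F (pick q s x))"
 by (simp add: u_statistic_def inj_tuples_def pick_def)

lemma finite_inj_tuples: "finite (inj_tuples q N)"
 by (rule finite_subset[OF _ finite_PiE[of "{..<q}" "%_. {..<N}"]]) (auto simp: inj_tuples_def)

lemma inj_tuples_lt: "s \<in> inj_tuples q N ==> k < q ==> s k < N"
 by (auto simp: inj_tuples_def)

lemma inj_tuples_empty: "N < q ==> inj_tuples q N = {}"
 using card_inj[of _ "{..<q}" "{..<N}"] by (fastforce simp: inj_tuples_def)

lemma card_image_inj_tuples: "s \<in> inj_tuples q N ==> card (s ` {..<q}) = q"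
 by (auto simp: inj_tuples_def card_image)

text \<open>An injective (q + 1)-tuple is an injective q-tuple with a new last entry. In the
  hierarchy that entry will be the target of a jump out of the sample.\<close>

lemma bij_betw_inj_tuples_Suc:
 "bij_betw (%(s, j). s(q := j)) (SIGMA s:inj_tuples q N. {..<N} - s ` {..<q}) (inj_tuples (Suc q) N)"
proof (rule bij_betw_byWitness[where f'="%s. (restrict s {..<q}, s q)"], goal_cases)
 case 1
 show ?case by (auto simp: inj_tuples_def restrict_def fun_eq_iff PiE_iff extensional_def)
next
 case 2
 show ?case by (auto simp: inj_tuples_def restrict_def fun_eq_iff PiE_iff extensional_def)
next
 case 3
 show ?case
 proof (rule image_subsetI)
  fix p assume "p \<in> (SIGMA s:inj_tuples q N. {..<N} - s ` {..<q})"
  then obtain s j where p: "p = (s, j)" and s: "s \<in> inj_tuples q N" and j: "j \<in> {..<N} - s ` {..<q}" by auto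
  have "inj_on (s(q := j)) {..<Suc q}"
   using s j by (auto simp: inj_tuples_def lessThan_Suc inj_on_def)
  then show "(case p of (s, j) => s(q := j)) \<in> inj_tuples (Suc q) N"
   using s j by (auto simp: p inj_tuples_def PiE_iff extensional_def less_Suc_eq)
 qed
next
 case 4
 show ?case
 proof (rule image_subsetI)
  fix s assume s: "s \<in> inj_tuples (Suc q) N"
  have 1: "restrict s {..<q} \<in> inj_tuples q N"
   using s by (auto simp: inj_tuples_def PiE_iff inj_on_def)
  have 2: "s q < N" using s by (auto simp: inj_tuples_def)
  have 3: "s q \<noteq> s k" if "k < q" for k
   using s that inj_onD[of s "{..<Suc q}" q k] by (auto simp: inj_tuples_def)
  show "(restrict s {..<q}, s q) \<in> (SIGMA s:inj_tuples q N. {..<N} - s ` {..<q})"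
   using 1 2 3 by auto
 qed
qed

lemma sum_inj_tuples_Suc:
 fixes f :: "(nat => nat) => real"
 shows "(\<Sum>s\<in>inj_tuples (Suc q) N. f s) = (\<Sum>s\<in>inj_tuples q N. \<Sum>j\<in>{..<N} - s ` {..<q}. f (s(q := j)))"
proof -
 have "(\<Sum>s\<in>inj_tuples (Suc q) N. f s) = (\<Sum>p\<in>(SIGMA s:inj_tuples q N. {..<N} - s ` {..<q}). f ((%(s, j). s(q := j)) p))"
  by (rule sum.reindex_bij_betw[OF bij_betw_inj_tuples_Suc, symmetric])
 also have "... = (\<Sum>s\<in>inj_tuples q N. \<Sum>j\<in>{..<N} - s ` {..<q}. f (s(q := j)))"
  by (subst sum.Sigma) (auto simp: finite_inj_tuples case_prod_beta')
 finally show ?thesis .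
qed

lemma card_inj_tuples: "q <= N ==> real (card (inj_tuples q N)) = fact N / fact (N - q)"
proof (induction q)
 case 0
 have "inj_tuples 0 N = {%x. undefined}" by (auto simp: inj_tuples_def)
 then show ?case by simp
next
 case (Suc q)
 have "real (card (inj_tuples (Suc q) N)) = (\<Sum>s\<in>inj_tuples (Suc q) N. 1)" by simp
 also have "... = (\<Sum>s\<in>inj_tuples q N. real (N - q))"
  unfolding sum_inj_tuples_Suc
 proof (rule sum.cong[OF refl])
  fix s assume s: "s \<in> inj_tuples q N"
  have "card ({..<N} - s ` {..<q}) = N - q"
   using s card_image_inj_tuples[OF s] by (subst card_Diff_subset) (auto simp: inj_tuples_lt)
  then show "(\<Sum>j\<in>{..<N} - s ` {..<q}. 1) = real (N - q)" by simp
 qed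
 also have "... = fact N / fact (N - q) * real (N - q)" using Suc by simp
 also have "... = fact N / fact (N - Suc q)"
 proof -
  have "N - q = Suc (N - Suc q)" using Suc by simp
  then have "(fact (N - q) :: real) = real (N - q) * fact (N - Suc q)" by (metis fact_Suc of_nat_mult of_nat_fact)
  then show ?thesis using Suc by simp
 qed
 finally show ?case .
qed

lemma u_statistic_bound:
 assumes "\<And>s. s \<in> inj_tuples q N ==> \<bar>F (pick q s x)\<bar> <= B" and B: "0 <= B"
 shows "\<bar>u_statistic N q x F\<bar> <= B"
proof (cases "q <= N")
 case True
 have "\<bar>\<Sum>s\<in>inj_tuples q N. F (pick q s x)\<bar> <= (\<Sum>s\<in>inj_tuples q N. B)"
  by (rule order_trans[OF sum_abs sum_mono[OF assms(1)]])
 also have "... = fact N / fact (N - q) * B" using card_inj_tuples[OF True] by simp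
 finally have "\<bar>\<Sum>s\<in>inj_tuples q N. F (pick q s x)\<bar> <= fact N / fact (N - q) * B" .
 then show ?thesis unfolding u_statistic_eq abs_mult by (simp add: field_simps)
next
 case False
 then show ?thesis using B by (simp add: u_statistic_eq inj_tuples_empty)
qed

lemma pick_in_space: "pick q s x \<in> space (tuple_space q)"
 by (auto simp: pick_def space_PiM)

lemma measurable_pick:
 assumes "s \<in> inj_tuples q N" "f \<in> Y \<rightarrow>\<^sub>M tuple_space N"
 shows "(%z. pick q s (f z)) \<in> Y \<rightarrow>\<^sub>M tuple_space q"
 unfolding pick_def
 by (intro measurable_restrict) (rule measurable_component[OF _ assms(2)], use assms(1) inj_tuples_lt in auto)

lemma measurable_u_statistic:
 assumes H: "(%z. H (fst z) (snd z)) \<in> borel_measurable (Y \<Otimes>\<^sub>M tuple_space q)" and b: "b \<in> Y \<rightarrow>\<^sub>M tuple_space N"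
 shows "(%z. u_statistic N q (b z) (H z)) \<in> borel_measurable Y"
 unfolding u_statistic_eq
proof (intro borel_measurable_times borel_measurable_const borel_measurable_sum)
 fix s assume s: "s \<in> inj_tuples q N"
 have "(%z. (z, pick q s (b z))) \<in> Y \<rightarrow>\<^sub>M Y \<Otimes>\<^sub>M tuple_space q"
  by (intro measurable_Pair measurable_ident_sets[OF refl] measurable_pick[OF s b])
 from measurable_compose[OF this H] show "(%z. H z (pick q s (b z))) \<in> borel_measurable Y" by simp
qed

lemma u_statistic_bm:
 assumes H: "H \<in> bm q" shows "(%x. u_statistic N q x H) \<in> bm N"
proof -
 obtain B where B: "0 <= B" "\<And>x. x \<in> space (tuple_space q) ==> \<bar>H x\<bar> <= B" using bounded_measurableD(2)[OF H] by blast
 show ?thesis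
  by (rule bounded_measurableI[OF measurable_u_statistic[OF measurable_compose[OF measurable_snd bounded_measurableD(1)[OF H]] measurable_ident_sets[OF refl]]])
    (rule u_statistic_bound[where F=H, OF B(2)[OF pick_in_space] B(1)])
qed

context feynman_kac_model
begin

lemma rtrans_add_const:
 assumes F: "F \<in> bm q" and r: "0 <= r" "0 <= t"
 shows "rtrans q r t (%x. F x + B) = (%x. rtrans q r t F x + B)"
 using rtrans_integrable[OF F r] prob_space.prob_space[OF path_law_prob[OF r(1)]]
  prob_space.finite_measure[OF path_law_prob[OF r(1)]]
 by (auto simp: rtrans_def fun_eq_iff finite_measure.integrable_const)

text \<open>Positions at time t depend only on the future of u, so this is
  \<open>path_law_markov\<close> at time u.\<close>

lemma transition_semigroup:
 assumes r: "0 <= r" "r <= u" "u <= t" and G: "G \<in> borel_measurable (tuple_space q)"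
 shows "transition q r u (transition q u t G) x = transition q r t G x"
proof -
 have t: "0 <= t" using r by simp
 have "(\<integral>\<^sup>+\<omega>. G (positions q t \<omega>) \<partial>path_law q r x) = (\<integral>\<^sup>+\<omega>. (\<integral>\<^sup>+\<omega>'. G (positions q t \<omega>') \<partial>path_law q u (positions q u \<omega>)) \<partial>path_law q r x)"
 proof (rule path_law_markov[OF r(1,2)])
  show "(%\<omega>. G (positions q t \<omega>)) \<in> borel_measurable (multipath q)"
   by (rule measurable_compose[OF measurable_positions[OF measurable_half_line_const[OF t] measurable_ident_sets[OF refl]] G])
  show "G (positions q t \<omega>) = G (positions q t \<omega>')" if "\<And>i v. i < q ==> u <= v ==> \<omega> i v = \<omega>' i v" for \<omega> \<omega>'
   using that r by (intro arg_cong[where f=G]) (auto simp: positions_def)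
 qed
 then show ?thesis by (simp add: transition_def)
qed

lemma rtrans_semigroup:
 assumes r: "0 <= r" "r <= u" "u <= t" and F: "F \<in> bm q"
 shows "rtrans q r u (rtrans q u t F) x = rtrans q r t F x"
proof -
 have t: "0 <= t" "0 <= u" using r by auto
 obtain B where B: "0 <= B" "\<And>x. x \<in> space (tuple_space q) ==> \<bar>F x\<bar> <= B" using bounded_measurableD(2)[OF F] by blast
 define G where "G = (%x. F x + B)"
 have G: "G \<in> bm q"
  unfolding G_def
 proof (rule bounded_measurableI[of _ _ "B + B"])
  show "\<bar>F x + B\<bar> <= B + B" if "x \<in> space (tuple_space q)" for x using B(1) B(2)[OF that] by linarith
 qed (use bounded_measurableD(1)[OF F] in simp)
 have G0: "0 <= G x" if "x \<in> space (tuple_space q)" for x using B(2)[OF that] unfolding G_def by linarith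
 have Gm: "(%x. ennreal (G x)) \<in> borel_measurable (tuple_space q)" using bounded_measurableD(1)[OF G] by measurable
 have tr: "transition q u t (%x. ennreal (G x)) = (%y. ennreal (rtrans q u t G y))"
  using ennreal_rtrans[OF G G0 t(2,1)] by auto
 have "ennreal (rtrans q r u (rtrans q u t G) x) = transition q r u (transition q u t (%x. ennreal (G x))) x"
  unfolding tr by (rule ennreal_rtrans[OF rtrans_bm[OF G t(2,1)] rtrans_nonneg[OF G0] r(1) t(2), symmetric])
 also have "... = transition q r t (%x. ennreal (G x)) x" by (rule transition_semigroup[OF r Gm])
 also have "... = ennreal (rtrans q r t G x)" by (rule ennreal_rtrans[OF G G0 r(1) t(1)])
 finally have "rtrans q r u (rtrans q u t G) x = rtrans q r t G x"
  using rtrans_nonneg[OF rtrans_nonneg[OF G0]] rtrans_nonneg[OF G0] by (simp add: ennreal_inj)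
 then show ?thesis
  by (simp add: G_def rtrans_add_const[OF F t(2,1)] rtrans_add_const[OF F r(1) t(1)] rtrans_add_const[OF rtrans_bm[OF F t(2,1)] r(1) t(2)])
qed

lemma rtrans_refl:
 assumes F: "F \<in> bm q" and t: "0 <= t" and x: "x \<in> space (tuple_space q)"
 shows "rtrans q t t F x = F x"
proof -
 have "rtrans q t t F x = (\<integral>\<omega>. F x \<partial>path_law q t x)"
  unfolding rtrans_def
 proof (rule integral_cong_AE)
  show "AE \<omega> in path_law q t x. F (positions q t \<omega>) = F x"
   using path_law_start[OF t, of q x]
  proof eventually_elim
   case (elim \<omega>)
   then have "positions q t \<omega> = x" using x by (auto simp: positions_def fun_eq_iff space_PiM PiE_iff extensional_def)
   then show ?case by simp
  qed
 qed (use rtrans_integrand[OF bounded_measurableD(1)[OF F] t t] in auto)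
 then show ?thesis using prob_space.prob_space[OF path_law_prob[OF t]] by simp
qed

text \<open>Distinct particles move independently, so an injective choice of coordinates of the
  N-particle law is the q-particle law from the chosen positions.\<close>

lemma rtrans_pick:
 assumes F: "F \<in> bm q" and r: "0 <= r" "0 <= t" and s: "s \<in> inj_tuples q N"
 shows "rtrans N r t (%x. F (pick q s x)) x = rtrans q r t F (pick q s x)"
proof -
 have re: "distr (path_law N r x) (\<Pi>\<^sub>M k\<in>{..<q}. K r (x (s k))) (%\<omega>. \<lambda>k\<in>{..<q}. \<omega> (s k)) = (\<Pi>\<^sub>M k\<in>{..<q}. K r (x (s k)))"
  unfolding path_law_def by (rule distr_PiM_reindex) (use s K_prob[OF r(1)] in \<open>auto simp: inj_tuples_def\<close>)
 have pl: "path_law q r (pick q s x) = (\<Pi>\<^sub>M k\<in>{..<q}. K r (x (s k)))"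
  unfolding path_law_def by (rule PiM_cong) (auto simp: pick_def)
 have re': "distr (path_law N r x) (path_law q r (pick q s x)) (pick q s) = path_law q r (pick q s x)"
  unfolding pl using re by (simp only: pick_def[abs_def])
 have m: "pick q s \<in> path_law N r x \<rightarrow>\<^sub>M path_law q r (pick q s x)"
 proof -
  have "(%\<omega>. \<lambda>k\<in>{..<q}. \<omega> (s k)) \<in> multipath N \<rightarrow>\<^sub>M multipath q"
   by (intro measurable_restrict measurable_component_singleton) (use s inj_tuples_lt in auto)
  then show ?thesis by (simp only: pick_def[abs_def] measurable_cong_sets[OF path_law_sets[OF r(1)] path_law_sets[OF r(1)]])
 qed
 have "rtrans q r t F (pick q s x) = (\<integral>\<omega>. F (positions q t \<omega>) \<partial>distr (path_law N r x) (path_law q r (pick q s x)) (pick q s))"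
  unfolding rtrans_def re' ..
 also have "... = (\<integral>\<omega>. F (positions q t (pick q s \<omega>)) \<partial>path_law N r x)"
  by (rule integral_distr[OF m rtrans_integrand[OF bounded_measurableD(1)[OF F] r]])
 also have "... = rtrans N r t (%x. F (pick q s x)) x"
  unfolding rtrans_def
  by (intro Bochner_Integration.integral_cong refl arg_cong[where f=F]) (auto simp: positions_def pick_def inj_tuples_lt[OF s])
 finally show ?thesis by simp
qed

lemma pick_bm:
 assumes F: "F \<in> bm q" and s: "s \<in> inj_tuples q N" shows "(%x. F (pick q s x)) \<in> bm N"
proof -
 obtain B where B: "\<And>x. x \<in> space (tuple_space q) ==> \<bar>F x\<bar> <= B" using bounded_measurableD(2)[OF F] by blast
 show ?thesis
  by (rule bounded_measurableI[OF measurable_compose[OF measurable_pick[OF s measurable_ident_sets[OF refl]] bounded_measurableD(1)[OF F]]])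
    (rule B[OF pick_in_space])
qed

lemma rtrans_u_statistic:
 assumes F: "F \<in> bm q" and r: "0 <= r" "0 <= t"
 shows "rtrans N r t (%x. u_statistic N q x F) x = u_statistic N q x (rtrans q r t F)"
proof -
 have "rtrans N r t (%x. u_statistic N q x F) x = 1 / (fact N / fact (N - q)) * (\<Sum>s\<in>inj_tuples q N. rtrans N r t (%x. F (pick q s x)) x)"
  unfolding rtrans_def u_statistic_eq using rtrans_integrable[OF pick_bm[OF F] r]
  by (subst integral_mult_right_zero, subst Bochner_Integration.integral_sum) auto
 also have "... = u_statistic N q x (rtrans q r t F)"
  unfolding u_statistic_eq using rtrans_pick[OF F r] by simp
 finally show ?thesis .
qed

text \<open>The sample consists of the first q coordinates of a (q + 1)-tuple; coordinate q is a
  particle outside the sample, to whose position the sampled particle k may jump. In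
  \<open>in1\<close> the target j belongs to the sample and the level does not change.\<close>

definition up1 :: "nat => nat => real => ((nat => 'a) => real) => (nat => 'a) => real" where
 "up1 q k r H x = vel r (x k) * H ((restrict x {..<q})(k := x q)) + (1 - vel r (x k)) * H (restrict x {..<q})"

definition in1 :: "nat => nat => real => ((nat => 'a) => real) => (nat => 'a) => real" where
 "in1 k j r H x = vel r (x k) * H (x(k := x j)) + (1 - vel r (x k)) * H x"

text \<open>A ring of one of the N - q particles outside the image of s is invisible to
  \<open>pick q s\<close> and returns H itself. A ring of the sampled particle k has a uniform
  target: outside the image it extends the tuple by that target, inside the image it is another
  sampled particle.\<close>

lemma sum_rjump_pick:
 assumes s: "s \<in> inj_tuples q N" and N: "1 <= N"
 shows "(\<Sum>i<N. rjump N i r (%y. H (pick q s y)) y) = real (N - q) * H (pick q s y) +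
  (\<Sum>k<q. 1 / real N * (\<Sum>j\<in>{..<N} - s ` {..<q}. up1 q k r H (pick (Suc q) (s(q := j)) y)) +
    1 / real N * (\<Sum>j<q. in1 k j r H (pick q s y)))"
proof -
 let ?S = "s ` {..<q}"
 have inj: "inj_on s {..<q}" using s by (simp add: inj_tuples_def)
 have sub: "?S \<subseteq> {..<N}" using s inj_tuples_lt by auto
 define D where "D = (%k j. vel r (y (s k)) * H ((pick q s y)(k := y j)) + (1 - vel r (y (s k))) * H (pick q s y))"
 have out: "rjump N i r (%y. H (pick q s y)) y = H (pick q s y)" if "i \<notin> ?S" for i
 proof -
  have "pick q s (y(i := a)) = pick q s y" for a using that by (auto simp: pick_def fun_eq_iff)
  then show ?thesis using N by (simp add: rjump_def algebra_simps)
 qed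
 have ins: "rjump N (s k) r (%y. H (pick q s y)) y = (\<Sum>j<N. 1 / real N * D k j)" if k: "k < q" for k
 proof -
  have "pick q s (y(s k := a)) = (pick q s y)(k := a)" for a
   using k inj by (auto simp: pick_def fun_eq_iff dest: inj_onD)
  then show ?thesis by (simp add: rjump_def D_def)
 qed
 have "(\<Sum>i<N. rjump N i r (%y. H (pick q s y)) y) = (\<Sum>i\<in>{..<N} - ?S. rjump N i r (%y. H (pick q s y)) y) + (\<Sum>i\<in>?S. rjump N i r (%y. H (pick q s y)) y)"
  by (rule sum.subset_diff[OF sub]) simp
 also have "(\<Sum>i\<in>{..<N} - ?S. rjump N i r (%y. H (pick q s y)) y) = real (N - q) * H (pick q s y)"
  using out card_image_inj_tuples[OF s] sub by (simp add: card_Diff_subset)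
 also have "(\<Sum>i\<in>?S. rjump N i r (%y. H (pick q s y)) y) = (\<Sum>k<q. \<Sum>j<N. 1 / real N * D k j)"
  using ins by (simp add: sum.reindex[OF inj])
 also have "... = (\<Sum>k<q. 1 / real N * (\<Sum>j\<in>{..<N} - ?S. up1 q k r H (pick (Suc q) (s(q := j)) y)) + 1 / real N * (\<Sum>j<q. in1 k j r H (pick q s y)))"
 proof (rule sum.cong[OF refl])
  fix k assume "k \<in> {..<q}"
  then have k: "k < q" by simp
  have "(\<Sum>j<N. 1 / real N * D k j) = 1 / real N * ((\<Sum>j\<in>{..<N} - ?S. D k j) + (\<Sum>j\<in>?S. D k j))"
   unfolding sum_distrib_left[symmetric] using sum.subset_diff[OF sub, of "D k"] by simp
  also have "(\<Sum>j\<in>{..<N} - ?S. D k j) = (\<Sum>j\<in>{..<N} - ?S. up1 q k r H (pick (Suc q) (s(q := j)) y))"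
  proof (rule sum.cong[OF refl])
   fix j
   have 1: "restrict (pick (Suc q) (s(q := j)) y) {..<q} = pick q s y" by (auto simp: pick_def fun_eq_iff)
   have 2: "pick (Suc q) (s(q := j)) y q = y j" "pick (Suc q) (s(q := j)) y k = y (s k)" using k by (auto simp: pick_def)
   show "D k j = up1 q k r H (pick (Suc q) (s(q := j)) y)" unfolding up1_def D_def 1 2 ..
  qed
  also have "(\<Sum>j\<in>?S. D k j) = (\<Sum>j<q. in1 k j r H (pick q s y))"
   unfolding sum.reindex[OF inj] using k by (intro sum.cong) (auto simp: D_def in1_def pick_def)
  finally show "(\<Sum>j<N. 1 / real N * D k j) = 1 / real N * (\<Sum>j\<in>{..<N} - ?S. up1 q k r H (pick (Suc q) (s(q := j)) y)) + 1 / real N * (\<Sum>j<q. in1 k j r H (pick q s y))"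
   by (simp only: distrib_left)
 qed
 finally show ?thesis .
qed

text \<open>The normalisations of levels q + 1 and q differ by the factor N - q, which with the 1 /
  N of the uniform target gives 1 - q / N. Targets inside the sample are only q out of N and keep
  the factor 1 / N. These are the two places where N enters the hierarchy after resummation.\<close>

lemma sum_rjump_u_statistic:
 assumes N: "1 <= N" and q: "q <= N"
 shows "(\<Sum>i<N. rjump N i r (%y. u_statistic N q y H) y) = (real N - real q) * u_statistic N q y H +
  ((1 - real q / real N) * u_statistic N (Suc q) y (%x. \<Sum>k<q. up1 q k r H x) +
   1 / real N * u_statistic N q y (%x. \<Sum>k<q. \<Sum>j<q. in1 k j r H x))"
proof -
 define c where "c = 1 / (fact N / fact (N - q) :: real)"
 have "rjump N i r (%y. u_statistic N q y H) y = c * (\<Sum>s\<in>inj_tuples q N. rjump N i r (%y. H (pick q s y)) y)" for i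
  unfolding rjump_def u_statistic_eq c_def[symmetric] sum_distrib_left
  by (subst sum.swap, intro sum.cong refl) (simp only: sum_distrib_left sum.distrib[symmetric], intro sum.cong refl, simp add: algebra_simps)
 then have "(\<Sum>i<N. rjump N i r (%y. u_statistic N q y H) y) = c * (\<Sum>s\<in>inj_tuples q N. \<Sum>i<N. rjump N i r (%y. H (pick q s y)) y)"
  by (subst sum.swap) (simp add: sum_distrib_left)
 also have "... = c * (\<Sum>s\<in>inj_tuples q N. real (N - q) * H (pick q s y) +
   (1 / real N * (\<Sum>j\<in>{..<N} - s ` {..<q}. \<Sum>k<q. up1 q k r H (pick (Suc q) (s(q := j)) y)) +
    1 / real N * (\<Sum>k<q. \<Sum>j<q. in1 k j r H (pick q s y))))"
 proof (intro arg_cong[where f="(*) c"] sum.cong refl)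
  fix s assume s: "s \<in> inj_tuples q N"
  have sw: "(\<Sum>j\<in>{..<N} - s ` {..<q}. \<Sum>k<q. up1 q k r H (pick (Suc q) (s(q := j)) y)) = (\<Sum>k<q. \<Sum>j\<in>{..<N} - s ` {..<q}. up1 q k r H (pick (Suc q) (s(q := j)) y))"
   by (rule sum.swap)
  have "(\<Sum>k<q. 1 / real N * (\<Sum>j\<in>{..<N} - s ` {..<q}. up1 q k r H (pick (Suc q) (s(q := j)) y)) + 1 / real N * (\<Sum>j<q. in1 k j r H (pick q s y))) =
   1 / real N * (\<Sum>j\<in>{..<N} - s ` {..<q}. \<Sum>k<q. up1 q k r H (pick (Suc q) (s(q := j)) y)) + 1 / real N * (\<Sum>k<q. \<Sum>j<q. in1 k j r H (pick q s y))"
   by (simp only: sw sum.distrib sum_distrib_left)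
  then show "(\<Sum>i<N. rjump N i r (%y. H (pick q s y)) y) = real (N - q) * H (pick q s y) +
   (1 / real N * (\<Sum>j\<in>{..<N} - s ` {..<q}. \<Sum>k<q. up1 q k r H (pick (Suc q) (s(q := j)) y)) +
    1 / real N * (\<Sum>k<q. \<Sum>j<q. in1 k j r H (pick q s y)))"
   unfolding sum_rjump_pick[OF s N] by simp
 qed
 also have "... = real (N - q) * (c * (\<Sum>s\<in>inj_tuples q N. H (pick q s y))) +
   (1 / real N * (c * (\<Sum>s\<in>inj_tuples (Suc q) N. \<Sum>k<q. up1 q k r H (pick (Suc q) s y))) +
   1 / real N * (c * (\<Sum>s\<in>inj_tuples q N. \<Sum>k<q. \<Sum>j<q. in1 k j r H (pick q s y))))"
  unfolding sum_inj_tuples_Suc by (simp only: sum.distrib sum_distrib_left distrib_left mult.left_commute)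
 also have "1 / real N * (c * (\<Sum>s\<in>inj_tuples (Suc q) N. \<Sum>k<q. up1 q k r H (pick (Suc q) s y))) =
   (1 - real q / real N) * u_statistic N (Suc q) y (%x. \<Sum>k<q. up1 q k r H x)"
 \<comment> \<open>At q = N there are no (q + 1)-tuples and the coefficient vanishes too, but the
   truncated difference N - Suc q would spoil the quotient of factorials.\<close>
 proof (cases "q = N")
  case True
  then show ?thesis by (simp add: inj_tuples_empty u_statistic_eq)
 next
  case False
  then have "N - q = Suc (N - Suc q)" using q by simp
  then have "(fact (N - q) :: real) = real (N - q) * fact (N - Suc q)" by (metis fact_Suc of_nat_mult of_nat_fact)
  then have "1 / real N * c = (1 - real q / real N) * (1 / (fact N / fact (N - Suc q)))"
   using N q by (simp add: c_def field_simps of_nat_diff)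
  then show ?thesis unfolding u_statistic_eq by (simp only: mult.assoc[symmetric])
 qed
 finally show ?thesis using q by (simp add: u_statistic_eq c_def of_nat_diff)
qed

end

section \<open>Measure-like functionals and kernel-like operators\<close>

definition bounded_by :: "'x measure => real => ('x => real) => bool" where
 "bounded_by S B F \<longleftrightarrow> F \<in> borel_measurable S \<and> 0 <= B \<and> (\<forall>x\<in>space S. \<bar>F x\<bar> <= B)"

lemma bounded_by_bm: "bounded_by S B F ==> F \<in> bounded_measurable S"
 unfolding bounded_by_def by (auto intro: bounded_measurableI)

lemma bm_bounded_by: "F \<in> bounded_measurable S ==> \<exists>B. bounded_by S B F"
 unfolding bounded_by_def using bounded_measurableD[of F S] by blast

text \<open>Two-time operators that behave like kernels from S' to S with mass at most c: positive,
  linear, and continuous under bounded pointwise convergence. In \<open>meas\<close> the later time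
  comes first and the earlier one second, because \<open>vol\<close> integrates over the earlier
  time with the later one as parameter.\<close>

locale op_ok =
 fixes S :: "'x measure" and S' :: "'y measure" and c :: real
  and A :: "real => real => ('x => real) => 'y => real"
 assumes c_nonneg: "0 <= c"
  and meas: "F \<in> bounded_measurable S ==>
   (%z. A (snd (fst z)) (fst (fst z)) F (snd z)) \<in> borel_measurable ((half_line \<Otimes>\<^sub>M half_line) \<Otimes>\<^sub>M S')"
  and bound: "bounded_by S B F ==> 0 <= r ==> 0 <= t ==> x \<in> space S' ==> \<bar>A r t F x\<bar> <= c * B"
  and lin: "F \<in> bounded_measurable S ==> G \<in> bounded_measurable S ==> 0 <= r ==> 0 <= t ==>
   x \<in> space S' ==> A r t (%y. a * F y + G y) x = a * A r t F x + A r t G x"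
  and nonneg: "F \<in> bounded_measurable S ==> 0 <= r ==> 0 <= t ==>
   (\<And>y. y \<in> space S ==> 0 <= F y) ==> x \<in> space S' ==> 0 <= A r t F x"
  and cont: "(\<And>n. bounded_by S B (Fn n)) ==> bounded_by S B F ==>
   (\<And>y. y \<in> space S ==> (%n. Fn n y) \<longlonglongrightarrow> F y) ==>
   0 <= r ==> 0 <= t ==> x \<in> space S' ==> (%n. A r t (Fn n) x) \<longlonglongrightarrow> A r t F x"

text \<open>A signed measure for each time, kept as a functional: \<open>cont\<close> is countable
  additivity in the form of bounded convergence. Sums, limits and Volterra integrals of such
  functionals can be formed without constructing measures; these appear only in
  \<open>posf_representation\<close>.\<close>

locale goodf =
 fixes S :: "'x measure" and g :: "real => ('x => real) => real"
 assumes lin: "F \<in> bounded_measurable S ==> G \<in> bounded_measurable S ==> 0 <= t ==>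
   g t (%y. a * F y + G y) = a * g t F + g t G"
  and meas: "F \<in> bounded_measurable S ==> (%t. g t F) \<in> borel_measurable half_line"
  and cont: "0 <= t ==> (\<And>n. bounded_by S B (Fn n)) ==> bounded_by S B F ==>
   (\<And>y. y \<in> space S ==> (%n. Fn n y) \<longlonglongrightarrow> F y) ==> (%n. g t (Fn n)) \<longlonglongrightarrow> g t F"
  and locally_bounded: "0 <= T ==>
   \<exists>C\<ge>0. \<forall>t F B. 0 <= t \<longrightarrow> t <= T \<longrightarrow> bounded_by S B F \<longrightarrow> \<bar>g t F\<bar> <= C * B"

lemmas goodfD = goodf.lin goodf.meas goodf.cont goodf.locally_bounded
lemmas op_okD = op_ok.c_nonneg op_ok.meas op_ok.bound op_ok.lin op_ok.nonneg op_ok.cont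

definition posf :: "'x measure => (real => ('x => real) => real) => bool" where
 "posf S g \<longleftrightarrow> (\<forall>F\<in>bounded_measurable S. \<forall>t\<ge>0. (\<forall>y\<in>space S. 0 <= F y) \<longrightarrow> 0 <= g t F)"

lemma op_ok_bounded_by:
 assumes A: "op_ok S S' c A" and F: "bounded_by S B F" and r: "0 <= r" "0 <= t"
 shows "bounded_by S' (c * B) (A r t F)"
 unfolding bounded_by_def
proof (intro conjI ballI)
 have p: "(t, r) \<in> space (half_line \<Otimes>\<^sub>M half_line)" using r by (simp add: space_pair_measure space_restrict_space)
 show "A r t F \<in> borel_measurable S'"
  using measurable_compose[OF measurable_Pair1'[OF p] op_okD(2)[OF A bounded_by_bm[OF F]]] by simp
 show "0 <= c * B" using op_okD(1)[OF A] F by (simp add: bounded_by_def)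
qed (rule op_okD(3)[OF A F r])

lemma bm_zero: "(%_. 0) \<in> bounded_measurable S" by (rule bounded_measurableI[of _ _ 0]) auto

text \<open>Functionals take functions on the whole type. If two functions agree on the space, their
  difference is bounded by 0 there, so \<open>locally_bounded\<close> with bound 0 shows that it has
  value 0.\<close>

lemma goodf_cong:
 assumes g: "goodf S g" and t: "0 <= t" and F: "F \<in> bounded_measurable S" and G: "G \<in> bounded_measurable S"
  and eq: "\<And>x. x \<in> space S ==> F x = G x"
 shows "g t F = g t G"
proof -
 obtain C where C: "\<And>t' F B. 0 <= t' ==> t' <= t ==> bounded_by S B F ==> \<bar>g t' F\<bar> <= C * B" using goodfD(4)[OF g t] by blast
 have "bounded_by S 0 (%y. (- 1) * F y + G y)"
  using eq bounded_measurableD(1)[OF F] bounded_measurableD(1)[OF G] by (auto simp: bounded_by_def)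
 then have "g t (%y. (- 1) * F y + G y) = 0" using C[OF t order_refl, of 0] by auto
 then show ?thesis unfolding goodfD(1)[OF g F G t] by simp
qed

lemma goodf_lin_rules:
 assumes g: "goodf S g" and t: "0 <= t"
 shows "g t (%_. 0) = 0"
  "F \<in> bounded_measurable S ==> g t (%y. c * F y) = c * g t F"
  "F \<in> bounded_measurable S ==> G \<in> bounded_measurable S ==> g t (%y. F y + G y) = g t F + g t G"
  "F \<in> bounded_measurable S ==> G \<in> bounded_measurable S ==> g t (%y. F y - G y) = g t F - g t G"
proof -
 show z: "g t (%_. 0) = 0" using goodfD(1)[OF g bm_zero bm_zero t, of "- 1"] by simp
 show "F \<in> bounded_measurable S ==> g t (%y. c * F y) = c * g t F"
  using goodfD(1)[OF g _ bm_zero t, of F c] z by simp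
 show "F \<in> bounded_measurable S ==> G \<in> bounded_measurable S ==> g t (%y. F y + G y) = g t F + g t G"
  using goodfD(1)[OF g _ _ t, of F G 1] by simp
 show "F \<in> bounded_measurable S ==> G \<in> bounded_measurable S ==> g t (%y. F y - G y) = g t F - g t G"
  using goodfD(1)[OF g _ _ t, of G F "- 1"] by simp
qed

lemma goodf_sum:
 assumes g: "goodf S g" and t: "0 <= t" and I: "finite I" and F: "\<And>i. i \<in> I ==> F i \<in> bounded_measurable S"
 shows "g t (%y. \<Sum>i\<in>I. F i y) = (\<Sum>i\<in>I. g t (F i)) \<and> (%y. \<Sum>i\<in>I. F i y) \<in> bounded_measurable S"
 using I F
proof (induction I rule: finite_induct)
 case empty
 show ?case by (simp add: goodf_lin_rules(1)[OF g t] bm_zero)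
next
 case (insert i I)
 obtain B1 B2 where B: "bounded_by S B1 (F i)" "bounded_by S B2 (%y. \<Sum>i\<in>I. F i y)"
  using insert bm_bounded_by by (metis insertI1 insertI2)
 have "bounded_by S (B1 + B2) (%y. F i y + (\<Sum>i\<in>I. F i y))"
  using B by (auto simp: bounded_by_def intro!: order_trans[OF abs_triangle_ineq] add_mono)
 from bounded_by_bm[OF this] show ?case
  using insert goodf_lin_rules(3)[OF g t, of "F i" "%y. \<Sum>i\<in>I. F i y"] by simp
qed

text \<open>The argument of a parametrised integral with \<open>cont\<close> in place of monotone
  convergence: indicators of rectangles, a Dynkin argument for all measurable sets, simple
  functions, and bounded limits.\<close>

lemma measurable_goodf:
 assumes g: "goodf S g" and a: "a \<in> Y \<rightarrow>\<^sub>M half_line"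
  and H: "(%z. H (fst z) (snd z)) \<in> borel_measurable (Y \<Otimes>\<^sub>M S)"
  and B: "\<And>y x. y \<in> space Y ==> x \<in> space S ==> \<bar>H y x\<bar> <= B"
 shows "(%y. g (a y) (H y)) \<in> borel_measurable Y"
proof -
 have a0: "0 <= a y" if "y \<in> space Y" for y using measurable_space[OF a that] by (simp add: space_restrict_space)
 have sec: "(%x. f (y, x)) \<in> borel_measurable S" if "f \<in> borel_measurable (Y \<Otimes>\<^sub>M S)" "y \<in> space Y" for f :: "_ => real" and y
  using measurable_compose[OF measurable_Pair1'[OF that(2)] that(1)] .
 have ind_bb: "bounded_by S 1 (%x. indicator A (y, x))" if "A \<in> sets (Y \<Otimes>\<^sub>M S)" "y \<in> space Y" for A y
  using sec[OF borel_measurable_indicator[OF that(1)] that(2)] by (auto simp: bounded_by_def indicator_def)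
 have const: "(%y. g (a y) F) \<in> borel_measurable Y" if "F \<in> bounded_measurable S" for F
  by (rule measurable_compose[OF a goodfD(2)[OF g that]])
 have one: "(%_. 1) \<in> bounded_measurable S" by (rule bounded_measurableI[of _ _ 1]) auto
 have ind: "(%y. g (a y) (%x. indicator A (y, x))) \<in> borel_measurable Y" if "A \<in> sets (Y \<Otimes>\<^sub>M S)" for A
  using that[unfolded sets_pair_measure]
 proof (induction A rule: sigma_sets_induct_disjoint[where \<Omega>="space Y \<times> space S", OF Int_stable_pair_measure_generator pair_measure_closed, consumes 1, case_names basic empty compl union])
  case (basic A)
  then obtain a' b' where A: "A = a' \<times> b'" "a' \<in> sets Y" "b' \<in> sets S" by auto
  have b': "indicator b' \<in> bounded_measurable S"
   using A(3) by (intro bounded_measurableI[of _ _ 1]) (auto simp: indicator_def)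
  have "(%y. indicator a' y * g (a y) (indicator b')) \<in> borel_measurable Y"
   by (intro borel_measurable_times borel_measurable_indicator A const b')
  then show ?case
  proof (rule measurable_cong[THEN iffD1, rotated])
   fix y assume y: "y \<in> space Y"
   have "g (a y) (%x. indicator a' y * indicator b' x) = indicator a' y * g (a y) (indicator b')"
    by (rule goodf_lin_rules(2)[OF g a0[OF y] b'])
   then show "indicator a' y * g (a y) (indicator b') = g (a y) (%x. indicator A (y, x))"
    by (simp add: A(1) indicator_times)
  qed
 next
  case empty
  show ?case by (rule measurable_cong[THEN iffD1, of Y "%_. 0"]) (auto simp: goodf_lin_rules(1)[OF g a0])
 next
  case (compl A)
  have A: "A \<in> sets (Y \<Otimes>\<^sub>M S)" using compl by (simp add: sets_pair_measure)
  have "(%y. g (a y) (%_. 1) - g (a y) (%x. indicator A (y, x))) \<in> borel_measurable Y"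
   by (intro borel_measurable_diff const one compl)
  then show ?case
  proof (rule measurable_cong[THEN iffD1, rotated])
   fix y assume y: "y \<in> space Y"
   have Ac: "space Y \<times> space S - A \<in> sets (Y \<Otimes>\<^sub>M S)" using sets.compl_sets[OF A] by (simp add: space_pair_measure)
   have "g (a y) (%x. indicator (space Y \<times> space S - A) (y, x)) = g (a y) (%x. 1 - indicator A (y, x))"
    using bounded_by_bm[OF ind_bb[OF Ac y]] bounded_by_bm[OF ind_bb[OF A y]] y
    by (intro goodf_cong[OF g a0[OF y]]) (auto simp: indicator_def bounded_measurable_def intro!: bounded_minus_comp one[unfolded bounded_measurable_def, simplified])
   then show "g (a y) (%_. 1) - g (a y) (%x. indicator A (y, x)) = g (a y) (%x. indicator (space Y \<times> space S - A) (y, x))"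
    using goodf_lin_rules(4)[OF g a0[OF y] one bounded_by_bm[OF ind_bb[OF A y]]] by simp
  qed
 next
  case (union A)
  have A: "A i \<in> sets (Y \<Otimes>\<^sub>M S)" for i using union by (auto simp: sets_pair_measure)
  show ?case
  proof (rule borel_measurable_LIMSEQ_real)
   fix n show "(%y. \<Sum>i<n. g (a y) (%x. indicator (A i) (y, x))) \<in> borel_measurable Y"
    by (intro borel_measurable_sum union)
  next
   fix y assume y: "y \<in> space Y"
   have U: "(\<Union>i. A i) \<in> sets (Y \<Otimes>\<^sub>M S)" using A by blast
   have fin: "(\<Sum>i<n. indicator (A i) (y, x)) = (indicator (\<Union>i<n. A i) (y, x) :: real)" for n x
    using union(1) by (intro indicator_UN_disjoint[symmetric]) (auto simp: disjoint_family_on_def)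
   have eq: "(\<Sum>i<n. g (a y) (%x. indicator (A i) (y, x))) = g (a y) (%x. \<Sum>i<n. indicator (A i) (y, x))" for n
    using goodf_sum[OF g a0[OF y], of "{..<n}" "%i x. indicator (A i) (y, x)"] bounded_by_bm[OF ind_bb[OF A y]] by simp
   have "(%n. g (a y) (%x. \<Sum>i<n. indicator (A i) (y, x))) \<longlonglongrightarrow> g (a y) (%x. indicator (\<Union>i. A i) (y, x))"
    unfolding fin
   proof (rule goodfD(3)[OF g a0[OF y]])
    show "bounded_by S 1 (%x. indicator (\<Union>i<n. A i) (y, x))" for n using A by (intro ind_bb y) auto
    show "bounded_by S 1 (%x. indicator (\<Union>i. A i) (y, x))" by (rule ind_bb[OF U y])
    show "(%n. indicator (\<Union>i<n. A i) (y, x) :: real) \<longlonglongrightarrow> indicator (\<Union>i. A i) (y, x)" for x by (rule LIMSEQ_indicator_UN)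
   qed
   then show "(%n. \<Sum>i<n. g (a y) (%x. indicator (A i) (y, x))) \<longlonglongrightarrow> g (a y) (%x. indicator (\<Union>i. A i) (y, x))"
    by (simp only: eq)
  qed
 qed
 have main: "(%y. g (a y) (%x. u (y, x))) \<in> borel_measurable Y"
  if u: "u \<in> borel_measurable (Y \<Otimes>\<^sub>M S)" "\<And>z. 0 <= u z" "\<And>z. z \<in> space (Y \<Otimes>\<^sub>M S) ==> u z <= C" for u :: "_ => real" and C
 proof -
  obtain f where f: "\<And>i. simple_function (Y \<Otimes>\<^sub>M S) (f i)" "\<And>z. z \<in> space (Y \<Otimes>\<^sub>M S) ==> (%i. f i z) \<longlonglongrightarrow> u z"
   "\<And>i z. z \<in> space (Y \<Otimes>\<^sub>M S) ==> norm (f i z) <= 2 * norm (u z)"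
   using borel_measurable_implies_sequence_metric[OF u(1), of 0] unfolding dist_norm diff_0_right by blast
  have fm: "f i \<in> borel_measurable (Y \<Otimes>\<^sub>M S)" for i by (rule borel_measurable_simple_function[OF f(1)])
  have C0: "bounded_by S \<bar>2 * C\<bar> (%x. f i (y, x))" "bounded_by S \<bar>2 * C\<bar> (%x. u (y, x))" if y: "y \<in> space Y" for i y
  proof -
   have "\<bar>f i (y, x)\<bar> <= \<bar>2 * C\<bar>" "\<bar>u (y, x)\<bar> <= \<bar>2 * C\<bar>" if x: "x \<in> space S" for x
   proof -
    have z: "(y, x) \<in> space (Y \<Otimes>\<^sub>M S)" using x y by (simp add: space_pair_measure)
    show "\<bar>f i (y, x)\<bar> <= \<bar>2 * C\<bar>" "\<bar>u (y, x)\<bar> <= \<bar>2 * C\<bar>"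
     using f(3)[OF z, of i] u(2)[of "(y, x)"] u(3)[OF z] by auto
   qed
   then show "bounded_by S \<bar>2 * C\<bar> (%x. f i (y, x))" "bounded_by S \<bar>2 * C\<bar> (%x. u (y, x))"
    using sec[OF fm y] sec[OF u(1) y] by (auto simp: bounded_by_def)
  qed
  show ?thesis
  proof (rule borel_measurable_LIMSEQ_real)
   fix i
   let ?V = "f i ` space (Y \<Otimes>\<^sub>M S)"
   have V: "finite ?V" using f(1) by (simp add: simple_function_def)
   have lev: "f i -` {v} \<inter> space (Y \<Otimes>\<^sub>M S) \<in> sets (Y \<Otimes>\<^sub>M S)" if "v \<in> ?V" for v using f(1)[of i] that by (auto simp: simple_function_def)
   have "(%y. \<Sum>v\<in>?V. v * g (a y) (%x. indicator (f i -` {v} \<inter> space (Y \<Otimes>\<^sub>M S)) (y, x))) \<in> borel_measurable Y"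
    by (intro borel_measurable_sum borel_measurable_times borel_measurable_const ind lev)
   then show "(%y. g (a y) (%x. f i (y, x))) \<in> borel_measurable Y"
   proof (rule measurable_cong[THEN iffD1, rotated])
    fix y assume y: "y \<in> space Y"
    let ?I = "%v x. v * indicator (f i -` {v} \<inter> space (Y \<Otimes>\<^sub>M S)) (y, x) :: real"
    have Ib: "(%x. indicator (f i -` {v} \<inter> space (Y \<Otimes>\<^sub>M S)) (y, x)) \<in> bounded_measurable S" if "v \<in> ?V" for v
     by (rule bounded_by_bm[OF ind_bb[OF lev[OF that] y]])
    have Ib': "?I v \<in> bounded_measurable S" if "v \<in> ?V" for v
     using Ib[OF that] by (intro bounded_measurableI[of _ _ "\<bar>v\<bar>"]) (auto simp: bounded_measurable_def indicator_def)
    have dec: "f i (y, x) = (\<Sum>v\<in>?V. ?I v x)" if x: "x \<in> space S" for x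
    proof -
     have z: "(y, x) \<in> space (Y \<Otimes>\<^sub>M S)" using x y by (simp add: space_pair_measure)
     have "(\<Sum>v\<in>?V. ?I v x) = (\<Sum>v\<in>?V. if v = f i (y, x) then v else 0)"
      using z by (intro sum.cong) (auto simp: indicator_def)
     then show ?thesis using V z by simp
    qed
    have "g (a y) (%x. f i (y, x)) = g (a y) (%x. \<Sum>v\<in>?V. ?I v x)"
     by (rule goodf_cong[OF g a0[OF y] bounded_by_bm[OF C0(1)[OF y]] conjunct2[OF goodf_sum[OF g a0[OF y] V Ib']] dec])
    also have "... = (\<Sum>v\<in>?V. v * g (a y) (%x. indicator (f i -` {v} \<inter> space (Y \<Otimes>\<^sub>M S)) (y, x)))"
     by (rule trans[OF conjunct1[OF goodf_sum[OF g a0[OF y] V Ib']] sum.cong[OF refl goodf_lin_rules(2)[OF g a0[OF y] Ib]]])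
    finally show "(\<Sum>v\<in>?V. v * g (a y) (%x. indicator (f i -` {v} \<inter> space (Y \<Otimes>\<^sub>M S)) (y, x))) = g (a y) (%x. f i (y, x))" by simp
   qed
  next
   fix y assume y: "y \<in> space Y"
   show "(%i. g (a y) (%x. f i (y, x))) \<longlonglongrightarrow> g (a y) (%x. u (y, x))"
    by (rule goodfD(3)[OF g a0[OF y] C0[OF y]]) (use f(2) y in \<open>auto simp: space_pair_measure\<close>)
  qed
 qed
 \<comment> \<open>Shifting by the bound makes H nonnegative on the space; the maximum with 0
   extends this to all points, as \<open>main\<close> demands.\<close>
 define C where "C = \<bar>B\<bar>"
 define u where "u = (%z. max 0 (H (fst z) (snd z) + C))"
 have um: "u \<in> borel_measurable (Y \<Otimes>\<^sub>M S)" unfolding u_def using H by measurable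
 have uH: "u (y, x) = H y x + C" if "y \<in> space Y" "x \<in> space S" for y x using B[OF that] by (auto simp: u_def C_def)
 have "(%y. g (a y) (%x. u (y, x)) - g (a y) (%_. C)) \<in> borel_measurable Y"
 proof (intro borel_measurable_diff main[OF um, of "2 * C"] const)
  show "0 <= u z" for z by (simp add: u_def)
  show "u z <= 2 * C" if "z \<in> space (Y \<Otimes>\<^sub>M S)" for z
   using that uH[of "fst z" "snd z"] B[of "fst z" "snd z"] by (auto simp: space_pair_measure C_def)
  show "(%_. C) \<in> bounded_measurable S" by (rule bounded_measurableI[of _ _ "\<bar>C\<bar>"]) auto
 qed
 then show ?thesis
 proof (rule measurable_cong[THEN iffD1, rotated])
  fix y assume y: "y \<in> space Y"
  have Hy: "H y \<in> bounded_measurable S"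
   using sec[OF H y] B[OF y] by (intro bounded_measurableI[of _ _ B]) auto
  have Cb: "(%_. C) \<in> bounded_measurable S" by (rule bounded_measurableI[of _ _ "\<bar>C\<bar>"]) auto
  have HC: "(%x. H y x + C) \<in> bounded_measurable S"
   using bounded_measurableD(1)[OF Hy] B[OF y] by (intro bounded_measurableI[of _ _ "B + \<bar>C\<bar>"]) (auto intro!: order_trans[OF abs_triangle_ineq] add_mono)
  have "(%x. u (y, x)) \<in> bounded_measurable S"
   using sec[OF um y] uH[OF y] HC by (auto simp: bounded_measurable_def image_def cong: bex_cong)
  then have "g (a y) (%x. u (y, x)) = g (a y) (%x. H y x + C)" by (rule goodf_cong[OF g a0[OF y] _ HC uH[OF y]])
  then show "g (a y) (%x. u (y, x)) - g (a y) (%_. C) = g (a y) (H y)"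
   using goodf_lin_rules(3)[OF g a0[OF y] Hy Cb] by simp
 qed
qed

text \<open>Simple functions within twice the bound of F approximate F pointwise, so by
  \<open>cont\<close> a functional is determined by its values on indicators.\<close>

lemma goodf_eqI:
 assumes g: "goodf S g" and h: "goodf S h" and t: "0 <= t"
  and eq: "\<And>A. A \<in> sets S ==> g t (indicator A) = h t (indicator A)" and F: "F \<in> bounded_measurable S"
 shows "g t F = h t F"
proof -
 obtain B where B: "bounded_by S B F" using bm_bounded_by[OF F] by blast
 have Fm: "F \<in> borel_measurable S" using B by (simp add: bounded_by_def)
 obtain f where f: "\<And>i. simple_function S (f i)" "\<And>z. z \<in> space S ==> (%i. f i z) \<longlonglongrightarrow> F z"
  "\<And>i z. z \<in> space S ==> norm (f i z) <= 2 * norm (F z)"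
  using borel_measurable_implies_sequence_metric[OF Fm, of 0] unfolding dist_norm diff_0_right by blast
 have bb: "bounded_by S (2 * B) (f i)" for i
 proof -
  have "\<bar>f i x\<bar> <= 2 * B" if "x \<in> space S" for x
  proof -
   have "\<bar>F x\<bar> <= B" using B that by (simp add: bounded_by_def)
   then show ?thesis using f(3)[OF that, of i] by simp
  qed
  then show ?thesis using B borel_measurable_simple_function[OF f(1)] by (simp add: bounded_by_def)
 qed
 have B2: "bounded_by S (2 * B) F"
 proof -
  have "\<bar>F x\<bar> <= 2 * B" if "x \<in> space S" for x
  proof -
   have "\<bar>F x\<bar> <= B" "0 <= B" using B that by (simp_all add: bounded_by_def)
   then show ?thesis by linarith
  qed
  then show ?thesis using B by (simp add: bounded_by_def)
 qed
 have "g t (f i) = h t (f i)" for i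
 proof -
  let ?V = "f i ` space S" and ?A = "%v. f i -` {v} \<inter> space S"
  have V: "finite ?V" and lev: "\<And>v. v \<in> ?V ==> ?A v \<in> sets S" using f(1)[of i] by (auto simp: simple_function_def)
  have Ib: "indicator (?A v) \<in> bounded_measurable S" if "v \<in> ?V" for v
   using lev[OF that] by (intro bounded_measurableI[of _ _ 1]) (auto simp: indicator_def)
  have Ib': "(%x. v * indicator (?A v) x) \<in> bounded_measurable S" if "v \<in> ?V" for v
   by (intro bounded_measurableI[of _ _ "\<bar>v\<bar>"] borel_measurable_times borel_measurable_const borel_measurable_indicator lev[OF that])
    (auto simp: indicator_def)
  have dec: "f i x = (\<Sum>v\<in>?V. v * indicator (?A v) x)" if x: "x \<in> space S" for x
  proof -
   have "(\<Sum>v\<in>?V. v * indicator (?A v) x) = (\<Sum>v\<in>?V. if v = f i x then v else 0)"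
    using x by (intro sum.cong) (auto simp: indicator_def)
   then show ?thesis using V x by simp
  qed
  have val: "k t (f i) = (\<Sum>v\<in>?V. v * k t (indicator (?A v)))" if k: "goodf S k" for k
  proof -
   have "k t (f i) = k t (%x. \<Sum>v\<in>?V. v * indicator (?A v) x)"
    by (rule goodf_cong[OF k t bounded_by_bm[OF bb] conjunct2[OF goodf_sum[OF k t V Ib']] dec])
   also have "... = (\<Sum>v\<in>?V. v * k t (indicator (?A v)))"
    by (rule trans[OF conjunct1[OF goodf_sum[OF k t V Ib']] sum.cong[OF refl goodf_lin_rules(2)[OF k t Ib]]])
   finally show ?thesis .
  qed
  show ?thesis unfolding val[OF g] val[OF h] using eq[OF lev] by simp
 qed
 then have "(%i. h t (f i)) \<longlonglongrightarrow> g t F" using goodf.cont[OF g t bb B2 f(2)] by simp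
 then show ?thesis using goodf.cont[OF h t bb B2 f(2)] LIMSEQ_unique by blast
qed

lemma integral_bounded_by:
 assumes "finite_measure \<mu>" "sets \<mu> = sets S" "bounded_by S B F"
 shows "integrable \<mu> F" "\<bar>\<integral>x. F x \<partial>\<mu>\<bar> <= measure \<mu> (space \<mu>) * B"
proof -
 interpret finite_measure \<mu> by fact
 have m: "F \<in> borel_measurable \<mu>" using assms(3) measurable_cong_sets[OF assms(2) refl] by (auto simp: bounded_by_def)
 have b: "\<bar>F x\<bar> <= B" if "x \<in> space \<mu>" for x using assms(3) that sets_eq_imp_space_eq[OF assms(2)] by (auto simp: bounded_by_def)
 show i: "integrable \<mu> F" by (rule integrable_const_bound[of _ B]) (use b m in auto)
 have "\<bar>\<integral>x. F x \<partial>\<mu>\<bar> <= (\<integral>x. \<bar>F x\<bar> \<partial>\<mu>)" by (rule integral_abs_bound)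
 also have "... <= (\<integral>x. B \<partial>\<mu>)" using i b by (intro integral_mono) auto
 finally show "\<bar>\<integral>x. F x \<partial>\<mu>\<bar> <= measure \<mu> (space \<mu>) * B" by simp
qed

lemma integral_bounded_tendsto:
 assumes "finite_measure \<mu>" "sets \<mu> = sets S" "\<And>n. bounded_by S B (Fn n)" "bounded_by S B F"
  "\<And>y. y \<in> space S ==> (%n. Fn n y) \<longlonglongrightarrow> F y"
 shows "(%n. \<integral>x. Fn n x \<partial>\<mu>) \<longlonglongrightarrow> (\<integral>x. F x \<partial>\<mu>)"
proof (rule integral_dominated_convergence[where w="%_. B"])
 interpret finite_measure \<mu> by fact
 have sp: "space \<mu> = space S" by (rule sets_eq_imp_space_eq[OF assms(2)])
 show "F \<in> borel_measurable \<mu>" "\<And>i. Fn i \<in> borel_measurable \<mu>"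
  using integral_bounded_by(1)[OF assms(1,2,4)] integral_bounded_by(1)[OF assms(1,2,3)] by auto
 show "integrable \<mu> (%_. B)" by simp
 show "AE x in \<mu>. (%i. Fn i x) \<longlonglongrightarrow> F x" using assms(5) sp by (intro AE_I2) auto
 show "AE x in \<mu>. norm (Fn i x) <= B" for i using assms(3)[of i] sp by (intro AE_I2) (auto simp: bounded_by_def)
qed

lemma goodf_integral:
 assumes fin: "finite_measure \<mu>" and sets: "sets \<mu> = sets S"
 shows "goodf S (%_ F. \<integral>x. F x \<partial>\<mu>)"
proof
 show "(\<integral>x. a * F x + G x \<partial>\<mu>) = a * (\<integral>x. F x \<partial>\<mu>) + (\<integral>x. G x \<partial>\<mu>)"
  if F: "F \<in> bounded_measurable S" and G: "G \<in> bounded_measurable S" for F G a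
 proof -
  obtain B B' where "bounded_by S B F" "bounded_by S B' G" using bm_bounded_by[OF F] bm_bounded_by[OF G] by blast
  then have "integrable \<mu> F" "integrable \<mu> G" by (auto intro: integral_bounded_by(1)[OF fin sets])
  then show ?thesis by simp
 qed
 show "(%n. \<integral>x. Fn n x \<partial>\<mu>) \<longlonglongrightarrow> (\<integral>x. F x \<partial>\<mu>)"
  if "\<And>n. bounded_by S B (Fn n)" "bounded_by S B F" "\<And>y. y \<in> space S ==> (%n. Fn n y) \<longlonglongrightarrow> F y" for B Fn F
  by (rule integral_bounded_tendsto[OF fin sets that])
 show "\<exists>C\<ge>0. \<forall>t F B. 0 <= t \<longrightarrow> t <= T \<longrightarrow> bounded_by S B F \<longrightarrow> \<bar>\<integral>x. F x \<partial>\<mu>\<bar> <= C * B" for T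
  using integral_bounded_by(2)[OF fin sets] by (intro exI[of _ "measure \<mu> (space \<mu>)"]) auto
qed simp

text \<open>Positivity makes the values on indicators a nonnegative set function, and
  \<open>cont\<close> applied to partial unions makes it countably additive. The resulting measure
  integrates every bounded function correctly by \<open>goodf_eqI\<close>.\<close>

lemma posf_representation:
 assumes g: "goodf S g" and p: "posf S g" and t: "0 <= t"
 shows "\<exists>\<mu>. finite_measure \<mu> \<and> sets \<mu> = sets S \<and> (\<forall>F\<in>bounded_measurable S. g t F = (\<integral>x. F x \<partial>\<mu>))"
proof -
 have ib: "bounded_by S 1 (indicator A)" if "A \<in> sets S" for A using that by (auto simp: bounded_by_def indicator_def)
 have pos: "0 <= g t (indicator A)" if "A \<in> sets S" for A
  using p bounded_by_bm[OF ib[OF that]] t by (auto simp: posf_def)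
 define \<mu> where "\<mu> = measure_of (space S) (sets S) (%A. ennreal (g t (indicator A)))"
 have sm: "sets \<mu> = sets S" by (simp add: \<mu>_def)
 have em: "emeasure \<mu> A = ennreal (g t (indicator A))" if A: "A \<in> sets S" for A
  unfolding \<mu>_def
 proof (rule emeasure_measure_of_sigma[OF _ _ _ A])
  show "sigma_algebra (space S) (sets S)" ..
  have "g t (indicator {}) = 0" using goodf_lin_rules(1)[OF g t] by (simp add: indicator_def[abs_def])
  then show "positive (sets S) (%A. ennreal (g t (indicator A)))" by (simp add: positive_def)
  show "countably_additive (sets S) (%A. ennreal (g t (indicator A)))"
  proof (rule countably_additiveI)
   fix A :: "nat => _" assume A: "range A \<subseteq> sets S" "disjoint_family A" "(\<Union>i. A i) \<in> sets S"
   have Ai: "A i \<in> sets S" for i using A by auto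
   have fin: "(\<Sum>i<n. indicator (A i) x) = (indicator (\<Union>i<n. A i) x :: real)" for n x
    using A(2) by (intro indicator_UN_disjoint[symmetric]) (auto simp: disjoint_family_on_def)
   have eq: "(\<Sum>i<n. g t (indicator (A i))) = g t (%x. \<Sum>i<n. indicator (A i) x)" for n
    using goodf_sum[OF g t, of "{..<n}" "%i. indicator (A i)"] bounded_by_bm[OF ib[OF Ai]] by simp
   have "(%n. g t (%x. indicator (\<Union>i<n. A i) x)) \<longlonglongrightarrow> g t (indicator (\<Union>i. A i))"
   proof (rule goodf.cont[OF g t])
    show "bounded_by S 1 (indicator (\<Union>i<n. A i))" for n using Ai by (intro ib) auto
    show "bounded_by S 1 (indicator (\<Union>i. A i))" by (rule ib[OF A(3)])
   qed (rule LIMSEQ_indicator_UN)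
   then have "(%i. g t (indicator (A i))) sums g t (indicator (\<Union>i. A i))"
    unfolding sums_def eq fin .
   then show "(\<Sum>i. ennreal (g t (indicator (A i)))) = ennreal (g t (indicator (\<Union>i. A i)))"
    using pos[OF Ai] by (intro suminf_ennreal_eq) auto
  qed
 qed
 have fm: "finite_measure \<mu>"
  by (rule finite_measureI) (simp add: em[OF sets.top] sets_eq_imp_space_eq[OF sm])
 have "g t F = (\<integral>x. F x \<partial>\<mu>)" if F: "F \<in> bounded_measurable S" for F
 proof (rule goodf_eqI[OF g goodf_integral[OF fm sm] t _ F])
  fix A assume A: "A \<in> sets S"
  then have "A \<in> sets \<mu>" "A \<inter> space \<mu> = A" using sm sets.sets_into_space[of A S] sets_eq_imp_space_eq[OF sm] by auto
  then show "g t (indicator A) = (\<integral>x. indicator A x \<partial>\<mu>)" using em[OF A] pos[OF A] by (simp add: measure_def)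
 qed
 then show ?thesis using fm sm by blast
qed

section \<open>Volterra operators with exponential damping\<close>

text \<open>The contribution of the last relevant ring: it happens at r with rate V, acts through A,
  and is followed by silence of rate k until t.\<close>

definition vol :: "real => real => (real => real => ('x => real) => 'y => real) => (real => ('y => real) => real) =>
  real => ('x => real) => real" where
 "vol V k A g t F = (\<integral>r. indicator {0..t} r * (V * exp (- (k * (t - r))) * g r (A r t F)) \<partial>lborel)"

context
 fixes S :: "'x measure" and S' :: "'y measure" and c V k :: real and A g
 assumes A: "op_ok S S' c A" and g: "goodf S' g" and V: "0 < V" and k: "0 <= k"
begin

lemma measurable_vol_integrand:
 assumes F: "F \<in> bounded_measurable S"
 shows "(%z. indicator {0..fst z} (snd z) * (V * exp (- (k * (fst z - snd z))) * g (snd z) (A (snd z) (fst z) F)))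
  \<in> borel_measurable (half_line \<Otimes>\<^sub>M lborel)"
proof -
 obtain B where B: "bounded_by S B F" using bm_bounded_by[OF F] by blast
 have 1: "(%y. g (snd y) (A (snd y) (fst y) F)) \<in> borel_measurable (half_line \<Otimes>\<^sub>M half_line)"
 proof (rule measurable_goodf[OF g measurable_snd, where B="c * B"])
  show "(%z. A (snd (fst z)) (fst (fst z)) F (snd z)) \<in> borel_measurable ((half_line \<Otimes>\<^sub>M half_line) \<Otimes>\<^sub>M S')"
   by (rule op_ok.meas[OF A F])
  show "\<bar>A (snd y) (fst y) F x\<bar> <= c * B" if "y \<in> space (half_line \<Otimes>\<^sub>M half_line)" "x \<in> space S'" for y x
   using that by (intro op_ok.bound[OF A B]) (auto simp: space_pair_measure space_restrict_space)
 qed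
 have 2: "(%z. (fst z, max 0 (snd z))) \<in> half_line \<Otimes>\<^sub>M lborel \<rightarrow>\<^sub>M half_line \<Otimes>\<^sub>M half_line"
 proof (rule measurable_Pair)
  show "(%z. max 0 (snd z)) \<in> half_line \<Otimes>\<^sub>M lborel \<rightarrow>\<^sub>M half_line"
   by (rule measurable_restrict_space2) (auto simp: measurable_lborel2)
 qed simp
 have 3: "(%z. g (max 0 (snd z)) (A (max 0 (snd z)) (fst z) F)) \<in> borel_measurable (half_line \<Otimes>\<^sub>M lborel)"
  using measurable_compose[OF 2 1] by simp
 have f: "fst \<in> borel_measurable (half_line \<Otimes>\<^sub>M lborel)"
  by (rule measurable_compose[OF measurable_fst]) (auto intro: measurable_restrict_space1)
 have s: "snd \<in> borel_measurable (half_line \<Otimes>\<^sub>M lborel)"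
  using measurable_snd[of half_line lborel] by (simp add: measurable_lborel2)
 have 4: "(%z. of_bool (0 <= snd z \<and> snd z <= fst z) * (V * exp (- (k * (fst z - snd z))) * g (max 0 (snd z)) (A (max 0 (snd z)) (fst z) F)))
  \<in> borel_measurable (half_line \<Otimes>\<^sub>M lborel)"
  using f s 3 by measurable
 show ?thesis
  by (rule measurable_cong[THEN iffD1, OF _ 4]) (auto simp: indicator_def)
qed

lemma vol_integrand_measurable:
 assumes F: "F \<in> bounded_measurable S" and t: "0 <= t"
 shows "(%r. indicator {0..t} r * (V * exp (- (k * (t - r))) * g r (A r t F))) \<in> borel_measurable borel"
proof -
 have "t \<in> space half_line" using t by (simp add: space_restrict_space)
 from measurable_compose[OF measurable_Pair1'[OF this] measurable_vol_integrand[OF F]]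
 show ?thesis by (simp add: measurable_lborel2)
qed

lemma vol_integrand_bound:
 assumes F: "bounded_by S B F" and r: "0 <= r" "r <= t"
  and C: "\<And>G B. bounded_by S' B G ==> \<bar>g r G\<bar> <= C * B"
 shows "\<bar>V * exp (- (k * (t - r))) * g r (A r t F)\<bar> <= V * (C * (c * B))"
proof -
 have b: "\<bar>g r (A r t F)\<bar> <= C * (c * B)" using r by (intro C op_ok_bounded_by[OF A F]) auto
 have "exp (- (k * (t - r))) <= 1" using k r by simp
 from mult_mono[OF this b] have "exp (- (k * (t - r))) * \<bar>g r (A r t F)\<bar> <= C * (c * B)" by simp
 from mult_left_mono[OF this, of V] show ?thesis using V by (simp add: abs_mult mult.assoc)
qed

lemma vol_integrable:
 assumes F: "F \<in> bounded_measurable S" and t: "0 <= t"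
 shows "integrable lborel (%r. indicator {0..t} r * (V * exp (- (k * (t - r))) * g r (A r t F)))"
proof -
 obtain B where B: "bounded_by S B F" using bm_bounded_by[OF F] by blast
 obtain C where C: "\<And>r G B. 0 <= r ==> r <= t ==> bounded_by S' B G ==> \<bar>g r G\<bar> <= C * B"
  using goodf.locally_bounded[OF g t] by blast
 show ?thesis
  by (rule integrable_Icc_bounded[OF vol_integrand_measurable[OF F t] vol_integrand_bound[OF B _ _ C]])
qed

text \<open>The integral of exp(-k (t - r)) exp(l r) over r in {0..t} is at most exp(l t) / (k + l).
  Damping and growth add up in the denominator; this is what compensates the norm c of A.\<close>

lemma vol_bound:
 assumes F: "bounded_by S B F" and t: "0 <= t" and l: "0 < k + l"
  and C: "\<And>r G B. 0 <= r ==> bounded_by S' B G ==> \<bar>g r G\<bar> <= D * exp (l * r) * B"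
 shows "\<bar>vol V k A g t F\<bar> <= V * c / (k + l) * D * exp (l * t) * B"
proof -
 have b: "\<bar>V * exp (- (k * (t - r))) * g r (A r t F)\<bar> <= (V * exp (- (k * t)) * D * c * B) * exp ((k + l) * r)" if r: "0 <= r" "r <= t" for r
 proof -
  have "\<bar>g r (A r t F)\<bar> <= D * exp (l * r) * (c * B)" using r t by (intro C op_ok_bounded_by[OF A F]) auto
  then have "V * exp (- (k * (t - r))) * \<bar>g r (A r t F)\<bar> <= V * exp (- (k * (t - r))) * (D * exp (l * r) * (c * B))"
   using V by (intro mult_left_mono) auto
  also have "... = V * D * c * B * (exp (- (k * (t - r))) * exp (l * r))" by simp
  also have "exp (- (k * (t - r))) * exp (l * r) = exp (- (k * t)) * exp ((k + l) * r)"
   by (simp add: exp_add[symmetric] algebra_simps)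
  finally show ?thesis using V by (simp add: abs_mult mult_ac)
 qed
 have D0: "0 <= V * exp (- (k * t)) * D * c * B" using b[of 0] t by simp
 have "\<bar>vol V k A g t F\<bar> <= (V * exp (- (k * t)) * D * c * B) * ((exp ((k + l) * t) - 1) / (k + l))"
  unfolding vol_def by (rule integral_Icc_exp_bound[OF vol_integrand_measurable[OF bounded_by_bm[OF F] t] t l b])
 also have "... <= (V * exp (- (k * t)) * D * c * B) * (exp ((k + l) * t) / (k + l))"
  using l by (intro mult_left_mono D0 divide_right_mono) auto
 also have "... = V * c / (k + l) * D * (exp (- (k * t)) * exp ((k + l) * t)) * B" by simp
 also have "exp (- (k * t)) * exp ((k + l) * t) = exp (l * t)" by (simp add: exp_add[symmetric] algebra_simps)
 finally show ?thesis .
qed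

lemma vol_goodf: "goodf S (vol V k A g)"
proof
 fix F G a and t :: real assume FG: "F \<in> bounded_measurable S" "G \<in> bounded_measurable S" and t: "0 <= t"
 have "vol V k A g t (%y. a * F y + G y) = (\<integral>r. a * (indicator {0..t} r * (V * exp (- (k * (t - r))) * g r (A r t F)))
   + indicator {0..t} r * (V * exp (- (k * (t - r))) * g r (A r t G)) \<partial>lborel)"
  unfolding vol_def
 proof (rule Bochner_Integration.integral_cong[OF refl])
  fix r
  have "g r (A r t (%y. a * F y + G y)) = a * g r (A r t F) + g r (A r t G)" if r: "0 <= r"
  proof -
   obtain B1 B2 where B: "bounded_by S B1 F" "bounded_by S B2 G" using bm_bounded_by FG by blast
   have bb: "bounded_by S (\<bar>a\<bar> * B1 + B2) (%y. a * F y + G y)"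
    unfolding bounded_by_def
   proof (intro conjI ballI)
    fix y assume "y \<in> space S"
    then have "\<bar>F y\<bar> <= B1" "\<bar>G y\<bar> <= B2" using B by (auto simp: bounded_by_def)
    then have "\<bar>a\<bar> * \<bar>F y\<bar> + \<bar>G y\<bar> <= \<bar>a\<bar> * B1 + B2" by (intro add_mono mult_left_mono) auto
    then show "\<bar>a * F y + G y\<bar> <= \<bar>a\<bar> * B1 + B2" using abs_triangle_ineq[of "a * F y" "G y"] by (simp add: abs_mult)
   qed (use B in \<open>auto simp: bounded_by_def\<close>)
   have m: "A r t F \<in> bounded_measurable S'" "A r t G \<in> bounded_measurable S'" "A r t (%y. a * F y + G y) \<in> bounded_measurable S'"
    using op_ok_bounded_by[OF A _ r t] B bb by (auto intro!: bounded_by_bm)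
   then have "(%x. a * A r t F x + A r t G x) \<in> bounded_measurable S'"
    by (subst bounded_measurable_def)
     (use m in \<open>auto simp: bounded_measurable_def op_ok.lin[OF A FG r t, symmetric] image_def cong: bex_cong\<close>)
   then have "g r (A r t (%y. a * F y + G y)) = g r (%x. a * A r t F x + A r t G x)"
    by (intro goodf_cong[OF g r m(3)] op_ok.lin[OF A FG r t])
   then show ?thesis using goodf.lin[OF g m(1,2) r] by simp
  qed
  then show "indicator {0..t} r * (V * exp (- (k * (t - r))) * g r (A r t (%y. a * F y + G y))) =
   a * (indicator {0..t} r * (V * exp (- (k * (t - r))) * g r (A r t F))) + indicator {0..t} r * (V * exp (- (k * (t - r))) * g r (A r t G))"
   by (auto simp: indicator_def algebra_simps)
 qed
 also have "... = a * vol V k A g t F + vol V k A g t G"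
  unfolding vol_def using vol_integrable[OF FG(1) t] vol_integrable[OF FG(2) t] by simp
 finally show "vol V k A g t (%y. a * F y + G y) = a * vol V k A g t F + vol V k A g t G" .
next
 fix F assume F: "F \<in> bounded_measurable S"
 show "(%t. vol V k A g t F) \<in> borel_measurable half_line"
  unfolding vol_def using lborel.borel_measurable_lebesgue_integral[of "%t r. indicator {0..t} r * (V * exp (- (k * (t - r))) * g r (A r t F))" half_line]
   measurable_vol_integrand[OF F] by (simp add: case_prod_beta')
next
 fix t :: real and B Fn F
 assume t: "0 <= t" and Fn: "\<And>n. bounded_by S B (Fn n)" and F: "bounded_by S B F" and lim: "\<And>y. y \<in> space S ==> (%n. Fn n y) \<longlonglongrightarrow> F y"
 obtain C where C: "\<And>r G B. 0 <= r ==> r <= t ==> bounded_by S' B G ==> \<bar>g r G\<bar> <= C * B"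
  using goodf.locally_bounded[OF g t] by blast
 show "(%n. vol V k A g t (Fn n)) \<longlonglongrightarrow> vol V k A g t F"
  unfolding vol_def
 proof (rule integral_dominated_convergence[where w="%r. indicator {0..t} r * (V * (C * (c * B)))"])
  show "(%r. indicator {0..t} r * (V * exp (- (k * (t - r))) * g r (A r t F))) \<in> borel_measurable lborel"
   "\<And>n. (%r. indicator {0..t} r * (V * exp (- (k * (t - r))) * g r (A r t (Fn n)))) \<in> borel_measurable lborel"
   using vol_integrand_measurable[OF bounded_by_bm[OF F] t] vol_integrand_measurable[OF bounded_by_bm[OF Fn] t] by (simp_all add: measurable_lborel2)
  show "integrable lborel (%r. indicator {0..t} r * (V * (C * (c * B))))"
   by (rule integrable_Icc_bounded[where B="\<bar>V * (C * (c * B))\<bar>"]) auto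
  show "AE r in lborel. (%n. indicator {0..t} r * (V * exp (- (k * (t - r))) * g r (A r t (Fn n)))) \<longlonglongrightarrow>
    indicator {0..t} r * (V * exp (- (k * (t - r))) * g r (A r t F))"
  proof (rule AE_I2)
   fix r :: real
   have "(%n. g r (A r t (Fn n))) \<longlonglongrightarrow> g r (A r t F)" if r: "0 <= r"
    by (rule goodf.cont[OF g r op_ok_bounded_by[OF A Fn r t] op_ok_bounded_by[OF A F r t] op_ok.cont[OF A Fn F lim r t]])
   then show "(%n. indicator {0..t} r * (V * exp (- (k * (t - r))) * g r (A r t (Fn n)))) \<longlonglongrightarrow>
    indicator {0..t} r * (V * exp (- (k * (t - r))) * g r (A r t F))"
    by (cases "0 <= r") (auto intro!: tendsto_mult_left simp: indicator_def)
  qed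
  show "AE r in lborel. norm (indicator {0..t} r * (V * exp (- (k * (t - r))) * g r (A r t (Fn n)))) <= indicator {0..t} r * (V * (C * (c * B)))" for n
   using vol_integrand_bound[OF Fn _ _ C] by (intro AE_I2) (auto simp: indicator_def)
 qed
next
 fix T :: real assume T: "0 <= T"
 obtain C where C0: "0 <= C" and C: "\<And>r G B. 0 <= r ==> r <= T ==> bounded_by S' B G ==> \<bar>g r G\<bar> <= C * B"
  using goodf.locally_bounded[OF g T] by blast
 have "\<bar>vol V k A g t F\<bar> <= (T * (V * (C * c))) * B" if t: "0 <= t" "t <= T" and F: "bounded_by S B F" for t F B
 proof -
  have B0: "0 <= V * (C * (c * B))" using F C0 V op_ok.c_nonneg[OF A] by (simp add: bounded_by_def)
  have "\<bar>vol V k A g t F\<bar> <= (\<integral>r. \<bar>indicator {0..t} r * (V * exp (- (k * (t - r))) * g r (A r t F))\<bar> \<partial>lborel)"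
   unfolding vol_def by (rule integral_abs_bound)
  also have "... <= (\<integral>r. indicator {0..t} r * (V * (C * (c * B))) \<partial>lborel)"
  proof (rule integral_mono)
   show "integrable lborel (%r. indicator {0..t} r * (V * (C * (c * B))))"
    by (rule integrable_Icc_bounded[where B="\<bar>V * (C * (c * B))\<bar>"]) auto
   show "\<bar>indicator {0..t} r * (V * exp (- (k * (t - r))) * g r (A r t F))\<bar> <= indicator {0..t} r * (V * (C * (c * B)))" for r
    using vol_integrand_bound[OF F, of r t C] C[of r] t by (auto simp: indicator_def)
  qed (intro integrable_abs vol_integrable[OF bounded_by_bm[OF F] t(1)])
  also have "... = t * (V * (C * (c * B)))" using t by simp
  also have "... <= T * (V * (C * (c * B)))" using t B0 by (intro mult_right_mono)
  finally show ?thesis by (simp add: mult_ac)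
 qed
 moreover have "0 <= T * (V * (C * c))" using T V C0 op_ok.c_nonneg[OF A] by simp
 ultimately show "\<exists>C\<ge>0. \<forall>t F B. 0 <= t \<longrightarrow> t <= T \<longrightarrow> bounded_by S B F \<longrightarrow> \<bar>vol V k A g t F\<bar> <= C * B" by blast
qed

lemma vol_posf:
 assumes p: "posf S' g"
 shows "posf S (vol V k A g)"
 unfolding posf_def
proof (intro ballI allI impI)
 fix F and t :: real assume F: "F \<in> bounded_measurable S" and t: "0 <= t" and pos: "\<forall>y\<in>space S. 0 <= F y"
 obtain B where B: "bounded_by S B F" using bm_bounded_by[OF F] by blast
 have "0 <= g r (A r t F)" if r: "0 <= r" for r
  using p bounded_by_bm[OF op_ok_bounded_by[OF A B r t]] op_ok.nonneg[OF A F r t] pos r unfolding posf_def by blast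
 then show "0 <= vol V k A g t F" unfolding vol_def using V by (intro Bochner_Integration.integral_nonneg) (auto simp: indicator_def)
qed

end

lemma vol_lin:
 assumes A: "op_ok S S' c A" and f: "goodf S' f" and g: "goodf S' g" and V: "0 < V" and k: "0 <= k"
  and t: "0 <= t" and F: "F \<in> bounded_measurable S"
 shows "vol V k A (%t F. a * f t F + g t F) t F = a * vol V k A f t F + vol V k A g t F"
proof -
 have "vol V k A (%t F. a * f t F + g t F) t F = (\<integral>r. a * (indicator {0..t} r * (V * exp (- (k * (t - r))) * f r (A r t F)))
   + indicator {0..t} r * (V * exp (- (k * (t - r))) * g r (A r t F)) \<partial>lborel)"
  unfolding vol_def by (rule Bochner_Integration.integral_cong) (simp_all add: algebra_simps)
 also have "... = a * vol V k A f t F + vol V k A g t F"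
  unfolding vol_def using vol_integrable[OF A f V k F t] vol_integrable[OF A g V k F t] by simp
 finally show ?thesis .
qed

lemma vol_cong:
 assumes A: "op_ok S S' c A" and t: "0 <= t" and F: "F \<in> bounded_measurable S"
  and eq: "\<And>r G. 0 <= r ==> G \<in> bounded_measurable S' ==> f r G = g r G"
 shows "vol V k A f t F = vol V k A g t F"
proof -
 obtain B where B: "bounded_by S B F" using bm_bounded_by[OF F] by blast
 have "f r (A r t F) = g r (A r t F)" if "0 <= r" for r
  by (rule eq[OF that bounded_by_bm[OF op_ok_bounded_by[OF A B that t]]])
 then show ?thesis unfolding vol_def
  by (intro Bochner_Integration.integral_cong refl) (auto simp: indicator_def)
qed

lemma goodf_comb:
 assumes f: "goodf S f" and g: "goodf S g"
 shows "goodf S (%t F. a * f t F + g t F)"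
proof
 show "a * f t (%y. b * F y + G y) + g t (%y. b * F y + G y) = b * (a * f t F + g t F) + (a * f t G + g t G)"
  if "F \<in> bounded_measurable S" "G \<in> bounded_measurable S" "0 <= t" for F G b and t :: real
  using goodf.lin[OF f that, of b] goodf.lin[OF g that, of b] by (simp add: algebra_simps)
 show "(%t. a * f t F + g t F) \<in> borel_measurable half_line" if "F \<in> bounded_measurable S" for F
  using goodf.meas[OF f that] goodf.meas[OF g that] by (intro borel_measurable_add borel_measurable_times) auto
 show "(%n. a * f t (Fn n) + g t (Fn n)) \<longlonglongrightarrow> a * f t F + g t F"
  if "0 <= t" "\<And>n. bounded_by S B (Fn n)" "bounded_by S B F" "\<And>y. y \<in> space S ==> (%n. Fn n y) \<longlonglongrightarrow> F y" for t B Fn F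
  by (intro tendsto_add tendsto_mult_left goodf.cont[OF f that] goodf.cont[OF g that])
 fix T :: real assume T: "0 <= T"
 obtain C where C: "0 <= C" "\<And>t F B. 0 <= t ==> t <= T ==> bounded_by S B F ==> \<bar>f t F\<bar> <= C * B"
  using goodf.locally_bounded[OF f T] by blast
 obtain D where D: "0 <= D" "\<And>t F B. 0 <= t ==> t <= T ==> bounded_by S B F ==> \<bar>g t F\<bar> <= D * B"
  using goodf.locally_bounded[OF g T] by blast
 have "\<bar>a * f t F + g t F\<bar> <= (\<bar>a\<bar> * C + D) * B" if h: "0 <= t" "t <= T" "bounded_by S B F" for t F B
 proof -
  have "\<bar>a * f t F + g t F\<bar> <= \<bar>a\<bar> * \<bar>f t F\<bar> + \<bar>g t F\<bar>" using abs_triangle_ineq[of "a * f t F" "g t F"] by (simp add: abs_mult)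
  also have "... <= \<bar>a\<bar> * (C * B) + D * B" by (intro add_mono mult_left_mono C(2)[OF h] D(2)[OF h]) simp
  finally show ?thesis by (simp add: algebra_simps)
 qed
 moreover have "0 <= \<bar>a\<bar> * C + D" using C(1) D(1) by simp
 ultimately show "\<exists>C\<ge>0. \<forall>t F B. 0 <= t \<longrightarrow> t <= T \<longrightarrow> bounded_by S B F \<longrightarrow> \<bar>a * f t F + g t F\<bar> <= C * B" by blast
qed

lemma goodf_zero: "goodf S (%_ _. 0)"
 by standard auto

section \<open>The abstract hierarchy and its weighted norms\<close>

lemma pochhammer_one_le: "1 <= x ==> 1 <= pochhammer (x :: real) n"
proof (induction n)
 case (Suc n)
 have "1 * 1 <= pochhammer x n * (x + real n)" using Suc by (intro mult_mono) auto
 then show ?case by (simp add: pochhammer_Suc)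
qed simp

lemma pochhammer_mono_right:
 assumes "1 <= (x :: real)" "m <= n"
 shows "pochhammer x m <= pochhammer x n"
 using assms(2)
proof (induction n rule: dec_induct)
 case (step n)
 have "pochhammer x n * 1 <= pochhammer x n * (x + real n)"
  using pochhammer_one_le[OF assms(1), of n] assms(1) by (intro mult_left_mono) auto
 then show ?case using step by (simp add: pochhammer_Suc)
qed simp

lemma power_le_pochhammer:
 assumes "1 <= (x :: real)"
 shows "x ^ n <= pochhammer x n"
proof (induction n)
 case (Suc n)
 have "x ^ n * x <= pochhammer x n * (x + real n)"
  using Suc assms pochhammer_one_le[OF assms, of n] by (intro mult_mono) auto
 then show ?case by (simp add: pochhammer_Suc mult.commute)
qed simp

type_synonym 'x family = "nat => real => ('x => real) => real"

definition comb :: "real => 'x family => 'x family =>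
  'x family" where
 "comb a f g = (%q t F. a * f q t F + g q t F)"

text \<open>The bound for the Neumann series of \<open>T\<close>: by \<open>Tpow_bound\<close> its
  m-th term carries the factor 1 / (m + 1)^2.\<close>

definition basel :: real where "basel = (\<Sum>m. 1 / real (Suc m) ^ 2)"

lemma summable_basel: "summable (%m. 1 / real (Suc m) ^ 2)"
 using inverse_power_summable[of 2, where 'a=real] by (subst summable_Suc_iff) (simp add: inverse_eq_divide)

lemma basel_nonneg: "0 <= basel"
 unfolding basel_def by (intro suminf_nonneg summable_basel) simp

text \<open>The moment equations stripped of the particle system. \<open>up q\<close> has norm q
  because each sampled particle may ring; \<open>ins q\<close> has norm q squared because both the
  ringing particle and its target are sampled.\<close>

locale hierarchy =
 fixes X :: "nat => 'x measure" and V :: real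
  and up ins :: "nat => real => real => ('x => real) => 'x => real"
 assumes V: "0 < V"
  and up_ok: "op_ok (X q) (X (Suc q)) (real q) (up q)"
  and ins_ok: "op_ok (X q) (X q) (real q * real q) (ins q)"
begin

definition T :: "'x family => 'x family" where
 "T g = (%q. vol V (real q * V) (up q) (g (Suc q)))"

definition I :: "'x family => 'x family" where
 "I g = (%q. vol V (real q * V) (ins q) (g q))"

text \<open>The correction that arises from the q / N in the coefficient 1 - q / N of the
  level-raising term.\<close>

definition qT :: "'x family => 'x family" where
 "qT g = (%q t F. real q * T g q t F)"

definition good :: "'x family => bool" where
 "good g \<longleftrightarrow> (\<forall>q\<ge>1. goodf (X q) (g q))"

definition pos :: "'x family => bool" where
 "pos g \<longleftrightarrow> (\<forall>q\<ge>1. posf (X q) (g q))"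

definition eqv :: "'x family => 'x family => bool" where
 "eqv f g \<longleftrightarrow> (\<forall>q\<ge>1. \<forall>t\<ge>0. \<forall>F\<in>bounded_measurable (X q). f q t F = g q t F)"

text \<open>The coefficient d may vary with the level. A constant d gives the norm of the overview;
  a decaying one arises in \<open>nb_weight\<close> and is what makes powers of \<open>T\<close>
  small.\<close>

definition nb :: "nat => (nat => real) => 'x family => bool" where
 "nb \<kappa> d g \<longleftrightarrow> (\<forall>q\<ge>1. \<forall>t\<ge>0. \<forall>F B. bounded_by (X q) B F \<longrightarrow>
   \<bar>g q t F\<bar> <= d q * pochhammer (real q) \<kappa> * exp (real \<kappa> * V * t) * B)"

lemma nbD: "nb \<kappa> d g ==> 1 <= q ==> 0 <= t ==> bounded_by (X q) B F ==>
  \<bar>g q t F\<bar> <= d q * pochhammer (real q) \<kappa> * exp (real \<kappa> * V * t) * B"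
 by (simp add: nb_def)

lemma nbI: "(\<And>q t F B. 1 <= q ==> 0 <= t ==> bounded_by (X q) B F ==>
  \<bar>g q t F\<bar> <= d q * pochhammer (real q) \<kappa> * exp (real \<kappa> * V * t) * B) ==> nb \<kappa> d g"
 by (simp add: nb_def)

lemma eqvD: "eqv f g ==> 1 <= q ==> 0 <= t ==> F \<in> bounded_measurable (X q) ==> f q t F = g q t F"
 by (simp add: eqv_def)

lemma eqvI: "(\<And>q t F. 1 <= q ==> 0 <= t ==> F \<in> bounded_measurable (X q) ==> f q t F = g q t F) ==> eqv f g"
 by (simp add: eqv_def)

lemma goodD: "good g ==> 1 <= q ==> goodf (X q) (g q)"
 by (simp add: good_def)

lemma qV: "0 <= real q * V" using V by simp

lemma good_T: "good g ==> good (T g)"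
 by (simp add: good_def T_def vol_goodf[OF up_ok _ V qV])

lemma good_I: "good g ==> good (I g)"
 by (simp add: good_def I_def vol_goodf[OF ins_ok _ V qV])

lemma good_comb: "good f ==> good g ==> good (comb a f g)"
 by (simp add: good_def comb_def goodf_comb)

lemma good_qT:
 assumes "good g"
 shows "good (qT g)"
 unfolding good_def qT_def
proof (intro allI impI)
 fix q :: nat assume "1 <= q"
 from goodf_comb[OF goodD[OF good_T[OF assms] this] goodf_zero, of "real q"]
 show "goodf (X q) (%t F. real q * T g q t F)" by simp
qed

lemma pos_T: "good g ==> pos g ==> pos (T g)"
 by (simp add: good_def pos_def T_def vol_posf[OF up_ok _ V qV])

lemma pos_I: "good g ==> pos g ==> pos (I g)"
 by (simp add: good_def pos_def I_def vol_posf[OF ins_ok _ V qV])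

lemma pos_qT: "good g ==> pos g ==> pos (qT g)"
 using pos_T[of g] by (simp add: pos_def posf_def qT_def)

lemma pos_comb: "pos f ==> pos g ==> 0 <= a ==> pos (comb a f g)"
 by (simp add: pos_def posf_def comb_def)

lemma T_comb: "good f ==> good g ==> 1 <= q ==> 0 <= t ==> F \<in> bounded_measurable (X q) ==>
  T (comb a f g) q t F = a * T f q t F + T g q t F"
 by (simp add: good_def T_def comb_def vol_lin[OF up_ok _ _ V qV])

lemma I_comb: "good f ==> good g ==> 1 <= q ==> 0 <= t ==> F \<in> bounded_measurable (X q) ==>
  I (comb a f g) q t F = a * I f q t F + I g q t F"
 by (simp add: good_def I_def comb_def vol_lin[OF ins_ok _ _ V qV])

lemma T_cong: "eqv f g ==> eqv (T f) (T g)"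
 unfolding T_def by (intro eqvI vol_cong[OF up_ok]) (auto simp: eqv_def)

text \<open>For damping q V, growth \<kappa> V and norm q, \<open>vol_bound\<close> yields the
  factor q / (q + \<kappa>). The weight at level q + 1 satisfies q (q + 1)_\<kappa> = (q + \<kappa>)
  (q)_\<kappa>, so the factor cancels exactly and only d moves down by one level. This cancellation
  dictates the choice of the weight.\<close>

lemma nb_T:
 assumes g: "good g" and n: "nb \<kappa> d g"
 shows "nb \<kappa> (%q. d (Suc q)) (T g)"
proof (rule nbI)
 fix q F B and t :: real assume q: "1 <= q" and t: "0 <= t" and F: "bounded_by (X q) B F"
 have l: "0 < real q * V + real \<kappa> * V" using q V by (simp add: add_pos_nonneg)
 have C: "\<bar>g (Suc q) r G\<bar> <= d (Suc q) * pochhammer (real q + 1) \<kappa> * exp (real \<kappa> * V * r) * B'"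
  if "0 <= r" "bounded_by (X (Suc q)) B' G" for r G B'
  using nbD[OF n _ that, simplified] by (simp add: add.commute)
 have "\<bar>T g q t F\<bar> <= V * real q / (real q * V + real \<kappa> * V) * (d (Suc q) * pochhammer (real q + 1) \<kappa>) * exp (real \<kappa> * V * t) * B"
  unfolding T_def by (rule vol_bound[OF up_ok goodD[OF g] V qV F t l C]) simp
 also have "V * real q / (real q * V + real \<kappa> * V) * (d (Suc q) * pochhammer (real q + 1) \<kappa>) =
   d (Suc q) * (real q * pochhammer (real q + 1) \<kappa> / (real q + real \<kappa>))"
  using V by (simp add: distrib_right[symmetric])
 also have "real q * pochhammer (real q + 1) \<kappa> = pochhammer (real q) \<kappa> * (real q + real \<kappa>)"
  using pochhammer_rec[of "real q" \<kappa>] pochhammer_Suc[of "real q" \<kappa>] by simp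
 finally show "\<bar>T g q t F\<bar> <= d (Suc q) * pochhammer (real q) \<kappa> * exp (real \<kappa> * V * t) * B"
  using q by simp
qed

lemma nb_mono:
 assumes n: "nb \<kappa> d g" and k: "\<kappa> <= \<kappa>'" and d: "\<And>q. 1 <= q ==> d q <= d' q" "\<And>q. 1 <= q ==> 0 <= d' q"
 shows "nb \<kappa>' d' g"
proof (rule nbI)
 fix q F B and t :: real assume q: "1 <= q" and t: "0 <= t" and F: "bounded_by (X q) B F"
 have B: "0 <= B" using F by (simp add: bounded_by_def)
 have q1: "1 <= real q" using q by simp
 have p: "pochhammer (real q) \<kappa> <= pochhammer (real q) \<kappa>'" "0 <= pochhammer (real q) \<kappa>"
  using pochhammer_mono_right[OF q1 k] pochhammer_one_le[OF q1, of \<kappa>] by auto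
 have e: "exp (real \<kappa> * V * t) <= exp (real \<kappa>' * V * t)" using k V t by (simp add: mult_right_mono)
 have "d q * pochhammer (real q) \<kappa> * exp (real \<kappa> * V * t) * B <= d' q * pochhammer (real q) \<kappa>' * exp (real \<kappa>' * V * t) * B"
  using d[OF q] p e B by (intro mult_right_mono mult_mono) auto
 then show "\<bar>g q t F\<bar> <= d' q * pochhammer (real q) \<kappa>' * exp (real \<kappa>' * V * t) * B" using nbD[OF n q t F] by linarith
qed

text \<open>The factor is q^2 / (q + \<kappa>), which is at most q + \<kappa>, the next factor of
  the rising factorial; this is where one order of \<kappa> is spent.\<close>

lemma nb_I:
 assumes g: "good g" and n: "nb \<kappa> (%_. D) g" and D: "0 <= D"
 shows "nb (Suc \<kappa>) (%_. D) (I g)"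
proof (rule nbI)
 fix q F B and t :: real assume q: "1 <= q" and t: "0 <= t" and F: "bounded_by (X q) B F"
 have B: "0 <= B" using F by (simp add: bounded_by_def)
 have q1: "1 <= real q" using q by simp
 have l: "0 < real q * V + real \<kappa> * V" using q V by (simp add: add_pos_nonneg)
 have p0: "0 <= pochhammer (real q) \<kappa>" using pochhammer_one_le[OF q1, of \<kappa>] by simp
 have "\<bar>I g q t F\<bar> <= V * (real q * real q) / (real q * V + real \<kappa> * V) * (D * pochhammer (real q) \<kappa>) * exp (real \<kappa> * V * t) * B"
  unfolding I_def by (rule vol_bound[OF ins_ok goodD[OF g q] V qV F t l nbD[OF n q]])
 also have "V * (real q * real q) / (real q * V + real \<kappa> * V) = real q * real q / (real q + real \<kappa>)"
  using V l q by (simp add: field_simps)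
 also have "real q * real q / (real q + real \<kappa>) * (D * pochhammer (real q) \<kappa>) * exp (real \<kappa> * V * t) * B
   <= (real q + real \<kappa>) * (D * pochhammer (real q) \<kappa>) * exp (real (Suc \<kappa>) * V * t) * B"
 proof (intro mult_right_mono mult_mono)
  have "real q * real q <= (real q + real \<kappa>) * (real q + real \<kappa>)" by (intro mult_mono) auto
  then show "real q * real q / (real q + real \<kappa>) <= real q + real \<kappa>" using q by (simp add: divide_le_eq)
  show "exp (real \<kappa> * V * t) <= exp (real (Suc \<kappa>) * V * t)" using V t by (simp add: mult_right_mono)
 qed (use D p0 B q in auto)
 also have "... = D * pochhammer (real q) (Suc \<kappa>) * exp (real (Suc \<kappa>) * V * t) * B" by (simp add: pochhammer_Suc)
 finally show "\<bar>I g q t F\<bar> <= D * pochhammer (real q) (Suc \<kappa>) * exp (real (Suc \<kappa>) * V * t) * B" .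
qed

text \<open>The prefactor q is at most the next factor q + \<kappa> of the rising factorial.\<close>

lemma nb_qT:
 assumes g: "good g" and n: "nb \<kappa> (%_. D) g" and D: "0 <= D"
 shows "nb (Suc \<kappa>) (%_. D) (qT g)"
proof (rule nbI)
 fix q F B and t :: real assume q: "1 <= q" and t: "0 <= t" and F: "bounded_by (X q) B F"
 have B: "0 <= B" using F by (simp add: bounded_by_def)
 have q1: "1 <= real q" using q by simp
 have p0: "0 <= pochhammer (real q) \<kappa>" using pochhammer_one_le[OF q1, of \<kappa>] by simp
 have "\<bar>qT g q t F\<bar> = real q * \<bar>T g q t F\<bar>" by (simp add: qT_def abs_mult)
 also have "... <= real q * (D * pochhammer (real q) \<kappa> * exp (real \<kappa> * V * t) * B)"
  by (intro mult_left_mono nbD[OF nb_T[OF g n] q t F]) simp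
 also have "... = real q * (D * pochhammer (real q) \<kappa>) * exp (real \<kappa> * V * t) * B" by simp
 also have "... <= (real q + real \<kappa>) * (D * pochhammer (real q) \<kappa>) * exp (real (Suc \<kappa>) * V * t) * B"
 proof (intro mult_right_mono mult_mono)
  show "exp (real \<kappa> * V * t) <= exp (real (Suc \<kappa>) * V * t)" using V t by (simp add: mult_right_mono)
 qed (use D p0 B q in auto)
 also have "... = D * pochhammer (real q) (Suc \<kappa>) * exp (real (Suc \<kappa>) * V * t) * B" by (simp add: pochhammer_Suc)
 finally show "\<bar>qT g q t F\<bar> <= D * pochhammer (real q) (Suc \<kappa>) * exp (real (Suc \<kappa>) * V * t) * B" .
qed

lemma nb_comb:
 assumes f: "nb \<kappa> d f" and g: "nb \<kappa> d' g"
 shows "nb \<kappa> (%q. \<bar>a\<bar> * d q + d' q) (comb a f g)"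
proof (rule nbI)
 fix q F B and t :: real assume h: "1 <= q" "0 <= t" "bounded_by (X q) B F"
 have "\<bar>comb a f g q t F\<bar> <= \<bar>a\<bar> * \<bar>f q t F\<bar> + \<bar>g q t F\<bar>"
  unfolding comb_def using abs_triangle_ineq[of "a * f q t F" "g q t F"] by (simp add: abs_mult)
 also have "... <= \<bar>a\<bar> * (d q * pochhammer (real q) \<kappa> * exp (real \<kappa> * V * t) * B) + d' q * pochhammer (real q) \<kappa> * exp (real \<kappa> * V * t) * B"
  by (intro add_mono mult_left_mono nbD[OF f h] nbD[OF g h]) simp
 finally show "\<bar>comb a f g q t F\<bar> <= (\<bar>a\<bar> * d q + d' q) * pochhammer (real q) \<kappa> * exp (real \<kappa> * V * t) * B"
  by (simp add: algebra_simps)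
qed

text \<open>Two extra factors of the weight buy the summable decay \<open>1/q\<^sup>2\<close> in the level.\<close>

lemma nb_weight:
 assumes n: "nb \<kappa> (%_. D) g" and D: "0 <= D"
 shows "nb (\<kappa> + 2) (%q. D / real q ^ 2) g"
proof (rule nbI)
 fix q F B and t :: real assume q: "1 <= q" and t: "0 <= t" and F: "bounded_by (X q) B F"
 have B: "0 <= B" using F by (simp add: bounded_by_def)
 have q1: "1 <= real q" using q by simp
 have p0: "0 <= pochhammer (real q) \<kappa>" using pochhammer_one_le[OF q1, of \<kappa>] by simp
 have "pochhammer (real q) \<kappa> * real q ^ 2 <= pochhammer (real q) \<kappa> * ((real q + real \<kappa>) * (real q + real \<kappa> + 1))"
  unfolding power2_eq_square by (intro mult_left_mono mult_mono p0) auto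
 also have "... = pochhammer (real q) (\<kappa> + 2)" by (simp add: pochhammer_Suc numeral_2_eq_2 algebra_simps)
 finally have p: "pochhammer (real q) \<kappa> <= pochhammer (real q) (\<kappa> + 2) / real q ^ 2" using q by (simp add: pos_le_divide_eq)
 have e: "exp (real \<kappa> * V * t) <= exp (real (\<kappa> + 2) * V * t)" using V t by (simp add: mult_right_mono)
 have "D * pochhammer (real q) \<kappa> * exp (real \<kappa> * V * t) * B <= D * (pochhammer (real q) (\<kappa> + 2) / real q ^ 2) * exp (real (\<kappa> + 2) * V * t) * B"
  using p e B D order_trans[OF p0 p] by (intro mult_right_mono mult_mono mult_nonneg_nonneg) (auto simp: p0)
 then show "\<bar>g q t F\<bar> <= D / real q ^ 2 * pochhammer (real q) (\<kappa> + 2) * exp (real (\<kappa> + 2) * V * t) * B"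
  using nbD[OF n q t F] by simp
qed

lemma Tpow_good: "good g ==> good ((T ^^ m) g)"
 by (induction m) (auto intro: good_T)

lemma Tpow_pos: "good g ==> pos g ==> pos ((T ^^ m) g)"
 by (induction m) (auto intro: pos_T Tpow_good)

lemma Tpow_nb: "good g ==> nb \<kappa> d g ==> nb \<kappa> (%q. d (q + m)) ((T ^^ m) g)"
proof (induction m)
 case (Suc m)
 from nb_T[OF Tpow_good[OF Suc.prems(1)] Suc.IH[OF Suc.prems]] show ?case by simp
qed simp

text \<open>With a constant coefficient the powers of \<open>T\<close> would only stay bounded.
  After \<open>nb_weight\<close> the coefficient is D / q^2, and m applications of
  \<open>nb_T\<close> evaluate it at level q + m, where it is at most D / (m + 1)^2.\<close>

lemma Tpow_bound:
 assumes g: "good g" and n: "nb \<kappa> (%_. D) g" and D: "0 <= D" and q: "1 <= q" and t: "0 <= t" and F: "bounded_by (X q) B F"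
 shows "\<bar>(T ^^ m) g q t F\<bar> <= 1 / real (Suc m) ^ 2 * (D * pochhammer (real q) (\<kappa> + 2) * exp (real (\<kappa> + 2) * V * t) * B)"
proof -
 have B: "0 <= B" using F by (simp add: bounded_by_def)
 have p0: "0 <= pochhammer (real q) (\<kappa> + 2)" using pochhammer_one_le[of "real q" "\<kappa> + 2"] q by simp
 have "\<bar>(T ^^ m) g q t F\<bar> <= D / real (q + m) ^ 2 * pochhammer (real q) (\<kappa> + 2) * exp (real (\<kappa> + 2) * V * t) * B"
  using nbD[OF Tpow_nb[OF g nb_weight[OF n D]] q t F] by simp
 also have "... = 1 / real (q + m) ^ 2 * (D * pochhammer (real q) (\<kappa> + 2) * exp (real (\<kappa> + 2) * V * t) * B)" by simp
 also have "... <= 1 / real (Suc m) ^ 2 * (D * pochhammer (real q) (\<kappa> + 2) * exp (real (\<kappa> + 2) * V * t) * B)"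
  using q D p0 B by (intro mult_right_mono divide_left_mono power_mono) auto
 finally show ?thesis .
qed

end

section \<open>Inversion of 1 - T by its Neumann series\<close>

context hierarchy
begin

definition series :: "'x family => 'x family" where
 "series g = (%q t F. \<Sum>m. (T ^^ m) g q t F)"

text \<open>Iterating f = h + T f gives f as a partial Neumann sum of h plus \<open>T ^^ n\<close>
  applied to f. By \<open>Tpow_bound\<close> the last term tends to 0 for any a priori bound C, so
  the final estimate depends on h alone. This independence of C is what later removes the dependence
  on N.\<close>

lemma stability:
 assumes f: "good f" and fb: "nb \<kappa>' (%_. C) f" and C: "0 <= C"
  and h: "good h" and hb: "nb \<kappa> (%_. D) h" and D: "0 <= D"
  and eq: "eqv f (comb 1 h (T f))"
 shows "nb (\<kappa> + 2) (%_. basel * D) f"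
proof (rule nbI)
 fix q F B and t :: real assume q: "1 <= q" and t: "0 <= t" and F: "bounded_by (X q) B F"
 have Fm: "F \<in> bounded_measurable (X q)" by (rule bounded_by_bm[OF F])
 have step: "eqv ((T ^^ m) f) (comb 1 ((T ^^ m) h) ((T ^^ Suc m) f))" for m
 proof (induction m)
  case 0 then show ?case using eq by simp
 next
  case (Suc m)
  have "eqv (T ((T ^^ m) f)) (T (comb 1 ((T ^^ m) h) ((T ^^ Suc m) f)))" by (rule T_cong[OF Suc])
  moreover have "T (comb 1 ((T ^^ m) h) ((T ^^ Suc m) f)) q t F = comb 1 (T ((T ^^ m) h)) (T ((T ^^ Suc m) f)) q t F"
   if "1 <= q" "0 <= t" "F \<in> bounded_measurable (X q)" for q t F
   using T_comb[OF Tpow_good[OF h, of m] Tpow_good[OF f, of "Suc m"] that, of 1] by (simp add: comb_def)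
  ultimately show ?case by (simp add: eqv_def)
 qed
 have it: "f q t F = (\<Sum>m<n. (T ^^ m) h q t F) + (T ^^ n) f q t F" for n
 proof (induction n)
  case (Suc n)
  have "(T ^^ n) f q t F = (T ^^ n) h q t F + (T ^^ Suc n) f q t F"
   using eqvD[OF step q t Fm, of n] by (simp add: comb_def)
  then show ?case using Suc by simp
 qed simp
 let ?P = "D * pochhammer (real q) (\<kappa> + 2) * exp (real (\<kappa> + 2) * V * t) * B"
 let ?Q = "C * pochhammer (real q) (\<kappa>' + 2) * exp (real (\<kappa>' + 2) * V * t) * B"
 have P0: "0 <= ?P" using D F pochhammer_one_le[of "real q" "\<kappa> + 2"] q by (simp add: bounded_by_def)
 have le: "\<bar>f q t F\<bar> <= basel * ?P + 1 / real (Suc n) ^ 2 * ?Q" for n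
 proof -
  have "\<bar>\<Sum>m<n. (T ^^ m) h q t F\<bar> <= (\<Sum>m<n. 1 / real (Suc m) ^ 2 * ?P)"
   by (intro order_trans[OF sum_abs] sum_mono Tpow_bound[OF h hb D q t F])
  also have "... = (\<Sum>m<n. 1 / real (Suc m) ^ 2) * ?P" by (simp add: sum_distrib_right)
  also have "... <= basel * ?P"
   unfolding basel_def by (intro mult_right_mono sum_le_suminf summable_basel P0) auto
  finally have "\<bar>\<Sum>m<n. (T ^^ m) h q t F\<bar> <= basel * ?P" .
  then show ?thesis using it[of n] Tpow_bound[OF f fb C q t F, of n] by linarith
 qed
 have "(%n. basel * ?P + 1 / real (Suc n) ^ 2 * ?Q) \<longlonglongrightarrow> basel * ?P + 0 * ?Q"
  by (intro tendsto_add tendsto_const tendsto_mult_right summable_LIMSEQ_zero[OF summable_basel])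
 from LIMSEQ_le_const[OF this] le have "\<bar>f q t F\<bar> <= basel * ?P" by simp
 then show "\<bar>f q t F\<bar> <= basel * D * pochhammer (real q) (\<kappa> + 2) * exp (real (\<kappa> + 2) * V * t) * B" by (simp add: mult.assoc)
qed

context
 fixes g \<kappa> D
 assumes g: "good g" and gb: "nb \<kappa> (%_. D) g" and D: "0 <= D"
begin

lemma series_summable:
 assumes q: "1 <= q" and t: "0 <= t" and F: "F \<in> bounded_measurable (X q)"
 shows "summable (%m. (T ^^ m) g q t F)"
proof -
 obtain B where B: "bounded_by (X q) B F" using bm_bounded_by[OF F] by blast
 show ?thesis
  using Tpow_bound[OF g gb D q t B] summable_basel
  by (intro summable_comparison_test'[OF summable_mult2[OF summable_basel]]) auto
qed

text \<open>Bounding all tails, and not only the full sum, is what permits exchanging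
  \<open>T\<close> with the infinite sum in \<open>series_eq\<close>.\<close>

lemma series_tail_bound:
 "nb (\<kappa> + 2) (%_. (\<Sum>m. 1 / real (Suc (m + n)) ^ 2) * D) (%q t F. series g q t F - (\<Sum>m<n. (T ^^ m) g q t F))"
proof (rule nbI)
 fix q F B and t :: real assume q: "1 <= q" and t: "0 <= t" and F: "bounded_by (X q) B F"
 let ?P = "D * pochhammer (real q) (\<kappa> + 2) * exp (real (\<kappa> + 2) * V * t) * B"
 have s: "summable (%m. 1 / real (Suc (m + n)) ^ 2)" using summable_ignore_initial_segment[OF summable_basel, of n] by simp
 have sg: "summable (%m. (T ^^ m) g q t F)" by (rule series_summable[OF q t bounded_by_bm[OF F]])
 have 1: "series g q t F - (\<Sum>m<n. (T ^^ m) g q t F) = (\<Sum>m. (T ^^ (m + n)) g q t F)"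
  unfolding series_def using suminf_split_initial_segment[OF sg, of n] by simp
 have "norm ((T ^^ (m + n)) g q t F) <= 1 / real (Suc (m + n)) ^ 2 * ?P" for m
  using Tpow_bound[OF g gb D q t F, of "m + n"] by simp
 then have "norm (\<Sum>m. (T ^^ (m + n)) g q t F) <= (\<Sum>m. 1 / real (Suc (m + n)) ^ 2 * ?P)"
  by (rule norm_suminf_le[OF _ summable_mult2[OF s]])
 then have "\<bar>\<Sum>m. (T ^^ (m + n)) g q t F\<bar> <= (\<Sum>m. 1 / real (Suc (m + n)) ^ 2) * ?P"
  unfolding real_norm_def suminf_mult2[OF s, of ?P] .
 then show "\<bar>series g q t F - (\<Sum>m<n. (T ^^ m) g q t F)\<bar> <= (\<Sum>m. 1 / real (Suc (m + n)) ^ 2) * D * pochhammer (real q) (\<kappa> + 2) * exp (real (\<kappa> + 2) * V * t) * B"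
  unfolding 1 by (simp only: mult.assoc)
qed

lemma series_nb: "nb (\<kappa> + 2) (%_. basel * D) (series g)"
 using series_tail_bound[of 0] by (simp add: basel_def)

text \<open>Each property passes to the sum term by term. For \<open>cont\<close> the bounds of
  \<open>Tpow_bound\<close> are uniform along the converging functions, so Tannery's theorem allows
  the limit under the sum.\<close>

lemma series_good: "good (series g)"
 unfolding good_def
proof (intro allI impI)
 fix q :: nat assume q: "1 <= q"
 note Tg = goodD[OF Tpow_good[OF g] q]
 show "goodf (X q) (series g q)"
 proof
  fix F G a and t :: real assume FG: "F \<in> bounded_measurable (X q)" "G \<in> bounded_measurable (X q)" and t: "0 <= t"
  have s: "summable (%m. (T ^^ m) g q t F)" "summable (%m. (T ^^ m) g q t G)" by (rule series_summable[OF q t FG(1)], rule series_summable[OF q t FG(2)])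
  have "series g q t (%y. a * F y + G y) = (\<Sum>m. a * (T ^^ m) g q t F + (T ^^ m) g q t G)"
   unfolding series_def by (simp only: goodf.lin[OF Tg FG t])
  also have "... = a * series g q t F + series g q t G"
   unfolding series_def by (simp add: suminf_add[symmetric] suminf_mult s summable_mult)
  finally show "series g q t (%y. a * F y + G y) = a * series g q t F + series g q t G" .
 next
  show "(%t. series g q t F) \<in> borel_measurable half_line" if "F \<in> bounded_measurable (X q)" for F
   unfolding series_def by (intro borel_measurable_suminf goodf.meas[OF Tg that])
 next
  fix t :: real and B Fn F
  assume t: "0 <= t" and Fn: "\<And>n. bounded_by (X q) B (Fn n)" and F: "bounded_by (X q) B F" and lim: "\<And>y. y \<in> space (X q) ==> (%n. Fn n y) \<longlonglongrightarrow> F y"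
  let ?P = "D * pochhammer (real q) (\<kappa> + 2) * exp (real (\<kappa> + 2) * V * t) * B"
  have "\<forall>\<^sub>F (k, n) in sequentially \<times>\<^sub>F sequentially. norm ((T ^^ k) g q t (Fn n)) <= 1 / real (Suc k) ^ 2 * ?P"
   using Tpow_bound[OF g gb D q t Fn] by (intro always_eventually) auto
  then show "(%n. series g q t (Fn n)) \<longlonglongrightarrow> series g q t F"
   unfolding series_def
   using tannerys_theorem[of "%m n. (T ^^ m) g q t (Fn n)" "%m. (T ^^ m) g q t F" sequentially,
     OF goodf.cont[OF Tg t Fn F lim] _ summable_mult2[OF summable_basel]] by simp
 next
  fix Tm :: real assume Tm: "0 <= Tm"
  let ?C = "basel * D * pochhammer (real q) (\<kappa> + 2) * exp (real (\<kappa> + 2) * V * Tm)"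
  have p0: "0 <= pochhammer (real q) (\<kappa> + 2)" using pochhammer_one_le[of "real q" "\<kappa> + 2"] q by simp
  have "\<bar>series g q t F\<bar> <= ?C * B" if t: "0 <= t" "t <= Tm" and F: "bounded_by (X q) B F" for t F B
  proof -
   have "exp (real (\<kappa> + 2) * V * t) <= exp (real (\<kappa> + 2) * V * Tm)" using t V by (simp add: mult_left_mono)
   then have "basel * D * pochhammer (real q) (\<kappa> + 2) * exp (real (\<kappa> + 2) * V * t) * B <= ?C * B"
    using F p0 D basel_nonneg by (intro mult_right_mono mult_left_mono) (auto simp: bounded_by_def)
   then show ?thesis using nbD[OF series_nb q t(1) F] by linarith
  qed
  moreover have "0 <= ?C" using p0 D basel_nonneg by simp
  ultimately show "\<exists>C\<ge>0. \<forall>t F B. 0 <= t \<longrightarrow> t <= Tm \<longrightarrow> bounded_by (X q) B F \<longrightarrow> \<bar>series g q t F\<bar> <= C * B" by blast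
 qed
qed

lemma series_pos: "pos g ==> pos (series g)"
 unfolding pos_def posf_def
proof (intro allI impI ballI)
 fix q F and t :: real assume p: "\<forall>q\<ge>1. \<forall>F\<in>bounded_measurable (X q). \<forall>t\<ge>0. (\<forall>y\<in>space (X q). 0 <= F y) \<longrightarrow> 0 <= g q t F"
  and q: "1 <= q" and F: "F \<in> bounded_measurable (X q)" and t: "0 <= t" and F0: "\<forall>y\<in>space (X q). 0 <= F y"
 have "pos g" using p by (simp add: pos_def posf_def)
 from Tpow_pos[OF g this] have "0 <= (T ^^ m) g q t F" for m using q F t F0 by (auto simp: pos_def posf_def)
 then show "0 <= series g q t F" unfolding series_def by (intro suminf_nonneg series_summable q t F)
qed

text \<open>\<open>T\<close> commutes with finite sums by linearity. Applied to the tail after n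
  terms it is bounded by the tail of a convergent series and tends to 0, so it commutes with the
  infinite sum, and splitting off the term m = 0 gives the fixed point equation.\<close>

lemma series_eq: "eqv (series g) (comb 1 g (T (series g)))"
proof (rule eqvI)
 fix q F and t :: real assume q: "1 <= q" and t: "0 <= t" and F: "F \<in> bounded_measurable (X q)"
 obtain B where B: "bounded_by (X q) B F" using bm_bounded_by[OF F] by blast
 let ?R = "%n q t F. series g q t F - (\<Sum>m<n. (T ^^ m) g q t F)"
 have RS: "?R (Suc n) = comb (- 1) ((T ^^ n) g) (?R n)" for n by (simp add: comb_def fun_eq_iff)
 have R: "good (?R n)" for n
 proof (induction n)
  case 0 then show ?case using series_good by simp
 next
  case (Suc n) then show ?case unfolding RS by (intro good_comb Tpow_good g)
 qed
 have TR: "T (?R n) q t F = T (series g) q t F - (\<Sum>m<n. (T ^^ Suc m) g q t F)" for n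
 proof (induction n)
  case (Suc n)
  show ?case unfolding RS T_comb[OF Tpow_good[OF g] R q t F] Suc by simp
 qed simp
 let ?\<tau> = "%n. (\<Sum>m. 1 / real (Suc (m + n)) ^ 2)"
 let ?P = "D * pochhammer (real q) (\<kappa> + 2) * exp (real (\<kappa> + 2) * V * t) * B"
 have "?\<tau> \<longlonglongrightarrow> 0" using suminf_exist_split2[OF summable_basel] by simp
 then have "(%n. ?\<tau> n * ?P) \<longlonglongrightarrow> 0" by (rule tendsto_mult_left_zero)
 moreover have "norm (T (?R n) q t F) <= ?\<tau> n * ?P" for n
  using nbD[OF nb_T[OF R series_tail_bound] q t B, of n] by (simp add: mult.assoc)
 ultimately have "(%n. T (?R n) q t F) \<longlonglongrightarrow> 0" by (intro Lim_null_comparison[of "%n. T (?R n) q t F" "%n. ?\<tau> n * ?P"] always_eventually) auto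
 then have "(%n. T (series g) q t F - T (?R n) q t F) \<longlonglongrightarrow> T (series g) q t F - 0" by (intro tendsto_diff tendsto_const)
 then have 1: "(%m. (T ^^ Suc m) g q t F) sums T (series g) q t F" unfolding TR by (simp add: sums_def)
 have "(%m. (T ^^ m) g q t F) sums series g q t F" unfolding series_def by (rule summable_sums[OF series_summable[OF q t F]])
 then have "(%m. (T ^^ Suc m) g q t F) sums (series g q t F - (T ^^ 0) g q t F)" by (subst sums_Suc_iff) simp
 from sums_unique2[OF 1 this] show "series g q t F = comb 1 g (T (series g)) q t F" by (simp add: comb_def)
qed

end

text \<open>The operator in front of 1 / N: jumps inside the sample minus the correction to the
  coefficient of the jumps out of it.\<close>

definition W :: "'x family => 'x family" where
 "W g = comb (- 1) (qT g) (I g)"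

lemma good_W: "good g ==> good (W g)"
 unfolding W_def by (intro good_comb good_qT good_I)

lemma W_comb: "good f ==> good g ==> 1 <= q ==> 0 <= t ==> F \<in> bounded_measurable (X q) ==>
  W (comb a f g) q t F = a * W f q t F + W g q t F"
 using T_comb[of f g q t F a] I_comb[of f g q t F a] by (simp add: W_def qT_def) (simp add: comb_def algebra_simps)

lemma nb_W:
 assumes g: "good g" and n: "nb \<kappa> (%_. D) g" and D: "0 <= D"
 shows "nb (Suc \<kappa>) (%_. 2 * D) (W g)"
 using nb_comb[OF nb_qT[OF assms] nb_I[OF assms], of "- 1"] by (simp add: W_def)

end

section \<open>Expansion in powers of 1/N with uniform remainder\<close>

locale hierarchy_expansion = hierarchy X V up ins
 for X :: "nat => 'x measure" and V and up ins :: "nat => real => real => ('x => real) => 'x => real" +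
 fixes g0 :: "'x family"
 assumes g0_good: "good g0" and g0_pos: "pos g0" and g0_nb: "nb 0 (%_. 1) g0"
begin

text \<open>
 The coefficients \<open>a\<^sub>0 = (1 - T)\<^sup>-\<^sup>1 g\<^sub>0\<close>, \<open>a\<^sub>j\<^sub>+\<^sub>1 = (1 - T)\<^sup>-\<^sup>1 W a\<^sub>j\<close> are differences
 of the positive families \<open>fst (coef_pn j)\<close> and \<open>snd (coef_pn j)\<close>, which makes them signed measures.
\<close>

primrec coef_pn :: "nat => 'x family \<times> 'x family" where
 "coef_pn 0 = (series g0, %_ _ _. 0)"
| "coef_pn (Suc j) = (series (comb 1 (I (fst (coef_pn j))) (qT (snd (coef_pn j)))),
   series (comb 1 (I (snd (coef_pn j))) (qT (fst (coef_pn j)))))"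

definition coef :: "nat => 'x family" where
 "coef j = comb (- 1) (snd (coef_pn j)) (fst (coef_pn j))"

text \<open>The properties that survive the recursion for the two parts of the coefficients. The
  order \<kappa> and the constant D grow from step to step, hence the existential form.\<close>

definition nice :: "'x family => bool" where
 "nice g \<longleftrightarrow> good g \<and> pos g \<and> (\<exists>\<kappa> D. 0 <= D \<and> nb \<kappa> (%_. D) g)"

lemma nice_common_nb:
 assumes f: "nb \<kappa> (%_. C) f" "0 <= C" and g: "nb \<kappa>' (%_. D) g" "0 <= D"
 shows "nb (max \<kappa> \<kappa>') (%_. \<bar>a\<bar> * C + D) (comb a f g)"
 by (rule nb_comb[OF nb_mono[OF f(1)] nb_mono[OF g(1)]]) (use f g in auto)

lemma nice_series:
 assumes "nice g"
 shows "nice (series g)"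
proof -
 obtain \<kappa> D where g: "good g" "nb \<kappa> (%_. D) g" "0 <= D" and p: "pos g" using assms by (auto simp: nice_def)
 have "0 <= basel * D" using g(3) basel_nonneg by simp
 then show ?thesis unfolding nice_def using series_good[OF g] series_pos[OF g p] series_nb[OF g] by blast
qed

lemma nice_source:
 assumes f: "nice f" and g: "nice g"
 shows "nice (comb 1 (I f) (qT g))"
proof -
 obtain \<kappa> D where f': "good f" "nb \<kappa> (%_. D) f" "0 <= D" and p: "pos f" using f by (auto simp: nice_def)
 obtain \<kappa>' D' where g': "good g" "nb \<kappa>' (%_. D') g" "0 <= D'" and p': "pos g" using g by (auto simp: nice_def)
 have "nb (max (Suc \<kappa>) (Suc \<kappa>')) (%_. \<bar>1\<bar> * D + D') (comb 1 (I f) (qT g))"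
  by (rule nice_common_nb[OF nb_I[OF f'] f'(3) nb_qT[OF g'] g'(3)])
 moreover have "0 <= \<bar>1\<bar> * D + D'" using f' g' by simp
 moreover have "good (comb 1 (I f) (qT g))" by (intro good_comb good_I good_qT f' g')
 moreover have "pos (comb 1 (I f) (qT g))" by (intro pos_comb pos_I pos_qT f' g' p p') simp
 ultimately show ?thesis unfolding nice_def by blast
qed

lemma nice_coef_pn: "nice (fst (coef_pn j)) \<and> nice (snd (coef_pn j))"
proof (induction j)
 case 0
 have "nice g0" using g0_good g0_pos g0_nb zero_le_one unfolding nice_def by blast
 moreover have "nice (%_ _ _. 0)" unfolding nice_def good_def pos_def posf_def
  by (auto simp: goodf_zero nb_def intro!: exI[of _ 0])
 ultimately show ?case using nice_series by simp
next
 case (Suc j)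
 then show ?case by (simp add: nice_series nice_source)
qed

lemma coef_good: "good (coef j)"
 unfolding coef_def using nice_coef_pn[of j] by (intro good_comb) (auto simp: nice_def)

lemma coef_nb: "\<exists>\<kappa> D. 0 <= D \<and> nb \<kappa> (%_. D) (coef j)"
proof -
 obtain \<kappa> D \<kappa>' D' where "nb \<kappa> (%_. D) (snd (coef_pn j))" "0 <= D" "nb \<kappa>' (%_. D') (fst (coef_pn j))" "0 <= D'"
  using nice_coef_pn[of j] by (auto simp: nice_def)
 from nice_common_nb[OF this, of "- 1"] this(2,4) show ?thesis unfolding coef_def by (intro exI conjI) auto
qed

lemma coef_signed_measure:
 assumes q: "1 <= q" and t: "0 <= t"
 shows "is_signed_measure (X q) (coef j q t)"
proof -
 have n: "goodf (X q) (fst (coef_pn j) q)" "posf (X q) (fst (coef_pn j) q)"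
  "goodf (X q) (snd (coef_pn j) q)" "posf (X q) (snd (coef_pn j) q)"
  using nice_coef_pn[of j] q by (auto simp: nice_def good_def pos_def)
 obtain \<mu> \<nu> where "finite_measure \<mu>" "sets \<mu> = sets (X q)" "\<forall>F\<in>bounded_measurable (X q). fst (coef_pn j) q t F = (\<integral>x. F x \<partial>\<mu>)"
  "finite_measure \<nu>" "sets \<nu> = sets (X q)" "\<forall>F\<in>bounded_measurable (X q). snd (coef_pn j) q t F = (\<integral>x. F x \<partial>\<nu>)"
  using posf_representation[OF n(1,2) t] posf_representation[OF n(3,4) t] by blast
 then show ?thesis unfolding is_signed_measure_def coef_def comb_def by (intro exI[of _ \<mu>] exI[of _ \<nu>]) auto
qed

lemma coef_eq_0:
 assumes h: "1 <= q" "0 <= t" "F \<in> bounded_measurable (X q)"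
 shows "coef 0 q t F = g0 q t F + T (coef 0) q t F"
proof -
 have n: "good (series g0)" "good (%_ _ _. 0)" using nice_coef_pn[of 0] by (auto simp: nice_def)
 have "T (%_ _ _. 0) q t F = 0" by (simp add: T_def vol_def)
 then show ?thesis
  using eqvD[OF series_eq[OF g0_good g0_nb zero_le_one] h] T_comb[OF n(2,1) h, of "- 1"] by (simp add: coef_def) (simp add: comb_def)
qed

text \<open>The operator W = I - qT applied to p - n is (I p + qT n) - (I n + qT p). This explains
  why \<open>coef_pn\<close> exchanges the two parts under \<open>qT\<close>, and subtracting the
  two Neumann series recovers W of the previous coefficient as source.\<close>

lemma coef_eq_Suc:
 assumes h: "1 <= q" "0 <= t" "F \<in> bounded_measurable (X q)"
 shows "coef (Suc j) q t F = W (coef j) q t F + T (coef (Suc j)) q t F"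
proof -
 let ?p = "fst (coef_pn j)" and ?n = "snd (coef_pn j)"
 have e: "series g q t F = g q t F + T (series g) q t F" if "nice g" for g
  using that eqvD[OF series_eq h] by (auto simp: nice_def comb_def)
 have np: "nice ?p" "nice ?n" using nice_coef_pn by auto
 have gd: "good ?p" "good ?n" using np by (auto simp: nice_def)
 have sp: "nice (comb 1 (I ?p) (qT ?n))" "nice (comb 1 (I ?n) (qT ?p))" using nice_source np by auto
 have gs: "good (series (comb 1 (I ?p) (qT ?n)))" "good (series (comb 1 (I ?n) (qT ?p)))"
  using nice_series[OF sp(1)] nice_series[OF sp(2)] by (auto simp: nice_def)
 have "T (coef (Suc j)) q t F = - 1 * T (series (comb 1 (I ?n) (qT ?p))) q t F + T (series (comb 1 (I ?p) (qT ?n))) q t F"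
  unfolding coef_def coef_pn.simps fst_conv snd_conv by (rule T_comb[OF gs(2,1) h])
 moreover have "W (coef j) q t F = - 1 * W ?n q t F + W ?p q t F" unfolding coef_def by (rule W_comb[OF gd(2,1) h])
 moreover have "coef (Suc j) q t F = - 1 * series (comb 1 (I ?n) (qT ?p)) q t F + series (comb 1 (I ?p) (qT ?n)) q t F"
  by (simp add: coef_def comb_def[of "- 1"])
 ultimately show ?thesis using e[OF sp(1)] e[OF sp(2)] by (simp add: W_def comb_def)
qed

text \<open>Moments at levels above \<open>N\<close> vanish, whereas their initial data do not; the defect is of order \<open>(q/N)\<^sup>R\<close> for every \<open>R\<close>.\<close>

definition is_moment_family :: "nat => 'x family => bool" where
 "is_moment_family N \<Phi> \<longleftrightarrow> good \<Phi> \<and> nb 0 (%_. 1) \<Phi> \<and>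
   (\<forall>q t F. N < q \<longrightarrow> 0 <= t \<longrightarrow> F \<in> bounded_measurable (X q) \<longrightarrow> \<Phi> q t F = 0) \<and>
   (\<forall>q t F. 1 <= q \<longrightarrow> q <= N \<longrightarrow> 0 <= t \<longrightarrow> F \<in> bounded_measurable (X q) \<longrightarrow>
    \<Phi> q t F = g0 q t F + T \<Phi> q t F + W \<Phi> q t F / real N)"

definition remainder :: "nat => 'x family => nat => 'x family" where
 "remainder N \<Phi> R = (%q t F. \<Phi> q t F - (\<Sum>j<R. coef j q t F / real N ^ j))"

definition defect :: "nat => 'x family" where
 "defect N = (%q t F. if q <= N then 0 else - g0 q t F)"

lemma defect_good: "good (defect N)"
 unfolding good_def
proof (intro allI impI)
 fix q :: nat assume q: "1 <= q"
 show "goodf (X q) (defect N q)"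
  using goodf_comb[OF goodD[OF g0_good q] goodf_zero, of "- 1"] goodf_zero[of "X q"]
  by (cases "q <= N") (simp_all add: defect_def)
qed

text \<open>The defect is nonzero only for q > N, where 1 <= (q / N)^R, and q^R is dominated by the
  rising factorial of length R. A power of 1 / N is thus bought with R orders of the weight.\<close>

lemma defect_nb:
 assumes N: "1 <= N"
 shows "nb R (%_. 1 / real N ^ R) (defect N)"
proof (rule nbI)
 fix q F B and t :: real assume q: "1 <= q" and t: "0 <= t" and F: "bounded_by (X q) B F"
 have B: "0 <= B" using F by (simp add: bounded_by_def)
 have q1: "1 <= real q" using q by simp
 have p0: "0 <= pochhammer (real q) R" using pochhammer_one_le[OF q1, of R] by simp
 have e: "1 <= exp (real R * V * t)" using V t by simp
 show "\<bar>defect N q t F\<bar> <= 1 / real N ^ R * pochhammer (real q) R * exp (real R * V * t) * B"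
 proof (cases "q <= N")
  case True
  then show ?thesis using p0 B by (simp add: defect_def)
 next
  case False
  have "real N ^ R <= real q ^ R" using False by (intro power_mono) auto
  also have "... <= pochhammer (real q) R" by (rule power_le_pochhammer[OF q1])
  finally have "1 <= 1 / real N ^ R * pochhammer (real q) R" using N by (simp add: le_divide_eq)
  then have "1 * 1 * B <= 1 / real N ^ R * pochhammer (real q) R * exp (real R * V * t) * B"
   using e B by (intro mult_right_mono mult_mono) auto
  moreover have "\<bar>defect N q t F\<bar> <= B" using nbD[OF g0_nb q t F] False by (simp add: defect_def)
  ultimately show ?thesis by simp
 qed
qed

lemma comb_apply: "comb a f g q t F = a * f q t F + g q t F"
 by (simp add: comb_def)

context
 fixes N :: nat and \<Phi>
 assumes N: "1 <= N" and \<Phi>: "is_moment_family N \<Phi>"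
begin

lemma remainder_Suc: "remainder N \<Phi> (Suc R) = comb (- (1 / real N ^ R)) (coef R) (remainder N \<Phi> R)"
 by (simp add: remainder_def comb_def fun_eq_iff)

lemma remainder_good: "good (remainder N \<Phi> R)"
proof (induction R)
 case 0 then show ?case using \<Phi> by (simp add: remainder_def is_moment_family_def)
next
 case (Suc R) then show ?case unfolding remainder_Suc by (intro good_comb coef_good)
qed

text \<open>These constants may depend on N and \<Phi>; they only supply the a priori bound that
  \<open>stability\<close> asks for and then discards.\<close>

lemma remainder_some_nb: "\<exists>\<kappa> D. 0 <= D \<and> nb \<kappa> (%_. D) (remainder N \<Phi> R)"
proof (induction R)
 case 0
 have "nb 0 (%_. 1) (remainder N \<Phi> 0)" using \<Phi> by (simp add: remainder_def is_moment_family_def)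
 then show ?case using zero_le_one by blast
next
 case (Suc R)
 obtain \<kappa> D \<kappa>' D' where "nb \<kappa> (%_. D) (coef R)" "0 <= D" "nb \<kappa>' (%_. D') (remainder N \<Phi> R)" "0 <= D'"
  using Suc coef_nb[of R] by blast
 from nice_common_nb[OF this, of "- (1 / real N ^ R)"] this(2,4) show ?case unfolding remainder_Suc by (intro exI conjI) auto
qed

text \<open>For q > N both \<open>T\<close> and \<open>W\<close> read the family only at the levels
  q and q + 1, where it vanishes, so the equation reduces to 0 = g0 + defect.\<close>

lemma moment_equation:
 assumes h: "1 <= q" "0 <= t" "F \<in> bounded_measurable (X q)"
 shows "\<Phi> q t F = g0 q t F + T \<Phi> q t F + W \<Phi> q t F / real N + defect N q t F"
proof (cases "q <= N")
 case True
 then show ?thesis using \<Phi> h by (auto simp: is_moment_family_def defect_def)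
next
 case False
 have z: "\<Phi> p r G = 0" if "q <= p" "0 <= r" "G \<in> bounded_measurable (X p)" for p r G
  using \<Phi> False that by (auto simp: is_moment_family_def)
 have "T \<Phi> q t F = vol V (real q * V) (up q) (%_ _. 0) t F" "I \<Phi> q t F = vol V (real q * V) (ins q) (%_ _. 0) t F"
  unfolding T_def I_def by (rule vol_cong[OF up_ok h(2,3)], use z in simp, rule vol_cong[OF ins_ok h(2,3)], use z in simp)
 then show ?thesis using z[OF order_refl h(2,3)] False by (simp add: W_def comb_def qT_def vol_def defect_def)
qed

text \<open>Subtracting the equation of the coefficient a_(R+1), divided by N^(R+1), removes from
  the source exactly the term W a_R / N^(R+1) by which \<open>W\<close> of the successive
  remainders, divided by N, differ. The base case subtracts the equation of a_0, which removes
  g0.\<close>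

lemma remainder_equation:
 "eqv (remainder N \<Phi> (Suc R)) (comb 1 (comb (1 / real N) (W (remainder N \<Phi> R)) (defect N)) (T (remainder N \<Phi> (Suc R))))"
proof (induction R)
 case 0
 show ?case
 proof (rule eqvI)
  fix q F and t :: real assume h: "1 <= q" "0 <= t" "F \<in> bounded_measurable (X q)"
  have g: "good \<Phi>" using \<Phi> by (simp add: is_moment_family_def)
  have e: "remainder N \<Phi> (Suc 0) = comb (- 1) (coef 0) \<Phi>" "remainder N \<Phi> 0 = \<Phi>" by (simp_all add: remainder_def comb_def fun_eq_iff)
  show "remainder N \<Phi> (Suc 0) q t F = comb 1 (comb (1 / real N) (W (remainder N \<Phi> 0)) (defect N)) (T (remainder N \<Phi> (Suc 0))) q t F"
   unfolding e comb_apply T_comb[OF coef_good g h] using moment_equation[OF h] coef_eq_0[OF h] by simp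
 qed
next
 case (Suc R)
 show ?case
 proof (rule eqvI)
  fix q F and t :: real assume h: "1 <= q" "0 <= t" "F \<in> bounded_measurable (X q)"
  let ?a = "1 / real N ^ R" and ?b = "1 / real N ^ Suc R"
  have IH: "remainder N \<Phi> (Suc R) q t F = 1 / real N * W (remainder N \<Phi> R) q t F + defect N q t F + T (remainder N \<Phi> (Suc R)) q t F"
   using eqvD[OF Suc h] by (simp add: comb_def)
  have 1: "remainder N \<Phi> (Suc (Suc R)) q t F = - ?b * coef (Suc R) q t F + remainder N \<Phi> (Suc R) q t F"
   unfolding remainder_Suc[of "Suc R"] by (simp add: comb_def)
  have 2: "T (remainder N \<Phi> (Suc (Suc R))) q t F = - ?b * T (coef (Suc R)) q t F + T (remainder N \<Phi> (Suc R)) q t F"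
   unfolding remainder_Suc[of "Suc R"] by (rule T_comb[OF coef_good remainder_good h])
  have 3: "W (remainder N \<Phi> (Suc R)) q t F = - ?a * W (coef R) q t F + W (remainder N \<Phi> R) q t F"
   unfolding remainder_Suc[of R] by (rule W_comb[OF coef_good remainder_good h])
  have "remainder N \<Phi> (Suc (Suc R)) q t F = 1 / real N * W (remainder N \<Phi> (Suc R)) q t F + defect N q t F + T (remainder N \<Phi> (Suc (Suc R))) q t F"
   unfolding 1 2 3 coef_eq_Suc[OF h, of R] IH by (simp add: algebra_simps)
  then show "remainder N \<Phi> (Suc (Suc R)) q t F = comb 1 (comb (1 / real N) (W (remainder N \<Phi> (Suc R))) (defect N)) (T (remainder N \<Phi> (Suc (Suc R)))) q t F"
   by (simp add: comb_def)
 qed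
qed

end

text \<open>The constants are chosen before N and \<Phi>. The source of the next remainder is W of
  the present one over N plus the defect, both of order N^-(R+1), and \<open>stability\<close>
  transfers this order at the price of a factor \<open>basel\<close> and two orders of weight. In 2
  C + 1 the term 2 C comes from \<open>nb_W\<close> and the 1 from the defect.\<close>

theorem remainder_bound:
 "\<exists>\<kappa> C. 0 <= C \<and> (\<forall>N \<Phi>. 1 <= N \<longrightarrow> is_moment_family N \<Phi> \<longrightarrow> nb \<kappa> (%_. C / real N ^ R) (remainder N \<Phi> R))"
proof (induction R)
 case 0
 have "remainder N \<Phi> 0 = \<Phi>" for N \<Phi> by (simp add: remainder_def fun_eq_iff)
 then show ?case by (intro exI[of _ 0] exI[of _ 1]) (auto simp: is_moment_family_def)
next
 case (Suc R)
 then obtain \<kappa> C where C: "0 <= C" and IH: "\<And>N \<Phi>. 1 <= N ==> is_moment_family N \<Phi> ==> nb \<kappa> (%_. C / real N ^ R) (remainder N \<Phi> R)"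
  by blast
 let ?k = "max (Suc \<kappa>) (Suc R)"
 have "nb (?k + 2) (%_. basel * (2 * C + 1) / real N ^ Suc R) (remainder N \<Phi> (Suc R))"
  if N: "1 <= N" and \<Phi>: "is_moment_family N \<Phi>" for N \<Phi>
 proof -
  obtain \<kappa>' D where D: "nb \<kappa>' (%_. D) (remainder N \<Phi> (Suc R))" "0 <= D" using remainder_some_nb[OF N \<Phi>] by blast
  have h: "nb ?k (%_. \<bar>1 / real N\<bar> * (2 * (C / real N ^ R)) + 1 / real N ^ Suc R) (comb (1 / real N) (W (remainder N \<Phi> R)) (defect N))"
   using C by (intro nice_common_nb nb_W remainder_good[OF N \<Phi>] IH N \<Phi> defect_nb) auto
  have "\<bar>1 / real N\<bar> * (2 * (C / real N ^ R)) + 1 / real N ^ Suc R = (2 * C + 1) / real N ^ Suc R"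
   by (simp add: add_divide_distrib)
  note h = h[unfolded this]
  have "nb (?k + 2) (%_. basel * ((2 * C + 1) / real N ^ Suc R)) (remainder N \<Phi> (Suc R))"
   by (rule stability[OF remainder_good[OF N \<Phi>] D _ h _ remainder_equation[OF N \<Phi>]])
    (use C in \<open>auto intro!: good_comb good_W remainder_good[OF N \<Phi>] defect_good\<close>)
  then show ?thesis by simp
 qed
 moreover have "0 <= basel * (2 * C + 1)" using C basel_nonneg by simp
 ultimately show ?case by blast
qed

end

section \<open>The Feynman-Kac operators form a hierarchy\<close>

lemma measurable_goodf_op:
 assumes A: "op_ok S S' c A" and g: "goodf S' g" and F: "F \<in> bounded_measurable S" and t: "0 <= t"
 shows "(%r. g r (A r t F)) \<in> borel_measurable half_line"
proof -
 obtain B where B: "bounded_by S B F" using bm_bounded_by[OF F] by blast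
 have p: "(%z. ((t, fst z), snd z)) \<in> half_line \<Otimes>\<^sub>M S' \<rightarrow>\<^sub>M (half_line \<Otimes>\<^sub>M half_line) \<Otimes>\<^sub>M S'"
  by (intro measurable_Pair measurable_half_line_const t measurable_fst measurable_snd)
 show ?thesis
 proof (rule measurable_goodf[OF g measurable_ident_sets[OF refl], where B="c * B"])
  show "(%z. A (fst z) t F (snd z)) \<in> borel_measurable (half_line \<Otimes>\<^sub>M S')"
   using measurable_compose[OF p op_ok.meas[OF A F]] by simp
  show "\<bar>A y t F x\<bar> <= c * B" if "y \<in> space half_line" "x \<in> space S'" for y x
   using that by (intro op_ok.bound[OF A B _ t]) (auto simp: space_restrict_space)
 qed
qed

lemma goodf_op_bound:
 assumes A: "op_ok S S' c A" and g: "goodf S' g" and F: "F \<in> bounded_measurable S" and t: "0 <= t"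
 shows "\<exists>C\<ge>0. \<forall>r. 0 <= r \<longrightarrow> r <= t \<longrightarrow> \<bar>g r (A r t F)\<bar> <= C"
proof -
 obtain B where B: "bounded_by S B F" using bm_bounded_by[OF F] by blast
 obtain C where C: "0 <= C" "\<And>r G B. 0 <= r ==> r <= t ==> bounded_by S' B G ==> \<bar>g r G\<bar> <= C * B"
  using goodf.locally_bounded[OF g t] by blast
 have "0 <= C * (c * B)" using C B op_ok.c_nonneg[OF A] by (simp add: bounded_by_def)
 then show ?thesis using C(2)[OF _ _ op_ok_bounded_by[OF A B _ t]] by blast
qed

text \<open>The common form of \<open>up1\<close> and \<open>in1\<close>: with probability v the
  operator is read at the moved configuration u x, otherwise at w x.\<close>

lemma op_ok_mix:
 assumes A: "op_ok S S1 c A" and u: "u \<in> S' \<rightarrow>\<^sub>M S1" and w: "w \<in> S' \<rightarrow>\<^sub>M S1"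
  and v: "(%z. v (fst z) (snd z)) \<in> borel_measurable (half_line \<Otimes>\<^sub>M S')"
  and v01: "\<And>r x. 0 <= r ==> 0 <= v r x \<and> v r x <= (1 :: real)"
 shows "op_ok S S' c (%r t F x. v r x * A r t F (u x) + (1 - v r x) * A r t F (w x))"
proof
 have us: "x \<in> space S' ==> u x \<in> space S1" and ws: "x \<in> space S' ==> w x \<in> space S1" for x
  using measurable_space[OF u] measurable_space[OF w] by auto
 show "0 <= c" by (rule op_ok.c_nonneg[OF A])
 fix F assume F: "F \<in> bounded_measurable S"
 let ?Y = "(half_line \<Otimes>\<^sub>M half_line) \<Otimes>\<^sub>M S'"
 have 1: "(%z. A (snd (fst z)) (fst (fst z)) F (f (snd z))) \<in> borel_measurable ?Y" if "f \<in> S' \<rightarrow>\<^sub>M S1" for f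
 proof -
  have "(%z. (fst z, f (snd z))) \<in> ?Y \<rightarrow>\<^sub>M (half_line \<Otimes>\<^sub>M half_line) \<Otimes>\<^sub>M S1"
   by (intro measurable_Pair measurable_fst measurable_compose[OF measurable_snd that])
  from measurable_compose[OF this op_ok.meas[OF A F]] show ?thesis by simp
 qed
 have 2: "(%z. v (snd (fst z)) (snd z)) \<in> borel_measurable ?Y"
 proof -
  have "(%z. (snd (fst z), snd z)) \<in> ?Y \<rightarrow>\<^sub>M half_line \<Otimes>\<^sub>M S'"
   by (intro measurable_Pair measurable_snd measurable_compose[OF measurable_fst measurable_snd])
  from measurable_compose[OF this v] show ?thesis by simp
 qed
 show "(%z. v (snd (fst z)) (snd z) * A (snd (fst z)) (fst (fst z)) F (u (snd z)) +
   (1 - v (snd (fst z)) (snd z)) * A (snd (fst z)) (fst (fst z)) F (w (snd z))) \<in> borel_measurable ?Y"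
  by (intro borel_measurable_add borel_measurable_times borel_measurable_diff borel_measurable_const 1 2 u w)
next
 have us: "x \<in> space S' ==> u x \<in> space S1" and ws: "x \<in> space S' ==> w x \<in> space S1" for x
  using measurable_space[OF u] measurable_space[OF w] by auto
 fix F B x and r t :: real assume F: "bounded_by S B F" and r: "0 <= r" "0 <= t" and x: "x \<in> space S'"
 have "\<bar>v r x * A r t F (u x) + (1 - v r x) * A r t F (w x)\<bar> <= v r x * \<bar>A r t F (u x)\<bar> + (1 - v r x) * \<bar>A r t F (w x)\<bar>"
  using v01[OF r(1), of x] abs_triangle_ineq[of "v r x * A r t F (u x)" "(1 - v r x) * A r t F (w x)"] by (simp add: abs_mult)
 also have "... <= v r x * (c * B) + (1 - v r x) * (c * B)"
  using v01[OF r(1), of x] by (intro add_mono mult_left_mono op_ok.bound[OF A F r] us ws x) auto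
 finally show "\<bar>v r x * A r t F (u x) + (1 - v r x) * A r t F (w x)\<bar> <= c * B" by (simp add: algebra_simps)
next
 have us: "x \<in> space S' ==> u x \<in> space S1" and ws: "x \<in> space S' ==> w x \<in> space S1" for x
  using measurable_space[OF u] measurable_space[OF w] by auto
 show "v r x * A r t (%y. a * F y + G y) (u x) + (1 - v r x) * A r t (%y. a * F y + G y) (w x) =
   a * (v r x * A r t F (u x) + (1 - v r x) * A r t F (w x)) + (v r x * A r t G (u x) + (1 - v r x) * A r t G (w x))"
  if "F \<in> bounded_measurable S" "G \<in> bounded_measurable S" "0 <= r" "0 <= t" "x \<in> space S'" for F G r t x a
  using op_ok.lin[OF A that(1-4) us[OF that(5)]] op_ok.lin[OF A that(1-4) ws[OF that(5)]] by (simp add: algebra_simps)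
 show "0 <= v r x * A r t F (u x) + (1 - v r x) * A r t F (w x)"
  if "F \<in> bounded_measurable S" "0 <= r" "0 <= t" "\<And>y. y \<in> space S ==> 0 <= F y" "x \<in> space S'" for F r t x
  using op_ok.nonneg[OF A that(1-4) us[OF that(5)]] op_ok.nonneg[OF A that(1-4) ws[OF that(5)]] v01[OF that(2), of x] by simp
 show "(%n. v r x * A r t (Fn n) (u x) + (1 - v r x) * A r t (Fn n) (w x)) \<longlonglongrightarrow> v r x * A r t F (u x) + (1 - v r x) * A r t F (w x)"
  if "\<And>n. bounded_by S B (Fn n)" "bounded_by S B F" "\<And>y. y \<in> space S ==> (%n. Fn n y) \<longlonglongrightarrow> F y" "0 <= r" "0 <= t" "x \<in> space S'" for B Fn F r t x
  by (intro tendsto_add tendsto_mult_left op_ok.cont[OF A that(1-5) us[OF that(6)]] op_ok.cont[OF A that(1-5) ws[OF that(6)]])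
qed

lemma op_ok_sum:
 assumes fin: "finite J" and A: "\<And>k. k \<in> J ==> op_ok S S' c (A k)" and c: "0 <= c"
 shows "op_ok S S' (real (card J) * c) (%r t F x. \<Sum>k\<in>J. A k r t F x)"
proof
 show "0 <= real (card J) * c" using c by simp
 show "(%z. \<Sum>k\<in>J. A k (snd (fst z)) (fst (fst z)) F (snd z)) \<in> borel_measurable ((half_line \<Otimes>\<^sub>M half_line) \<Otimes>\<^sub>M S')"
  if "F \<in> bounded_measurable S" for F by (intro borel_measurable_sum op_ok.meas[OF A that])
 show "\<bar>\<Sum>k\<in>J. A k r t F x\<bar> <= real (card J) * c * B" if "bounded_by S B F" "0 <= r" "0 <= t" "x \<in> space S'" for F B r t x
 proof -
  have "\<bar>\<Sum>k\<in>J. A k r t F x\<bar> <= (\<Sum>k\<in>J. c * B)" by (intro order_trans[OF sum_abs] sum_mono op_ok.bound[OF A that])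
  then show ?thesis by simp
 qed
 show "(\<Sum>k\<in>J. A k r t (%y. a * F y + G y) x) = a * (\<Sum>k\<in>J. A k r t F x) + (\<Sum>k\<in>J. A k r t G x)"
  if h: "F \<in> bounded_measurable S" "G \<in> bounded_measurable S" "0 <= r" "0 <= t" "x \<in> space S'" for F G r t x a
 proof -
  have "(\<Sum>k\<in>J. A k r t (%y. a * F y + G y) x) = (\<Sum>k\<in>J. a * A k r t F x + A k r t G x)"
   by (rule sum.cong[OF refl op_ok.lin[OF A h]])
  then show ?thesis by (simp add: sum.distrib sum_distrib_left)
 qed
 show "0 <= (\<Sum>k\<in>J. A k r t F x)"
  if "F \<in> bounded_measurable S" "0 <= r" "0 <= t" "\<And>y. y \<in> space S ==> 0 <= F y" "x \<in> space S'" for F r t x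
  by (rule sum_nonneg, rule op_ok.nonneg[OF A that])
 show "(%n. \<Sum>k\<in>J. A k r t (Fn n) x) \<longlonglongrightarrow> (\<Sum>k\<in>J. A k r t F x)"
  if "\<And>n. bounded_by S B (Fn n)" "bounded_by S B F" "\<And>y. y \<in> space S ==> (%n. Fn n y) \<longlonglongrightarrow> F y" "0 <= r" "0 <= t" "x \<in> space S'" for B Fn F r t x
  by (rule tendsto_sum, rule op_ok.cont[OF A that])
qed

context feynman_kac_model
begin

lemma path_law_bounded_by:
 assumes F: "bounded_by (tuple_space q) B F" and r: "0 <= r" "0 <= t"
 shows "bounded_by (path_law q r x) B (%\<omega>. F (positions q t \<omega>))"
 using F rtrans_integrand[OF _ r, of F q x] positions_in_space[of q t] by (auto simp: bounded_by_def)

lemma rtrans_op_ok: "op_ok (tuple_space q) (tuple_space q) 1 (rtrans q)"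
proof
 fix F :: "(nat => 'a) => real" assume F: "F \<in> bm q"
 let ?Y = "(half_line \<Otimes>\<^sub>M half_line) \<Otimes>\<^sub>M tuple_space q"
 show "(%z. rtrans q (snd (fst z)) (fst (fst z)) F (snd z)) \<in> borel_measurable ?Y"
  by (rule measurable_rtrans)
   (intro measurable_compose[OF measurable_snd bounded_measurableD(1)[OF F]] measurable_compose[OF measurable_fst measurable_snd]
    measurable_compose[OF measurable_fst measurable_fst] measurable_snd)+
next
 show "\<bar>rtrans q r t F x\<bar> <= 1 * B" if "bounded_by (tuple_space q) B F" "0 <= r" "0 <= t" for F B r t x
  using rtrans_bound[of F q B r t x] that by (simp add: bounded_by_def)
 show "rtrans q r t (%y. a * F y + G y) x = a * rtrans q r t F x + rtrans q r t G x"
  if "F \<in> bm q" "G \<in> bm q" "0 <= r" "0 <= t" for F G r t x a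
  unfolding rtrans_def using rtrans_integrable[OF that(1,3,4)] rtrans_integrable[OF that(2,3,4)] by simp
 show "0 <= rtrans q r t F x" if "\<And>y. y \<in> space (tuple_space q) ==> 0 <= F y" for F r t x
  by (rule rtrans_nonneg[OF that])
 show "(%n. rtrans q r t (Fn n) x) \<longlonglongrightarrow> rtrans q r t F x"
  if h: "\<And>n. bounded_by (tuple_space q) B (Fn n)" "bounded_by (tuple_space q) B F" "\<And>y. y \<in> space (tuple_space q) ==> (%n. Fn n y) \<longlonglongrightarrow> F y"
   and r: "0 <= r" "0 <= t" for B Fn F r t x
  unfolding rtrans_def
  by (rule integral_bounded_tendsto[OF prob_space.finite_measure[OF path_law_prob[OF r(1)]] refl
     path_law_bounded_by[OF h(1) r] path_law_bounded_by[OF h(2) r] h(3)[OF positions_in_space]])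
qed simp

definition up_op :: "nat => real => real => ((nat => 'a) => real) => (nat => 'a) => real" where
 "up_op q r t F x = (\<Sum>k<q. up1 q k r (rtrans q r t F) x)"

definition in_op :: "nat => real => real => ((nat => 'a) => real) => (nat => 'a) => real" where
 "in_op q r t F x = (\<Sum>k<q. \<Sum>j<q. in1 k j r (rtrans q r t F) x)"

lemma measurable_vel_component:
 assumes k: "k < p"
 shows "(%z. vel (fst z) (snd z k)) \<in> borel_measurable (half_line \<Otimes>\<^sub>M tuple_space p)"
 by (rule measurable_vel[OF measurable_fst]) (rule measurable_compose[OF measurable_snd measurable_component_singleton], use k in simp)

lemma up_op_ok: "op_ok (tuple_space q) (tuple_space (Suc q)) (real q) (up_op q)"
proof -
 have 1: "op_ok (tuple_space q) (tuple_space (Suc q)) 1 (%r t F x. up1 q k r (rtrans q r t F) x)" if k: "k \<in> {..<q}" for k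
  unfolding up1_def
 proof (rule op_ok_mix[OF rtrans_op_ok])
  show w: "(%x. restrict x {..<q}) \<in> tuple_space (Suc q) \<rightarrow>\<^sub>M (tuple_space q :: (nat => 'a) measure)"
   by (rule measurable_restrict_subset) auto
  \<comment> \<open>The update is written as a restriction so that measurability can be checked
    coordinatewise; the two agree because k < q.\<close>
  have "(%x. \<lambda>i\<in>{..<q}. if i = k then x q else x i) \<in> tuple_space (Suc q) \<rightarrow>\<^sub>M (tuple_space q :: (nat => 'a) measure)"
  proof (rule measurable_restrict)
   fix i assume i: "i \<in> {..<q}"
   show "(%x. if i = k then x q else x i) \<in> tuple_space (Suc q) \<rightarrow>\<^sub>M (borel :: 'a measure)"
    using measurable_component_singleton[of q "{..<Suc q}" "%_. borel :: 'a measure"]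
     measurable_component_singleton[of i "{..<Suc q}" "%_. borel :: 'a measure"] i by (cases "i = k") auto
  qed
  moreover have "(\<lambda>i\<in>{..<q}. if i = k then x q else x i) = (restrict x {..<q})(k := x q)" for x :: "nat => 'a"
   using k by (auto simp: fun_eq_iff)
  ultimately show "(%x. (restrict x {..<q})(k := x q)) \<in> tuple_space (Suc q) \<rightarrow>\<^sub>M (tuple_space q :: (nat => 'a) measure)" by simp
  show "(%z. vel (fst z) (snd z k)) \<in> borel_measurable (half_line \<Otimes>\<^sub>M tuple_space (Suc q))"
   by (rule measurable_vel_component) (use k in simp)
 qed (use vel_bounds in auto)
 have "op_ok (tuple_space q) (tuple_space (Suc q)) (real (card {..<q}) * 1) (%r t F x. \<Sum>k<q. up1 q k r (rtrans q r t F) x)"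
  by (rule op_ok_sum[OF finite_lessThan 1]) simp_all
 then show ?thesis unfolding up_op_def[abs_def] by simp
qed

lemma in_op_ok: "op_ok (tuple_space q) (tuple_space q) (real q * real q) (in_op q)"
proof -
 have 1: "op_ok (tuple_space q) (tuple_space q) 1 (%r t F x. in1 k j r (rtrans q r t F) x)" if k: "k \<in> {..<q}" and j: "j \<in> {..<q}" for k j
  unfolding in1_def
 proof (rule op_ok_mix[OF rtrans_op_ok])
  show "(%x. x) \<in> tuple_space q \<rightarrow>\<^sub>M (tuple_space q :: (nat => 'a) measure)" by (rule measurable_ident_sets[OF refl])
  have "(%x. \<lambda>i\<in>{..<q}. if i = k then x j else x i) \<in> tuple_space q \<rightarrow>\<^sub>M (tuple_space q :: (nat => 'a) measure)"
  proof (rule measurable_restrict)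
   fix i assume i: "i \<in> {..<q}"
   show "(%x. if i = k then x j else x i) \<in> tuple_space q \<rightarrow>\<^sub>M (borel :: 'a measure)"
    using measurable_component_singleton[of j "{..<q}" "%_. borel :: 'a measure"]
     measurable_component_singleton[of i "{..<q}" "%_. borel :: 'a measure"] i j by (cases "i = k") auto
  qed
  moreover have "(\<lambda>i\<in>{..<q}. if i = k then x j else x i) = x(k := x j)" if "x \<in> space (tuple_space q)" for x :: "nat => 'a"
   using k that by (auto simp: fun_eq_iff space_PiM PiE_def extensional_def)
  ultimately show "(%x. x(k := x j)) \<in> tuple_space q \<rightarrow>\<^sub>M (tuple_space q :: (nat => 'a) measure)"
   by (simp cong: measurable_cong)
  show "(%z. vel (fst z) (snd z k)) \<in> borel_measurable (half_line \<Otimes>\<^sub>M tuple_space q)"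
   by (rule measurable_vel_component) (use k in simp)
 qed (use vel_bounds in auto)
 have 2: "op_ok (tuple_space q) (tuple_space q) (real q) (%r t F x. \<Sum>j<q. in1 k j r (rtrans q r t F) x)" if "k \<in> {..<q}" for k
 proof -
  have "op_ok (tuple_space q) (tuple_space q) (real (card {..<q}) * 1) (%r t F x. \<Sum>j<q. in1 k j r (rtrans q r t F) x)"
   by (rule op_ok_sum[OF finite_lessThan 1[OF that]]) simp_all
  then show ?thesis by simp
 qed
 have "op_ok (tuple_space q) (tuple_space q) (real (card {..<q}) * real q) (%r t F x. \<Sum>k<q. \<Sum>j<q. in1 k j r (rtrans q r t F) x)"
  by (rule op_ok_sum[OF finite_lessThan 2]) simp_all
 then show ?thesis unfolding in_op_def[abs_def] by simp
qed

abbreviation \<eta>pow :: "nat => (nat => 'a) measure" where "\<eta>pow q \<equiv> Pi\<^sub>M {..<q} (%_. \<eta>0)"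

lemma \<eta>pow_prob: "prob_space (\<eta>pow q)"
 by (rule prob_space_PiM) (rule initial_law)

lemma \<eta>pow_sets: "sets (\<eta>pow q) = sets (tuple_space q)"
 by (rule sets_PiM_cong) (simp_all add: initial_law)

text \<open>The case in which none of the q sampled clocks rings by t. The damping has rate q V and
  not N V, as the unsampled clocks have been summed away, so the term is free of N.\<close>

definition init_term :: "nat => real => ((nat => 'a) => real) => real" where
 "init_term q t F = exp (- (real q * Vinf * t)) * (\<integral>x. rtrans q 0 t F x \<partial>\<eta>pow q)"

lemma init_term_bound:
 assumes F: "bounded_by (tuple_space q) B F" and t: "0 <= t"
 shows "\<bar>init_term q t F\<bar> <= B"
proof -
 interpret P: prob_space "\<eta>pow q" by (rule \<eta>pow_prob)
 have b: "bounded_by (tuple_space q) B (rtrans q 0 t F)" using op_ok_bounded_by[OF rtrans_op_ok F order_refl t] by simp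
 have "\<bar>\<integral>x. rtrans q 0 t F x \<partial>\<eta>pow q\<bar> <= B"
  using integral_bounded_by(2)[OF P.finite_measure \<eta>pow_sets b] P.prob_space by simp
 moreover have "exp (- (real q * Vinf * t)) <= 1" using Vinf_pos t by simp
 ultimately have "exp (- (real q * Vinf * t)) * \<bar>\<integral>x. rtrans q 0 t F x \<partial>\<eta>pow q\<bar> <= 1 * B" by (intro mult_mono) auto
 then show ?thesis by (simp add: init_term_def abs_mult)
qed

lemma init_term_goodf: "goodf (tuple_space q) (init_term q)"
proof
 interpret P: prob_space "\<eta>pow q" by (rule \<eta>pow_prob)
 note fin = P.finite_measure
 have bb: "bounded_by (tuple_space q) B (rtrans q 0 t F)" if "bounded_by (tuple_space q) B F" "0 <= t" for B F t
  using op_ok_bounded_by[OF rtrans_op_ok that(1) order_refl that(2)] by simp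
 show "init_term q t (%y. a * F y + G y) = a * init_term q t F + init_term q t G"
  if FG: "F \<in> bm q" "G \<in> bm q" and t: "0 <= t" for F G a t
 proof -
  obtain B B' where "bounded_by (tuple_space q) B F" "bounded_by (tuple_space q) B' G" using bm_bounded_by FG by blast
  then have "integrable (\<eta>pow q) (rtrans q 0 t F)" "integrable (\<eta>pow q) (rtrans q 0 t G)"
   using integral_bounded_by(1)[OF fin \<eta>pow_sets bb] t by auto
  moreover have "(\<integral>x. rtrans q 0 t (%y. a * F y + G y) x \<partial>\<eta>pow q) = (\<integral>x. a * rtrans q 0 t F x + rtrans q 0 t G x \<partial>\<eta>pow q)"
   by (rule Bochner_Integration.integral_cong[OF refl op_ok.lin[OF rtrans_op_ok FG order_refl t]])
    (simp add: sets_eq_imp_space_eq[OF \<eta>pow_sets])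
  ultimately show ?thesis by (simp add: init_term_def algebra_simps)
 qed
 show "(%t. init_term q t F) \<in> borel_measurable half_line" if F: "F \<in> bm q" for F
 proof -
  have p: "(%z. ((fst z, 0), snd z)) \<in> half_line \<Otimes>\<^sub>M tuple_space q \<rightarrow>\<^sub>M (half_line \<Otimes>\<^sub>M half_line) \<Otimes>\<^sub>M tuple_space q"
   by (intro measurable_Pair measurable_half_line_const measurable_fst measurable_snd) simp
  have "(%z. rtrans q 0 (fst z) F (snd z)) \<in> borel_measurable (half_line \<Otimes>\<^sub>M tuple_space q)"
   using measurable_compose[OF p op_ok.meas[OF rtrans_op_ok F]] by simp
  then have "(%z. rtrans q 0 (fst z) F (snd z)) \<in> borel_measurable (half_line \<Otimes>\<^sub>M \<eta>pow q)"
   using measurable_cong_sets[OF sets_pair_measure_cong[OF refl \<eta>pow_sets, of half_line] refl] by blast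
  then have "(%t. \<integral>x. rtrans q 0 t F x \<partial>\<eta>pow q) \<in> borel_measurable half_line"
   using P.borel_measurable_lebesgue_integral[of "%t x. rtrans q 0 t F x" half_line] by (simp add: case_prod_beta')
  moreover have "(%t. exp (- (real q * Vinf * t))) \<in> borel_measurable half_line"
   by (rule measurable_restrict_space1) measurable
  ultimately show ?thesis unfolding init_term_def by (intro borel_measurable_times)
 qed
 show "(%n. init_term q t (Fn n)) \<longlonglongrightarrow> init_term q t F"
  if t: "0 <= t" and h: "\<And>n. bounded_by (tuple_space q) B (Fn n)" "bounded_by (tuple_space q) B F" "\<And>y. y \<in> space (tuple_space q) ==> (%n. Fn n y) \<longlonglongrightarrow> F y" for t B Fn F
  unfolding init_term_def
  by (intro tendsto_mult_left integral_bounded_tendsto[OF fin \<eta>pow_sets bb[OF h(1) t] bb[OF h(2) t]] op_ok.cont[OF rtrans_op_ok h order_refl t])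
 show "\<exists>C\<ge>0. \<forall>t F B. 0 <= t \<longrightarrow> t <= T \<longrightarrow> bounded_by (tuple_space q) B F \<longrightarrow> \<bar>init_term q t F\<bar> <= C * B" for T
  using init_term_bound by (intro exI[of _ 1]) auto
qed

lemma init_term_posf: "posf (tuple_space q) (init_term q)"
 unfolding posf_def init_term_def
 by (auto intro!: mult_nonneg_nonneg Bochner_Integration.integral_nonneg rtrans_nonneg)

sublocale H: hierarchy tuple_space Vinf up_op in_op
 by (rule hierarchy.intro) (rule Vinf_pos up_op_ok in_op_ok)+

sublocale H: hierarchy_expansion tuple_space Vinf up_op in_op init_term
proof
 show "H.good init_term" by (simp add: H.good_def init_term_goodf)
 show "H.pos init_term" by (simp add: H.pos_def init_term_posf)
 show "H.nb 0 (%_. 1) init_term" by (simp add: H.nb_def init_term_bound)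
qed

end

section \<open>Moments of the particle system satisfy the hierarchy\<close>

lemma integral_PiM_pick:
 fixes \<mu> :: "'b measure" and H :: "(nat => 'b) => real"
 assumes \<mu>: "prob_space \<mu>" and s: "s \<in> inj_tuples q N" and H: "H \<in> borel_measurable (Pi\<^sub>M {..<q} (%_. \<mu>))"
 shows "(\<integral>x. H (pick q s x) \<partial>Pi\<^sub>M {..<N} (%_. \<mu>)) = (\<integral>x. H x \<partial>Pi\<^sub>M {..<q} (%_. \<mu>))"
proof -
 have s': "inj_on s {..<q}" "s \<in> {..<q} \<rightarrow> {..<N}" using s by (auto simp: inj_tuples_def)
 have m: "(%x. pick q s x) \<in> Pi\<^sub>M {..<N} (%_. \<mu>) \<rightarrow>\<^sub>M Pi\<^sub>M {..<q} (%_. \<mu>)"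
  unfolding pick_def by (rule measurable_restrict, rule measurable_component_singleton) (use s' in auto)
 have "distr (Pi\<^sub>M {..<N} (%_. \<mu>)) (Pi\<^sub>M {..<q} (%_. \<mu>)) (%x. pick q s x) = Pi\<^sub>M {..<q} (%_. \<mu>)"
  unfolding pick_def using distr_PiM_reindex[of "{..<N}" "%_. \<mu>" s "{..<q}"] \<mu> s' by auto
 then show ?thesis using integral_distr[OF m H] by simp
qed

lemma u_statistic_lin: "u_statistic N q x (%y. a * F y + G y) = a * u_statistic N q x F + u_statistic N q x G"
 by (simp add: u_statistic_eq sum.distrib sum_distrib_left algebra_simps)

context particle_model
begin

definition moment :: "nat => real => ((nat => 'a) => real) => real" where
 "moment q t F = mean_conf t (%x. u_statistic N q x F)"

lemma moment_eq_mean_u_statistic: "moment q t F = mean_u_statistic N M Z t q F"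
proof -
 have "pick q s (conf t w) = pick q s (particle N Z t w)" if "s \<in> inj_tuples q N" for s w
  using inj_tuples_lt[OF that] by (auto simp: pick_def conf_def fun_eq_iff)
 then have "u_statistic N q (conf t w) F = u_statistic N q (particle N Z t w) F" for w
  unfolding u_statistic_eq by simp
 then show ?thesis by (simp add: moment_def mean_conf_def mean_u_statistic_def)
qed

lemma u_statistic_bounded_by:
 assumes F: "bounded_by (tuple_space q) B F"
 shows "bounded_by (tuple_space N) B (%x. u_statistic N q x F)"
proof -
 have "0 <= B" "\<And>x. x \<in> space (tuple_space q) ==> \<bar>F x\<bar> <= B" using F by (auto simp: bounded_by_def)
 then have "\<bar>u_statistic N q x F\<bar> <= B" for x by (intro u_statistic_bound) (auto intro: pick_in_space)
 then show ?thesis using \<open>0 <= B\<close> bounded_measurableD(1)[OF u_statistic_bm[OF bounded_by_bm[OF F]]] by (auto simp: bounded_by_def)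
qed

lemma moment_bound:
 assumes F: "bounded_by (tuple_space q) B F" and t: "0 <= t"
 shows "\<bar>moment q t F\<bar> <= B"
 unfolding moment_def using u_statistic_bounded_by[OF F] by (intro mean_conf_bound t) (auto simp: bounded_by_def)

lemma moment_goodf: "goodf (tuple_space q) (moment q)"
proof
 show "moment q t (%y. a * F y + G y) = a * moment q t F + moment q t G"
  if "F \<in> bm q" "G \<in> bm q" "0 <= t" for F G a t
  unfolding moment_def mean_conf_def u_statistic_lin
  using mean_conf_integrable[OF u_statistic_bm[OF that(1)] that(3)] mean_conf_integrable[OF u_statistic_bm[OF that(2)] that(3)] by simp
 show "(%t. moment q t F) \<in> borel_measurable half_line" if F: "F \<in> bm q" for F
  unfolding moment_def
  by (rule measurable_mean_conf[OF measurable_compose[OF measurable_snd bounded_measurableD(1)[OF u_statistic_bm[OF F]]] measurable_ident_sets[OF refl]])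
 show "(%n. moment q t (Fn n)) \<longlonglongrightarrow> moment q t F"
  if t: "0 <= t" and h: "\<And>n. bounded_by (tuple_space q) B (Fn n)" "bounded_by (tuple_space q) B F" "\<And>y. y \<in> space (tuple_space q) ==> (%n. Fn n y) \<longlonglongrightarrow> F y" for t B Fn F
  unfolding moment_def mean_conf_def
 proof (rule integral_bounded_tendsto[OF MP.finite_measure refl, where B=B])
  have "bounded_by M B (%w. u_statistic N q (conf t w) G)" if "bounded_by (tuple_space q) B G" for G
   using u_statistic_bounded_by[OF that] measurable_compose[OF measurable_conf_const[OF t]] conf_in_space
   by (auto simp: bounded_by_def)
  then show "bounded_by M B (%w. u_statistic N q (conf t w) F)" "\<And>n. bounded_by M B (%w. u_statistic N q (conf t w) (Fn n))" using h by auto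
  show "(%n. u_statistic N q (conf t w) (Fn n)) \<longlonglongrightarrow> u_statistic N q (conf t w) F" for w
   unfolding u_statistic_eq by (intro tendsto_mult_left tendsto_sum h(3) pick_in_space)
 qed
 show "\<exists>C\<ge>0. \<forall>t F B. 0 <= t \<longrightarrow> t <= T \<longrightarrow> bounded_by (tuple_space q) B F \<longrightarrow> \<bar>moment q t F\<bar> <= C * B" for T
  using moment_bound by (intro exI[of _ 1]) auto
qed

lemma moment_posf: "posf (tuple_space q) (moment q)"
 unfolding posf_def moment_def mean_conf_def u_statistic_eq
 by (intro ballI allI impI Bochner_Integration.integral_nonneg mult_nonneg_nonneg sum_nonneg)
  (auto intro: pick_in_space)

lemma moment_zero: "N < q ==> moment q t F = 0"
 by (simp add: moment_def mean_conf_def u_statistic_eq inj_tuples_empty)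

text \<open>The initial positions are i.i.d., so each injective tuple has law
  \<open>\<eta>pow q\<close>, and the number of tuples cancels the normalisation.\<close>

lemma integral_u_statistic_initial:
 assumes q: "q <= N" and H: "H \<in> bm q"
 shows "(\<integral>x. u_statistic N q x H \<partial>\<eta>N) = (\<integral>x. H x \<partial>\<eta>pow q)"
proof -
 have Hm: "H \<in> borel_measurable (\<eta>pow q)"
  using bounded_measurableD(1)[OF H] measurable_cong_sets[OF \<eta>pow_sets refl] by blast
 obtain B where B: "bounded_by (tuple_space q) B H" using bm_bounded_by[OF H] by blast
 have int: "integrable (\<eta>pow N) (%x. H (pick q s x))" if s: "s \<in> inj_tuples q N" for s
 proof -
  obtain B' where "bounded_by (tuple_space N) B' (%x. H (pick q s x))" using bm_bounded_by[OF pick_bm[OF H s]] by blast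
  from integral_bounded_by(1)[OF prob_space.finite_measure[OF \<eta>pow_prob] \<eta>pow_sets this] show ?thesis .
 qed
 have "(\<integral>x. u_statistic N q x H \<partial>\<eta>pow N) = 1 / (fact N / fact (N - q)) * (\<Sum>s\<in>inj_tuples q N. \<integral>x. H (pick q s x) \<partial>\<eta>pow N)"
  unfolding u_statistic_eq using int by simp
 also have "(\<Sum>s\<in>inj_tuples q N. \<integral>x. H (pick q s x) \<partial>\<eta>pow N) = (\<Sum>s\<in>inj_tuples q N. \<integral>x. H x \<partial>\<eta>pow q)"
  by (rule sum.cong[OF refl integral_PiM_pick[OF initial_law(1) _ Hm]])
 also have "... = fact N / fact (N - q) * (\<integral>x. H x \<partial>\<eta>pow q)" using card_inj_tuples[OF q] by simp
 finally show ?thesis by simp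
qed

lemma sum_mean_rjump_moment:
 assumes q: "q <= N" and F: "F \<in> bm q" and r: "0 <= r" "0 <= t"
 shows "(\<Sum>i<N. mean_conf r (rjump N i r (%y. u_statistic N q y (rtrans q r t F)))) =
  (real N - real q) * moment q r (rtrans q r t F) +
  ((1 - real q / real N) * moment (Suc q) r (up_op q r t F) + 1 / real N * moment q r (in_op q r t F))"
proof -
 obtain B where B: "bounded_by (tuple_space q) B F" using bm_bounded_by[OF F] by blast
 have e: "rtrans N r t (%x. u_statistic N q x F) = (%x. u_statistic N q x (rtrans q r t F))"
  by (rule ext) (rule rtrans_u_statistic[OF F r])
 have j: "rjump N i r (%y. u_statistic N q y (rtrans q r t F)) \<in> bm N" if "i < N" for i
  using rjump_rtrans_bm[OF u_statistic_bm[OF F] r that] unfolding e .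
 have upm: "(%x. u_statistic N (Suc q) x (up_op q r t F)) \<in> bm N" and inm: "(%x. u_statistic N q x (in_op q r t F)) \<in> bm N"
  and rm: "(%x. u_statistic N q x (rtrans q r t F)) \<in> bm N"
  by (intro u_statistic_bm bounded_by_bm[OF op_ok_bounded_by[OF up_op_ok B r]] bounded_by_bm[OF op_ok_bounded_by[OF in_op_ok B r]] rtrans_bm F r)+
 have "(\<Sum>i<N. mean_conf r (rjump N i r (%y. u_statistic N q y (rtrans q r t F)))) =
   (\<integral>w. (\<Sum>i<N. rjump N i r (%y. u_statistic N q y (rtrans q r t F)) (conf r w)) \<partial>M)"
  unfolding mean_conf_def by (rule Bochner_Integration.integral_sum[symmetric]) (rule mean_conf_integrable[OF j r(1)], simp)
 also have "... = (\<integral>w. (real N - real q) * u_statistic N q (conf r w) (rtrans q r t F) +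
  ((1 - real q / real N) * u_statistic N (Suc q) (conf r w) (up_op q r t F) + 1 / real N * u_statistic N q (conf r w) (in_op q r t F)) \<partial>M)"
  unfolding sum_rjump_u_statistic[OF N q] up_op_def[abs_def] in_op_def[abs_def] ..
 also have "... = (real N - real q) * moment q r (rtrans q r t F) +
  ((1 - real q / real N) * moment (Suc q) r (up_op q r t F) + 1 / real N * moment q r (in_op q r t F))"
  unfolding moment_def mean_conf_def
  using mean_conf_integrable[OF upm r(1)] mean_conf_integrable[OF inm r(1)] mean_conf_integrable[OF rm r(1)] by simp
 finally show ?thesis .
qed

text \<open>The equation for the N-particle configuration, applied to a U-statistic, has rate N V
  and contains the term (N - q) V times the moment itself, from rings outside the sample.
  \<open>volterra_resummation\<close> with lam = N V and \<mu> = q V absorbs this term; the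
  remaining source consists of the rings of sampled particles and splits into \<open>H.T\<close> and
  \<open>H.W / N\<close>.\<close>

lemma moment_hierarchy:
 assumes q: "1 <= q" "q <= N" and t: "0 <= t" and F: "F \<in> bm q"
 shows "moment q t F = init_term q t F + H.T moment q t F + H.W moment q t F / real N"
proof -
 \<comment> \<open>At time u the moment is taken of F transported back from t to u. By the semigroup
   property transporting further back to r gives g at r, so the equation closes in u with a single
   function.\<close>
 define g where "g u = moment q u (rtrans q u t F)" for u
 \<comment> \<open>The source from rings of sampled particles: targets outside the sample and inside
   it.\<close>
 define \<beta> where "\<beta> r = Vinf * ((1 - real q / real N) * moment (Suc q) r (up_op q r t F) + 1 / real N * moment q r (in_op q r t F))" for r
 define c where "c = (\<integral>x. rtrans q 0 t F x \<partial>\<eta>pow q)"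
 let ?l = "real N * Vinf" and ?m = "real q * Vinf"
 have eq: "g u = exp (- ?l * u) * c + (\<integral>r. indicator {0..u} r * (exp (- ?l * (u - r)) * ((?l - ?m) * g r + \<beta> r)) \<partial>lborel)"
  if u: "0 <= u" "u <= t" for u
 proof -
  let ?G = "%x. u_statistic N q x (rtrans q u t F)"
  have Fu: "rtrans q u t F \<in> bm q" by (rule rtrans_bm[OF F u(1) t])
  have tr: "rtrans N r u ?G = (%x. u_statistic N q x (rtrans q r t F))" if r: "0 <= r" "r <= u" for r
  proof
   fix x
   have "rtrans q r u (rtrans q u t F) = rtrans q r t F" by (rule ext) (rule rtrans_semigroup[OF r u(2) F])
   then show "rtrans N r u ?G x = u_statistic N q x (rtrans q r t F)" using rtrans_u_statistic[OF Fu r(1) u(1), of N x] by simp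
  qed
  have "g u = exp (- real N * Vinf * u) * (\<integral>x. rtrans N 0 u ?G x \<partial>\<eta>N) +
    (\<integral>r. indicator {0..u} r * (\<Sum>i<N. Vinf * exp (- real N * Vinf * (u - r)) * mean_conf r (rjump N i r (rtrans N r u ?G))) \<partial>lborel)"
   unfolding g_def moment_def by (rule mean_conf_equation[OF u(1) u_statistic_bm[OF Fu]])
  moreover have "(\<integral>x. rtrans N 0 u ?G x \<partial>\<eta>N) = c"
   unfolding tr[OF order_refl u(1)] c_def by (rule integral_u_statistic_initial[OF q(2) rtrans_bm[OF F order_refl t]])
  moreover have "(\<integral>r. indicator {0..u} r * (\<Sum>i<N. Vinf * exp (- real N * Vinf * (u - r)) * mean_conf r (rjump N i r (rtrans N r u ?G))) \<partial>lborel) =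
    (\<integral>r. indicator {0..u} r * (exp (- ?l * (u - r)) * ((?l - ?m) * g r + \<beta> r)) \<partial>lborel)"
  proof (rule Bochner_Integration.integral_cong[OF refl])
   fix r
   have "(\<Sum>i<N. Vinf * exp (- real N * Vinf * (u - r)) * mean_conf r (rjump N i r (rtrans N r u ?G))) =
     exp (- ?l * (u - r)) * ((?l - ?m) * g r + \<beta> r)" if r: "0 <= r" "r <= u"
   proof -
    have "(\<Sum>i<N. Vinf * exp (- real N * Vinf * (u - r)) * mean_conf r (rjump N i r (rtrans N r u ?G))) =
      exp (- ?l * (u - r)) * (Vinf * (\<Sum>i<N. mean_conf r (rjump N i r (%y. u_statistic N q y (rtrans q r t F)))))"
     unfolding tr[OF r] by (simp add: sum_distrib_left mult_ac)
    also have "Vinf * (\<Sum>i<N. mean_conf r (rjump N i r (%y. u_statistic N q y (rtrans q r t F)))) = (?l - ?m) * g r + \<beta> r"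
     unfolding sum_mean_rjump_moment[OF q(2) F r(1) t] g_def \<beta>_def by (simp add: algebra_simps)
    finally show ?thesis .
   qed
   then show "indicator {0..u} r * (\<Sum>i<N. Vinf * exp (- real N * Vinf * (u - r)) * mean_conf r (rjump N i r (rtrans N r u ?G))) =
     indicator {0..u} r * (exp (- ?l * (u - r)) * ((?l - ?m) * g r + \<beta> r))" by (auto simp: indicator_def)
  qed
  ultimately show ?thesis by simp
 qed
 have gh: "g \<in> borel_measurable half_line" unfolding g_def by (rule measurable_goodf_op[OF rtrans_op_ok moment_goodf F t])
 have bh: "\<beta> \<in> borel_measurable half_line" unfolding \<beta>_def
  by (intro borel_measurable_times borel_measurable_add borel_measurable_const
    measurable_goodf_op[OF up_op_ok moment_goodf F t] measurable_goodf_op[OF in_op_ok moment_goodf F t])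
 obtain C where C: "\<And>r. 0 <= r ==> r <= t ==> \<bar>g r\<bar> <= C" unfolding g_def using goodf_op_bound[OF rtrans_op_ok moment_goodf F t] by blast
 obtain C1 where C1: "\<And>r. 0 <= r ==> r <= t ==> \<bar>moment (Suc q) r (up_op q r t F)\<bar> <= C1" using goodf_op_bound[OF up_op_ok moment_goodf F t] by blast
 obtain C2 where C2: "\<And>r. 0 <= r ==> r <= t ==> \<bar>moment q r (in_op q r t F)\<bar> <= C2" using goodf_op_bound[OF in_op_ok moment_goodf F t] by blast
 have bB: "\<bar>\<beta> r\<bar> <= Vinf * (\<bar>1 - real q / real N\<bar> * C1 + \<bar>1 / real N\<bar> * C2)" if r: "0 <= r" "r <= t" for r
 proof -
  let ?x = "(1 - real q / real N) * moment (Suc q) r (up_op q r t F)" and ?y = "1 / real N * moment q r (in_op q r t F)"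
  have "\<bar>?x\<bar> <= \<bar>1 - real q / real N\<bar> * C1" "\<bar>?y\<bar> <= \<bar>1 / real N\<bar> * C2"
   unfolding abs_mult by (intro mult_left_mono C1 C2 r abs_ge_zero)+
  then have "\<bar>?x + ?y\<bar> <= \<bar>1 - real q / real N\<bar> * C1 + \<bar>1 / real N\<bar> * C2" using abs_triangle_ineq[of ?x ?y] by linarith
  from mult_left_mono[OF this, of Vinf] show ?thesis unfolding \<beta>_def abs_mult using Vinf_pos by simp
 qed
 have gt: "g t = moment q t F"
 proof -
  have "u_statistic N q x (rtrans q t t F) = u_statistic N q x F" for x
   unfolding u_statistic_eq by (simp add: rtrans_refl[OF F t pick_in_space])
  then show ?thesis by (simp add: g_def moment_def)
 qed
 have main: "g t = exp (- ?m * t) * c + (\<integral>r. indicator {0..t} r * (exp (- ?m * (t - r)) * \<beta> r) \<partial>lborel)"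
 \<comment> \<open>If every particle is sampled, the two rates coincide and the equation is already
   the claim; otherwise \<mu> < lam as the resummation requires.\<close>
 proof (cases "q = N")
  case True
  then show ?thesis using eq[OF t order_refl] by simp
 next
  case False
  show ?thesis
  proof (rule volterra_resummation[OF _ _ t _ C _ bB eq])
   show "0 < ?m" "?m < ?l" using q False Vinf_pos by auto
   show "(%r. indicator {0..t} r * g r) \<in> borel_measurable borel" "(%r. indicator {0..t} r * \<beta> r) \<in> borel_measurable borel"
    by (rule borel_measurable_half_line_indicator_real[OF gh], simp, force, rule borel_measurable_half_line_indicator_real[OF bh], simp, force)
  qed
 qed
 let ?u = "%r. indicator {0..t} r * (Vinf * exp (- (?m * (t - r))) * moment (Suc q) r (up_op q r t F))"
 let ?i = "%r. indicator {0..t} r * (Vinf * exp (- (?m * (t - r))) * moment q r (in_op q r t F))"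
 have m0: "0 <= ?m" using Vinf_pos by simp
 have ui: "integrable lborel ?u" "integrable lborel ?i"
  by (rule vol_integrable[OF up_op_ok moment_goodf Vinf_pos m0 F t], rule vol_integrable[OF in_op_ok moment_goodf Vinf_pos m0 F t])
 have "(\<integral>r. indicator {0..t} r * (exp (- ?m * (t - r)) * \<beta> r) \<partial>lborel) = (\<integral>r. (1 - real q / real N) * ?u r + 1 / real N * ?i r \<partial>lborel)"
  by (rule Bochner_Integration.integral_cong) (simp_all add: \<beta>_def algebra_simps)
 also have "... = (1 - real q / real N) * H.T moment q t F + 1 / real N * H.I moment q t F"
  unfolding H.T_def H.I_def vol_def using ui by simp
 also have "... = H.T moment q t F + H.W moment q t F / real N"
  by (simp add: H.W_def comb_def H.qT_def algebra_simps diff_divide_distrib)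
 finally show ?thesis using main unfolding gt by (simp add: init_term_def c_def)
qed

lemma moment_family: "H.is_moment_family N moment"
 unfolding H.is_moment_family_def
 using moment_goodf moment_bound moment_zero moment_hierarchy by (auto simp: H.good_def H.nb_def)

lemma moment_signed_measure:
 assumes t: "0 <= t"
 shows "is_signed_measure (tuple_space q) (moment q t)"
proof -
 obtain \<mu> where "finite_measure \<mu>" "sets \<mu> = sets (tuple_space q)" "\<forall>F\<in>bm q. moment q t F = (\<integral>x. F x \<partial>\<mu>)"
  using posf_representation[OF moment_goodf moment_posf t] by blast
 moreover have "finite_measure (null_measure (tuple_space q))" by (rule finite_measureI) simp
 ultimately show ?thesis unfolding is_signed_measure_def
  by (intro exI[of _ \<mu>] exI[of _ "null_measure (tuple_space q)"]) simp
qed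

end

section \<open>From the expansion to discrete derivatives\<close>

text \<open>Unrolling the recursion, the r-th discrete derivative is N^r times the error of the
  expansion after r terms, so the limits \<open>D j\<close> are the coefficients of the expansion in
  1 / N.\<close>

lemma discrete_derivative_expansion:
 assumes N: "1 <= N"
 shows "discrete_derivative \<Theta> D r N f = real N ^ r * (\<Theta> N f - (\<Sum>j<r. D j f / real N ^ j))"
proof (induction r)
 case (Suc r)
 have "real N ^ r \<noteq> 0" using N by simp
 then show ?case by (simp add: Suc algebra_simps)
qed simp

text \<open>One family of remainder estimates serves both requirements: order r bounds the r-th
  derivative, and order r + 1 makes it converge to \<open>D r\<close>.\<close>

lemma differentiable_up_to_any_orderI:
 assumes m: "1 <= m" and \<Theta>: "\<And>N. m <= N ==> is_signed_measure S (\<Theta> N)" and D: "\<And>r. is_signed_measure S (D r)"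
  and test: "\<B> \<subseteq> bounded_measurable S"
  and rem: "\<And>r. \<exists>C. \<forall>N\<ge>m. \<forall>f B. bounded_by S B f \<longrightarrow> \<bar>\<Theta> N f - (\<Sum>j<r. D j f / real N ^ j)\<bar> <= C / real N ^ r * B"
 shows "differentiable_up_to_any_order S \<B> m \<Theta>"
 unfolding differentiable_up_to_any_order_def
proof (intro conjI allI impI exI[of _ D])
 have bd: "\<exists>C. \<forall>N\<ge>m. \<forall>f B. bounded_by S B f \<longrightarrow> \<bar>discrete_derivative \<Theta> D r N f\<bar> <= C * B" for r
 proof -
  obtain C where C: "\<And>N f B. m <= N ==> bounded_by S B f ==> \<bar>\<Theta> N f - (\<Sum>j<r. D j f / real N ^ j)\<bar> <= C / real N ^ r * B"
   using rem[of r] by blast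
  have "\<bar>discrete_derivative \<Theta> D r N f\<bar> <= C * B" if N: "m <= N" and f: "bounded_by S B f" for N f B
  proof -
   have N1: "1 <= N" using N m by simp
   have "real N ^ r * \<bar>\<Theta> N f - (\<Sum>j<r. D j f / real N ^ j)\<bar> <= real N ^ r * (C / real N ^ r * B)"
    by (intro mult_left_mono C[OF N f]) simp
   also have "... = C * B" using N1 by simp
   finally show ?thesis unfolding discrete_derivative_expansion[OF N1] abs_mult by simp
  qed
  then show ?thesis by blast
 qed
 show "is_signed_measure S (\<Theta> N)" if "m <= N" for N by (rule \<Theta>[OF that])
 fix r
 show "is_signed_measure S (D r)" by (rule D)
 show "uniformly_bounded S \<B> m (discrete_derivative \<Theta> D r)"
 proof -
  obtain C where C: "\<And>N f B. m <= N ==> bounded_by S B f ==> \<bar>discrete_derivative \<Theta> D r N f\<bar> <= C * B" using bd[of r] by blast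
  have "(SUP N\<in>{m..}. tv_norm S \<B> (discrete_derivative \<Theta> D r N)) <= ennreal C"
   unfolding tv_norm_def
  proof (intro SUP_least)
   fix N f assume N: "N \<in> {m..}" and f: "f \<in> {f \<in> \<B>. \<forall>x\<in>space S. \<bar>f x\<bar> <= 1}"
   have "bounded_by S 1 f" using f test bounded_measurableD(1)[of f S] by (auto simp: bounded_by_def)
   from C[OF _ this, of N] N show "ennreal \<bar>discrete_derivative \<Theta> D r N f\<bar> <= ennreal C" by (simp add: ennreal_leI)
  qed
  then show ?thesis unfolding uniformly_bounded_def by (rule order.strict_trans1) simp
 qed
 show "converges_strongly \<B> (discrete_derivative \<Theta> D r) (D r)"
  unfolding converges_strongly_def
 proof
  fix f assume "f \<in> \<B>"
  then obtain B where B: "bounded_by S B f" using test bm_bounded_by[of f S] by blast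
  \<comment> \<open>The next derivative is N times the distance of the r-th one from
    \<open>D r\<close>; its boundedness gives a rate of convergence 1 / N.\<close>
  obtain C where C: "\<And>N f B. m <= N ==> bounded_by S B f ==> \<bar>discrete_derivative \<Theta> D (Suc r) N f\<bar> <= C * B" using bd[of "Suc r"] by blast
  have "\<bar>discrete_derivative \<Theta> D r N f - D r f\<bar> <= C * B / real N" if "m <= N" for N
   using C[OF that B] that m by (simp add: abs_mult pos_le_divide_eq mult.commute)
  then have "\<forall>\<^sub>F N in sequentially. norm (discrete_derivative \<Theta> D r N f - D r f) <= C * B / real N"
   by (intro eventually_sequentiallyI[of m]) simp
  then have "(%N. discrete_derivative \<Theta> D r N f - D r f) \<longlonglongrightarrow> 0"
   by (rule Lim_null_comparison) (rule lim_const_over_n)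
  then show "(%N. discrete_derivative \<Theta> D r N f) \<longlonglongrightarrow> D r f" by (simp add: LIM_zero_iff)
 qed
qed

theorem theorem1p6:
  fixes K :: "real \<Rightarrow> 'a::metric_space \<Rightarrow> (real \<Rightarrow> 'a) measure"
    and \<eta>0 :: "'a measure"
    and \<D> :: "('a \<Rightarrow> real) set"
    and L :: "real \<Rightarrow> ('a \<Rightarrow> real) \<Rightarrow> 'a \<Rightarrow> real"
    and V :: "real \<Rightarrow> 'a \<Rightarrow> real"
    and Vinf :: real
    and M :: "nat \<Rightarrow> 'w measure"
    and Z :: "nat \<Rightarrow> nat \<Rightarrow> 'w \<Rightarrow> 'a particle_state"
    and \<B> :: "nat \<Rightarrow> ((nat \<Rightarrow> 'a) \<Rightarrow> real) set"
    and q :: nat and t :: real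
  assumes model: "feynman_kac_model K \<eta>0 \<D> L V Vinf"
    and particles: "\<And>N. N \<ge> 1 \<Longrightarrow> particle_system K \<eta>0 V Vinf N (M N) (Z N)"
    and test_functions: "\<And>p. \<B> p \<subseteq> bounded_measurable (tuple_space p)"
    and q: "q \<ge> 1"
    and t: "t > 0"
  shows "differentiable_up_to_any_order (tuple_space q) (\<B> q) q
           (\<lambda>N F. mean_u_statistic N (M N) (Z N) t q F)"
proof -
 interpret feynman_kac_model K \<eta>0 \<D> L V Vinf by (rule model)
 have pm: "particle_model K \<eta>0 \<D> L V Vinf N (M N) (Z N)" if "1 <= N" for N
  by (intro particle_model.intro particle_model_axioms.intro model that particles)
 let ?\<Phi> = "%N. particle_model.moment N (M N) (Z N)"
 have eq: "mean_u_statistic N (M N) (Z N) t q F = ?\<Phi> N q t F" if "1 <= N" for N F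
  by (rule particle_model.moment_eq_mean_u_statistic[OF pm[OF that], symmetric])
 have t0: "0 <= t" using t by simp
 show ?thesis
 proof (rule differentiable_up_to_any_orderI[OF q _ H.coef_signed_measure[OF q t0] test_functions])
  show "is_signed_measure (tuple_space q) (%F. mean_u_statistic N (M N) (Z N) t q F)" if "q <= N" for N
  proof -
   have N: "1 <= N" using q that by simp
   show ?thesis unfolding eq[OF N] by (rule particle_model.moment_signed_measure[OF pm[OF N] t0])
  qed
  fix r
  obtain \<kappa> C where C: "\<And>N \<Phi>. 1 <= N ==> H.is_moment_family N \<Phi> ==> H.nb \<kappa> (%_. C / real N ^ r) (H.remainder N \<Phi> r)"
   using H.remainder_bound[of r] by blast
  \<comment> \<open>For fixed q and t the weight in \<open>H.nb\<close> is a constant, so the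
    uniform estimate becomes the remainder bound required here.\<close>
  let ?C = "C * pochhammer (real q) \<kappa> * exp (real \<kappa> * Vinf * t)"
  have "\<bar>mean_u_statistic N (M N) (Z N) t q F - (\<Sum>j<r. H.coef j q t F / real N ^ j)\<bar> <= ?C / real N ^ r * B"
   if qN: "q <= N" and F: "bounded_by (tuple_space q) B F" for N F B
  proof -
   have N: "1 <= N" using q qN by simp
   from H.nbD[OF C[OF N particle_model.moment_family[OF pm[OF N]]] q t0 F]
   show ?thesis unfolding eq[OF N] H.remainder_def by simp
  qed
  then show "\<exists>C. \<forall>N\<ge>q. \<forall>F B. bounded_by (tuple_space q) B F \<longrightarrow>
    \<bar>mean_u_statistic N (M N) (Z N) t q F - (\<Sum>j<r. H.coef j q t F / real N ^ j)\<bar> <= C / real N ^ r * B" by blast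
 qed
qed

end
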